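(* Let $\Omega,p,h,\gamma$ satisfy the standing assumptions listed in the context, fix $\varepsilon>0$, $m>0$, $\mu\ge 0$, and for every $\delta\in(0,1]$ let $u_{\varepsilon,m,\mu,\delta}\in\mathcal M_m^+$ be a minimizer of $I_{\mu,\delta}$ over $\mathcal M_m^+$. Put $d(x)=\operatorname{dist}(x,\partial\Omega)$ and assume: (i) there are constants $\delta_0\in(0,1]$, $c_*>0$, $\vartheta>0$, independent of $\delta$, such that $u_{\varepsilon,m,\mu,\delta}(x)\ge c_*d(x)^{\vartheta}$ for a.e. $x\in\Omega$ and every $0<\delta\le\delta_0$; (ii) the function $\omega_\vartheta(x):=h(x)d(x)^{1-\vartheta\gamma(x)}$ belongs to $L^{p'(\cdot)}(\Omega)$. Let $0<\delta_n\le 1$ with $\delta_n\downarrow 0$ as $n\to\infty$, and for each $n$ let $(u_n,\lambda_n)=(u_{\varepsilon,m,\mu,\delta_n},\lambda_{\varepsilon,m,\mu,\delta_n})\in X\times\mathbb R$ satisfy $J(u_n)=m$ and $$\int_\Omega A_\varepsilon(x,\nabla u_n)\cdot\nabla\phi\,dx=\lambda_n\int_\Omega u_n^{p(x)-1}\phi\,dx+\mu\int_\Omega h(x)(u_n+\delta_n)^{-\gamma(x)}\phi\,dx\qquad\text{for every }\phi\in X.$$ Then, after passing to a subsequence, there exist $u_{\varepsilon,m,\mu}\in X$ and $\lambda_{\varepsilon,m,\mu}\in\mathbb R$ such that $$u_n\to u_{\varepsilon,m,\mu}\ \text{ (strongly) in }X,\qquad \lambda_n\to\lambda_{\varepsilon,m,\mu}\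 \text{ in }\mathbb R.$$ Moreover, $J(u_{\varepsilon,m,\mu})=m$ and $u_{\varepsilon,m,\mu}\ge c_*d^{\vartheta}>0$ a.e. in $\Omega$, and the limiting pair is a positive normalized weak solution of the singular problem, i.e. $$\int_\Omega A_\varepsilon(x,\nabla u_{\varepsilon,m,\mu})\cdot\nabla\phi\,dx=\lambda_{\varepsilon,m,\mu}\int_\Omega u_{\varepsilon,m,\mu}^{p(x)-1}\phi\,dx+\mu\int_\Omega h(x)\,u_{\varepsilon,m,\mu}^{-\gamma(x)}\phi\,dx\qquad\text{for every }\phi\in X.$$
   Context: Standing assumptions: $N\ge2$ and $\Omega\subset\mathbb R^N$ is a bounded domain with Lipschitz boundary. The exponent $p:\overline\Omega\to(1,\infty)$ satisfies $1<p^-\le p(x)\le p^+<\infty$, where $p^-=\min_{\overline\Omega}p$ and $p^+=\max_{\overline\Omega}p$, and is log-Hölder continuous: there is $C_{\log}>0$ with $|p(x)-p(y)|\le C_{\log}/\log(e+1/|x-y|)$ for all $x\ne y$ in $\overline\Omega$. Further $h\in L^\infty(\Omega)$, $h\ge0$ a.e., $h\not\equiv0$; and $\gamma\in C(\overline\Omega)$ with $0<\gamma^-\le\gamma(x)\le\gamma^+<1$ for all $x\in\overline\Omega$. Spaces: $L^{p(\cdot)}(\Omega)$ is the space of measurable $u$ with $\int_\Omega|u|^{p(x)}dx<\infty$, with the Luxemburg norm $\|u\|_{p(\cdot)}=\inf\{\tau>0:\int_\Omega|u/\tau|^{p(x)}dx\le1\}$; $p'(x)=p(x)/(p(x)-1)$.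 $W^{1,p(\cdot)}(\Omega)=\{u\in L^{p(\cdot)}(\Omega):|\nabla u|\in L^{p(\cdot)}(\Omega)\}$ with norm $\|u\|_{p(\cdot)}+\|\nabla u\|_{p(\cdot)}$; $X=W^{1,p(\cdot)}_0(\Omega)$ is the closure of $C_0^\infty(\Omega)$ in $W^{1,p(\cdot)}(\Omega)$, with the equivalent norm $\|u\|=\|\nabla u\|_{p(\cdot)}$. $X_+=\{u\in X:u\ge0\text{ a.e. in }\Omega\}$. Functionals: $r_\varepsilon(\xi)=(\varepsilon^2+|\xi|^2)^{1/2}$, $A_\varepsilon(x,\xi)=r_\varepsilon(\xi)^{p(x)-2}\xi$, $\Phi_\varepsilon(x,\xi)=\frac{r_\varepsilon(\xi)^{p(x)}-\varepsilon^{p(x)}}{p(x)}$ for $\xi\in\mathbb R^N$; $E_\varepsilon(u)=\int_\Omega\Phi_\varepsilon(x,\nabla u)\,dx$; $J(u)=\int_\Omega\frac{|u|^{p(x)}}{p(x)}dx$; $\mathcal M_m^+=\{u\in X_+:J(u)=m\}$. For $0<\delta\le1$ and $s\ge0$, $G_\delta(x,s)=\frac{(s+\delta)^{1-\gamma(x)}-\delta^{1-\gamma(x)}}{1-\gamma(x)}$, and $I_{\mu,\delta}(u)=E_\varepsilon(u)-\mu\int_\Omega h(x)G_\delta(x,u)\,dx$ for $u\in X_+$. *)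

theory Defs
  imports "HOL-Analysis.Analysis"
begin

text \<open>
  The ambient space is an arbitrary Euclidean space \<open>'a\<close>, playing the role of \<open>\<real>\<^sup>N\<close> with
  \<open>N = DIM('a)\<close>. Elements of the function spaces are represented by functions on \<open>'a\<close>
  of which only the restriction to \<open>\<Omega>\<close>, up to null sets, matters. Measurability and integrals on
  \<open>\<Omega>\<close> refer to \<open>lebesgue_on \<Omega>\<close>.
\<close>

section \<open>Domain and exponent\<close>

text \<open>
  Locally, in the coordinates \<open>x = (x - (x \<bullet> e) *\<^sub>R e) + (x \<bullet> e) *\<^sub>R e\<close> given by a unit vector \<open>e\<close>,
  the set is the part lying strictly above the graph of a Lipschitz function \<open>f\<close> on the
  hyperplane orthogonal to \<open>e\<close>.
\<close>

definition lipschitz_boundary :: "'a::euclidean_space set \<Rightarrow> bool" where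
  "lipschitz_boundary \<Omega> \<longleftrightarrow>
     (\<forall>z\<in>frontier \<Omega>. \<exists>e U f L. norm e = 1 \<and> open U \<and> z \<in> U \<and>
        L-lipschitz_on {y. y \<bullet> e = 0} (f :: 'a \<Rightarrow> real) \<and>
        \<Omega> \<inter> U = {x \<in> U. f (x - (x \<bullet> e) *\<^sub>R e) < x \<bullet> e})"

definition bounded_lipschitz_domain :: "'a::euclidean_space set \<Rightarrow> bool" where
  "bounded_lipschitz_domain \<Omega> \<longleftrightarrow>
     open \<Omega> \<and> connected \<Omega> \<and> \<Omega> \<noteq> {} \<and> bounded \<Omega> \<and> lipschitz_boundary \<Omega>"

definition log_hoelder_on :: "'a::metric_space set \<Rightarrow> ('a \<Rightarrow> real) \<Rightarrow> bool" where
  "log_hoelder_on S p \<longleftrightarrow>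
     (\<exists>C>0. \<forall>x\<in>S. \<forall>y\<in>S. x \<noteq> y \<longrightarrow> \<bar>p x - p y\<bar> \<le> C / ln (exp 1 + 1 / dist x y))"

text \<open>
  The witnesses \<open>pm\<close> and \<open>pp\<close> may be taken to be the minimum and the maximum of \<open>p\<close> on the compact
  set \<open>closure \<Omega>\<close>.
\<close>

definition admissible_exponent :: "'a::euclidean_space set \<Rightarrow> ('a \<Rightarrow> real) \<Rightarrow> bool" where
  "admissible_exponent \<Omega> p \<longleftrightarrow>
     (\<exists>pm pp. 1 < pm \<and> (\<forall>x\<in>closure \<Omega>. pm \<le> p x \<and> p x \<le> pp)) \<and>
     log_hoelder_on (closure \<Omega>) p"

definition Linfty_space :: "'a::euclidean_space set \<Rightarrow> ('a \<Rightarrow> real) set" where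
  "Linfty_space \<Omega> =
     {h \<in> borel_measurable (lebesgue_on \<Omega>). \<exists>C. AE x in lebesgue_on \<Omega>. \<bar>h x\<bar> \<le> C}"


section \<open>Variable exponent Lebesgue spaces\<close>

definition Lp_space :: "'a::euclidean_space set \<Rightarrow> ('a \<Rightarrow> real) \<Rightarrow> ('a \<Rightarrow> real) set" where
  "Lp_space \<Omega> p =
     {u \<in> borel_measurable (lebesgue_on \<Omega>).
        (\<integral>\<^sup>+x. ennreal (\<bar>u x\<bar> powr p x) \<partial>lebesgue_on \<Omega>) < \<infinity>}"

definition luxemburg_norm :: "'a::euclidean_space set \<Rightarrow> ('a \<Rightarrow> real) \<Rightarrow> ('a \<Rightarrow> real) \<Rightarrow> real" where
  "luxemburg_norm \<Omega> p u =
     Inf {\<tau>. 0 < \<tau> \<and> (\<integral>\<^sup>+x. ennreal (\<bar>u x / \<tau>\<bar> powr p x) \<partial>lebesgue_on \<Omega>) \<le> 1}"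


section \<open>Sobolev spaces\<close>

primrec C_k :: "nat \<Rightarrow> ('a::euclidean_space \<Rightarrow> real) \<Rightarrow> bool" where
  "C_k 0 = (\<lambda>f. continuous_on UNIV f)"
| "C_k (Suc k) = (\<lambda>f. (\<forall>x. f differentiable (at x)) \<and>
     (\<forall>b\<in>Basis. C_k k (\<lambda>x. frechet_derivative f (at x) b)))"

definition test_functions :: "'a::euclidean_space set \<Rightarrow> ('a \<Rightarrow> real) set" where
  "test_functions \<Omega> =
     {\<phi>. (\<forall>k. C_k k \<phi>) \<and> compact (closure {x. \<phi> x \<noteq> 0}) \<and> closure {x. \<phi> x \<noteq> 0} \<subseteq> \<Omega>}"

definition locally_integrable ::
  "'a::euclidean_space set \<Rightarrow> ('a \<Rightarrow> 'b::euclidean_space) \<Rightarrow> bool" where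
  "locally_integrable \<Omega> f \<longleftrightarrow> (\<forall>K. compact K \<and> K \<subseteq> \<Omega> \<longrightarrow> set_integrable lebesgue K f)"

definition has_weak_gradient ::
  "'a::euclidean_space set \<Rightarrow> ('a \<Rightarrow> real) \<Rightarrow> ('a \<Rightarrow> 'a) \<Rightarrow> bool" where
  "has_weak_gradient \<Omega> u g \<longleftrightarrow>
     locally_integrable \<Omega> u \<and> locally_integrable \<Omega> g \<and>
     (\<forall>\<phi>\<in>test_functions \<Omega>. \<forall>b\<in>Basis.
        (LINT x|lebesgue_on \<Omega>. u x * frechet_derivative \<phi> (at x) b) =
        - (LINT x|lebesgue_on \<Omega>. (g x \<bullet> b) * \<phi> x))"

text \<open>
  A representative of \<open>\<nabla>u\<close>. Weak gradients are unique only up to null sets, and everything below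
  depends on \<open>\<nabla>u\<close> only up to null sets. The value is meaningful only if \<open>u\<close> is weakly
  differentiable.
\<close>

definition wgrad :: "'a::euclidean_space set \<Rightarrow> ('a \<Rightarrow> real) \<Rightarrow> 'a \<Rightarrow> 'a" where
  "wgrad \<Omega> u = (SOME g. has_weak_gradient \<Omega> u g)"

definition W1p_space :: "'a::euclidean_space set \<Rightarrow> ('a \<Rightarrow> real) \<Rightarrow> ('a \<Rightarrow> real) set" where
  "W1p_space \<Omega> p =
     {u \<in> Lp_space \<Omega> p. (\<exists>g. has_weak_gradient \<Omega> u g) \<and> (\<lambda>x. norm (wgrad \<Omega> u x)) \<in> Lp_space \<Omega> p}"

definition W1p_norm :: "'a::euclidean_space set \<Rightarrow> ('a \<Rightarrow> real) \<Rightarrow> ('a \<Rightarrow> real) \<Rightarrow> real" where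
  "W1p_norm \<Omega> p u = luxemburg_norm \<Omega> p u + luxemburg_norm \<Omega> p (\<lambda>x. norm (wgrad \<Omega> u x))"

definition X_space :: "'a::euclidean_space set \<Rightarrow> ('a \<Rightarrow> real) \<Rightarrow> ('a \<Rightarrow> real) set" where
  "X_space \<Omega> p =
     {u \<in> W1p_space \<Omega> p. \<forall>e>0. \<exists>\<phi>\<in>test_functions \<Omega>. W1p_norm \<Omega> p (\<lambda>x. u x - \<phi> x) < e}"

definition X_norm :: "'a::euclidean_space set \<Rightarrow> ('a \<Rightarrow> real) \<Rightarrow> ('a \<Rightarrow> real) \<Rightarrow> real" where
  "X_norm \<Omega> p u = luxemburg_norm \<Omega> p (\<lambda>x. norm (wgrad \<Omega> u x))"

definition X_plus :: "'a::euclidean_space set \<Rightarrow> ('a \<Rightarrow> real) \<Rightarrow> ('a \<Rightarrow> real) set" where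
  "X_plus \<Omega> p = {u \<in> X_space \<Omega> p. AE x in lebesgue_on \<Omega>. 0 \<le> u x}"


section \<open>Functionals\<close>

definition r_eps :: "real \<Rightarrow> 'a::euclidean_space \<Rightarrow> real" where
  "r_eps \<epsilon> \<xi> = sqrt (\<epsilon>\<^sup>2 + (norm \<xi>)\<^sup>2)"

definition A_eps :: "('a \<Rightarrow> real) \<Rightarrow> real \<Rightarrow> 'a \<Rightarrow> 'a::euclidean_space \<Rightarrow> 'a" where
  "A_eps p \<epsilon> x \<xi> = (r_eps \<epsilon> \<xi> powr (p x - 2)) *\<^sub>R \<xi>"

definition Phi_eps :: "('a \<Rightarrow> real) \<Rightarrow> real \<Rightarrow> 'a \<Rightarrow> 'a::euclidean_space \<Rightarrow> real" where
  "Phi_eps p \<epsilon> x \<xi> = (r_eps \<epsilon> \<xi> powr p x - \<epsilon> powr p x) / p x"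

definition E_eps :: "'a::euclidean_space set \<Rightarrow> ('a \<Rightarrow> real) \<Rightarrow> real \<Rightarrow> ('a \<Rightarrow> real) \<Rightarrow> real" where
  "E_eps \<Omega> p \<epsilon> u = (LINT x|lebesgue_on \<Omega>. Phi_eps p \<epsilon> x (wgrad \<Omega> u x))"

definition J_fun :: "'a::euclidean_space set \<Rightarrow> ('a \<Rightarrow> real) \<Rightarrow> ('a \<Rightarrow> real) \<Rightarrow> real" where
  "J_fun \<Omega> p u = (LINT x|lebesgue_on \<Omega>. \<bar>u x\<bar> powr p x / p x)"

definition M_plus :: "'a::euclidean_space set \<Rightarrow> ('a \<Rightarrow> real) \<Rightarrow> real \<Rightarrow> ('a \<Rightarrow> real) set" where
  "M_plus \<Omega> p m = {u \<in> X_plus \<Omega> p. J_fun \<Omega> p u = m}"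

definition G_delta :: "('a \<Rightarrow> real) \<Rightarrow> real \<Rightarrow> 'a \<Rightarrow> real \<Rightarrow> real" where
  "G_delta \<gamma> \<delta> x s = ((s + \<delta>) powr (1 - \<gamma> x) - \<delta> powr (1 - \<gamma> x)) / (1 - \<gamma> x)"

definition I_fun ::
  "'a::euclidean_space set \<Rightarrow> ('a \<Rightarrow> real) \<Rightarrow> ('a \<Rightarrow> real) \<Rightarrow> ('a \<Rightarrow> real) \<Rightarrow>
   real \<Rightarrow> real \<Rightarrow> real \<Rightarrow> ('a \<Rightarrow> real) \<Rightarrow> real" where
  "I_fun \<Omega> p h \<gamma> \<epsilon> \<mu> \<delta> u =
     E_eps \<Omega> p \<epsilon> u - \<mu> * (LINT x|lebesgue_on \<Omega>. h x * G_delta \<gamma> \<delta> x (u x))"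

definition is_minimizer_on :: "('b \<Rightarrow> real) \<Rightarrow> 'b set \<Rightarrow> 'b \<Rightarrow> bool" where
  "is_minimizer_on F S u \<longleftrightarrow> u \<in> S \<and> (\<forall>v\<in>S. F u \<le> F v)"

definition bdist :: "'a::euclidean_space set \<Rightarrow> 'a \<Rightarrow> real" where
  "bdist \<Omega> x = infdist x (frontier \<Omega>)"

end

theory Submission
  imports Defs "HOL-Complex_Analysis.Great_Picard" "HOL-Real_Asymp.Real_Asymp"
begin

text \<open>The solutions \<open>u\<^sub>n\<close> are compact in \<open>X\<close> because the equations themselves force strong
convergence. Comparing the minimizers with one fixed competitor bounds their energies, hence their
gradients, uniformly in the shift (\<open>minimizer_gradient_bound\<close>), and testing each equation with its own
solution bounds the multipliers (\<open>lam_bounded\<close>). The embedding of \<open>X\<close> into the variable exponent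
Lebesgue space is compact (\<open>X_space_compact\<close>), so a subsequence is Cauchy there. Subtract two of the equations
and test with the difference of the two solutions: on the left stands a quantity that controls the
distance of the gradients by strong monotonicity of the operator (\<open>strong_monotonicity\<close>); on the right,
the multiplier terms are small by compactness, and the singular terms have the good sign
because \<open>s \<mapsto> (s + \<delta>) powr (- \<gamma>)\<close> decreases, except for an error \<open>\<delta> powr (1 - \<gamma>)\<close> caused by
the two shifts being different (\<open>singular_difference_le\<close>, \<open>Dif_le\<close>). Hence the gradients are Cauchy
as well, and \<open>X\<close> is complete.

The limit equation follows by dominated convergence. Only the singular term needs a new majorant. The lower
bound for the solutions yields \<open>h (u\<^sub>n + \<delta>\<^sub>n) powr (- \<gamma>) \<bar>\<phi>\<bar> \<le> const \<omega> \<bar>\<phi>\<bar> / d\<close>, where \<open>\<omega>\<close> is the given weight, and the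
right-hand side is integrable by Young's inequality as soon as \<open>\<phi> / d\<close> lies in the variable exponent Lebesgue
space. This is Hardy's inequality (\<open>X_space_hardy\<close>).

Compactness and Hardy's inequality both rest on one estimate, \<open>avg_powr_bound\<close>: the average of a function
\<open>f\<close> over a ball of radius comparable to \<open>t\<close>, raised to the power \<open>p x\<close>, is at most a constant times one plus the average
of \<open>f powr p\<close>. It is Jensen's inequality up to a factor \<open>(1 / t) powr (N * osc p)\<close>, and log-Hoelder
continuity keeps this factor bounded. For compactness, a test function differs from its mean over the
ball of radius \<open>s\<close> by at most \<open>s\<close> times such averages of its gradient, while the means form an equicontinuous
family. For Hardy's inequality, the Lipschitz boundary provides near each boundary point a cone of directions
along which every point \<open>x\<close> leaves the domain within a distance comparable to \<open>d x\<close>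
(\<open>lipschitz_exit_time\<close>). A test function is the integral of its gradient along these segments; averaging over the cone and applying the
estimate to the exponent \<open>p / q\<close>, where \<open>1 < q \<le> p\<close>, reduces the claim to Hardy's inequality with
the constant exponent \<open>q\<close> on parallel lines (\<open>line_hardy\<close>).

Two reductions let all this be carried out with integrals of powers. Smooth bumps built from
\<open>exp (- 1 / x)\<close> show that weak gradients are unique, so that the chosen representative is linear almost everywhere
and agrees with the classical gradient on test functions. The Luxemburg norm is small exactly when the
modular is, so that \<open>X\<close> is the closure of the test functions under modular convergence.\<close>

section \<open>Smooth functions and bumps\<close>

lemma C_k_Suc_iff:
  "C_k (Suc k) f \<longleftrightarrow> (\<forall>x. f differentiable (at x)) \<and>
     (\<forall>b\<in>Basis. C_k k (\<lambda>x. frechet_derivative f (at x) b))"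
  by simp

declare C_k.simps(2) [simp del]

lemma C_k_SucI:
  assumes "\<And>x. (f has_derivative f' x) (at x)"
    and "\<And>b. b \<in> Basis \<Longrightarrow> C_k k (\<lambda>x. f' x b)"
  shows "C_k (Suc k) f"
proof -
  have "frechet_derivative f (at x) = f' x" for x
    using assms(1) frechet_derivative_at by metis
  then show ?thesis
    using assms unfolding C_k_Suc_iff differentiable_def by auto
qed

lemma C_k_Suc_has_derivative:
  "C_k (Suc k) f \<Longrightarrow> (f has_derivative frechet_derivative f (at x)) (at x)"
  unfolding C_k_Suc_iff using frechet_derivative_works by blast

lemma C_k_mono: "C_k (Suc k) f \<Longrightarrow> C_k k f"
proof (induction k arbitrary: f)
  case 0
  then show ?case
    by (auto simp: C_k_Suc_iff intro!: continuous_at_imp_continuous_on differentiable_imp_continuous_within)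
next
  case (Suc k)
  then show ?case unfolding C_k_Suc_iff[of "Suc k"] C_k_Suc_iff[of k] by blast
qed

lemma C_k_const: "C_k k (\<lambda>x. c)"
proof (induction k arbitrary: c)
  case (Suc k)
  show ?case by (rule C_k_SucI[OF has_derivative_const]) (rule Suc)
qed auto

lemma C_k_add: "C_k k f \<Longrightarrow> C_k k g \<Longrightarrow> C_k k (\<lambda>x. f x + g x)"
proof (induction k arbitrary: f g)
  case (Suc k)
  show ?case
    by (rule C_k_SucI[OF has_derivative_add[OF Suc.prems(1)[THEN C_k_Suc_has_derivative]
              Suc.prems(2)[THEN C_k_Suc_has_derivative]]])
       (use Suc in \<open>auto simp: C_k_Suc_iff\<close>)
qed (auto intro: continuous_intros)

lemma C_k_mult: "C_k k f \<Longrightarrow> C_k k g \<Longrightarrow> C_k k (\<lambda>x. f x * g x)"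
proof (induction k arbitrary: f g)
  case (Suc k)
  show ?case
  proof (rule C_k_SucI[OF has_derivative_mult[OF Suc.prems(1)[THEN C_k_Suc_has_derivative]
              Suc.prems(2)[THEN C_k_Suc_has_derivative]]])
    fix b :: 'a assume b: "b \<in> Basis"
    show "C_k k (\<lambda>x. f x * frechet_derivative g (at x) b + frechet_derivative f (at x) b * g x)"
      using Suc b C_k_mono[OF Suc.prems(1)] C_k_mono[OF Suc.prems(2)]
      by (intro C_k_add Suc.IH) (auto simp: C_k_Suc_iff)
  qed
qed (auto intro: continuous_intros)

lemma C_k_prod: "finite S \<Longrightarrow> (\<And>i. i \<in> S \<Longrightarrow> C_k k (f i)) \<Longrightarrow> C_k k (\<lambda>x. \<Prod>i\<in>S. f i x)"
  by (induction S rule: finite_induct) (auto intro: C_k_const C_k_mult)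

text \<open>A class of functions of one real variable that is closed under derivatives consists of smooth functions;
this avoids writing down higher derivatives.\<close>

lemma C_k_of_coordinate:
  fixes i :: "'a::euclidean_space"
  assumes G: "\<And>g. g \<in> G \<Longrightarrow> \<exists>g'\<in>G. \<forall>x. (g has_real_derivative g' x) (at x)" and "g \<in> G"
  shows "C_k k (\<lambda>x::'a. g (c * (x \<bullet> i) + d))"
  using \<open>g \<in> G\<close>
proof (induction k arbitrary: g)
  case 0
  obtain g' where "\<forall>x. (g has_real_derivative g' x) (at x)" using G[OF 0] by blast
  then have "continuous_on UNIV g"
    using DERIV_isCont continuous_at_imp_continuous_on by blast
  then have "continuous_on UNIV (\<lambda>x::'a. g (c * (x \<bullet> i) + d))"
    by (rule continuous_on_compose2) (auto intro!: continuous_intros)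
  then show ?case by simp
next
  case (Suc k)
  obtain g' where g': "g' \<in> G" "\<forall>x. (g has_real_derivative g' x) (at x)" using G[OF Suc.prems] by blast
  have "((\<lambda>x::'a. g (c * (x \<bullet> i) + d)) has_derivative (\<lambda>h. g' (c * (x \<bullet> i) + d) * (c * (h \<bullet> i)))) (at x)" for x
  proof -
    have "(g has_derivative (\<lambda>h. g' (c * (x \<bullet> i) + d) * h)) (at (c * (x \<bullet> i) + d))"
      using g'(2) by (auto simp: has_field_derivative_def)
    then show ?thesis
      by (rule has_derivative_compose[rotated, where f="\<lambda>x. c * (x \<bullet> i) + d"])
         (auto intro!: derivative_eq_intros)
  qed
  then show ?case
    by (rule C_k_SucI) (intro C_k_mult C_k_const Suc.IH g')
qed

text \<open>The functions \<open>q (1 / x) exp (- 1 / x)\<close>, extended by zero, with a polynomial \<open>q\<close>: the smallest class that contains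
\<open>exp (- 1 / x)\<close> and is closed under derivatives.\<close>

definition flat :: "real poly \<Rightarrow> real \<Rightarrow> real" where
  "flat q x = (if x > 0 then poly q (inverse x) * exp (- inverse x) else 0)"

lemma poly_exp_minus_tendsto_0: "((\<lambda>y. poly q y * exp (- y)) \<longlongrightarrow> (0::real)) at_top"
proof -
  have "((\<lambda>y. \<Sum>i\<le>degree q. coeff q i * (y ^ i / exp y)) \<longlongrightarrow> (\<Sum>i\<le>degree q. coeff q i * 0)) at_top"
    by (intro tendsto_intros tendsto_power_div_exp_0)
  also have "(\<lambda>y. \<Sum>i\<le>degree q. coeff q i * (y ^ i / exp y)) = (\<lambda>y. poly q y * exp (- y))"
    by (simp add: poly_altdef exp_minus sum_distrib_right divide_inverse mult.assoc)
  finally show ?thesis by simp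
qed

lemma flat_has_derivative:
  "(flat q has_real_derivative flat (monom 1 2 * (q - pderiv q)) x) (at x)"
proof -
  consider "x > 0" | "x < 0" | "x = 0" by linarith
  then show ?thesis
  proof cases
    case 1
    have "((\<lambda>x. poly q (inverse x) * exp (- inverse x)) has_real_derivative
        flat (monom 1 2 * (q - pderiv q)) x) (at x)"
      using 1 by (auto intro!: derivative_eq_intros poly_DERIV[THEN DERIV_chain2]
          simp: flat_def poly_monom field_simps power2_eq_square)
    then show ?thesis
      by (rule has_field_derivative_transform_within_open[where S="{0<..}"]) (use 1 in \<open>auto simp: flat_def\<close>)
  next
    case 2
    have "((\<lambda>x. 0) has_real_derivative flat (monom 1 2 * (q - pderiv q)) x) (at x)"
      using 2 by (simp add: flat_def)
    then show ?thesis
      by (rule has_field_derivative_transform_within_open[where S="{..<0}"]) (use 2 in \<open>auto simp: flat_def\<close>)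
  next
    case 3
    have "((\<lambda>h. flat q h / h) \<longlongrightarrow> 0) (at_left 0)"
      by (rule tendsto_eventually) (auto simp: eventually_at flat_def intro!: exI[of _ 1])
    moreover have "((\<lambda>h. flat q h / h) \<longlongrightarrow> 0) (at_right 0)"
    proof -
      have "((\<lambda>h. poly (monom 1 1 * q) (inverse h) * exp (- inverse h)) \<longlongrightarrow> 0) (at_right (0::real))"
        by (rule filterlim_compose[OF poly_exp_minus_tendsto_0 filterlim_inverse_at_top_right])
      then show ?thesis
        by (rule Lim_transform_eventually)
           (auto simp: eventually_at flat_def poly_monom field_simps intro!: exI[of _ 1])
    qed
    ultimately have "((\<lambda>h. flat q h / h) \<longlongrightarrow> 0) (at 0)"
      by (simp add: filterlim_at_split)
    then show ?thesis using 3 by (simp add: DERIV_def flat_def)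
  qed
qed

lemma C_k_flat_coordinate: "C_k k (\<lambda>x. flat q (c * (x \<bullet> i) + d))"
  by (rule C_k_of_coordinate[where G="range flat"]) (auto intro: flat_has_derivative)

abbreviation hat :: "real \<Rightarrow> real" where "hat \<equiv> flat 1"

lemma hat_bounds: "0 \<le> hat x" "hat x \<le> 1"
  by (auto simp: flat_def)

lemma hat_pos_iff: "hat x \<noteq> 0 \<longleftrightarrow> x > 0"
  by (auto simp: flat_def)

lemma hat_tendsto_1: "c > 0 \<Longrightarrow> (\<lambda>n. hat (real (Suc n) * c)) \<longlonglongrightarrow> 1"
proof -
  assume c: "c > 0"
  have "(\<lambda>n. exp (- (inverse (real (Suc n)) * inverse c))) \<longlonglongrightarrow> exp (- (0 * inverse c))"
    by (intro tendsto_intros LIMSEQ_inverse_real_of_nat)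
  then show ?thesis using c by (simp add: flat_def)
qed

text \<open>The factor \<open>Suc n\<close> plays the role of an \<open>n\<close>-th root, since \<open>exp (- 1 / x)\<close> to the power \<open>1 / n\<close> is
\<open>exp (- 1 / (n x))\<close>: the bumps stay smooth and converge to the indicator of the box.\<close>

definition box_bump :: "nat \<Rightarrow> 'a::euclidean_space \<Rightarrow> 'a \<Rightarrow> 'a \<Rightarrow> real" where
  "box_bump n a b x =
     (\<Prod>i\<in>Basis. hat (real (Suc n) * (x \<bullet> i - a \<bullet> i)) * hat (real (Suc n) * (b \<bullet> i - x \<bullet> i)))"

lemma C_k_box_bump: "C_k k (box_bump n a b)"
proof -
  have "C_k k (\<lambda>x. \<Prod>i\<in>Basis. hat (real (Suc n) * (x \<bullet> i) + - real (Suc n) * (a \<bullet> i)) *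
     hat (- real (Suc n) * (x \<bullet> i) + real (Suc n) * (b \<bullet> i)))"
    by (intro C_k_prod C_k_mult C_k_flat_coordinate) auto
  also have "(\<lambda>x. \<Prod>i\<in>Basis. hat (real (Suc n) * (x \<bullet> i) + - real (Suc n) * (a \<bullet> i)) *
     hat (- real (Suc n) * (x \<bullet> i) + real (Suc n) * (b \<bullet> i))) = box_bump n a b"
    unfolding box_bump_def by (intro ext prod.cong refl arg_cong2[where f="(*)"] arg_cong[where f=hat]) (simp_all add: algebra_simps)
  finally show ?thesis .
qed

lemma box_bump_bounds: "0 \<le> box_bump n a b x" "box_bump n a b x \<le> 1"
  unfolding box_bump_def by (auto intro!: prod_nonneg prod_le_1 mult_nonneg_nonneg mult_le_one hat_bounds)

lemma box_bump_nonzero_iff: "box_bump n a b x \<noteq> 0 \<longleftrightarrow> x \<in> box a b"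
  unfolding box_bump_def by (auto simp: hat_pos_iff box_def zero_less_mult_iff)

lemma box_bump_test_function:
  assumes "cbox a b \<subseteq> \<Omega>" shows "box_bump n a b \<in> test_functions \<Omega>"
proof -
  have "closure {x. box_bump n a b x \<noteq> 0} \<subseteq> cbox a b"
    unfolding box_bump_nonzero_iff by (intro closure_minimal) (auto simp: box_subset_cbox)
  then show ?thesis
    using assms unfolding test_functions_def
    by (auto simp: C_k_box_bump intro: compact_Int_closed[of "cbox a b"] 
        closed_subset bounded_subset[OF bounded_cbox] simp: compact_eq_bounded_closed)
qed

lemma box_bump_tendsto: "(\<lambda>n. box_bump n a b x) \<longlonglongrightarrow> indicator (box a b) x"
proof (cases "x \<in> box a b")
  case True
  have "(\<lambda>n. box_bump n a b x) \<longlonglongrightarrow> (\<Prod>i\<in>(Basis::'a set). 1 * 1)"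
    unfolding box_bump_def by (intro tendsto_intros hat_tendsto_1) (use True in \<open>auto simp: box_def\<close>)
  then show ?thesis using True by simp
next
  case False
  then have "box_bump n a b x = 0" for n using box_bump_nonzero_iff by blast
  then show ?thesis using False by simp
qed

lemma continuous_on_test_function: "\<phi> \<in> test_functions \<Omega> \<Longrightarrow> continuous_on UNIV \<phi>"
proof -
  assume "\<phi> \<in> test_functions \<Omega>"
  then have "C_k 0 \<phi>" unfolding test_functions_def by blast
  then show ?thesis by simp
qed

text \<open>Makes all integrals in the definition of weak gradients meaningful.\<close>

lemma locally_integrable_mult:
  fixes f :: "'a::euclidean_space \<Rightarrow> real"
  assumes f: "locally_integrable \<Omega> f" and K: "compact K" "K \<subseteq> \<Omega>"
    and \<psi>: "continuous_on UNIV \<psi>" "\<And>x. x \<notin> K \<Longrightarrow> \<psi> x = 0" and \<Omega>: "open \<Omega>"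
  shows "integrable (lebesgue_on \<Omega>) (\<lambda>x. f x * \<psi> x)"
proof -
  have "compact (\<psi> ` K)" using K \<psi> by (intro compact_continuous_image) (auto intro: continuous_on_subset)
  then obtain B where B: "\<And>x. x \<in> K \<Longrightarrow> norm (\<psi> x) \<le> B"
    by (metis bounded_iff compact_imp_bounded imageI)
  have [measurable]: "\<psi> \<in> borel_measurable lebesgue" 
    using borel_measurable_continuous_onI[OF \<psi>(1)] by (intro measurable_completion) simp
  have int: "integrable lebesgue (\<lambda>x. indicator K x * f x)"
    using f K unfolding locally_integrable_def set_integrable_def by auto
  have "integrable lebesgue (\<lambda>x. (indicator K x * f x) * \<psi> x)"
  proof (rule Bochner_Integration.integrable_bound[OF integrable_mult_right[OF int, of B]])
    show "(\<lambda>x. indicator K x * f x * \<psi> x) \<in> borel_measurable lebesgue" using int by measurable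
    show "AE x in lebesgue. norm (indicator K x * f x * \<psi> x) \<le> norm (B * (indicator K x * f x))"
    proof (rule AE_I2)
      fix x show "norm (indicator K x * f x * \<psi> x) \<le> norm (B * (indicator K x * f x))"
      proof (cases "x \<in> K")
        case True
        then have "\<bar>\<psi> x\<bar> \<le> \<bar>B\<bar>" using B[of x] by auto
        then show ?thesis using True by (auto simp: abs_mult mult.commute intro: mult_left_mono mult_right_mono)
      qed auto
    qed
  qed
  also have "(\<lambda>x. (indicator K x * f x) * \<psi> x) = (\<lambda>x. indicator \<Omega> x *\<^sub>R (f x * \<psi> x))"
    using K \<psi>(2) by (auto simp: fun_eq_iff indicator_def)
  finally show ?thesis using \<Omega>
    by (subst integrable_restrict_space) (auto simp: Int_def)
qed

lemma test_function_support:
  assumes "\<phi> \<in> test_functions \<Omega>"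
  obtains K where "compact K" "K \<subseteq> \<Omega>" "\<And>x. x \<notin> K \<Longrightarrow> \<phi> x = 0"
    "\<And>x b. x \<notin> K \<Longrightarrow> frechet_derivative \<phi> (at x) b = 0"
proof
  let ?K = "closure {x. \<phi> x \<noteq> 0}"
  show "compact ?K" "?K \<subseteq> \<Omega>" using assms by (auto simp: test_functions_def)
  show "x \<notin> ?K \<Longrightarrow> \<phi> x = 0" for x using closure_subset[of "{x. \<phi> x \<noteq> 0}"] by blast
  show "frechet_derivative \<phi> (at x) b = 0" if "x \<notin> ?K" for x b
  proof -
    have "((\<lambda>x. 0) has_derivative (\<lambda>h. 0)) (at x)" by simp
    then have "(\<phi> has_derivative (\<lambda>h. 0)) (at x)"
      by (rule has_derivative_transform_within_open[where s="- ?K"])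
         (use that closure_subset[of "{x. \<phi> x \<noteq> 0}"] in auto)
    then show ?thesis using frechet_derivative_at by metis
  qed
qed

section \<open>The fundamental lemma of the calculus of variations\<close>

text \<open>Bumps approximate the indicator of the box boundedly, so dominated convergence applies.\<close>

lemma integral_box_eq_0:
  fixes f :: "'a::euclidean_space \<Rightarrow> real"
  assumes \<Omega>: "open \<Omega>" and f: "locally_integrable \<Omega> f"
    and 0: "\<And>\<psi>. \<psi> \<in> test_functions \<Omega> \<Longrightarrow> (LINT x|lebesgue_on \<Omega>. f x * \<psi> x) = 0"
    and ab: "cbox a b \<subseteq> \<Omega>"
  shows "(LINT x|lebesgue. indicator (box a b) x * f x) = 0"
proof -
  have int: "integrable lebesgue (\<lambda>x. indicator (cbox a b) x * f x)"
    using f ab unfolding locally_integrable_def set_integrable_def by auto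
  have [measurable]: "box_bump n a b \<in> borel_measurable lebesgue" for n
    using C_k_box_bump[of 0 n a b] borel_measurable_continuous_onI[of "box_bump n a b"]
    by (intro measurable_completion) simp
  have m: "(\<lambda>x. indicator (box a b) x * (indicator (cbox a b) x * f x)) \<in> borel_measurable lebesgue"
    by (intro borel_measurable_times[OF _ borel_measurable_integrable[OF int]] borel_measurable_indicator) auto
  have "(\<lambda>n. LINT x|lebesgue. box_bump n a b x * (indicator (cbox a b) x * f x)) \<longlonglongrightarrow> 
     (LINT x|lebesgue. indicator (box a b) x * (indicator (cbox a b) x * f x))"
  proof (rule integral_dominated_convergence[where w="\<lambda>x. norm (indicator (cbox a b) x * f x)"])
    show "AE x in lebesgue. (\<lambda>n. box_bump n a b x * (indicator (cbox a b) x * f x))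
         \<longlonglongrightarrow> indicator (box a b) x * (indicator (cbox a b) x * f x)"
      by (intro AE_I2 tendsto_intros box_bump_tendsto)
    show "AE x in lebesgue. norm (box_bump n a b x * (indicator (cbox a b) x * f x))
            \<le> norm (indicator (cbox a b) x * f x)" for n
      using box_bump_bounds[of n a b] by (intro AE_I2) (auto simp: abs_mult intro!: mult_left_le_one_le)
    show "(\<lambda>x. box_bump n a b x * (indicator (cbox a b) x * f x)) \<in> borel_measurable lebesgue" for n
      using borel_measurable_integrable[OF int] by measurable
  qed (use int m in \<open>auto intro: integrable_norm\<close>)
  moreover have "(LINT x|lebesgue. box_bump n a b x * (indicator (cbox a b) x * f x)) = 0" for n
  proof -
    have "(\<lambda>x. box_bump n a b x * (indicator (cbox a b) x * f x)) = (\<lambda>x. indicator \<Omega> x *\<^sub>R (f x * box_bump n a b x))"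
      using ab box_bump_nonzero_iff[of n a b] box_subset_cbox[of a b]
      by (fastforce simp: fun_eq_iff indicator_def)
    then show ?thesis using 0[OF box_bump_test_function[OF ab, of n]] \<Omega>
      by (simp add: integral_restrict_space)
  qed
  moreover have "(\<lambda>x. indicator (box a b) x * (indicator (cbox a b) x * f x)) = (\<lambda>x. indicator (box a b) x * f x)"
    using box_subset_cbox[of a b] by (auto simp: fun_eq_iff indicator_def)
  ultimately show ?thesis
    using LIMSEQ_unique[OF _ tendsto_const[of 0]] by simp
qed

text \<open>Open boxes are stable under intersection and generate the Borel sets, so by Dynkin's lemma the integral of the
function vanishes over all Borel subsets of the box. The detour over a Borel measurable representative is due to
the completion of the measure.\<close>

lemma AE_0_on_box:
  fixes f :: "'a::euclidean_space \<Rightarrow> real"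
  assumes \<Omega>: "open \<Omega>" and f: "locally_integrable \<Omega> f"
    and 0: "\<And>\<psi>. \<psi> \<in> test_functions \<Omega> \<Longrightarrow> (LINT x|lebesgue_on \<Omega>. f x * \<psi> x) = 0"
    and ab: "cbox a b \<subseteq> \<Omega>"
  shows "AE x in lebesgue. x \<in> box a b \<longrightarrow> f x = 0"
proof -
  let ?F = "\<lambda>x. indicator (box a b) x * f x"
  have "set_integrable lebesgue (cbox a b) f"
    using f ab unfolding locally_integrable_def by auto
  then have "set_integrable lebesgue (box a b) f"
    by (rule set_integrable_subset) (auto simp: box_subset_cbox)
  then have int: "integrable lebesgue ?F" by (simp add: set_integrable_def)
  obtain g where g: "g \<in> borel_measurable lborel" "AE x in lborel. ?F x = g x"
    using completion_ex_borel_measurable_real[OF borel_measurable_integrable[OF int]] by blast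
  have gae: "AE x in lebesgue. ?F x = g x" using g(2) by (rule AE_completion)
  have gm: "g \<in> borel_measurable lebesgue" using g(1) measurable_completion by blast
  have gint: "integrable lebesgue g"
    using Bochner_Integration.integrable_cong_AE[OF borel_measurable_integrable[OF int] gm gae] int by blast
  then have gi: "integrable lborel g" using integrable_completion[OF g(1)] by simp
  have eq: "(LINT x|lborel. indicator S x * g x) = (LINT x|lebesgue. indicator S x * ?F x)" if "S \<in> sets borel" for S
  proof -
    have "(LINT x|lborel. indicator S x * g x) = (LINT x|lebesgue. indicator S x * g x)"
      using g(1) that by (subst integral_completion) auto
    also have "\<dots> = (LINT x|lebesgue. indicator S x * ?F x)"
    proof (rule integral_cong_AE)
      show "(\<lambda>x. indicat_real S x * g x) \<in> borel_measurable lebesgue" using that by (intro borel_measurable_times gm borel_measurable_indicator sets_completionI_sets) auto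
      show "(\<lambda>x. indicat_real S x * ?F x) \<in> borel_measurable lebesgue"
        using that by (intro borel_measurable_times[OF _ borel_measurable_integrable[OF int]] borel_measurable_indicator) auto
    qed (use gae in auto)
    finally show ?thesis .
  qed
  have *: "(LINT x|lborel. indicator S x * g x) = 0" if "S \<in> sets borel" for S
  proof -
    have S: "S \<in> sigma_sets UNIV (range (\<lambda>(c, d). box c d))"
      using that unfolding borel_eq_box by simp
    have pw: "range (\<lambda>(c::'a, d). box c d) \<subseteq> Pow UNIV" by simp
    have st: "Int_stable (range (\<lambda>(c::'a, d). box c d))"
      by (auto simp: Int_stable_def box_Int_box)
    show ?thesis using st pw S
    proof (induction S rule: sigma_sets_induct_disjoint)
      fix A assume "A \<in> range (\<lambda>(c::'a, d). box c d)"
      then obtain c d where A: "A = box c d" by auto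
      obtain c' d' where cd: "box c d \<inter> box a b = box c' d'" "cbox c' d' \<subseteq> cbox a b"
      proof
        show "box c d \<inter> box a b = box (\<Sum>i\<in>Basis. max (c\<bullet>i) (a\<bullet>i) *\<^sub>R i) (\<Sum>i\<in>Basis. min (d\<bullet>i) (b\<bullet>i) *\<^sub>R i)"
          by (rule box_Int_box)
        show "cbox (\<Sum>i\<in>Basis. max (c\<bullet>i) (a\<bullet>i) *\<^sub>R i) (\<Sum>i\<in>Basis. min (d\<bullet>i) (b\<bullet>i) *\<^sub>R i) \<subseteq> cbox a b"
          by (auto simp: cbox_def)
      qed
      have "(\<lambda>x. indicator A x * ?F x) = (\<lambda>x. indicator (box c' d') x * f x)"
        using A cd(1) by (auto simp: fun_eq_iff indicator_def)
      then show "(LINT x|lborel. indicator A x * g x) = 0"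
        using A eq[of A] integral_box_eq_0[OF \<Omega> f 0, of c' d'] cd(2) ab by auto
    next
      fix A assume A: "A \<in> sigma_sets UNIV (range (\<lambda>(c::'a, d). box c d))" "(LINT x|lborel. indicator A x * g x) = 0"
      then have Ab: "A \<in> sets borel" unfolding borel_eq_box by simp
      have i: "integrable lborel (\<lambda>x. indicator A x * g x)"
        using integrable_mult_indicator[OF _ gi, of A] Ab by simp
      have "(LINT x|lborel. indicator (UNIV - A) x * g x) = (LINT x|lborel. g x - indicator A x * g x)"
        by (intro Bochner_Integration.integral_cong refl) (auto simp: indicator_def)
      also have "\<dots> = (LINT x|lborel. g x)" using A(2) gi i by simp
      also have "\<dots> = (LINT x|lborel. indicator UNIV x * g x)" by simp
      also have "\<dots> = 0"
        using eq[of UNIV] integral_box_eq_0[OF \<Omega> f 0 ab] by auto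
      finally show "(LINT x|lborel. indicator (UNIV - A) x * g x) = 0" .
    next
      fix A :: "nat \<Rightarrow> 'a set"
      assume d: "disjoint_family A" and A: "range A \<subseteq> sigma_sets UNIV (range (\<lambda>(c::'a, d). box c d))"
        and z: "\<And>i. (LINT x|lborel. indicator (A i) x * g x) = 0"
      have Ab: "A i \<in> sets lborel" for i using A unfolding sets_lborel borel_eq_box by auto
      have "set_integrable lborel (\<Union>i. A i) g"
        unfolding set_integrable_def using integrable_mult_indicator[OF _ gi, of "\<Union>i. A i"] Ab by auto
      then have "(\<integral>x\<in>(\<Union>i. A i). g x \<partial>lborel) = (\<Sum>i. (\<integral>x\<in>(A i). g x \<partial>lborel))"
        using d by (intro lebesgue_integral_countable_add Ab) (auto simp: disjoint_family_on_def)
      then show "(LINT x|lborel. indicator (\<Union>i. A i) x * g x) = 0"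
        using z by (simp add: set_lebesgue_integral_def)
    qed auto
  qed
  have "AE x in lborel. g x = 0"
    by (rule density_unique_real[OF gi]) (auto simp: set_lebesgue_integral_def *)
  then have "AE x in lebesgue. g x = 0" by (rule AE_completion)
  with gae show ?thesis by eventually_elim auto
qed

lemma fundamental_lemma:
  fixes f :: "'a::euclidean_space \<Rightarrow> real"
  assumes \<Omega>: "open \<Omega>" and f: "locally_integrable \<Omega> f"
    and 0: "\<And>\<psi>. \<psi> \<in> test_functions \<Omega> \<Longrightarrow> (LINT x|lebesgue_on \<Omega>. f x * \<psi> x) = 0"
  shows "AE x in lebesgue_on \<Omega>. f x = 0"
proof -
  obtain D where D: "countable D" "D \<subseteq> Pow \<Omega>" "\<And>X. X \<in> D \<Longrightarrow> \<exists>a b. X = cbox a b" "\<Union>D = \<Omega>"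
    using open_countable_Union_open_cbox[OF \<Omega>] by metis
  have "AE x in lebesgue. x \<in> X \<longrightarrow> f x = 0" if X: "X \<in> D" for X
  proof -
    obtain a b where ab: "X = cbox a b" using D X by blast
    \<comment> \<open>The faces of a box are null sets, so it suffices to treat open boxes.\<close>
    have "AE x in lebesgue. x \<notin> cbox a b - box a b"
      using negligible_frontier_interval negligible_iff_null_sets AE_not_in by blast
    moreover have "AE x in lebesgue. x \<in> box a b \<longrightarrow> f x = 0"
      using X D ab by (intro AE_0_on_box[OF \<Omega> f 0]) auto
    ultimately show ?thesis by eventually_elim (auto simp: ab)
  qed
  then have "AE x in lebesgue. \<forall>X\<in>D. x \<in> X \<longrightarrow> f x = 0"
    using AE_ball_countable[OF D(1), of "\<lambda>x X. x \<in> X \<longrightarrow> f x = 0" lebesgue] by simp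
  then have "AE x in lebesgue. x \<in> \<Omega> \<longrightarrow> f x = 0"
    by eventually_elim (use D(4) in blast)
  then show ?thesis using \<Omega> by (subst AE_restrict_space_iff) auto
qed

section \<open>Weak gradients\<close>

definition grad :: "('a::euclidean_space \<Rightarrow> real) \<Rightarrow> 'a \<Rightarrow> 'a" where
  "grad \<phi> x = (\<Sum>b\<in>Basis. frechet_derivative \<phi> (at x) b *\<^sub>R b)"

lemma grad_inner_Basis: "b \<in> Basis \<Longrightarrow> grad \<phi> x \<bullet> b = frechet_derivative \<phi> (at x) b"
  by (simp add: grad_def inner_sum_left inner_Basis if_distrib cong: if_cong)

lemma test_function_C_k: "\<phi> \<in> test_functions \<Omega> \<Longrightarrow> C_k k \<phi>"
  by (simp add: test_functions_def)

lemma test_function_has_derivative: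
  assumes "\<phi> \<in> test_functions \<Omega>"
  shows "(\<phi> has_derivative (\<lambda>h. grad \<phi> x \<bullet> h)) (at x)"
proof -
  have d: "(\<phi> has_derivative frechet_derivative \<phi> (at x)) (at x)"
    using C_k_Suc_has_derivative[OF test_function_C_k[OF assms]] .
  then have lin: "linear (frechet_derivative \<phi> (at x))" by (rule has_derivative_linear)
  have "frechet_derivative \<phi> (at x) h = grad \<phi> x \<bullet> h" for h
  proof -
    have "frechet_derivative \<phi> (at x) h = frechet_derivative \<phi> (at x) (\<Sum>b\<in>Basis. (h \<bullet> b) *\<^sub>R b)"
      by (simp add: euclidean_representation)
    also have "\<dots> = (\<Sum>b\<in>Basis. (h \<bullet> b) * frechet_derivative \<phi> (at x) b)"
      by (simp add: linear_sum[OF lin] linear_scale[OF lin])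
    also have "\<dots> = grad \<phi> x \<bullet> h"
      by (simp add: grad_def inner_sum_left inner_commute[of h] mult.commute)
    finally show ?thesis .
  qed
  then show ?thesis using d by (metis (no_types, lifting) ext)
qed

lemma continuous_on_grad:
  assumes "\<phi> \<in> test_functions \<Omega>" shows "continuous_on UNIV (grad \<phi>)"
  unfolding grad_def
proof (intro continuous_intros)
  fix b :: 'a assume "b \<in> Basis"
  then have "C_k 0 (\<lambda>x. frechet_derivative \<phi> (at x) b)"
    using test_function_C_k[OF assms, of 1] by (simp add: C_k_Suc_iff)
  then show "continuous_on UNIV (\<lambda>x. frechet_derivative \<phi> (at x) b)" by simp
qed

lemma test_function_grad_support:
  assumes "\<phi> \<in> test_functions \<Omega>"
  obtains K where "compact K" "K \<subseteq> \<Omega>" "\<And>x. x \<notin> K \<Longrightarrow> \<phi> x = 0" "\<And>x. x \<notin> K \<Longrightarrow> grad \<phi> x = 0"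
  by (rule test_function_support[OF assms]) (auto simp: grad_def)

lemma test_function_outside:
  assumes "\<phi> \<in> test_functions \<Omega>" "x \<notin> \<Omega>" shows "\<phi> x = 0" "grad \<phi> x = 0"
  using test_function_grad_support[OF assms(1)] assms(2) by (metis subsetD)+

lemma bounded_on_compact_support:
  fixes f :: "'a::euclidean_space \<Rightarrow> 'b::real_normed_vector"
  assumes "continuous_on UNIV f" "compact K" "\<And>x. x \<notin> K \<Longrightarrow> f x = 0"
  obtains B where "B > 0" "\<And>x. norm (f x) \<le> B"
proof -
  have "compact (f ` K)" using assms by (intro compact_continuous_image) (auto intro: continuous_on_subset)
  then obtain B where "B > 0" "\<And>x. x \<in> K \<Longrightarrow> norm (f x) \<le> B"
    by (metis bounded_pos compact_imp_bounded imageI)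
  then show ?thesis using assms(3) that[of B] by (metis less_eq_real_def norm_zero)
qed

lemma test_function_bounded:
  assumes "\<phi> \<in> test_functions \<Omega>"
  obtains B where "B > 0" "\<And>x. \<bar>\<phi> x\<bar> \<le> B" "\<And>x. norm (grad \<phi> x) \<le> B"
proof -
  obtain K where K: "compact K" "\<And>x. x \<notin> K \<Longrightarrow> \<phi> x = 0" "\<And>x. x \<notin> K \<Longrightarrow> grad \<phi> x = 0"
    using test_function_grad_support[OF assms] by metis
  obtain B1 where "B1 > 0" "\<And>x. norm (\<phi> x) \<le> B1"
    using bounded_on_compact_support[OF continuous_on_test_function[OF assms] K(1,2)] by blast
  moreover obtain B2 where "B2 > 0" "\<And>x. norm (grad \<phi> x) \<le> B2"
    using bounded_on_compact_support[OF continuous_on_grad[OF assms] K(1,3)] by blast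
  ultimately show ?thesis using that[of "max B1 B2"] by (auto simp: le_max_iff_disj)
qed

lemma test_functions_mult:
  assumes "\<phi> \<in> test_functions \<Omega>" "\<psi> \<in> test_functions \<Omega>"
  shows "(\<lambda>x. \<phi> x * \<psi> x) \<in> test_functions \<Omega>"
proof -
  have "closure {x. \<phi> x * \<psi> x \<noteq> 0} \<subseteq> closure {x. \<phi> x \<noteq> 0}" by (rule closure_mono) auto
  moreover from this have "compact (closure {x. \<phi> x * \<psi> x \<noteq> 0})"
    using assms(1) unfolding test_functions_def compact_eq_bounded_closed by (auto intro: bounded_subset)
  moreover have "C_k k (\<lambda>x. \<phi> x * \<psi> x)" for k
    using assms by (intro C_k_mult test_function_C_k)
  ultimately show ?thesis using assms(1) unfolding test_functions_def by blast
qed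

lemma test_functions_diff:
  assumes "\<phi> \<in> test_functions \<Omega>" "\<psi> \<in> test_functions \<Omega>"
  shows "(\<lambda>x. \<phi> x - \<psi> x) \<in> test_functions \<Omega>"
proof -
  have "closure {x. \<phi> x - \<psi> x \<noteq> 0} \<subseteq> closure ({x. \<phi> x \<noteq> 0} \<union> {x. \<psi> x \<noteq> 0})" by (rule closure_mono) auto
  then have s: "closure {x. \<phi> x - \<psi> x \<noteq> 0} \<subseteq> closure {x. \<phi> x \<noteq> 0} \<union> closure {x. \<psi> x \<noteq> 0}" by simp
  then have "compact (closure {x. \<phi> x - \<psi> x \<noteq> 0})" using assms
    unfolding test_functions_def compact_eq_bounded_closed
    by (auto intro: bounded_subset[of "closure {x. \<phi> x \<noteq> 0} \<union> closure {x. \<psi> x \<noteq> 0}"])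
  moreover have "C_k k (\<lambda>x. \<phi> x + (-1) * \<psi> x)" for k
    using assms by (intro C_k_add C_k_mult C_k_const test_function_C_k)
  ultimately show ?thesis using assms s by (auto simp: test_functions_def)
qed

lemma grad_diff:
  assumes "\<phi> \<in> test_functions \<Omega>" "\<psi> \<in> test_functions \<Omega>"
  shows "grad (\<lambda>x. \<phi> x - \<psi> x) x = grad \<phi> x - grad \<psi> x"
proof -
  have "((\<lambda>x. \<phi> x - \<psi> x) has_derivative (\<lambda>h. grad \<phi> x \<bullet> h - grad \<psi> x \<bullet> h)) (at x)"
    by (intro has_derivative_diff test_function_has_derivative[OF assms(1)] test_function_has_derivative[OF assms(2)])
  moreover have "((\<lambda>x. \<phi> x - \<psi> x) has_derivative (\<lambda>h. grad (\<lambda>x. \<phi> x - \<psi> x) x \<bullet> h)) (at x)"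
    by (rule test_function_has_derivative[OF test_functions_diff[OF assms]])
  ultimately have "(\<lambda>h. grad \<phi> x \<bullet> h - grad \<psi> x \<bullet> h) = (\<lambda>h. grad (\<lambda>x. \<phi> x - \<psi> x) x \<bullet> h)"
    by (rule has_derivative_unique)
  then have "grad (\<lambda>x. \<phi> x - \<psi> x) x \<bullet> h = (grad \<phi> x - grad \<psi> x) \<bullet> h" for h
    by (simp add: inner_diff_left fun_eq_iff)
  then show ?thesis by (rule euclidean_eqI)
qed

lemma integrable_compact_support:
  fixes f :: "'a::euclidean_space \<Rightarrow> 'b::euclidean_space"
  assumes "continuous_on UNIV f" "compact K" "\<And>x. x \<notin> K \<Longrightarrow> f x = 0"
  shows "integrable lborel f"
proof -
  have "integrable lborel (\<lambda>x. indicator K x *\<^sub>R f x)"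
    using assms by (intro borel_integrable_compact) (auto intro: continuous_on_subset)
  also have "(\<lambda>x. indicator K x *\<^sub>R f x) = f" using assms by (auto simp: fun_eq_iff indicator_def)
  finally show ?thesis .
qed

text \<open>By translation invariance the integral of each difference quotient vanishes; the quotients converge to the
directional derivative and are bounded with bounded support.\<close>

lemma integral_directional_derivative_eq_0:
  fixes F :: "'a::euclidean_space \<Rightarrow> real"
  assumes F: "F \<in> test_functions \<Omega>"
  shows "(LINT x|lborel. grad F x \<bullet> b) = 0"
proof -
  obtain K where K: "compact K" "\<And>x. x \<notin> K \<Longrightarrow> F x = 0" "\<And>x. x \<notin> K \<Longrightarrow> grad F x = 0"
    using test_function_grad_support[OF F] by metis
  obtain B where B: "B > 0" "\<And>x. norm (grad F x) \<le> B" using test_function_bounded[OF F] by metis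
  obtain R where R: "R > 0" "\<And>x. x \<in> K \<Longrightarrow> norm x \<le> R" using compact_imp_bounded[OF K(1)] bounded_pos by metis
  have cF: "continuous_on UNIV F" using continuous_on_test_function[OF F] .
  have [measurable]: "F \<in> borel_measurable borel" using borel_measurable_continuous_onI[OF cF] .
  have intF: "integrable lborel F" using integrable_compact_support[OF cF K(1,2)] .
  \<comment> \<open>Difference quotients along the sequence of steps \<open>1 / (n + 1)\<close>.\<close>
  define t where "t n = inverse (real (Suc n))" for n
  have t: "t n > 0" "t n \<le> 1" "t n \<noteq> 0" for n by (auto simp: t_def field_simps)
  have t0: "t \<longlonglongrightarrow> 0" unfolding t_def by (rule LIMSEQ_inverse_real_of_nat)
  define Q where "Q n x = (F (x + t n *\<^sub>R b) - F x) / t n" for n x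
  have Qb: "\<bar>Q n x\<bar> \<le> B * norm b" for n x
  proof -
    have "norm (F (x + t n *\<^sub>R b) - F x) \<le> B * norm (x + t n *\<^sub>R b - x)"
    proof (rule differentiable_bound[of UNIV])
      show "(F has_derivative (\<lambda>h. grad F x \<bullet> h)) (at x within UNIV)" for x
        using test_function_has_derivative[OF F] by simp
      show "onorm (\<lambda>h. grad F x \<bullet> h) \<le> B" for x
      proof (rule onorm_le)
        fix h show "norm (grad F x \<bullet> h) \<le> B * norm h"
          using Cauchy_Schwarz_ineq2[of "grad F x" h]
          mult_right_mono[OF B(2)[of x] norm_ge_zero[of h]] by simp
      qed
    qed auto
    then show ?thesis using t[of n] by (simp add: Q_def field_simps)
  qed
  have "(\<lambda>n. LINT x|lborel. Q n x) \<longlonglongrightarrow> (LINT x|lborel. grad F x \<bullet> b)"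
  proof (rule integral_dominated_convergence[where w="\<lambda>x. indicator (cball 0 (R + norm b)) x *\<^sub>R (B * norm b)"])
    show "(\<lambda>x. grad F x \<bullet> b) \<in> borel_measurable lborel"
      using borel_measurable_continuous_onI[OF continuous_on_grad[OF F]] by simp
    show "Q n \<in> borel_measurable lborel" for n unfolding Q_def by measurable
    show "integrable lborel (\<lambda>x::'a. indicator (cball 0 (R + norm b)) x *\<^sub>R (B * norm b))"
      by (intro borel_integrable_compact) auto
    show "AE x in lborel. (\<lambda>n. Q n x) \<longlonglongrightarrow> grad F x \<bullet> b"
    proof (rule AE_I2)
      fix x
      have "((\<lambda>s. F (x + s *\<^sub>R b)) has_derivative (\<lambda>s. grad F x \<bullet> (s *\<^sub>R b))) (at 0)"
        using test_function_has_derivative[OF F, of x]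
        by (intro has_derivative_compose[where f="\<lambda>s. x + s *\<^sub>R b" and g=F and g'="\<lambda>h. grad F x \<bullet> h"]) 
           (auto intro!: derivative_eq_intros)
      then have "((\<lambda>s. F (x + s *\<^sub>R b)) has_field_derivative (grad F x \<bullet> b)) (at 0)"
        by (simp add: has_field_derivative_def mult_commute_abs)
      then have "((\<lambda>h. (F (x + h *\<^sub>R b) - F x) / h) \<longlongrightarrow> grad F x \<bullet> b) (at 0)"
        by (simp add: DERIV_def)
      then show "(\<lambda>n. Q n x) \<longlonglongrightarrow> grad F x \<bullet> b" unfolding Q_def
        by (rule filterlim_compose) (use t t0 in \<open>auto simp: filterlim_at\<close>)
    qed
    show "AE x in lborel. norm (Q n x) \<le> indicator (cball 0 (R + norm b)) x *\<^sub>R (B * norm b)" for n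
    proof (rule AE_I2)
      fix x show "norm (Q n x) \<le> indicator (cball 0 (R + norm b)) x *\<^sub>R (B * norm b)"
      proof (cases "norm x \<le> R + norm b")
        case True then show ?thesis using Qb by (simp add: )
      next
        case False
        have "norm x \<le> norm (x + t n *\<^sub>R b) + norm (t n *\<^sub>R b)" by (metis add_diff_cancel_right' norm_triangle_ineq4)
        moreover have "norm (t n *\<^sub>R b) \<le> norm b" using t[of n] by (simp add: mult_left_le_one_le)
        ultimately have "norm (x + t n *\<^sub>R b) > R" using False by linarith
        then have "F (x + t n *\<^sub>R b) = 0" "F x = 0" using False R K(2) norm_ge_zero[of b] by (force simp del: norm_ge_zero)+
        then show ?thesis using B by (simp add: Q_def)
      qed
    qed
  qed
  moreover have "(LINT x|lborel. Q n x) = 0" for n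
  proof -
    have "integrable (distr lborel borel ((+) (t n *\<^sub>R b))) F" using intF by (simp add: lborel_distr_plus)
    then have i: "integrable lborel (\<lambda>x. F (x + t n *\<^sub>R b))"
      by (subst (asm) integrable_distr_eq) (auto simp: add.commute)
    have "(LINT x|lborel. F x) = (LINT x|distr lborel borel ((+) (t n *\<^sub>R b)). F x)" by (simp add: lborel_distr_plus)
    also have "\<dots> = (LINT x|lborel. F (x + t n *\<^sub>R b))" by (subst integral_distr) (auto simp: add.commute)
    finally show ?thesis using i intF by (simp add: Q_def)
  qed
  ultimately show ?thesis using LIMSEQ_unique[OF _ tendsto_const[of 0]] by simp
qed

lemma integral_lebesgue_on_eq_lborel:
  fixes f :: "'a::euclidean_space \<Rightarrow> real"
  assumes "open \<Omega>" "f \<in> borel_measurable borel" "\<And>x. x \<notin> \<Omega> \<Longrightarrow> f x = 0"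
  shows "(LINT x|lebesgue_on \<Omega>. f x) = (LINT x|lborel. f x)"
proof -
  have "(\<lambda>x. indicator \<Omega> x *\<^sub>R f x) = f" using assms(3) by (auto simp: fun_eq_iff indicator_def)
  then show ?thesis using assms(1,2) by (simp add: integral_restrict_space integral_completion)
qed

lemma locally_integrable_continuous:
  fixes f :: "'a::euclidean_space \<Rightarrow> 'b::euclidean_space"
  assumes "continuous_on UNIV f" shows "locally_integrable \<Omega> f"
  unfolding locally_integrable_def set_integrable_def
proof (intro allI impI)
  fix K assume "compact K \<and> K \<subseteq> \<Omega>"
  then have "integrable lborel (\<lambda>x. indicator K x *\<^sub>R f x)"
    using assms by (intro borel_integrable_compact) (auto intro: continuous_on_subset)
  then show "integrable lebesgue (\<lambda>x. indicator K x *\<^sub>R f x)"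
    using integrable_completion[of "\<lambda>x. indicator K x *\<^sub>R f x" lborel] by auto
qed

text \<open>Integration by parts: apply the previous lemma to the product of the two test functions.\<close>

lemma has_weak_gradient_grad:
  assumes \<Omega>: "open \<Omega>" and \<phi>: "\<phi> \<in> test_functions \<Omega>"
  shows "has_weak_gradient \<Omega> \<phi> (grad \<phi>)"
  unfolding has_weak_gradient_def
proof (intro conjI ballI)
  show "locally_integrable \<Omega> \<phi>" "locally_integrable \<Omega> (grad \<phi>)"
    using locally_integrable_continuous continuous_on_test_function[OF \<phi>] continuous_on_grad[OF \<phi>] by auto
  fix \<psi> b assume \<psi>: "\<psi> \<in> test_functions \<Omega>" and b: "b \<in> (Basis :: 'a set)"
  note c = continuous_on_test_function[OF \<phi>] continuous_on_grad[OF \<phi>] continuous_on_test_function[OF \<psi>] continuous_on_grad[OF \<psi>]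
  note [measurable] = c[THEN borel_measurable_continuous_onI]
  obtain K where K: "compact K" "K \<subseteq> \<Omega>" "\<And>x. x \<notin> K \<Longrightarrow> \<phi> x = 0" "\<And>x. x \<notin> K \<Longrightarrow> grad \<phi> x = 0"
    using test_function_grad_support[OF \<phi>] by metis
  have i1: "integrable lborel (\<lambda>x. \<phi> x * (grad \<psi> x \<bullet> b))"
    using K by (intro integrable_compact_support[of _ K] continuous_intros c) auto
  have i2: "integrable lborel (\<lambda>x. (grad \<phi> x \<bullet> b) * \<psi> x)"
    using K by (intro integrable_compact_support[of _ K] continuous_intros c) auto
  have "grad (\<lambda>x. \<phi> x * \<psi> x) x \<bullet> b = \<phi> x * (grad \<psi> x \<bullet> b) + (grad \<phi> x \<bullet> b) * \<psi> x" for x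
    using fun_cong[OF has_derivative_unique[OF test_function_has_derivative[OF test_functions_mult[OF \<phi> \<psi>], of x]
      has_derivative_mult[OF test_function_has_derivative[OF \<phi>, of x] test_function_has_derivative[OF \<psi>, of x]]], of b]
    by simp
  then have "(LINT x|lborel. \<phi> x * (grad \<psi> x \<bullet> b) + (grad \<phi> x \<bullet> b) * \<psi> x) = 0"
    using integral_directional_derivative_eq_0[OF test_functions_mult[OF \<phi> \<psi>], of b] by simp
  then have e: "(LINT x|lborel. \<phi> x * (grad \<psi> x \<bullet> b)) = - (LINT x|lborel. (grad \<phi> x \<bullet> b) * \<psi> x)"
    using i1 i2 by simp
  have e2: "(LINT x|lebesgue_on \<Omega>. \<phi> x * (grad \<psi> x \<bullet> b)) = (LINT x|lborel. \<phi> x * (grad \<psi> x \<bullet> b))"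
    by (intro integral_lebesgue_on_eq_lborel[OF \<Omega>]) (auto simp: test_function_outside[OF \<phi>])
  have e3: "(LINT x|lebesgue_on \<Omega>. (grad \<phi> x \<bullet> b) * \<psi> x) = (LINT x|lborel. (grad \<phi> x \<bullet> b) * \<psi> x)"
    by (intro integral_lebesgue_on_eq_lborel[OF \<Omega>]) (auto simp: test_function_outside[OF \<phi>])
  show "(LINT x|lebesgue_on \<Omega>. \<phi> x * frechet_derivative \<psi> (at x) b) = - (LINT x|lebesgue_on \<Omega>. (grad \<phi> x \<bullet> b) * \<psi> x)"
    using e e2 e3 grad_inner_Basis[OF b, of \<psi>] by simp
qed

lemma locally_integrable_test_mult:
  fixes f :: "'a::euclidean_space \<Rightarrow> real"
  assumes "open \<Omega>" "locally_integrable \<Omega> f" "\<psi> \<in> test_functions \<Omega>"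
  shows "integrable (lebesgue_on \<Omega>) (\<lambda>x. f x * \<psi> x)"
    and "b \<in> Basis \<Longrightarrow> integrable (lebesgue_on \<Omega>) (\<lambda>x. f x * frechet_derivative \<psi> (at x) b)"
proof -
  obtain K where K: "compact K" "K \<subseteq> \<Omega>" "\<And>x. x \<notin> K \<Longrightarrow> \<psi> x = 0" "\<And>x. x \<notin> K \<Longrightarrow> grad \<psi> x = 0"
    using test_function_grad_support[OF assms(3)] by metis
  show "integrable (lebesgue_on \<Omega>) (\<lambda>x. f x * \<psi> x)"
    using K assms by (intro locally_integrable_mult[of _ _ K] continuous_on_test_function)
  assume b: "b \<in> Basis"
  have "integrable (lebesgue_on \<Omega>) (\<lambda>x. f x * (grad \<psi> x \<bullet> b))"
    using K assms by (intro locally_integrable_mult[of _ _ K] continuous_intros continuous_on_grad) auto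
  then show "integrable (lebesgue_on \<Omega>) (\<lambda>x. f x * frechet_derivative \<psi> (at x) b)"
    using grad_inner_Basis[OF b] by simp
qed

lemma locally_integrable_inner:
  assumes "locally_integrable \<Omega> f" shows "locally_integrable \<Omega> (\<lambda>x. f x \<bullet> b)"
proof -
  have "integrable lebesgue (\<lambda>x. (indicator K x *\<^sub>R f x) \<bullet> b)" if "compact K" "K \<subseteq> \<Omega>" for K
    using assms that unfolding locally_integrable_def set_integrable_def by (intro integrable_inner_left) auto
  then show ?thesis unfolding locally_integrable_def set_integrable_def by simp
qed

lemma locally_integrable_diff:
  assumes "locally_integrable \<Omega> f" "locally_integrable \<Omega> g" shows "locally_integrable \<Omega> (\<lambda>x. f x - g x)"
  using assms unfolding locally_integrable_def by (auto intro: set_integral_diff)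

lemma has_weak_gradient_diff:
  assumes \<Omega>: "open \<Omega>" and u: "has_weak_gradient \<Omega> u g" and v: "has_weak_gradient \<Omega> v k"
  shows "has_weak_gradient \<Omega> (\<lambda>x. u x - v x) (\<lambda>x. g x - k x)"
  unfolding has_weak_gradient_def
proof (intro conjI ballI)
  have l: "locally_integrable \<Omega> u" "locally_integrable \<Omega> g" "locally_integrable \<Omega> v" "locally_integrable \<Omega> k"
    using u v by (auto simp: has_weak_gradient_def)
  then show "locally_integrable \<Omega> (\<lambda>x. u x - v x)" "locally_integrable \<Omega> (\<lambda>x. g x - k x)"
    by (auto intro: locally_integrable_diff)
  fix \<psi> b assume \<psi>: "\<psi> \<in> test_functions \<Omega>" and b: "b \<in> (Basis :: 'a set)"
  note i = locally_integrable_test_mult[OF \<Omega> _ \<psi>]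
  show "(LINT x|lebesgue_on \<Omega>. (u x - v x) * frechet_derivative \<psi> (at x) b) =
       - (LINT x|lebesgue_on \<Omega>. (g x - k x) \<bullet> b * \<psi> x)"
    using u v \<psi> b i(2)[OF l(1) b] i(2)[OF l(3) b] i(1)[OF locally_integrable_inner[OF l(2)], of b]
       i(1)[OF locally_integrable_inner[OF l(4)], of b]
    by (simp add: has_weak_gradient_def left_diff_distrib inner_diff_left)
qed

lemma has_weak_gradient_unique:
  fixes u :: "'a::euclidean_space \<Rightarrow> real"
  assumes \<Omega>: "open \<Omega>" and u: "has_weak_gradient \<Omega> u g" "has_weak_gradient \<Omega> u k"
  shows "AE x in lebesgue_on \<Omega>. g x = k x"
proof -
  have "AE x in lebesgue_on \<Omega>. (g x - k x) \<bullet> b = 0" if b: "b \<in> Basis" for b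
  proof (rule fundamental_lemma[OF \<Omega>])
    have l: "locally_integrable \<Omega> g" "locally_integrable \<Omega> k"
      using u by (auto simp: has_weak_gradient_def)
    then show "locally_integrable \<Omega> (\<lambda>x. (g x - k x) \<bullet> b)"
      by (intro locally_integrable_inner locally_integrable_diff)
    fix \<psi> assume \<psi>: "\<psi> \<in> test_functions \<Omega>"
    note i = locally_integrable_test_mult(1)[OF \<Omega> _ \<psi>]
    have "(LINT x|lebesgue_on \<Omega>. u x * frechet_derivative \<psi> (at x) b) = - (LINT x|lebesgue_on \<Omega>. (g x \<bullet> b) * \<psi> x)"
      "(LINT x|lebesgue_on \<Omega>. u x * frechet_derivative \<psi> (at x) b) = - (LINT x|lebesgue_on \<Omega>. (k x \<bullet> b) * \<psi> x)"
      using u \<psi> b unfolding has_weak_gradient_def by blast+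
    then have "(LINT x|lebesgue_on \<Omega>. (g x \<bullet> b) * \<psi> x) = (LINT x|lebesgue_on \<Omega>. (k x \<bullet> b) * \<psi> x)"
      by linarith
    then show "(LINT x|lebesgue_on \<Omega>. (g x - k x) \<bullet> b * \<psi> x) = 0"
      using i[OF locally_integrable_inner[OF l(1)], of b] i[OF locally_integrable_inner[OF l(2)], of b]
      by (simp add: inner_diff_left left_diff_distrib)
  qed
  then have "AE x in lebesgue_on \<Omega>. \<forall>b\<in>Basis. (g x - k x) \<bullet> b = 0"
    by (subst AE_ball_countable) (auto intro: countable_finite)
  then show ?thesis by eventually_elim (simp add: euclidean_all_zero_iff)
qed

lemma has_weak_gradient_wgrad: "has_weak_gradient \<Omega> u g \<Longrightarrow> has_weak_gradient \<Omega> u (wgrad \<Omega> u)"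
  unfolding wgrad_def by (rule someI[where P="has_weak_gradient \<Omega> u"])

lemma wgrad_eq_AE:
  assumes "open \<Omega>" "has_weak_gradient \<Omega> u g" shows "AE x in lebesgue_on \<Omega>. wgrad \<Omega> u x = g x"
  by (rule has_weak_gradient_unique[OF assms(1) has_weak_gradient_wgrad[OF assms(2)] assms(2)])

section \<open>Averages and variable powers\<close>

text \<open>This pointwise inequality, integrated, replaces Jensen's and Hoelder's inequalities below.\<close>

lemma powr_above_tangent:
  fixes a y q :: real
  assumes "a > 0" "y \<ge> 0" "q \<ge> 1"
  shows "a powr q + q * a powr (q - 1) * (y - a) \<le> y powr q"
proof (cases "y = 0")
  case True
  have "a powr q = a powr (q - 1) * a" using assms powr_add[of a "q - 1" 1] by simp
  then have "a powr q + q * a powr (q - 1) * (y - a) = (1 - q) * a powr q" using True by (simp add: algebra_simps)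
  also have "\<dots> \<le> 0" using assms by (intro mult_nonpos_nonneg) auto
  finally show ?thesis by (simp add: True)
next
  case False
  have "y powr q - a powr q \<ge> (q * a powr (q - 1)) * (y - a)"
  proof (rule convex_on_imp_above_tangent[OF powr_convex[OF assms(3)]])
    have "((\<lambda>x. x powr q) has_real_derivative q * a powr (q - 1)) (at a)"
      using assms(1) by (rule has_real_derivative_powr)
    then show "((\<lambda>x. x powr q) has_real_derivative q * a powr (q - 1)) (at a within {0<..})"
      by (rule has_field_derivative_at_within)
  qed (use assms False in \<open>auto simp: interior_open\<close>)
  then show ?thesis by simp
qed

text \<open>Integrate the tangent inequality for \<open>f / w\<close> at the mean value \<open>a\<close> of \<open>f / w\<close> with respect to the density \<open>w\<close>.
With \<open>w = 1\<close> this is Jensen's inequality, with other weights Hoelder's.\<close>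

lemma integral_powr_le_weighted:
  fixes f w :: "'b \<Rightarrow> real"
  assumes "q \<ge> 1" and f: "integrable M f" "AE x in M. 0 \<le> f x" and w: "integrable M w" "AE x in M. 0 < w x"
    and fw: "integrable M (\<lambda>x. f x powr q * w x powr (1 - q))"
  shows "(\<integral>x. f x \<partial>M) powr q \<le> (\<integral>x. w x \<partial>M) powr (q - 1) * (\<integral>x. f x powr q * w x powr (1 - q) \<partial>M)"
proof (cases "(\<integral>x. f x \<partial>M) = 0 \<or> (\<integral>x. w x \<partial>M) = 0")
  case True
  then show ?thesis
  proof
    assume "(\<integral>x. f x \<partial>M) = 0"
    then show ?thesis by (auto intro!: mult_nonneg_nonneg integral_nonneg_AE)
  next
    assume "(\<integral>x. w x \<partial>M) = 0"
    then have "AE x in M. w x = 0" using w by (subst (asm) integral_nonneg_eq_0_iff_AE) auto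
    with w(2) have "AE x in M. f x = 0" by eventually_elim auto
    then have "(\<integral>x. f x \<partial>M) = 0" by (rule integral_eq_zero_AE)
    then show ?thesis by (auto intro!: mult_nonneg_nonneg integral_nonneg_AE)
  qed
next
  case False
  define F Z where "F = (\<integral>x. f x \<partial>M)" and "Z = (\<integral>x. w x \<partial>M)"
  have "F \<ge> 0" "Z \<ge> 0" using f w unfolding F_def Z_def by (auto intro!: integral_nonneg_AE elim: eventually_mono)
  then have pos: "F > 0" "Z > 0" using False unfolding F_def Z_def by linarith+
  define a where "a = F / Z"
  have a: "a > 0" using pos by (simp add: a_def)
  have pw: "AE x in M. a powr q * w x + q * a powr (q - 1) * (f x - a * w x) \<le> f x powr q * w x powr (1 - q)"
    using f(2) w(2)
  proof eventually_elim
    case (elim x)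
    have "(a powr q + q * a powr (q - 1) * (f x / w x - a)) * w x \<le> (f x / w x) powr q * w x"
      using elim by (intro mult_right_mono powr_above_tangent a assms) auto
    also have "(f x / w x) powr q * w x = f x powr q * w x powr (1 - q)"
      using elim by (simp add: powr_divide powr_diff field_simps)
    also have "(a powr q + q * a powr (q - 1) * (f x / w x - a)) * w x =
        a powr q * w x + q * a powr (q - 1) * (f x / w x * w x - a * w x)"
      by (simp add: algebra_simps)
    also have "f x / w x * w x = f x" using elim by simp
    finally show ?case .
  qed
  have "a powr q * Z = (\<integral>x. a powr q * w x + q * a powr (q - 1) * (f x - a * w x) \<partial>M)"
    using f w pos by (simp add: F_def[symmetric] Z_def[symmetric] a_def)
  also have "\<dots> \<le> (\<integral>x. f x powr q * w x powr (1 - q) \<partial>M)"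
    using f w by (intro integral_mono_AE fw pw) auto
  finally have "Z powr (q - 1) * (a powr q * Z) \<le> Z powr (q - 1) * (\<integral>x. f x powr q * w x powr (1 - q) \<partial>M)"
    by (intro mult_left_mono) auto
  moreover have "Z powr (q - 1) * (a powr q * Z) = F powr q"
    using pos by (simp add: a_def powr_divide powr_diff)
  ultimately show ?thesis by (simp add: F_def Z_def)
qed

lemma integrable_of_bounded:
  fixes f :: "'b \<Rightarrow> real"
  assumes "emeasure M (space M) = 1" "f \<in> borel_measurable M" "AE x in M. 0 \<le> f x" "AE x in M. f x \<le> b"
  shows "integrable M f"
proof -
  interpret finite_measure M by (rule finite_measureI) (use assms(1) in simp)
  show ?thesis
    by (rule integrable_const_bound[of _ b]) (use assms in \<open>auto elim: eventually_elim2\<close>)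
qed

lemma jensen_powr:
  fixes f :: "'b \<Rightarrow> real"
  assumes M: "emeasure M (space M) = 1" and "q \<ge> 1" and f: "f \<in> borel_measurable M" "AE x in M. 0 \<le> f x" "AE x in M. f x \<le> b"
  shows "(\<integral>x. f x \<partial>M) powr q \<le> (\<integral>x. f x powr q \<partial>M)"
proof -
  interpret finite_measure M by (rule finite_measureI) (use M in simp)
  have "integrable M (\<lambda>x. f x powr q)"
  proof (rule integrable_of_bounded[OF M])
    show "AE x in M. f x powr q \<le> b powr q"
      using f(2,3) by eventually_elim (use assms(2) in \<open>auto intro: powr_mono2\<close>)
  qed (use f in auto)
  then show ?thesis
    using integral_powr_le_weighted[OF assms(2) integrable_of_bounded[OF M f] f(2), of "\<lambda>_. 1"] M
    by (simp add: measure_def)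
qed

lemma le_one_plus_powr: "0 \<le> (y::real) \<Longrightarrow> 1 \<le> a \<Longrightarrow> a \<le> b \<Longrightarrow> y powr a \<le> 1 + y powr b"
  using powr_le1[of a y] powr_mono[of a b y] powr_ge_zero[of y b] by (cases "y \<le> 1") (auto intro: add_increasing2 add_increasing simp del: powr_ge_zero)

text \<open>Split off the power \<open>px - ps\<close>, where \<open>ps\<close> is a lower bound for the exponents that occur: the mean is at most \<open>Q\<close>, so this
power costs the factor \<open>C\<close>, and Jensen's inequality applies with the constant exponent \<open>ps\<close>.\<close>

lemma jensen_variable_powr:
  fixes G :: "'b \<Rightarrow> real"
  assumes M: "emeasure M (space M) = 1"
    and G: "G \<in> borel_measurable M" "\<And>x. 0 \<le> G x" "\<And>x. G x \<le> b"
    and e: "e \<in> borel_measurable M" "AE x in M. ps \<le> e x" "\<And>x. e x \<le> P"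
    and ps: "1 \<le> ps" "ps \<le> px"
    and Q: "1 + (\<integral>x. G x powr e x \<partial>M) \<le> Q" and C: "1 \<le> C" "Q powr (px - ps) \<le> C"
  shows "(\<integral>x. G x \<partial>M) powr px \<le> C * (1 + (\<integral>x. G x powr e x \<partial>M))"
proof -
  interpret finite_measure M by (rule finite_measureI) (use M in simp)
  have one: "(\<integral>x. 1 \<partial>M) = (1::real)" using M by (simp add: measure_def)
  define A where "A = (\<integral>x. G x \<partial>M)"
  define I where "I = (\<integral>x. G x powr e x \<partial>M)"
  have iG: "integrable M G" using integrable_of_bounded[OF M G(1), of b] G by auto
  have iGe: "integrable M (\<lambda>x. G x powr e x)"
  proof (rule integrable_of_bounded[OF M])
    show "AE x in M. G x powr e x \<le> (max 1 b) powr P"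
      using e(2)
    proof eventually_elim
      case (elim x)
      have "G x powr e x \<le> (max 1 b) powr e x" using G elim ps by (intro powr_mono2) (auto simp: le_max_iff_disj)
      also have "\<dots> \<le> (max 1 b) powr P" using e by (intro powr_mono) auto
      finally show ?case .
    qed
  qed (use G e in auto)
  have I0: "I \<ge> 0" unfolding I_def by (intro integral_nonneg_AE) auto
  have A0: "A \<ge> 0" unfolding A_def using G by (intro integral_nonneg_AE) auto
  show ?thesis
  proof (cases "A \<le> 1")
    case True
    then have "A powr px \<le> 1" using A0 ps by (intro powr_le1) auto
    also have "1 \<le> C * (1 + I)" using C I0 mult_mono[of 1 C 1 "1 + I"] by simp
    finally show ?thesis by (simp add: A_def I_def)
  next
    case False
    have "A \<le> (\<integral>x. 1 + G x powr e x \<partial>M)" unfolding A_def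
    proof (intro integral_mono_AE iG)
      show "AE x in M. G x \<le> 1 + G x powr e x"
        using e(2)
      proof eventually_elim
        case (elim x) then show ?case using le_one_plus_powr[OF G(2)[of x], of 1 "e x"] ps G(2)[of x] by simp
      qed
    qed (use iGe in auto)
    also have "\<dots> = 1 + I" using iGe one by (simp add: I_def)
    finally have AQ: "A \<le> Q" using Q by (simp add: I_def)
    have "A powr ps \<le> (\<integral>x. G x powr ps \<partial>M)"
      unfolding A_def by (rule jensen_powr[OF M ps(1) G(1), of b]) (use G in auto)
    also have "\<dots> \<le> (\<integral>x. 1 + G x powr e x \<partial>M)"
    proof (intro integral_mono_AE)
      show "integrable M (\<lambda>x. G x powr ps)"
        by (rule integrable_of_bounded[OF M, of _ "b powr ps"]) (use G ps in \<open>auto intro!: AE_I2 powr_mono2\<close>)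
      show "AE x in M. G x powr ps \<le> 1 + G x powr e x"
        using e(2) by eventually_elim (use le_one_plus_powr G ps in auto)
    qed (use iGe in auto)
    also have "\<dots> = 1 + I" using iGe one by (simp add: I_def)
    finally have 1: "A powr ps \<le> 1 + I" .
    have 2: "A powr (px - ps) \<le> C" using AQ False ps A0 C(2)
      by (meson powr_mono2 order_trans diff_ge_0_iff_ge)
    have "A powr px = A powr (px - ps) * A powr ps" by (simp add: powr_add[symmetric])
    also have "\<dots> \<le> C * (1 + I)" using 1 2 C by (intro mult_mono) auto
    finally show ?thesis by (simp add: A_def I_def)
  qed
qed

text \<open>The point of log-Hoelder continuity: a power of \<open>1 / t\<close> raised to an oscillation of the exponent at scale \<open>t\<close> stays
bounded. Taking logarithms, the factor \<open>ln (1 / t)\<close> cancels.\<close>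

lemma log_scale_bound:
  fixes M t R C :: real
  assumes "0 \<le> M" "0 < t" "1 \<le> R" "0 \<le> C"
  shows "(2 + M * (1 / t) ^ N) powr (C / ln (exp 1 + 1 / (t * R)))
    \<le> exp (C * (ln (2 + M) + real N * (ln R + 1)))"
proof -
  define l where "l = ln (exp 1 + 1 / (t * R))"
  have l: "l \<ge> 1"
  proof -
    have "ln (exp 1) \<le> l" unfolding l_def using assms by (subst ln_le_cancel_iff) (auto intro!: add_pos_nonneg)
    then show ?thesis by simp
  qed
  have p: "exp 1 + 1 / t > 0" using assms by (intro add_pos_nonneg) auto
  have "exp 1 + 1 / t \<le> R * (exp 1 + 1 / (t * R))"
    using assms mult_right_mono[of 1 R "exp 1"] by (simp add: field_simps)
  then have "ln (exp 1 + 1 / t) \<le> ln (R * (exp 1 + 1 / (t * R)))"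
    using p by (intro ln_mono) auto
  also have "\<dots> = ln R + l" using assms unfolding l_def by (intro ln_mult_pos) (auto intro!: add_pos_nonneg)
  finally have 1: "ln (exp 1 + 1 / t) \<le> ln R + l" .
  have e1: "1 \<le> exp 1 + 1 / t" using assms by (intro add_increasing2) auto
  have "2 + M * (1 / t) ^ N \<le> 2 * (exp 1 + 1 / t) ^ N + M * (exp 1 + 1 / t) ^ N"
    using assms one_le_power[OF e1, of N] by (intro add_mono mult_left_mono power_mono) (auto)
  then have "ln (2 + M * (1 / t) ^ N) \<le> ln ((2 + M) * (exp 1 + 1 / t) ^ N)"
    using assms by (intro ln_mono) (auto simp: algebra_simps intro!: add_pos_nonneg)
  also have "\<dots> = ln (2 + M) + real N * ln (exp 1 + 1 / t)"
    using assms p by (subst ln_mult_pos) (auto simp: ln_realpow)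
  also have "\<dots> \<le> ln (2 + M) + real N * (ln R + l)"
    using 1 by (intro add_left_mono mult_left_mono) auto
  also have "\<dots> \<le> (ln (2 + M) + real N * (ln R + 1)) * l"
  proof -
    have "ln (2 + M) * 1 \<le> ln (2 + M) * l" "(real N * ln R) * 1 \<le> (real N * ln R) * l"
      using l assms by (intro mult_left_mono; simp)+
    then show ?thesis by (simp add: algebra_simps)
  qed
  finally have 2: "ln (2 + M * (1 / t) ^ N) \<le> (ln (2 + M) + real N * (ln R + 1)) * l" .
  have "(2 + M * (1 / t) ^ N) powr (C / l) = exp (C / l * ln (2 + M * (1 / t) ^ N))"
    using assms by (auto simp: powr_def add_nonneg_eq_0_iff)
  also have "C / l * ln (2 + M * (1 / t) ^ N) \<le> C / l * ((ln (2 + M) + real N * (ln R + 1)) * l)"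
    using 2 l assms by (intro mult_left_mono) auto
  also have "\<dots> = C * (ln (2 + M) + real N * (ln R + 1))" using l by simp
  finally show ?thesis by (simp add: l_def)
qed

text \<open>Change of variables: the reflection and scaling \<open>\<nu> \<mapsto> x - t \<nu>\<close> maps Lebesgue measure to a multiple of itself.\<close>

lemma nn_integral_affine:
  fixes F :: "'a::euclidean_space \<Rightarrow> ennreal"
  assumes [measurable]: "F \<in> borel_measurable borel" and t: "t > 0"
  shows "(\<integral>\<^sup>+\<nu>. F (x - t *\<^sub>R \<nu>) \<partial>lborel) = ennreal ((1 / t) ^ DIM('a)) * (\<integral>\<^sup>+y. F y \<partial>lborel)"
proof -
  have "(\<integral>\<^sup>+y. F y \<partial>lborel) = (\<integral>\<^sup>+y. F y \<partial>density (distr lborel borel (\<lambda>\<nu>::'a. x + (- t) *\<^sub>R \<nu>)) (\<lambda>_. ennreal (\<bar>- t\<bar> ^ DIM('a))))"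
    using t by (subst lborel_affine[of "- t" x]) auto
  also have "\<dots> = ennreal (t ^ DIM('a)) * (\<integral>\<^sup>+\<nu>. F (x - t *\<^sub>R \<nu>) \<partial>lborel)"
    using t by (subst nn_integral_density) (auto simp: nn_integral_distr nn_integral_cmult)
  finally have "ennreal ((1 / t) ^ DIM('a)) * (\<integral>\<^sup>+y. F y \<partial>lborel) =
     ennreal ((1 / t) ^ DIM('a)) * ennreal (t ^ DIM('a)) * (\<integral>\<^sup>+\<nu>. F (x - t *\<^sub>R \<nu>) \<partial>lborel)"
    by (simp add: mult.assoc)
  also have "ennreal ((1 / t) ^ DIM('a)) * ennreal (t ^ DIM('a)) = 1"
    using t by (simp add: ennreal_mult'[symmetric] power_mult_distrib[symmetric])
  finally show ?thesis by simp
qed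

abbreviation unif :: "'a::euclidean_space \<Rightarrow> real \<Rightarrow> 'a measure" where
  "unif a \<kappa> \<equiv> uniform_measure lborel (ball a \<kappa>)"

abbreviation unif01 :: "real measure" where
  "unif01 \<equiv> uniform_measure lborel {0..1}"

lemma emeasure_unif:
  assumes "\<kappa> > 0" shows "emeasure (unif a \<kappa>) (space (unif a \<kappa>)) = 1"
proof -
  have "emeasure lborel (ball a \<kappa>) \<noteq> 0" using content_ball_pos[OF assms, of a] by (auto simp: measure_def)
  moreover have "emeasure lborel (ball a \<kappa>) \<noteq> \<infinity>" using emeasure_lborel_ball_finite[of a \<kappa>] by auto
  ultimately show ?thesis by (simp add: top.not_eq_extremum)
qed

lemma emeasure_unif01: "emeasure unif01 (space unif01) = 1"
  using emeasure_uniform_measure_1[of lborel "{0..1::real}"] by simp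

lemma AE_unif: "AE \<nu> in unif a \<kappa>. \<nu> \<in> ball a \<kappa>"
  by (rule AE_uniform_measureI) auto

lemma AE_unif01: "AE \<theta> in unif01. 0 < \<theta> \<and> \<theta> \<le> 1"
proof (rule AE_uniform_measureI)
  have "AE \<theta> in lborel. \<theta> \<noteq> (0::real)" by (rule AE_lborel_singleton)
  then show "AE \<theta> in lborel. \<theta> \<in> {0..1::real} \<longrightarrow> 0 < \<theta> \<and> \<theta> \<le> 1" by eventually_elim auto
qed auto

lemma finite_measure_unif: "\<kappa> > 0 \<Longrightarrow> finite_measure (unif a \<kappa>)"
  by (rule finite_measureI) (use emeasure_unif[of \<kappa> a] in \<open>simp del: space_uniform_measure\<close>)

lemma finite_measure_unif01: "finite_measure unif01"
  by (rule finite_measureI) (use emeasure_unif01 in \<open>simp del: space_uniform_measure\<close>)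

text \<open>Averages over the ball \<open>x - t ball a \<kappa>\<close> are at most the integral divided by the volume of this ball.\<close>

lemma nn_integral_unif_le:
  fixes F :: "'a::euclidean_space \<Rightarrow> ennreal"
  assumes [measurable]: "F \<in> borel_measurable borel" and t: "t > 0" and \<kappa>: "\<kappa> > 0"
  shows "(\<integral>\<^sup>+\<nu>. F (x - t *\<^sub>R \<nu>) \<partial>unif a \<kappa>) \<le>
     ennreal ((1 / t) ^ DIM('a) / measure lborel (ball a \<kappa>)) * (\<integral>\<^sup>+y. F y \<partial>lborel)"
proof -
  have m: "measure lborel (ball a \<kappa>) > 0" using \<kappa> content_ball_pos[of \<kappa> a] by simp
  have e: "emeasure lborel (ball a \<kappa>) = ennreal (measure lborel (ball a \<kappa>))"
    using emeasure_lborel_ball_finite[of a \<kappa>] by (simp add: emeasure_eq_ennreal_measure less_top)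
  have "(\<integral>\<^sup>+\<nu>. F (x - t *\<^sub>R \<nu>) \<partial>unif a \<kappa>) = (\<integral>\<^sup>+\<nu>. F (x - t *\<^sub>R \<nu>) * indicator (ball a \<kappa>) \<nu> \<partial>lborel) / emeasure lborel (ball a \<kappa>)"
    by (rule nn_integral_uniform_measure) auto
  also have "\<dots> \<le> (\<integral>\<^sup>+\<nu>. F (x - t *\<^sub>R \<nu>) \<partial>lborel) / emeasure lborel (ball a \<kappa>)"
    by (intro divide_right_mono_ennreal nn_integral_mono) (auto simp: indicator_def)
  also have "\<dots> = ennreal ((1 / t) ^ DIM('a) / measure lborel (ball a \<kappa>)) * (\<integral>\<^sup>+y. F y \<partial>lborel)"
    unfolding nn_integral_affine[OF assms(1) t] e using m t
    by (simp add: divide_ennreal_def inverse_ennreal divide_inverse ennreal_mult' mult_ac)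
  finally show ?thesis .
qed

section \<open>The modular\<close>

text \<open>Extended real valued, so that it can be manipulated without integrability proofs.\<close>

definition modular :: "'a::euclidean_space set \<Rightarrow> ('a \<Rightarrow> real) \<Rightarrow> ('a \<Rightarrow> 'b::real_normed_vector) \<Rightarrow> ennreal" where
  "modular \<Omega> p f = (\<integral>\<^sup>+x. ennreal (norm (f x) powr p x) \<partial>lebesgue_on \<Omega>)"

lemma norm_add_powr_le:
  fixes a b :: "'b::real_normed_vector"
  assumes "0 \<le> q" "q \<le> P"
  shows "norm (a + b) powr q \<le> 2 powr P * (norm a powr q + norm b powr q)"
proof -
  let ?m = "max (norm a) (norm b)"
  have "norm (a + b) \<le> 2 * ?m" using norm_triangle_ineq[of a b] by linarith
  then have "norm (a + b) powr q \<le> (2 * ?m) powr q" using assms by (intro powr_mono2) auto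
  also have "\<dots> = 2 powr q * ?m powr q" by (simp add: powr_mult)
  also have "\<dots> \<le> 2 powr P * (norm a powr q + norm b powr q)"
    using assms by (intro mult_mono powr_mono) (auto simp: max_def)
  finally show ?thesis .
qed

lemma nn_integral_lebesgue_on:
  fixes F :: "'a::euclidean_space \<Rightarrow> ennreal"
  assumes "open \<Omega>" "F \<in> borel_measurable borel"
  shows "(\<integral>\<^sup>+x. F x \<partial>lebesgue_on \<Omega>) = (\<integral>\<^sup>+x. F x * indicator \<Omega> x \<partial>lborel)"
  using assms by (simp add: nn_integral_restrict_space nn_integral_completion)

lemma nn_integral_translate:
  fixes F :: "'a::euclidean_space \<Rightarrow> ennreal"
  assumes [measurable]: "F \<in> borel_measurable borel"
  shows "(\<integral>\<^sup>+x. F (x - c) \<partial>lborel) = (\<integral>\<^sup>+x. F x \<partial>lborel)"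
proof -
  have "(\<integral>\<^sup>+x. F x \<partial>lborel) = (\<integral>\<^sup>+x. F x \<partial>distr lborel borel ((+) (- c)))"
    by (simp add: lborel_distr_plus)
  also have "\<dots> = (\<integral>\<^sup>+x. F (x - c) \<partial>lborel)" by (subst nn_integral_distr) auto
  finally show ?thesis by simp
qed

lemma integral_unif01:
  fixes g :: "real \<Rightarrow> real"
  assumes "continuous_on UNIV g"
  shows "(\<integral>\<theta>. g \<theta> \<partial>unif01) = integral {0..1} g"
proof -
  have [measurable]: "g \<in> borel_measurable borel" using assms by (rule borel_measurable_continuous_onI)
  have i: "integrable lborel (\<lambda>\<theta>. indicator {0..1} \<theta> *\<^sub>R g \<theta>)"
    using assms by (intro borel_integrable_compact) (auto intro: continuous_on_subset)
  have "unif01 = density lborel (\<lambda>x. ennreal (indicator {0..1} x))"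
    unfolding uniform_measure_def by (intro density_cong) (auto simp: indicator_def)
  then have "(\<integral>\<theta>. g \<theta> \<partial>unif01) = (\<integral>\<theta>. indicator {0..1} \<theta> *\<^sub>R g \<theta> \<partial>lborel)"
    by (simp add: integral_density)
  also have "\<dots> = integral {0..1} g"
    using set_borel_integral_eq_integral(2)[of "{0..1}" g] i
    by (simp add: set_integrable_def set_lebesgue_integral_def)
  finally show ?thesis .
qed

text \<open>The fundamental theorem of calculus on the segment from \<open>x - v\<close> to \<open>x\<close>.\<close>

lemma test_function_increment_le:
  fixes x :: "'a::euclidean_space"
  assumes \<phi>: "\<phi> \<in> test_functions \<Omega>"
  shows "\<bar>\<phi> x - \<phi> (x - v)\<bar> \<le> norm v * (\<integral>\<theta>. norm (grad \<phi> (x - \<theta> *\<^sub>R v)) \<partial>unif01)"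
proof -
  have cg: "continuous_on UNIV (\<lambda>\<theta>. grad \<phi> (x - \<theta> *\<^sub>R v))"
    by (rule continuous_on_compose2[OF continuous_on_grad[OF \<phi>]]) (auto intro!: continuous_intros)
  have "((\<lambda>\<theta>. - (grad \<phi> (x - \<theta> *\<^sub>R v) \<bullet> v)) has_integral (\<phi> (x - 1 *\<^sub>R v) - \<phi> (x - 0 *\<^sub>R v))) {0..1}"
  proof (rule fundamental_theorem_of_calculus)
    fix \<theta> :: real
    have "((\<lambda>\<theta>. \<phi> (x - \<theta> *\<^sub>R v)) has_derivative (\<lambda>h. grad \<phi> (x - \<theta> *\<^sub>R v) \<bullet> (- h *\<^sub>R v))) (at \<theta>)"
      by (rule has_derivative_compose[where f="\<lambda>\<theta>. x - \<theta> *\<^sub>R v", OF _ test_function_has_derivative[OF \<phi>]])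
         (auto intro!: derivative_eq_intros)
    then have "((\<lambda>\<theta>. \<phi> (x - \<theta> *\<^sub>R v)) has_vector_derivative - (grad \<phi> (x - \<theta> *\<^sub>R v) \<bullet> v)) (at \<theta>)"
      by (simp add: has_vector_derivative_def)
    then show "((\<lambda>\<theta>. \<phi> (x - \<theta> *\<^sub>R v)) has_vector_derivative - (grad \<phi> (x - \<theta> *\<^sub>R v) \<bullet> v)) (at \<theta> within {0..1})"
      by (rule has_vector_derivative_at_within)
  qed auto
  from integral_unique[OF this]
  have "\<bar>\<phi> x - \<phi> (x - v)\<bar> = norm (integral {0..1} (\<lambda>\<theta>. - (grad \<phi> (x - \<theta> *\<^sub>R v) \<bullet> v)))"
    by (simp only: real_norm_def scaleR_one scaleR_zero_left diff_zero abs_minus_commute)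
  also have "\<dots> \<le> integral {0..1} (\<lambda>\<theta>. norm v * norm (grad \<phi> (x - \<theta> *\<^sub>R v)))"
  proof (rule integral_norm_bound_integral)
    show "(\<lambda>\<theta>. - (grad \<phi> (x - \<theta> *\<^sub>R v) \<bullet> v)) integrable_on {0..1}"
      by (intro integrable_continuous_real continuous_intros continuous_on_subset[OF cg]) auto
    show "(\<lambda>\<theta>. norm v * norm (grad \<phi> (x - \<theta> *\<^sub>R v))) integrable_on {0..1}"
      by (intro integrable_continuous_real continuous_intros continuous_on_subset[OF cg]) auto
    show "norm (- (grad \<phi> (x - \<theta> *\<^sub>R v) \<bullet> v)) \<le> norm v * norm (grad \<phi> (x - \<theta> *\<^sub>R v))" for \<theta>
      using Cauchy_Schwarz_ineq2[of "grad \<phi> (x - \<theta> *\<^sub>R v)" v] by (simp add: mult.commute)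
  qed
  also have "\<dots> = norm v * integral {0..1} (\<lambda>\<theta>. norm (grad \<phi> (x - \<theta> *\<^sub>R v)))" by simp
  also have "integral {0..1} (\<lambda>\<theta>. norm (grad \<phi> (x - \<theta> *\<^sub>R v))) = (\<integral>\<theta>. norm (grad \<phi> (x - \<theta> *\<^sub>R v)) \<partial>unif01)"
    by (intro integral_unif01[symmetric] continuous_intros cg)
  finally show ?thesis .
qed

section \<open>Log-Hoelder continuous exponents\<close>

text \<open>Only the values of the exponent in \<open>\<Omega>\<close> enter. The exponent \<open>1\<close> is admitted because Hardy's inequality applies
the averaging estimate to a quotient \<open>p / q\<close> that may attain \<open>1\<close>.\<close>

locale log_exponent =
  fixes \<Omega> :: "'a::euclidean_space set" and p :: "'a \<Rightarrow> real" and P C :: real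
  assumes open_\<Omega>: "open \<Omega>" and bounded_\<Omega>: "bounded \<Omega>"
    and p_ge: "\<And>x. x \<in> \<Omega> \<Longrightarrow> 1 \<le> p x" and p_le: "\<And>x. x \<in> \<Omega> \<Longrightarrow> p x \<le> P" and P: "1 \<le> P"
    and C: "0 \<le> C"
    and log_h: "\<And>x y. x \<in> \<Omega> \<Longrightarrow> y \<in> \<Omega> \<Longrightarrow> x \<noteq> y \<Longrightarrow> \<bar>p x - p y\<bar> \<le> C / ln (exp 1 + 1 / dist x y)"
begin

text \<open>A Borel measurable extension of the exponent to the whole space. Outside \<open>\<Omega>\<close> it only meets functions that vanish, and the
value \<open>P\<close> keeps all lower bounds for \<open>p\<close> valid.\<close>

definition pb :: "'a \<Rightarrow> real" where "pb x = (if x \<in> \<Omega> then p x else P)"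

lemma pb_bounds: "1 \<le> pb x" "pb x \<le> P"
  using p_ge p_le P by (auto simp: pb_def)

lemma continuous_on_p: "continuous_on \<Omega> p"
  unfolding continuous_on_def
proof
  fix x assume x: "x \<in> \<Omega>"
  have "((\<lambda>d. C / ln (exp 1 + 1 / d)) \<longlongrightarrow> 0) (at_right 0)"
    by real_asymp
  moreover have "filterlim (\<lambda>y. dist x y) (at_right 0) (at x within \<Omega>)"
    unfolding filterlim_at
    by (auto intro!: tendsto_eq_intros eventually_at_filter[THEN iffD2] always_eventually simp: eventually_at_filter)
  ultimately have "((\<lambda>y. C / ln (exp 1 + 1 / dist x y)) \<longlongrightarrow> 0) (at x within \<Omega>)"
    by (rule filterlim_compose)
  moreover have "\<forall>\<^sub>F y in at x within \<Omega>. norm (p y - p x) \<le> C / ln (exp 1 + 1 / dist x y)"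
    using log_h[OF x] by (auto simp: eventually_at_filter abs_minus_commute intro!: always_eventually)
  ultimately have "((\<lambda>y. p y - p x) \<longlongrightarrow> 0) (at x within \<Omega>)"
    by (rule Lim_null_comparison[rotated])
  then show "(p \<longlongrightarrow> p x) (at x within \<Omega>)" by (simp add: LIM_zero_iff)
qed

lemma pb_measurable [measurable]: "pb \<in> borel_measurable borel"
  unfolding pb_def using open_\<Omega> continuous_on_p
  by (intro borel_measurable_continuous_on_if) auto

lemma p_measurable [measurable]: "p \<in> borel_measurable (lebesgue_on \<Omega>)"
  using open_\<Omega> by (intro continuous_imp_measurable_on_sets_lebesgue continuous_on_p) auto

lemma emeasure_\<Omega>_finite: "emeasure lborel \<Omega> < \<infinity>"
  using emeasure_bounded_finite[OF bounded_\<Omega>] by (simp add: top.not_eq_extremum less_top)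

lemma finite_measure_\<Omega>: "finite_measure (lebesgue_on \<Omega>)"
  using emeasure_\<Omega>_finite open_\<Omega> by (intro finite_measureI) (simp add: emeasure_restrict_space)

definition vol :: real where "vol = measure lborel \<Omega>"

lemma vol: "vol \<ge> 0" "emeasure lborel \<Omega> = ennreal vol"
  using emeasure_\<Omega>_finite by (auto simp: vol_def emeasure_eq_ennreal_measure less_top)

lemma modular_eq_lborel:
  fixes f :: "'a \<Rightarrow> 'b::{real_normed_vector, second_countable_topology}"
  assumes [measurable]: "f \<in> borel_measurable borel" and "\<And>x. x \<notin> \<Omega> \<Longrightarrow> f x = 0"
  shows "modular \<Omega> p f = (\<integral>\<^sup>+x. ennreal (norm (f x) powr pb x) \<partial>lborel)"
proof -
  have "modular \<Omega> p f = (\<integral>\<^sup>+x. ennreal (norm (f x) powr pb x) \<partial>lebesgue_on \<Omega>)"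
    unfolding modular_def by (intro nn_integral_cong) (auto simp: pb_def)
  also have "\<dots> = (\<integral>\<^sup>+x. ennreal (norm (f x) powr pb x) * indicator \<Omega> x \<partial>lborel)"
    by (intro nn_integral_lebesgue_on open_\<Omega>) auto
  also have "\<dots> = (\<integral>\<^sup>+x. ennreal (norm (f x) powr pb x) \<partial>lborel)"
    using assms(2) by (intro nn_integral_cong) (auto simp: indicator_def)
  finally show ?thesis .
qed

lemma modular_add_le:
  fixes f g :: "'a \<Rightarrow> 'b::{real_normed_vector, second_countable_topology}"
  assumes [measurable]: "f \<in> borel_measurable (lebesgue_on \<Omega>)" "g \<in> borel_measurable (lebesgue_on \<Omega>)"
  shows "modular \<Omega> p (\<lambda>x. f x + g x) \<le> ennreal (2 powr P) * (modular \<Omega> p f + modular \<Omega> p g)"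
proof -
  have "modular \<Omega> p (\<lambda>x. f x + g x) \<le> (\<integral>\<^sup>+x. ennreal (2 powr P) * (ennreal (norm (f x) powr p x) + ennreal (norm (g x) powr p x)) \<partial>lebesgue_on \<Omega>)"
    unfolding modular_def
  proof (intro nn_integral_mono)
    fix x assume "x \<in> space (lebesgue_on \<Omega>)"
    then have x: "x \<in> \<Omega>" by simp
    show "ennreal (norm (f x + g x) powr p x) \<le> ennreal (2 powr P) * (ennreal (norm (f x) powr p x) + ennreal (norm (g x) powr p x))"
      using norm_add_powr_le[of "p x" P "f x" "g x"] p_ge[OF x] p_le[OF x]
      by (simp add: ennreal_plus[symmetric] ennreal_mult'[symmetric] del: ennreal_plus)
  qed
  also have "\<dots> = ennreal (2 powr P) * (modular \<Omega> p f + modular \<Omega> p g)"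
    unfolding modular_def by (simp add: nn_integral_cmult nn_integral_add)
  finally show ?thesis .
qed

lemma nn_integral_le_modular:
  fixes f :: "'a \<Rightarrow> 'b::{real_normed_vector, second_countable_topology}"
  assumes [measurable]: "f \<in> borel_measurable borel" and 0: "\<And>x. x \<notin> \<Omega> \<Longrightarrow> f x = 0"
  shows "(\<integral>\<^sup>+x. ennreal (norm (f x)) \<partial>lborel) \<le> ennreal vol + modular \<Omega> p f"
proof -
  have "(\<integral>\<^sup>+x. ennreal (norm (f x)) \<partial>lborel) \<le> (\<integral>\<^sup>+x. indicator \<Omega> x + ennreal (norm (f x) powr pb x) \<partial>lborel)"
  proof (intro nn_integral_mono)
    fix x
    show "ennreal (norm (f x)) \<le> indicator \<Omega> x + ennreal (norm (f x) powr pb x)"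
      using le_one_plus_powr[of "norm (f x)" 1 "pb x"] pb_bounds[of x] 0[of x]
      by (cases "x \<in> \<Omega>") (auto simp: ennreal_plus[symmetric] ennreal_1[symmetric] simp del: ennreal_plus ennreal_1)
  qed
  also have "\<dots> = emeasure lborel \<Omega> + (\<integral>\<^sup>+x. ennreal (norm (f x) powr pb x) \<partial>lborel)"
    using open_\<Omega> by (subst nn_integral_add) auto
  finally show ?thesis using modular_eq_lborel[OF assms] vol by simp
qed

text \<open>At scale \<open>t\<close> the exponents that occur lie above \<open>p x - C / ln (e + 1 / (t R))\<close>, and the average of \<open>f powr p\<close> is at most a
multiple of \<open>M (1 / t)\<^sup>N\<close> because its integral is at most \<open>M\<close>. Hence the loss in
\<open>jensen_variable_powr\<close> is bounded by \<open>log_scale_bound\<close>. The function \<open>G\<close> may be smaller than \<open>f\<close>, which lets Hardy's inequality restrict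
the average to points before the exit from \<open>\<Omega>\<close>.\<close>

lemma avg_powr_bound:
  assumes \<kappa>: "0 < \<kappa>" and R: "norm a + \<kappa> \<le> R" "1 \<le> R" and M: "0 \<le> M"
  obtains C0 where "1 \<le> C0" "\<And>f b G x t. \<lbrakk>f \<in> borel_measurable borel; \<And>y. 0 \<le> f y; \<And>y. f y \<le> b; \<And>y. y \<notin> \<Omega> \<Longrightarrow> f y = 0;
       (\<integral>\<^sup>+y. ennreal (f y powr pb y) \<partial>lborel) \<le> ennreal M; 0 < t; G \<in> borel_measurable borel;
       \<And>\<nu>. 0 \<le> G \<nu>; \<And>\<nu>. G \<nu> \<le> f (x - t *\<^sub>R \<nu>); x \<in> \<Omega>\<rbrakk> \<Longrightarrow>
      (\<integral>\<nu>. G \<nu> \<partial>unif a \<kappa>) powr p x \<le> C0 * (1 + (\<integral>\<nu>. G \<nu> powr pb (x - t *\<^sub>R \<nu>) \<partial>unif a \<kappa>))"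
proof -
  define m where "m = measure lborel (ball a \<kappa>)"
  have m: "m > 0" using \<kappa> content_ball_pos by (simp add: m_def)
  \<comment> \<open>The average of \<open>f powr p\<close> at scale \<open>t\<close> is at most \<open>M' (1 / t)\<^sup>N\<close>.\<close>
  define M' where "M' = M / m"
  have M': "M' \<ge> 0" using M m by (simp add: M'_def)
  define C0 where "C0 = max 1 (exp (C * (ln (2 + M') + real DIM('a) * (ln R + 1))))"
  show ?thesis
  proof (rule that[of C0])
    show "1 \<le> C0" by (simp add: C0_def)
    fix f b G x t
    assume [measurable]: "f \<in> borel_measurable borel" and f0: "\<And>y. 0 \<le> f y" and fb: "\<And>y. f y \<le> b"
      and fout: "\<And>y. y \<notin> \<Omega> \<Longrightarrow> f y = 0"
      and fM: "(\<integral>\<^sup>+y. ennreal (f y powr pb y) \<partial>lborel) \<le> ennreal M" and t: "0 < (t::real)"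
      and [measurable]: "G \<in> borel_measurable borel"
      and G0: "\<And>\<nu>. 0 \<le> G \<nu>" and Gf: "\<And>\<nu>. G \<nu> \<le> f (x - t *\<^sub>R \<nu>)" and x: "x \<in> \<Omega>"
    let ?U = "unif a \<kappa>"
    define l where "l = ln (exp 1 + 1 / (t * R))"
    have l: "l \<ge> 1"
    proof -
      have "ln (exp 1) \<le> l" unfolding l_def using t R by (intro ln_mono) (auto intro!: add_pos_nonneg)
      then show ?thesis by simp
    qed
    \<comment> \<open>A lower bound for the exponents at all points \<open>x - t \<nu>\<close>, by log-Hoelder continuity at distance at most \<open>t R\<close>.\<close>
    define ps where "ps = max 1 (p x - C / l)"
    define e where "e \<nu> = pb (x - t *\<^sub>R \<nu>)" for \<nu>
    have [measurable]: "e \<in> borel_measurable borel" unfolding e_def by measurable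
    have ps: "1 \<le> ps" "ps \<le> p x" "p x - ps \<le> C / l" using p_ge[OF x] C l by (auto simp: ps_def)
    have eps: "ps \<le> e \<nu>" if "\<nu> \<in> ball a \<kappa>" for \<nu>
    proof (cases "x - t *\<^sub>R \<nu> \<in> \<Omega> \<and> x \<noteq> x - t *\<^sub>R \<nu>")
      case True
      let ?y = "x - t *\<^sub>R \<nu>"
      have "norm \<nu> \<le> norm a + dist a \<nu>" using norm_triangle_ineq2[of \<nu> a] by (simp add: dist_norm norm_minus_commute)
      then have nu: "norm \<nu> \<le> R" using that R by simp
      have d: "dist x ?y = t * norm \<nu>" using t by (simp add: dist_norm)
      then have d': "0 < dist x ?y" "dist x ?y \<le> t * R" using True nu t by auto
      have "l \<le> ln (exp 1 + 1 / dist x ?y)" unfolding l_def using d' t R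
        by (intro ln_mono) (auto intro!: add_pos_nonneg add_mono frac_le)
      then have "C / ln (exp 1 + 1 / dist x ?y) \<le> C / l" using C l by (intro divide_left_mono) auto
      with log_h[OF x _, of ?y] True have "p ?y \<ge> p x - C / l" by auto
      then show ?thesis using True p_ge[of ?y] by (simp add: e_def pb_def ps_def)
    next
      case False
      then show ?thesis using ps p_le[OF x] x by (auto simp: e_def pb_def)
    qed
    define I where "I = (\<integral>\<nu>. G \<nu> powr e \<nu> \<partial>?U)"
    have b0: "b \<ge> 0" using f0 fb order_trans by blast
    have bG: "G \<nu> \<le> b" for \<nu> using Gf fb order_trans by blast
    have iGe: "integrable ?U (\<lambda>\<nu>. G \<nu> powr e \<nu>)"
    proof (rule integrable_of_bounded[OF emeasure_unif[OF \<kappa>], of _ _ "(max 1 b) powr P"])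
      show "AE \<nu> in ?U. G \<nu> powr e \<nu> \<le> (max 1 b) powr P"
      proof (rule AE_I2)
        fix \<nu>
        have "G \<nu> powr e \<nu> \<le> (max 1 b) powr e \<nu>"
          using G0 bG[of \<nu>] pb_bounds(1)[of "x - t *\<^sub>R \<nu>"] by (intro powr_mono2) (auto simp: e_def le_max_iff_disj)
        also have "\<dots> \<le> (max 1 b) powr P" using pb_bounds by (intro powr_mono) (auto simp: e_def)
        finally show "G \<nu> powr e \<nu> \<le> (max 1 b) powr P" .
      qed
    qed auto
    have "ennreal I = (\<integral>\<^sup>+\<nu>. ennreal (G \<nu> powr e \<nu>) \<partial>?U)"
      unfolding I_def by (rule nn_integral_eq_integral[symmetric, OF iGe]) auto
    also have "\<dots> \<le> (\<integral>\<^sup>+\<nu>. ennreal (f (x - t *\<^sub>R \<nu>) powr pb (x - t *\<^sub>R \<nu>)) \<partial>?U)"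
    proof (intro nn_integral_mono ennreal_leI)
      fix \<nu>
      show "G \<nu> powr e \<nu> \<le> f (x - t *\<^sub>R \<nu>) powr pb (x - t *\<^sub>R \<nu>)"
        using G0 Gf pb_bounds(1)[of "x - t *\<^sub>R \<nu>"] unfolding e_def by (intro powr_mono2) auto
    qed
    also have "\<dots> \<le> ennreal ((1 / t) ^ DIM('a) / m) * (\<integral>\<^sup>+y. ennreal (f y powr pb y) \<partial>lborel)"
      unfolding m_def by (rule nn_integral_unif_le[OF _ t \<kappa>]) auto
    also have "\<dots> \<le> ennreal ((1 / t) ^ DIM('a) / m) * ennreal M" by (intro mult_left_mono fM) auto
    also have "\<dots> = ennreal (M' * (1 / t) ^ DIM('a))"
      using m t M by (simp add: M'_def ennreal_mult'[symmetric] mult_ac)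
    finally have I: "I \<le> M' * (1 / t) ^ DIM('a)" using M' t by (subst (asm) ennreal_le_iff) auto
    have "(\<integral>\<nu>. G \<nu> \<partial>?U) powr p x \<le> C0 * (1 + (\<integral>\<nu>. G \<nu> powr e \<nu> \<partial>?U))"
    proof (rule jensen_variable_powr[OF emeasure_unif[OF \<kappa>]])
      show "1 + (\<integral>\<nu>. G \<nu> powr e \<nu> \<partial>?U) \<le> 2 + M' * (1 / t) ^ DIM('a)" using I by (simp add: I_def)
      have Q1: "1 \<le> 2 + M' * (1 / t) ^ DIM('a)" using M' t by (intro add_increasing2) auto
      have "(2 + M' * (1 / t) ^ DIM('a)) powr (p x - ps) \<le> (2 + M' * (1 / t) ^ DIM('a)) powr (C / l)"
        using ps Q1 by (intro powr_mono) auto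
      also have "\<dots> \<le> C0" unfolding l_def C0_def using log_scale_bound[OF M' t R(2) C, of "DIM('a)"] by simp
      finally show "(2 + M' * (1 / t) ^ DIM('a)) powr (p x - ps) \<le> C0" .
      show "AE \<nu> in ?U. ps \<le> e \<nu>" using AE_unif by eventually_elim (rule eps)
    qed (use G0 bG pb_bounds ps in \<open>auto simp: e_def C0_def\<close>)
    then show "(\<integral>\<nu>. G \<nu> \<partial>?U) powr p x \<le> C0 * (1 + (\<integral>\<nu>. G \<nu> powr pb (x - t *\<^sub>R \<nu>) \<partial>?U))"
      by (simp add: e_def)
  qed
qed

end

section \<open>Mollification\<close>

lemma emeasure_pair_1:
  assumes "emeasure M1 (space M1) = 1" "emeasure M2 (space M2) = 1"
  shows "emeasure (M1 \<Otimes>\<^sub>M M2) (space (M1 \<Otimes>\<^sub>M M2)) = 1"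
proof -
  interpret M2: finite_measure M2 by (rule finite_measureI) (use assms in simp)
  show ?thesis using assms by (simp add: space_pair_measure M2.emeasure_pair_measure_Times)
qed

lemma fubini_bounded:
  fixes f :: "'b \<Rightarrow> 'c \<Rightarrow> real"
  assumes M: "emeasure M1 (space M1) = 1" "emeasure M2 (space M2) = 1"
    and f: "case_prod f \<in> borel_measurable (M1 \<Otimes>\<^sub>M M2)" "\<And>x y. 0 \<le> f x y" "\<And>x y. f x y \<le> b"
  shows "(\<integral>x. (\<integral>y. f x y \<partial>M2) \<partial>M1) = (\<integral>y. (\<integral>x. f x y \<partial>M1) \<partial>M2)"
proof -
  interpret M1: finite_measure M1 by (rule finite_measureI) (use M in simp)
  interpret M2: finite_measure M2 by (rule finite_measureI) (use M in simp)
  interpret pair_sigma_finite M1 M2 ..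
  have "integrable (M1 \<Otimes>\<^sub>M M2) (case_prod f)"
    using f by (intro integrable_of_bounded[OF emeasure_pair_1[OF M], of _ b]) auto
  then show ?thesis by (rule Fubini_integral[symmetric])
qed

lemma integral_le_bound:
  fixes f :: "'b \<Rightarrow> real"
  assumes M: "emeasure M (space M) = 1" and "f \<in> borel_measurable M" "\<And>x. 0 \<le> f x" "\<And>x. f x \<le> b"
  shows "(\<integral>x. f x \<partial>M) \<le> b"
proof -
  interpret finite_measure M by (rule finite_measureI) (use M in simp)
  have "b \<ge> 0" using assms(3,4) order_trans by blast
  then have "(\<integral>x. f x \<partial>M) \<le> (\<integral>x. b \<partial>M)"
    using assms by (intro integral_mono integrable_of_bounded[OF M, of _ b]) auto
  then show ?thesis using M by (simp add: measure_def)
qed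

definition mollify :: "real \<Rightarrow> ('a::euclidean_space \<Rightarrow> real) \<Rightarrow> 'a \<Rightarrow> real" where
  "mollify s \<phi> x = (\<integral>\<nu>. \<phi> (x - s *\<^sub>R \<nu>) \<partial>unif 0 1)"

lemma integrable_unif_test:
  assumes \<phi>: "\<phi> \<in> test_functions \<Omega>" and \<kappa>: "\<kappa> > 0"
  shows "integrable (unif a \<kappa>) (\<lambda>\<nu>. \<phi> (x - s *\<^sub>R \<nu>))"
proof -
  interpret finite_measure "unif a \<kappa>" by (rule finite_measure_unif[OF \<kappa>])
  have [measurable]: "\<phi> \<in> borel_measurable borel"
    using continuous_on_test_function[OF \<phi>] by (rule borel_measurable_continuous_onI)
  obtain B where "\<And>x. \<bar>\<phi> x\<bar> \<le> B" using test_function_bounded[OF \<phi>] by metis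
  then show ?thesis by (intro integrable_const_bound[of _ B]) auto
qed

lemma mollify_measurable [measurable]:
  assumes \<phi>: "\<phi> \<in> test_functions \<Omega>"
  shows "mollify s \<phi> \<in> borel_measurable borel"
proof -
  interpret finite_measure "unif (0::'a) 1" by (rule finite_measure_unif) simp
  have [measurable]: "\<phi> \<in> borel_measurable borel"
    using continuous_on_test_function[OF \<phi>] by (rule borel_measurable_continuous_onI)
  show ?thesis unfolding mollify_def by measurable
qed

text \<open>Integrate the gradient along the segments from \<open>x\<close> to \<open>x - s \<nu>\<close> and exchange the order of integration, so that for each
fraction \<open>\<theta>\<close> of the segment an average over a ball of radius \<open>s \<theta>\<close> appears.\<close>

lemma mollify_diff_le:
  fixes x :: "'a::euclidean_space"
  assumes \<phi>: "\<phi> \<in> test_functions \<Omega>" and s: "0 < s"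
  shows "\<bar>\<phi> x - mollify s \<phi> x\<bar> \<le> s * (\<integral>\<theta>. (\<integral>\<nu>. norm (grad \<phi> (x - (s * \<theta>) *\<^sub>R \<nu>)) \<partial>unif 0 1) \<partial>unif01)"
proof -
  let ?U = "unif (0::'a) 1"
  interpret finite_measure ?U by (rule finite_measure_unif) simp
  interpret T: finite_measure unif01 by (rule finite_measure_unif01)
  have U1: "emeasure ?U (space ?U) = 1" by (rule emeasure_unif) simp
  have [measurable]: "\<phi> \<in> borel_measurable borel" "grad \<phi> \<in> borel_measurable borel"
    using continuous_on_test_function[OF \<phi>] continuous_on_grad[OF \<phi>] by (auto intro: borel_measurable_continuous_onI)
  obtain B where B: "\<And>x. norm (grad \<phi> x) \<le> B" using test_function_bounded[OF \<phi>] by metis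
  note i = integrable_unif_test[OF \<phi>, of 1 0 x s, simplified]
  have "\<phi> x - mollify s \<phi> x = (\<integral>\<nu>. \<phi> x - \<phi> (x - s *\<^sub>R \<nu>) \<partial>?U)"
    unfolding mollify_def using i U1 by (simp add: measure_def)
  then have "\<bar>\<phi> x - mollify s \<phi> x\<bar> \<le> (\<integral>\<nu>. \<bar>\<phi> x - \<phi> (x - s *\<^sub>R \<nu>)\<bar> \<partial>?U)"
    using integral_abs_bound by metis
  also have "\<dots> \<le> (\<integral>\<nu>. s * (\<integral>\<theta>. norm (grad \<phi> (x - (s * \<theta>) *\<^sub>R \<nu>)) \<partial>unif01) \<partial>?U)"
  proof (rule integral_mono_AE)
    show "integrable ?U (\<lambda>\<nu>. \<bar>\<phi> x - \<phi> (x - s *\<^sub>R \<nu>)\<bar>)" using i by auto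
    have "integrable ?U (\<lambda>\<nu>. \<integral>\<theta>. norm (grad \<phi> (x - (s * \<theta>) *\<^sub>R \<nu>)) \<partial>unif01)"
      by (rule integrable_of_bounded[OF U1, of _ B]) (auto intro!: integral_le_bound[OF emeasure_unif01] B)
    then show "integrable ?U (\<lambda>\<nu>. s * (\<integral>\<theta>. norm (grad \<phi> (x - (s * \<theta>) *\<^sub>R \<nu>)) \<partial>unif01))" by auto
    show "AE \<nu> in ?U. \<bar>\<phi> x - \<phi> (x - s *\<^sub>R \<nu>)\<bar> \<le> s * (\<integral>\<theta>. norm (grad \<phi> (x - (s * \<theta>) *\<^sub>R \<nu>)) \<partial>unif01)"
      using AE_unif[of 0 1]
    proof eventually_elim
      case (elim \<nu>)
      have "\<bar>\<phi> x - \<phi> (x - s *\<^sub>R \<nu>)\<bar> \<le> norm (s *\<^sub>R \<nu>) * (\<integral>\<theta>. norm (grad \<phi> (x - \<theta> *\<^sub>R (s *\<^sub>R \<nu>))) \<partial>unif01)"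
        by (rule test_function_increment_le[OF \<phi>])
      also have "\<dots> \<le> s * (\<integral>\<theta>. norm (grad \<phi> (x - \<theta> *\<^sub>R (s *\<^sub>R \<nu>))) \<partial>unif01)"
        using elim s by (intro mult_right_mono) (auto intro!: mult_left_le)
      finally show ?case by (simp add: mult.commute)
    qed
  qed
  also have "\<dots> = s * (\<integral>\<theta>. (\<integral>\<nu>. norm (grad \<phi> (x - (s * \<theta>) *\<^sub>R \<nu>)) \<partial>?U) \<partial>unif01)"
    by (subst fubini_bounded[OF U1 emeasure_unif01, of _ B, symmetric]) (auto intro: B)
  finally show ?thesis .
qed

context log_exponent begin

text \<open>Jensen's inequality in \<open>\<theta>\<close> and the averaging estimate in \<open>\<nu>\<close> bound the difference pointwise by averages of
\<open>norm (grad \<phi>) powr p\<close>; translations preserve the integral over \<open>x\<close>.\<close>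

lemma mollify_modular_bound:
  assumes M: "0 \<le> M"
  obtains C1 where "0 \<le> C1" "\<And>\<phi> s. \<lbrakk>\<phi> \<in> test_functions \<Omega>; modular \<Omega> p (grad \<phi>) \<le> ennreal M; 0 < s; s \<le> 1\<rbrakk> \<Longrightarrow>
     modular \<Omega> p (\<lambda>x. \<phi> x - mollify s \<phi> x) \<le> ennreal (C1 * s)"
proof -
  let ?U = "unif (0::'a) 1"
  interpret U: finite_measure ?U by (rule finite_measure_unif) simp
  interpret T: finite_measure unif01 by (rule finite_measure_unif01)
  have U1: "emeasure ?U (space ?U) = 1" by (rule emeasure_unif) simp
  obtain C0 where C0: "1 \<le> C0" and avg: "\<And>f b G x t. \<lbrakk>f \<in> borel_measurable borel; \<And>y. 0 \<le> f y; \<And>y. f y \<le> b; \<And>y. y \<notin> \<Omega> \<Longrightarrow> f y = 0;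
       (\<integral>\<^sup>+y. ennreal (f y powr pb y) \<partial>lborel) \<le> ennreal M; 0 < t; G \<in> borel_measurable borel;
       \<And>\<nu>. 0 \<le> G \<nu>; \<And>\<nu>. G \<nu> \<le> f (x - t *\<^sub>R \<nu>); x \<in> \<Omega>\<rbrakk> \<Longrightarrow>
      (\<integral>\<nu>. G \<nu> \<partial>?U) powr p x \<le> C0 * (1 + (\<integral>\<nu>. G \<nu> powr pb (x - t *\<^sub>R \<nu>) \<partial>?U))"
    by (rule avg_powr_bound[of 1 0 1 M]) (use M in \<open>simp_all, blast\<close>)
  show ?thesis
  proof (rule that[of "C0 * (vol + M)"])
    show "0 \<le> C0 * (vol + M)" using C0 vol M by simp
    fix \<phi> :: "'a \<Rightarrow> real" and s :: real
    assume \<phi>: "\<phi> \<in> test_functions \<Omega>" and gM: "modular \<Omega> p (grad \<phi>) \<le> ennreal M" and s: "0 < s" "s \<le> 1"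
    have [measurable]: "\<phi> \<in> borel_measurable borel" "grad \<phi> \<in> borel_measurable borel"
      using continuous_on_test_function[OF \<phi>] continuous_on_grad[OF \<phi>] by (auto intro: borel_measurable_continuous_onI)
    note [measurable] = mollify_measurable[OF \<phi>]
    obtain B where B: "B > 0" "\<And>x. norm (grad \<phi> x) \<le> B" using test_function_bounded[OF \<phi>] by metis
    define F where "F y = norm (grad \<phi> y) powr pb y" for y
    have [measurable]: "F \<in> borel_measurable borel" unfolding F_def by measurable
    define b where "b = (max 1 B) powr P"
    have Fb: "0 \<le> F y" "F y \<le> b" for y
    proof -
      have "F y \<le> (max 1 B) powr pb y" unfolding F_def using B pb_bounds[of y] by (intro powr_mono2) (auto simp: le_max_iff_disj)
      also have "\<dots> \<le> b" unfolding b_def using pb_bounds by (intro powr_mono) auto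
      finally show "F y \<le> b" .
    qed (simp add: F_def)
    have gm: "modular \<Omega> p (grad \<phi>) = (\<integral>\<^sup>+y. ennreal (F y) \<partial>lborel)"
      unfolding F_def by (rule modular_eq_lborel) (auto simp: test_function_outside[OF \<phi>])
    define K where "K x = (\<integral>\<theta>. (\<integral>\<nu>. F (x - (s * \<theta>) *\<^sub>R \<nu>) \<partial>?U) \<partial>unif01)" for x
    have Kn: "ennreal (K x) = (\<integral>\<^sup>+\<theta>. (\<integral>\<^sup>+\<nu>. ennreal (F (x - (s * \<theta>) *\<^sub>R \<nu>)) \<partial>?U) \<partial>unif01)" for x
    proof -
      have "(\<integral>\<^sup>+\<nu>. ennreal (F (x - (s * \<theta>) *\<^sub>R \<nu>)) \<partial>?U) = ennreal (\<integral>\<nu>. F (x - (s * \<theta>) *\<^sub>R \<nu>) \<partial>?U)" for \<theta>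
        by (intro nn_integral_eq_integral integrable_of_bounded[OF U1, of _ b]) (use Fb in auto)
      moreover have "(\<integral>\<^sup>+\<theta>. ennreal (\<integral>\<nu>. F (x - (s * \<theta>) *\<^sub>R \<nu>) \<partial>?U) \<partial>unif01) = ennreal (K x)"
        unfolding K_def
        by (intro nn_integral_eq_integral integrable_of_bounded[OF emeasure_unif01, of _ b])
           (use Fb in \<open>auto intro!: integral_nonneg_AE integral_le_bound[OF U1]\<close>)
      ultimately show ?thesis by simp
    qed
    \<comment> \<open>The factor \<open>s powr p x\<close> is at most \<open>s\<close> because \<open>s \<le> 1 \<le> p x\<close>.\<close>
    have pw: "\<bar>\<phi> x - mollify s \<phi> x\<bar> powr p x \<le> s * C0 * (1 + K x)" if x: "x \<in> \<Omega>" for x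
    proof -
      define H where "H \<theta> = (\<integral>\<nu>. norm (grad \<phi> (x - (s * \<theta>) *\<^sub>R \<nu>)) \<partial>?U)" for \<theta>
      define k where "k \<theta> = (\<integral>\<nu>. F (x - (s * \<theta>) *\<^sub>R \<nu>) \<partial>?U)" for \<theta>
      have [measurable]: "H \<in> borel_measurable borel" "k \<in> borel_measurable borel"
        unfolding H_def k_def by measurable
      have H: "0 \<le> H \<theta>" "H \<theta> \<le> B" for \<theta>
        unfolding H_def by (auto intro!: integral_nonneg_AE integral_le_bound[OF U1] B)
      have k: "0 \<le> k \<theta>" "k \<theta> \<le> b" for \<theta>
        unfolding k_def using Fb by (auto intro!: integral_nonneg_AE integral_le_bound[OF U1])
      have ik: "integrable unif01 k" using k by (intro integrable_of_bounded[OF emeasure_unif01, of _ b]) auto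
      have px: "1 \<le> p x" using p_ge[OF x] .
      have "\<bar>\<phi> x - mollify s \<phi> x\<bar> powr p x \<le> (s * (\<integral>\<theta>. H \<theta> \<partial>unif01)) powr p x"
        using mollify_diff_le[OF \<phi> s(1), of x] px unfolding H_def by (intro powr_mono2) auto
      also have "\<dots> = s powr p x * (\<integral>\<theta>. H \<theta> \<partial>unif01) powr p x" by (simp add: powr_mult)
      also have "\<dots> \<le> s * (\<integral>\<theta>. H \<theta> \<partial>unif01) powr p x"
        using s px powr_mono'[of 1 "p x" s] by (intro mult_right_mono) auto
      also have "\<dots> \<le> s * (\<integral>\<theta>. H \<theta> powr p x \<partial>unif01)"
        using s H by (intro mult_left_mono jensen_powr[OF emeasure_unif01 px, of _ B]) auto
      also have "\<dots> \<le> s * (\<integral>\<theta>. C0 * (1 + k \<theta>) \<partial>unif01)"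
      proof (intro mult_left_mono integral_mono_AE)
        show "integrable unif01 (\<lambda>\<theta>. H \<theta> powr p x)"
          using H px by (intro integrable_of_bounded[OF emeasure_unif01, of _ "B powr p x"]) (auto intro!: powr_mono2)
        show "integrable unif01 (\<lambda>\<theta>. C0 * (1 + k \<theta>))" using ik by auto
        show "AE \<theta> in unif01. H \<theta> powr p x \<le> C0 * (1 + k \<theta>)"
          using AE_unif01
        proof eventually_elim
          case (elim \<theta>)
          show ?case unfolding H_def k_def F_def
            by (rule avg[of "\<lambda>y. norm (grad \<phi> y)" B])
               (use gM gm B x s elim in \<open>auto simp: F_def test_function_outside[OF \<phi>]\<close>)
        qed
      qed (use s in auto)
      also have "(\<integral>\<theta>. C0 * (1 + k \<theta>) \<partial>unif01) = C0 * (1 + K x)"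
        unfolding K_def k_def[symmetric] using ik by (simp add: measure_def)
      finally show ?thesis by (simp add: mult.assoc)
    qed
    have [measurable]: "K \<in> borel_measurable borel" unfolding K_def by measurable
    have K0: "K x \<ge> 0" for x unfolding K_def using Fb by (auto intro!: integral_nonneg_AE)
    have "modular \<Omega> p (\<lambda>x. \<phi> x - mollify s \<phi> x) \<le> (\<integral>\<^sup>+x. ennreal (s * C0) * (1 + ennreal (K x)) \<partial>lebesgue_on \<Omega>)"
      unfolding modular_def
    proof (intro nn_integral_mono)
      fix x assume "x \<in> space (lebesgue_on \<Omega>)"
      then show "ennreal (norm (\<phi> x - mollify s \<phi> x) powr p x) \<le> ennreal (s * C0) * (1 + ennreal (K x))"
        using pw[of x] K0[of x] s C0
        by (simp add: ennreal_1[symmetric] ennreal_plus[symmetric] ennreal_mult'[symmetric] del: ennreal_plus ennreal_1)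
    qed
    also have "\<dots> = (\<integral>\<^sup>+x. ennreal (s * C0) * (1 + ennreal (K x)) * indicator \<Omega> x \<partial>lborel)"
      by (intro nn_integral_lebesgue_on open_\<Omega>) auto
    also have "\<dots> \<le> (\<integral>\<^sup>+x. ennreal (s * C0) * (indicator \<Omega> x + ennreal (K x)) \<partial>lborel)"
      by (intro nn_integral_mono) (auto simp: indicator_def)
    also have "\<dots> = ennreal (s * C0) * (emeasure lborel \<Omega> + (\<integral>\<^sup>+x. ennreal (K x) \<partial>lborel))"
      using open_\<Omega> by (simp add: nn_integral_cmult nn_integral_add)
    also have "(\<integral>\<^sup>+x. ennreal (K x) \<partial>lborel) \<le> ennreal M"
    proof -
      interpret LT: pair_sigma_finite lborel unif01 ..
      interpret LU: pair_sigma_finite lborel ?U ..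
      have "(\<integral>\<^sup>+x. ennreal (K x) \<partial>lborel) = (\<integral>\<^sup>+\<theta>. (\<integral>\<^sup>+x. (\<integral>\<^sup>+\<nu>. ennreal (F (x - (s * \<theta>) *\<^sub>R \<nu>)) \<partial>?U) \<partial>lborel) \<partial>unif01)"
        unfolding Kn by (rule LT.Fubini'[symmetric]) measurable
      also have "\<dots> = (\<integral>\<^sup>+\<theta>. (\<integral>\<^sup>+\<nu>. (\<integral>\<^sup>+x. ennreal (F (x - (s * \<theta>) *\<^sub>R \<nu>)) \<partial>lborel) \<partial>?U) \<partial>unif01)"
        by (intro nn_integral_cong LU.Fubini'[symmetric]) measurable
      also have "\<dots> = (\<integral>\<^sup>+\<theta>. (\<integral>\<^sup>+(\<nu>::'a). modular \<Omega> p (grad \<phi>) \<partial>?U) \<partial>unif01)"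
        unfolding gm by (intro nn_integral_cong nn_integral_translate) measurable
      also have "\<dots> = modular \<Omega> p (grad \<phi>)" using U1 emeasure_unif01 by simp
      finally show ?thesis using gM by simp
    qed
    finally show "modular \<Omega> p (\<lambda>x. \<phi> x - mollify s \<phi> x) \<le> ennreal (C0 * (vol + M) * s)"
      using vol M C0 s by (simp add: mult_left_mono ennreal_plus[symmetric] ennreal_mult'[symmetric] mult_ac del: ennreal_plus)
  qed
qed

text \<open>For fixed \<open>s\<close> the mollified functions form a bounded and equicontinuous family, since averages are controlled by \<open>L\<^sup>1\<close> norms.\<close>

lemma mollify_bounds:
  assumes M: "0 \<le> M" and s: "0 < s"
  obtains K where "0 < K" "\<And>\<phi> x. \<lbrakk>\<phi> \<in> test_functions \<Omega>; modular \<Omega> p \<phi> \<le> ennreal M\<rbrakk> \<Longrightarrow> \<bar>mollify s \<phi> x\<bar> \<le> K"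
    "\<And>\<phi> x y. \<lbrakk>\<phi> \<in> test_functions \<Omega>; modular \<Omega> p (grad \<phi>) \<le> ennreal M\<rbrakk> \<Longrightarrow> \<bar>mollify s \<phi> x - mollify s \<phi> y\<bar> \<le> K * norm (x - y)"
proof -
  let ?U = "unif (0::'a) 1"
  interpret U: finite_measure ?U by (rule finite_measure_unif) simp
  interpret T: finite_measure unif01 by (rule finite_measure_unif01)
  interpret TU: pair_sigma_finite unif01 ?U ..
  define c where "c = (1 / s) ^ DIM('a) / measure lborel (ball (0::'a) 1)"
  have c: "c \<ge> 0" using s by (simp add: c_def)
  define K where "K = c * (vol + M) + 1"
  have cK: "c * (vol + M) \<le> K" by (simp add: K_def)
  have avg: "(\<integral>\<^sup>+\<nu>. ennreal (norm (f (x - s *\<^sub>R \<nu>))) \<partial>?U) \<le> ennreal K"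
    if [measurable]: "f \<in> borel_measurable borel" and "\<And>y. y \<notin> \<Omega> \<Longrightarrow> f y = 0" "modular \<Omega> p f \<le> ennreal M"
    for f :: "'a \<Rightarrow> 'b::{real_normed_vector, second_countable_topology}" and x
  proof -
    have "(\<integral>\<^sup>+\<nu>. ennreal (norm (f (x - s *\<^sub>R \<nu>))) \<partial>?U) \<le> ennreal c * (\<integral>\<^sup>+y. ennreal (norm (f y)) \<partial>lborel)"
      unfolding c_def by (rule nn_integral_unif_le) (use s in auto)
    also have "\<dots> \<le> ennreal c * (ennreal vol + ennreal M)"
      using nn_integral_le_modular[OF that(1,2)] that(3) by (intro mult_left_mono) (auto intro: order_trans add_left_mono)
    also have "\<dots> = ennreal (c * (vol + M))" using c vol M by (simp add: ennreal_plus[symmetric] ennreal_mult'[symmetric] del: ennreal_plus)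
    also have "\<dots> \<le> ennreal K" using cK by (rule ennreal_leI)
    finally show ?thesis .
  qed
  show ?thesis
  proof (rule that[of K])
    show K: "0 < K" unfolding K_def using c vol M by (intro add_nonneg_pos) auto
    fix \<phi> :: "'a \<Rightarrow> real" and x assume \<phi>: "\<phi> \<in> test_functions \<Omega>"
    have [measurable]: "\<phi> \<in> borel_measurable borel" "grad \<phi> \<in> borel_measurable borel"
      using continuous_on_test_function[OF \<phi>] continuous_on_grad[OF \<phi>] by (auto intro: borel_measurable_continuous_onI)
    obtain B where B: "B > 0" "\<And>x. norm (grad \<phi> x) \<le> B" using test_function_bounded[OF \<phi>] by metis
    note i = integrable_unif_test[OF \<phi>, of 1 0 _ s, simplified]
    {
      assume m: "modular \<Omega> p \<phi> \<le> ennreal M"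
      have "ennreal \<bar>mollify s \<phi> x\<bar> \<le> (\<integral>\<^sup>+\<nu>. ennreal (norm (\<phi> (x - s *\<^sub>R \<nu>))) \<partial>?U)"
        using integral_norm_bound_ennreal[OF i] unfolding mollify_def by simp
      also have "\<dots> \<le> ennreal K" by (rule avg) (use m test_function_outside[OF \<phi>] in auto)
      finally show "\<bar>mollify s \<phi> x\<bar> \<le> K" using K by (subst (asm) ennreal_le_iff) auto
    }
    {
      fix y assume m: "modular \<Omega> p (grad \<phi>) \<le> ennreal M"
      have "mollify s \<phi> x - mollify s \<phi> y = (\<integral>\<nu>. \<phi> (x - s *\<^sub>R \<nu>) - \<phi> (y - s *\<^sub>R \<nu>) \<partial>?U)"
        unfolding mollify_def using i by simp
      then have "ennreal \<bar>mollify s \<phi> x - mollify s \<phi> y\<bar> \<le> (\<integral>\<^sup>+\<nu>. ennreal (norm (\<phi> (x - s *\<^sub>R \<nu>) - \<phi> (y - s *\<^sub>R \<nu>))) \<partial>?U)"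
        using integral_norm_bound_ennreal[OF Bochner_Integration.integrable_diff[OF i[of x] i[of y]]] by simp
      also have "\<dots> \<le> (\<integral>\<^sup>+\<nu>. (\<integral>\<^sup>+\<theta>. ennreal (norm (x - y)) * ennreal (norm (grad \<phi> ((x - \<theta> *\<^sub>R (x - y)) - s *\<^sub>R \<nu>))) \<partial>unif01) \<partial>?U)"
      proof (rule nn_integral_mono)
        fix \<nu>
        have "norm (\<phi> (x - s *\<^sub>R \<nu>) - \<phi> (y - s *\<^sub>R \<nu>)) \<le> norm (x - y) * (\<integral>\<theta>. norm (grad \<phi> ((x - s *\<^sub>R \<nu>) - \<theta> *\<^sub>R (x - y))) \<partial>unif01)"
          using test_function_increment_le[OF \<phi>, of "x - s *\<^sub>R \<nu>" "x - y"] by (simp add: algebra_simps)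
        then have "ennreal (norm (\<phi> (x - s *\<^sub>R \<nu>) - \<phi> (y - s *\<^sub>R \<nu>))) \<le>
            ennreal (norm (x - y)) * ennreal (\<integral>\<theta>. norm (grad \<phi> ((x - s *\<^sub>R \<nu>) - \<theta> *\<^sub>R (x - y))) \<partial>unif01)"
          by (simp add: ennreal_mult'[symmetric])
        also have "ennreal (\<integral>\<theta>. norm (grad \<phi> ((x - s *\<^sub>R \<nu>) - \<theta> *\<^sub>R (x - y))) \<partial>unif01) =
            (\<integral>\<^sup>+\<theta>. ennreal (norm (grad \<phi> ((x - s *\<^sub>R \<nu>) - \<theta> *\<^sub>R (x - y)))) \<partial>unif01)"
          by (intro nn_integral_eq_integral[symmetric] integrable_of_bounded[OF emeasure_unif01, of _ B]) (use B in auto)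
        finally show "ennreal (norm (\<phi> (x - s *\<^sub>R \<nu>) - \<phi> (y - s *\<^sub>R \<nu>))) \<le>
            (\<integral>\<^sup>+\<theta>. ennreal (norm (x - y)) * ennreal (norm (grad \<phi> ((x - \<theta> *\<^sub>R (x - y)) - s *\<^sub>R \<nu>))) \<partial>unif01)"
          by (subst nn_integral_cmult) (auto simp: algebra_simps)
      qed
      also have "\<dots> = (\<integral>\<^sup>+\<theta>. (\<integral>\<^sup>+\<nu>. ennreal (norm (x - y)) * ennreal (norm (grad \<phi> ((x - \<theta> *\<^sub>R (x - y)) - s *\<^sub>R \<nu>))) \<partial>?U) \<partial>unif01)"
        by (rule TU.Fubini') measurable
      also have "\<dots> \<le> (\<integral>\<^sup>+(\<theta>::real). ennreal (norm (x - y)) * ennreal K \<partial>unif01)"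
        using avg[of "grad \<phi>"] m test_function_outside[OF \<phi>]
        by (intro nn_integral_mono) (auto simp: nn_integral_cmult intro!: mult_left_mono)
      also have "\<dots> = ennreal (K * norm (x - y))"
        using emeasure_unif01 K by (simp add: ennreal_mult'[symmetric] mult.commute)
      finally show "\<bar>mollify s \<phi> x - mollify s \<phi> y\<bar> \<le> K * norm (x - y)"
        using K by (subst (asm) ennreal_le_iff) auto
    }
  qed
qed

lemma test_function_measurable_on:
  assumes "\<phi> \<in> test_functions \<Omega>"
  shows "\<phi> \<in> borel_measurable (lebesgue_on \<Omega>)" "grad \<phi> \<in> borel_measurable (lebesgue_on \<Omega>)"
    "mollify s \<phi> \<in> borel_measurable (lebesgue_on \<Omega>)"
proof -
  have m: "f \<in> borel_measurable (lebesgue_on \<Omega>)" if "f \<in> borel_measurable borel" for f :: "'a \<Rightarrow> 'c::topological_space"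
    using that by (intro measurable_restrict_space1 measurable_completion) simp
  show "\<phi> \<in> borel_measurable (lebesgue_on \<Omega>)" "grad \<phi> \<in> borel_measurable (lebesgue_on \<Omega>)"
    using continuous_on_test_function[OF assms] continuous_on_grad[OF assms]
    by (auto intro!: m borel_measurable_continuous_onI)
  show "mollify s \<phi> \<in> borel_measurable (lebesgue_on \<Omega>)" by (intro m mollify_measurable[OF assms])
qed

section \<open>Compactness for test functions\<close>

lemma modular_tendsto_0_dominated:
  fixes f :: "nat \<Rightarrow> 'a \<Rightarrow> real"
  assumes m: "\<And>n. f n \<in> borel_measurable (lebesgue_on \<Omega>)"
    and b: "\<And>n x. x \<in> \<Omega> \<Longrightarrow> \<bar>f n x\<bar> \<le> B"
    and l: "\<And>x. x \<in> \<Omega> \<Longrightarrow> (\<lambda>n. f n x) \<longlonglongrightarrow> 0"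
  shows "(\<lambda>n. modular \<Omega> p (f n)) \<longlonglongrightarrow> 0"
proof -
  interpret finite_measure "lebesgue_on \<Omega>" by (rule finite_measure_\<Omega>)
  note [measurable] = m
  have "(\<lambda>n. modular \<Omega> p (f n)) \<longlonglongrightarrow> (\<integral>\<^sup>+x. 0 \<partial>lebesgue_on \<Omega>)"
    unfolding modular_def
  proof (rule nn_integral_dominated_convergence[where w="\<lambda>_. ennreal ((max 1 B) powr P)"])
    show "(\<integral>\<^sup>+x. ennreal ((max 1 B) powr P) \<partial>lebesgue_on \<Omega>) < \<infinity>"
      using emeasure_finite[of "space (lebesgue_on \<Omega>)"]
      unfolding nn_integral_const infinity_ennreal_def by (simp add: ennreal_mult_eq_top_iff less_top[symmetric])
    show "AE x in lebesgue_on \<Omega>. ennreal (norm (f n x) powr p x) \<le> ennreal ((max 1 B) powr P)" for n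
    proof (intro AE_I2 ennreal_leI)
      fix x assume "x \<in> space (lebesgue_on \<Omega>)"
      then have x: "x \<in> \<Omega>" by simp
      have "norm (f n x) powr p x \<le> (max 1 B) powr p x"
        using b[OF x, of n] p_ge[OF x] by (intro powr_mono2) (auto simp: le_max_iff_disj)
      also have "\<dots> \<le> (max 1 B) powr P" using p_le[OF x] by (intro powr_mono) auto
      finally show "norm (f n x) powr p x \<le> (max 1 B) powr P" .
    qed
    show "AE x in lebesgue_on \<Omega>. (\<lambda>n. ennreal (norm (f n x) powr p x)) \<longlonglongrightarrow> 0"
    proof (rule AE_I2)
      fix x assume "x \<in> space (lebesgue_on \<Omega>)"
      then have x: "x \<in> \<Omega>" by simp
      have "(\<lambda>n. norm (f n x) powr p x) \<longlonglongrightarrow> 0"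
        using p_ge[OF x] by (intro tendsto_zero_powrI[where b="p x"] tendsto_norm_zero l x) auto
      then show "(\<lambda>n. ennreal (norm (f n x) powr p x)) \<longlonglongrightarrow> 0"
        using tendsto_ennrealI by fastforce
    qed
  qed measurable
  then show ?thesis by simp
qed

lemma modular_diff_commute: "modular \<Omega> p (\<lambda>x. f x - g x) = modular \<Omega> p (\<lambda>x. g x - f x)"
  unfolding modular_def by (simp add: norm_minus_commute)

text \<open>The mollified functions converge along a subsequence at countably many points and scales, hence
everywhere by equicontinuity, hence in the modular by boundedness. Mollification moves all functions
by a uniformly small amount, which transfers the Cauchy property.\<close>

lemma test_functions_compact:
  fixes \<phi> :: "nat \<Rightarrow> 'a \<Rightarrow> real"
  assumes M: "0 \<le> M" and \<phi>: "\<And>n. \<phi> n \<in> test_functions \<Omega>"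
    and b: "\<And>n. modular \<Omega> p (\<phi> n) \<le> ennreal M" "\<And>n. modular \<Omega> p (grad (\<phi> n)) \<le> ennreal M"
  obtains r where "strict_mono (r :: nat \<Rightarrow> nat)"
    "\<And>e. 0 < e \<Longrightarrow> \<exists>N. \<forall>m\<ge>N. \<forall>n\<ge>N. modular \<Omega> p (\<lambda>x. \<phi> (r m) x - \<phi> (r n) x) \<le> ennreal e"
proof -
  define s where "s j = inverse (real (Suc j))" for j
  have s: "0 < s j" "s j \<le> 1" for j by (auto simp: s_def field_simps)
  have "\<exists>K. 0 < K \<and> (\<forall>n x. \<bar>mollify (s j) (\<phi> n) x\<bar> \<le> K) \<and>
      (\<forall>n x y. \<bar>mollify (s j) (\<phi> n) x - mollify (s j) (\<phi> n) y\<bar> \<le> K * norm (x - y))" for j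
    by (rule mollify_bounds[OF M s(1)[of j]]) (use \<phi> b in blast)
  then obtain K where K: "\<And>j. 0 < K j" "\<And>j n x. \<bar>mollify (s j) (\<phi> n) x\<bar> \<le> K j"
      "\<And>j n x y. \<bar>mollify (s j) (\<phi> n) x - mollify (s j) (\<phi> n) y\<bar> \<le> K j * norm (x - y)" by metis
  obtain C1 where C1: "0 \<le> C1" "\<And>\<phi> s. \<lbrakk>\<phi> \<in> test_functions \<Omega>; modular \<Omega> p (grad \<phi>) \<le> ennreal M; 0 < s; s \<le> 1\<rbrakk> \<Longrightarrow>
     modular \<Omega> p (\<lambda>x. \<phi> x - mollify s \<phi> x) \<le> ennreal (C1 * s)"
    using mollify_modular_bound[OF M] by metis
  obtain D :: "'a set" where D: "countable D" "\<And>X. open X \<Longrightarrow> X \<noteq> {} \<Longrightarrow> \<exists>d\<in>D. d \<in> X"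
    using countable_dense_setE by metis
  \<comment> \<open>Dividing by \<open>K j\<close> gives one bound for all scales, as the diagonal argument requires.\<close>
  obtain r where r: "strict_mono (r :: nat \<Rightarrow> nat)"
    "\<And>z. z \<in> D \<times> UNIV \<Longrightarrow> \<exists>l. (\<lambda>n. (case z of (x, j) \<Rightarrow> mollify (s j) (\<phi> (r n)) x / K j)) \<longlonglongrightarrow> l"
  proof (rule function_convergent_subsequence[where S="D \<times> (UNIV::nat set)" and M=1 and
      f="\<lambda>n z. case z of (x, j) \<Rightarrow> mollify (s j) (\<phi> n) x / K j"])
    show "countable (D \<times> (UNIV::nat set))" using D(1) by auto
    show "norm (case z of (x, j) \<Rightarrow> mollify (s j) (\<phi> n) x / K j) \<le> 1" for n z
      using K(2) less_imp_le[OF K(1)] by (auto split: prod.split simp: divide_le_eq_1 K(1))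
  qed blast
  have conv: "convergent (\<lambda>n. mollify (s j) (\<phi> (r n)) x)" for j x
  proof -
    have "Cauchy (\<lambda>n. mollify (s j) (\<phi> (r n)) x)"
      unfolding Cauchy_def
    proof (intro allI impI)
      fix e :: real assume e: "0 < e"
      obtain d where d: "d \<in> D" "dist x d < e / (3 * K j)"
      proof -
        have "0 < e / (3 * K j)" using e K(1)[of j] by simp
        then have "ball x (e / (3 * K j)) \<noteq> {}" by (metis ball_eq_empty not_le)
        from D(2)[OF open_ball this] that show ?thesis by auto
      qed
      have dK: "K j * norm (x - d) < e / 3"
        using d(2) K(1)[of j] by (simp add: dist_norm field_simps)
      obtain l where "(\<lambda>n. mollify (s j) (\<phi> (r n)) d / K j) \<longlonglongrightarrow> l" using r(2)[of "(d, j)"] d by auto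
      then have "(\<lambda>n. K j * (mollify (s j) (\<phi> (r n)) d / K j)) \<longlonglongrightarrow> K j * l" by (intro tendsto_intros)
      then have "(\<lambda>n. mollify (s j) (\<phi> (r n)) d) \<longlonglongrightarrow> K j * l" using K(1)[of j] by simp
      then have "Cauchy (\<lambda>n. mollify (s j) (\<phi> (r n)) d)" by (rule LIMSEQ_imp_Cauchy)
      then obtain N where N: "\<And>m n. m \<ge> N \<Longrightarrow> n \<ge> N \<Longrightarrow>
          dist (mollify (s j) (\<phi> (r m)) d) (mollify (s j) (\<phi> (r n)) d) < e / 3"
        using e unfolding Cauchy_def by (metis divide_pos_pos zero_less_numeral)
      show "\<exists>N. \<forall>m\<ge>N. \<forall>n\<ge>N. dist (mollify (s j) (\<phi> (r m)) x) (mollify (s j) (\<phi> (r n)) x) < e"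
      proof (intro exI allI impI)
        fix m n assume "m \<ge> N" "n \<ge> N"
        then have "\<bar>mollify (s j) (\<phi> (r m)) d - mollify (s j) (\<phi> (r n)) d\<bar> < e / 3"
          using N by (simp add: dist_real_def)
        moreover have "\<bar>mollify (s j) (\<phi> (r m)) x - mollify (s j) (\<phi> (r m)) d\<bar> < e / 3"
          "\<bar>mollify (s j) (\<phi> (r n)) x - mollify (s j) (\<phi> (r n)) d\<bar> < e / 3"
          using K(3)[of j _ x d] dK by (meson le_less_trans)+
        ultimately show "dist (mollify (s j) (\<phi> (r m)) x) (mollify (s j) (\<phi> (r n)) x) < e"
          unfolding dist_real_def by linarith
      qed
    qed
    then show ?thesis by (simp add: Cauchy_convergent_iff)
  qed
  define a where "a j x = lim (\<lambda>n. mollify (s j) (\<phi> (r n)) x)" for j x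
  have a: "(\<lambda>n. mollify (s j) (\<phi> (r n)) x) \<longlonglongrightarrow> a j x" for j x
    using conv[of j x] by (simp add: a_def convergent_LIMSEQ_iff)
  note mm = test_function_measurable_on[OF \<phi>]
  have am: "a j \<in> borel_measurable (lebesgue_on \<Omega>)" for j
    by (rule borel_measurable_LIMSEQ_real[OF a]) (rule mm)
  have aK: "\<bar>a j x\<bar> \<le> K j" for j x
    using K(2) by (intro LIMSEQ_le_const2[OF tendsto_rabs[OF a[of j x]]]) auto
  have lim0: "(\<lambda>n. modular \<Omega> p (\<lambda>x. mollify (s j) (\<phi> (r n)) x - a j x)) \<longlonglongrightarrow> 0" for j
  proof (rule modular_tendsto_0_dominated[where B="2 * K j"])
    show "\<bar>mollify (s j) (\<phi> (r n)) x - a j x\<bar> \<le> 2 * K j" for n x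
      using K(2)[of j "r n" x] aK[of j x] by linarith
    show "(\<lambda>n. mollify (s j) (\<phi> (r n)) x - a j x) \<longlonglongrightarrow> 0" for x
      using tendsto_diff[OF a tendsto_const, of j x "a j x"] by simp
  qed (intro borel_measurable_diff mm am)
  show ?thesis
  proof (rule that[OF r(1)])
    fix e :: real assume e: "0 < e"
    define c where "c = 2 powr P"
    have c: "c \<ge> 1" using P powr_mono[of 0 P 2] by (simp add: c_def)
    \<comment> \<open>Each of the two nested triangle inequalities costs a factor \<open>2 c\<close>.\<close>
    define \<eta> where "\<eta> = e / (4 * c * c)"
    have \<eta>: "\<eta> > 0" using e c by (simp add: \<eta>_def)
    obtain j where j: "C1 * s j < \<eta>"
    proof -
      have "(\<lambda>j. C1 * s j) \<longlonglongrightarrow> C1 * 0" unfolding s_def by (intro tendsto_intros LIMSEQ_inverse_real_of_nat)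
      then have "\<forall>\<^sub>F j in sequentially. C1 * s j < \<eta>" using order_tendstoD(2)[of _ "C1 * 0" sequentially \<eta>] \<eta> by simp
      then show ?thesis using that by (auto simp: eventually_sequentially)
    qed
    have "\<forall>\<^sub>F n in sequentially. modular \<Omega> p (\<lambda>x. mollify (s j) (\<phi> (r n)) x - a j x) < ennreal \<eta>"
      using order_tendstoD(2)[OF lim0, of "ennreal \<eta>" j] \<eta> by simp
    then obtain N where N: "\<And>n. n \<ge> N \<Longrightarrow> modular \<Omega> p (\<lambda>x. mollify (s j) (\<phi> (r n)) x - a j x) < ennreal \<eta>"
      by (auto simp: eventually_sequentially)
    have 1: "modular \<Omega> p (\<lambda>x. \<phi> (r n) x - a j x) \<le> ennreal (2 * c * \<eta>)" if "n \<ge> N" for n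
    proof -
      have "modular \<Omega> p (\<lambda>x. \<phi> (r n) x - a j x) = modular \<Omega> p (\<lambda>x. (\<phi> (r n) x - mollify (s j) (\<phi> (r n)) x) + (mollify (s j) (\<phi> (r n)) x - a j x))"
        by simp
      also have "\<dots> \<le> ennreal c * (modular \<Omega> p (\<lambda>x. \<phi> (r n) x - mollify (s j) (\<phi> (r n)) x) + modular \<Omega> p (\<lambda>x. mollify (s j) (\<phi> (r n)) x - a j x))"
        unfolding c_def by (intro modular_add_le borel_measurable_diff mm am)
      also have "\<dots> \<le> ennreal c * (ennreal \<eta> + ennreal \<eta>)"
        using order_trans[OF C1(2)[OF \<phi> b(2) s, of "r n" j] ennreal_leI[OF less_imp_le[OF j]]] less_imp_le[OF N[OF that]]
        by (intro mult_left_mono add_mono) auto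
      also have "\<dots> = ennreal (2 * c * \<eta>)"
        using c \<eta> by (simp add: ennreal_plus[symmetric] ennreal_mult'[symmetric] del: ennreal_plus)
      finally show ?thesis .
    qed
    show "\<exists>N. \<forall>m\<ge>N. \<forall>n\<ge>N. modular \<Omega> p (\<lambda>x. \<phi> (r m) x - \<phi> (r n) x) \<le> ennreal e"
    proof (intro exI allI impI)
      fix m n assume mn: "m \<ge> N" "n \<ge> N"
      have "modular \<Omega> p (\<lambda>x. \<phi> (r m) x - \<phi> (r n) x) = modular \<Omega> p (\<lambda>x. (\<phi> (r m) x - a j x) + (a j x - \<phi> (r n) x))"
        by simp
      also have "\<dots> \<le> ennreal c * (modular \<Omega> p (\<lambda>x. \<phi> (r m) x - a j x) + modular \<Omega> p (\<lambda>x. a j x - \<phi> (r n) x))"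
        unfolding c_def by (intro modular_add_le borel_measurable_diff mm am)
      also have "\<dots> \<le> ennreal c * (ennreal (2 * c * \<eta>) + ennreal (2 * c * \<eta>))"
        using 1 mn modular_diff_commute[of "a j"] by (intro mult_left_mono add_mono) auto
      also have "\<dots> = ennreal (c * (2 * c * \<eta> + 2 * c * \<eta>))"
        using c \<eta> by (simp add: ennreal_plus[symmetric] ennreal_mult'[symmetric] del: ennreal_plus)
      also have "c * (2 * c * \<eta> + 2 * c * \<eta>) = e" using c by (simp add: \<eta>_def)
      finally show "modular \<Omega> p (\<lambda>x. \<phi> (r m) x - \<phi> (r n) x) \<le> ennreal e" .
    qed
  qed
qed

end

section \<open>Exit times\<close>

text \<open>The value for \<open>\<nu> = 0\<close> makes the function nonnegative and jointly measurable on bounded sets.\<close>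

definition exit_time :: "'a::euclidean_space set \<Rightarrow> 'a \<Rightarrow> 'a \<Rightarrow> real" where
  "exit_time \<Omega> x \<nu> = (if \<nu> = 0 then 0 else Inf {t. 0 \<le> t \<and> x - t *\<^sub>R \<nu> \<notin> \<Omega>})"

lemma exit_time_nonneg:
  assumes "bounded \<Omega>" shows "0 \<le> exit_time \<Omega> x \<nu>"
    and "\<nu> \<noteq> 0 \<Longrightarrow> {t. 0 \<le> t \<and> x - t *\<^sub>R \<nu> \<notin> \<Omega>} \<noteq> {}"
proof -
  show ne: "{t. 0 \<le> t \<and> x - t *\<^sub>R \<nu> \<notin> \<Omega>} \<noteq> {}" if \<nu>: "\<nu> \<noteq> 0"
  proof -
    obtain B where B: "\<And>y. y \<in> \<Omega> \<Longrightarrow> norm y \<le> B" using assms bounded_iff by metis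
    define t where "t = (\<bar>B\<bar> + norm x + 1) / norm \<nu>"
    have t: "t \<ge> 0" "t * norm \<nu> = \<bar>B\<bar> + norm x + 1" using \<nu> by (auto simp: t_def)
    have "norm (t *\<^sub>R \<nu>) \<le> norm (x - t *\<^sub>R \<nu>) + norm x"
      by (metis add.commute norm_minus_commute norm_triangle_sub)
    then have "norm (x - t *\<^sub>R \<nu>) > B" using t by simp
    then have "x - t *\<^sub>R \<nu> \<notin> \<Omega>" using B by force
    then show ?thesis using t by blast
  qed
  then show "0 \<le> exit_time \<Omega> x \<nu>"
    unfolding exit_time_def by (auto intro: cInf_greatest)
qed

lemma exit_time_le:
  assumes "0 \<le> t" "x - t *\<^sub>R \<nu> \<notin> \<Omega>" shows "exit_time \<Omega> x \<nu> \<le> t"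
proof (cases "\<nu> = 0")
  case False
  have "Inf {t. 0 \<le> t \<and> x - t *\<^sub>R \<nu> \<notin> \<Omega>} \<le> t"
    using assms by (intro cInf_lower bdd_belowI[of _ 0]) auto
  then show ?thesis using False by (simp add: exit_time_def)
qed (use assms in \<open>simp add: exit_time_def\<close>)

lemma before_exit_time: "0 \<le> t \<Longrightarrow> t < exit_time \<Omega> x \<nu> \<Longrightarrow> x - t *\<^sub>R \<nu> \<in> \<Omega>"
  using exit_time_le[of t x \<nu> \<Omega>] by (cases "x - t *\<^sub>R \<nu> \<in> \<Omega>") auto

lemma at_exit_time:
  assumes "open \<Omega>" "bounded \<Omega>" "\<nu> \<noteq> 0" shows "x - exit_time \<Omega> x \<nu> *\<^sub>R \<nu> \<notin> \<Omega>"
proof -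
  let ?S = "{t. 0 \<le> t \<and> x - t *\<^sub>R \<nu> \<notin> \<Omega>}"
  have "closed ((\<lambda>t. x - t *\<^sub>R \<nu>) -` (- \<Omega>))"
    using assms(1) by (intro continuous_closed_vimage) (auto intro!: continuous_intros)
  then have "closed ({0..} \<inter> (\<lambda>t. x - t *\<^sub>R \<nu>) -` (- \<Omega>))" by (intro closed_Int closed_atLeast)
  also have "{0..} \<inter> (\<lambda>t. x - t *\<^sub>R \<nu>) -` (- \<Omega>) = ?S" by auto
  finally have "Inf ?S \<in> ?S"
    using exit_time_nonneg(2)[OF assms(2,3), of x] by (intro closed_contains_Inf) (auto intro: bdd_belowI[of _ 0])
  then show ?thesis using assms(3) by (simp add: exit_time_def)
qed

text \<open>Membership of a whole segment is an open condition on its endpoints, which is what makes exit times measurable.\<close>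

lemma less_exit_time_iff:
  assumes "open \<Omega>" "bounded \<Omega>" "\<nu> \<noteq> 0" "0 \<le> t"
  shows "t < exit_time \<Omega> x \<nu> \<longleftrightarrow> (\<forall>\<theta>\<in>{0..1}. x - (\<theta> * t) *\<^sub>R \<nu> \<in> \<Omega>)"
proof
  assume *: "t < exit_time \<Omega> x \<nu>"
  show "\<forall>\<theta>\<in>{0..1}. x - (\<theta> * t) *\<^sub>R \<nu> \<in> \<Omega>"
  proof
    fix \<theta> :: real assume "\<theta> \<in> {0..1}"
    then have "0 \<le> \<theta> * t" "\<theta> * t \<le> t" using assms(4) by (auto intro: mult_left_le_one_le)
    then show "x - (\<theta> * t) *\<^sub>R \<nu> \<in> \<Omega>" using * by (intro before_exit_time) auto
  qed
next
  assume *: "\<forall>\<theta>\<in>{0..1}. x - (\<theta> * t) *\<^sub>R \<nu> \<in> \<Omega>"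
  show "t < exit_time \<Omega> x \<nu>"
  proof (rule ccontr)
    assume "\<not> t < exit_time \<Omega> x \<nu>"
    then have le: "exit_time \<Omega> x \<nu> \<le> t" by simp
    note e = at_exit_time[OF assms(1-3), of x] exit_time_nonneg(1)[OF assms(2), of x \<nu>]
    show False
    proof (cases "t = 0")
      case True then show ?thesis using * e le by fastforce
    next
      case False
      then have "x - (exit_time \<Omega> x \<nu> / t * t) *\<^sub>R \<nu> \<in> \<Omega>" using * e le assms(4) by (intro *[rule_format]) auto
      then show ?thesis using e False by simp
    qed
  qed
qed

text \<open>Exit times decrease at unit speed along the line.\<close>

lemma exit_time_shift:
  assumes "open \<Omega>" "bounded \<Omega>" "\<nu> \<noteq> 0" "0 \<le> t" "t < exit_time \<Omega> x \<nu>"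
  shows "exit_time \<Omega> (x - t *\<^sub>R \<nu>) \<nu> = exit_time \<Omega> x \<nu> - t"
proof (rule antisym)
  show "exit_time \<Omega> (x - t *\<^sub>R \<nu>) \<nu> \<le> exit_time \<Omega> x \<nu> - t"
    using at_exit_time[OF assms(1-3), of x] assms(5) by (intro exit_time_le) (auto simp: algebra_simps)
  have "exit_time \<Omega> x \<nu> \<le> t + exit_time \<Omega> (x - t *\<^sub>R \<nu>) \<nu>"
    using at_exit_time[OF assms(1-3), of "x - t *\<^sub>R \<nu>"] exit_time_nonneg(1)[OF assms(2), of "x - t *\<^sub>R \<nu>" \<nu>] assms(4)
    by (intro exit_time_le) (auto simp: algebra_simps)
  then show "exit_time \<Omega> x \<nu> - t \<le> exit_time \<Omega> (x - t *\<^sub>R \<nu>) \<nu>" by simp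
qed

lemma exit_time_pos:
  assumes "open \<Omega>" "bounded \<Omega>" "\<nu> \<noteq> 0" "x \<in> \<Omega>" shows "0 < exit_time \<Omega> x \<nu>"
  using less_exit_time_iff[OF assms(1-3), of 0 x] assms(4) by simp

text \<open>The segment is compact, so \<open>\<Omega>\<close> contains a uniform neighbourhood of it.\<close>

lemma open_segments_inside:
  assumes \<Omega>: "open (\<Omega> :: 'a::euclidean_space set)" and "(0::real) \<le> t"
  shows "open {z. \<forall>\<theta>\<in>{0..1}. fst z - (\<theta> * t) *\<^sub>R snd z \<in> \<Omega>}"
  unfolding open_dist
proof
  fix z assume z: "z \<in> {z. \<forall>\<theta>\<in>{0..1}. fst z - (\<theta> * t) *\<^sub>R snd z \<in> \<Omega>}"
  let ?K = "(\<lambda>\<theta>. fst z - (\<theta> * t) *\<^sub>R snd z) ` {0..1}"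
  have "compact ?K" by (intro compact_continuous_image continuous_intros) auto
  moreover have "?K \<subseteq> \<Omega>" using z by auto
  ultimately obtain e where e: "0 < e" "(\<Union>x\<in>?K. cball x e) \<subseteq> \<Omega>"
    using compact_subset_open_imp_cball_epsilon_subset[OF _ \<Omega>] by metis
  define d where "d = e / (1 + t)"
  have d: "0 < d" using e assms by (simp add: d_def)
  show "\<exists>d>0. \<forall>y. dist y z < d \<longrightarrow> y \<in> {z. \<forall>\<theta>\<in>{0..1}. fst z - (\<theta> * t) *\<^sub>R snd z \<in> \<Omega>}"
  proof (intro exI[of _ d] conjI allI impI d CollectI ballI)
    fix y \<theta> assume y: "dist y z < d" and \<theta>: "\<theta> \<in> {0..1::real}"
    let ?a = "fst y - (\<theta> * t) *\<^sub>R snd y" and ?b = "fst z - (\<theta> * t) *\<^sub>R snd z"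
    have "?a - ?b = (fst y - fst z) - (\<theta> * t) *\<^sub>R (snd y - snd z)" by (simp add: algebra_simps)
    then have "norm (?a - ?b) \<le> norm (fst y - fst z) + norm ((\<theta> * t) *\<^sub>R (snd y - snd z))" 
      by (simp only: norm_triangle_ineq4)
    also have "norm ((\<theta> * t) *\<^sub>R (snd y - snd z)) \<le> t * norm (snd y - snd z)"
      using \<theta> assms by (auto intro!: mult_right_mono mult_left_le_one_le)
    also have "norm (fst y - fst z) + t * norm (snd y - snd z) \<le> d + t * d"
      using y dist_fst_le[of y z] dist_snd_le[of y z] assms
      by (intro add_mono mult_left_mono) (auto simp: dist_norm)
    also have "d + t * d = d * (1 + t)" by (simp add: algebra_simps)
    also have "\<dots> = e" using assms by (simp add: d_def)
    finally have "?a \<in> cball ?b e" by (simp add: dist_norm norm_minus_commute)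
    then show "?a \<in> \<Omega>" using e(2) \<theta> by blast
  qed
qed

lemma exit_time_measurable_pair:
  assumes "open (\<Omega> :: 'a::euclidean_space set)" "bounded \<Omega>"
  shows "(\<lambda>z. exit_time \<Omega> (fst z) (snd z)) \<in> borel_measurable borel"
proof (rule borel_measurableI_greater)
  fix t :: real
  show "{z \<in> space borel. t < exit_time \<Omega> (fst z) (snd z)} \<in> sets borel"
  proof (cases "t < 0")
    case True
    then have "{z \<in> space borel. t < exit_time \<Omega> (fst z) (snd z)} = UNIV"
      using exit_time_nonneg(1)[OF assms(2)] by (auto intro: less_le_trans)
    then show ?thesis by simp
  next
    case False
    then have t: "0 \<le> t" by simp
    have "t < exit_time \<Omega> x \<nu> \<longleftrightarrow> (\<forall>\<theta>\<in>{0..1}. x - (\<theta> * t) *\<^sub>R \<nu> \<in> \<Omega>) \<and> \<nu> \<noteq> 0" for x \<nu>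
      using less_exit_time_iff[OF assms _ t, of \<nu> x] t by (cases "\<nu> = 0") (auto simp: exit_time_def)
    then have "{z \<in> space borel. t < exit_time \<Omega> (fst z) (snd z)} =
        {z. \<forall>\<theta>\<in>{0..1}. fst z - (\<theta> * t) *\<^sub>R snd z \<in> \<Omega>} \<inter> {z. snd z \<noteq> 0}"
      by (simp add: Collect_conj_eq)
    moreover have "open {z::'a\<times>'a. snd z \<noteq> 0}"
      by (intro open_Collect_neq continuous_intros)
    ultimately show ?thesis using open_segments_inside[OF assms(1) t] by auto
  qed
qed

lemma exit_time_measurable:
  assumes "open (\<Omega> :: 'a::euclidean_space set)" "bounded \<Omega>"
    and [measurable]: "f \<in> borel_measurable M" "g \<in> borel_measurable M"
  shows "(\<lambda>x. exit_time \<Omega> (f x) (g x)) \<in> borel_measurable M"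
  using measurable_compose[OF _ exit_time_measurable_pair[OF assms(1,2)], of "\<lambda>x. (f x, g x)" M]
  by (simp add: borel_prod[symmetric])

section \<open>Hardy's inequality on lines\<close>

text \<open>The two parametrizations of a segment, by length and by fraction.\<close>

lemma nn_integral_unif01_scale:
  fixes H :: "real \<Rightarrow> ennreal"
  assumes [measurable]: "H \<in> borel_measurable borel" and D: "0 < D"
  shows "ennreal D * (\<integral>\<^sup>+\<theta>. H (D * \<theta>) \<partial>unif01) = (\<integral>\<^sup>+t. H t * indicator {0..D} t \<partial>lborel)"
proof -
  have "(\<integral>\<^sup>+t. H t * indicator {0..D} t \<partial>lborel) = ennreal \<bar>D\<bar> * (\<integral>\<^sup>+\<theta>. H (0 + D * \<theta>) * indicator {0..D} (0 + D * \<theta>) \<partial>lborel)"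
    using D by (intro nn_integral_real_affine) auto
  also have "(\<integral>\<^sup>+\<theta>. H (0 + D * \<theta>) * indicator {0..D} (0 + D * \<theta>) \<partial>lborel) = (\<integral>\<^sup>+\<theta>. H (D * \<theta>) * indicator {0..1} \<theta> \<partial>lborel)"
    using D by (intro nn_integral_cong) (auto simp: indicator_def zero_le_mult_iff mult_le_cancel_left1)
  also have "\<dots> = (\<integral>\<^sup>+\<theta>. H (D * \<theta>) \<partial>unif01)"
    by (subst nn_integral_uniform_measure) (auto simp: divide_ennreal_def)
  finally show ?thesis using D by simp
qed

text \<open>The weight for Hardy's inequality: integrable up to the exit point, yet singular enough that the transposed
integral below converges at infinity.\<close>

lemma inverse_sqrt_weight:
  shows "integrable unif01 (\<lambda>\<theta>. (1 - \<theta>) powr (- 1 / 2))" "(\<integral>\<theta>. (1 - \<theta>) powr (- 1 / 2) \<partial>unif01) = 2"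
    and "AE \<theta> in unif01. 0 < (1 - \<theta>) powr (- 1 / 2)"
proof -
  have "((\<lambda>x. x powr (- 1 / 2)) has_integral (1 powr (- 1 / 2 + 1) / (- 1 / 2 + 1))) {0..1::real}"
    by (rule has_integral_powr_from_0) auto
  then have h: "((\<lambda>x. x powr (- 1 / 2)) has_integral 2) {0..1::real}" by simp
  have "(\<integral>\<^sup>+x. ennreal (x powr (- 1 / 2)) * indicator {0..1} x \<partial>lborel) = ennreal 2"
  proof -
    have "((\<lambda>x. x powr (- 1 / 2) * indicator {0..1} x) has_integral 2) (UNIV :: real set)"
    proof -
      have eq: "(\<lambda>x::real. x powr (- 1 / 2) * indicator {0..1} x) = (\<lambda>x. if x \<in> {0..1} then x powr (- 1 / 2) else 0)"
        by (auto simp: indicator_def)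
      show ?thesis unfolding eq using h by (subst has_integral_restrict_UNIV)
    qed
    then have "(\<integral>\<^sup>+x. ennreal (x powr (- 1 / 2) * indicator {0..1} x) \<partial>lborel) = ennreal 2"
      by (rule nn_integral_has_integral_lborel[rotated 2]) auto
    then show ?thesis by (simp add: ennreal_mult' ennreal_indicator)
  qed
  also have "(\<integral>\<^sup>+x. ennreal (x powr (- 1 / 2)) * indicator {0..1} x \<partial>lborel) =
     ennreal \<bar>-1\<bar> * (\<integral>\<^sup>+x. ennreal ((1 + (-1) * x) powr (- 1 / 2)) * indicator {0..1} (1 + (-1) * x) \<partial>lborel)"
    by (intro nn_integral_real_affine) auto
  also have "\<dots> = (\<integral>\<^sup>+x. ennreal ((1 - x) powr (- 1 / 2)) * indicator {0..1} x \<partial>lborel)"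
    by (auto intro!: nn_integral_cong simp: indicator_def)
  also have "\<dots> = (\<integral>\<^sup>+x. ennreal ((1 - x) powr (- 1 / 2)) \<partial>unif01)"
    by (subst nn_integral_uniform_measure) (auto simp: divide_ennreal_def)
  finally have n: "(\<integral>\<^sup>+x. ennreal ((1 - x) powr (- 1 / 2)) \<partial>unif01) = ennreal 2" .
  show i: "integrable unif01 (\<lambda>\<theta>. (1 - \<theta>) powr (- 1 / 2))"
    by (rule integrableI_nonneg) (use n in auto)
  show "(\<integral>\<theta>. (1 - \<theta>) powr (- 1 / 2) \<partial>unif01) = 2"
  proof -
    have "ennreal (\<integral>\<theta>. (1 - \<theta>) powr (- 1 / 2) \<partial>unif01) = ennreal 2"
      by (subst nn_integral_eq_integral[OF i, symmetric]) (simp_all only: n, simp)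
    moreover have "0 \<le> (\<integral>\<theta>. (1 - \<theta>) powr (- 1 / 2) \<partial>unif01)" by (intro integral_nonneg_AE) auto
    ultimately show ?thesis by (subst (asm) ennreal_inj) auto
  qed
  have "AE \<theta> in lborel. \<theta> \<noteq> (1::real)" by (rule AE_lborel_singleton)
  then show "AE \<theta> in unif01. 0 < (1 - \<theta>) powr (- 1 / 2)"
    by (intro AE_uniform_measureI) (auto elim: eventually_mono)
qed

lemma nn_integral_powr_tail:
  assumes "0 < \<tau>" "0 < \<beta>"
  shows "(\<integral>\<^sup>+t. ennreal ((\<tau> + t) powr (- 1 - \<beta>)) * indicator {0..} t \<partial>lborel) = ennreal (\<tau> powr (- \<beta>) / \<beta>)"
proof -
  have "(\<integral>\<^sup>+t. ennreal ((\<tau> + t) powr (- 1 - \<beta>)) * indicator {0..} t \<partial>lborel) = ennreal (0 - (- ((\<tau> + 0) powr (- \<beta>) / \<beta>)))"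
  proof (rule nn_integral_FTC_atLeast)
    show "DERIV (\<lambda>t. - ((\<tau> + t) powr (- \<beta>) / \<beta>)) t :> (\<tau> + t) powr (- 1 - \<beta>)" if "0 \<le> t" for t
    proof -
      have "((\<lambda>t. (\<tau> + t) powr (- \<beta>)) has_real_derivative (- \<beta> * (\<tau> + t) powr (- \<beta> - 1)) * 1) (at t)"
        by (rule DERIV_chain2[OF has_real_derivative_powr]) (use that assms in \<open>auto intro!: derivative_eq_intros\<close>)
      from DERIV_minus[OF DERIV_cdivide[OF this, of \<beta>]]
      have "DERIV (\<lambda>t. - ((\<tau> + t) powr (- \<beta>) / \<beta>)) t :> (\<tau> + t) powr (- \<beta> - 1)" using assms by simp
      moreover have "- \<beta> - 1 = - 1 - \<beta>" by simp
      ultimately show ?thesis by (simp only:)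
    qed
    show "((\<lambda>t. - ((\<tau> + t) powr (- \<beta>) / \<beta>)) \<longlongrightarrow> 0) at_top"
      using assms by real_asymp
  qed auto
  then show ?thesis by simp
qed

text \<open>The integral from \<open>x\<close> to the exit point is estimated by Hoelder's inequality with the weight
\<open>(1 - \<theta>) powr (- 1 / 2)\<close>. In terms of the point \<open>y = x - t \<nu>\<close> the remaining kernel is
\<open>\<tau> y powr \<beta> (\<tau> y + t) powr (- 1 - \<beta>)\<close>, because exit times decrease at unit speed. Translating \<open>x\<close> to \<open>y\<close> for fixed \<open>t\<close> and integrating over
\<open>t\<close> first gives the constant \<open>1 / \<beta>\<close>.\<close>

lemma line_hardy:
  fixes \<Omega> :: "'a::euclidean_space set" and g :: "'a \<Rightarrow> real"
  assumes \<Omega>: "open \<Omega>" "bounded \<Omega>" and \<nu>: "\<nu> \<noteq> 0" and q: "1 < q"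
    and [measurable]: "g \<in> borel_measurable borel" and g: "\<And>y. 0 \<le> g y" "\<And>y. g y \<le> b"
  shows "(\<integral>\<^sup>+x. ennreal ((\<integral>\<theta>. g (x - (exit_time \<Omega> x \<nu> * \<theta>) *\<^sub>R \<nu>) \<partial>unif01) powr q) * indicator \<Omega> x \<partial>lborel)
    \<le> ennreal (2 powr q / (q - 1)) * (\<integral>\<^sup>+y. ennreal (g y powr q) \<partial>lborel)"
proof -
  define \<beta> where "\<beta> = (q - 1) / 2"
  have \<beta>: "0 < \<beta>" using q by (simp add: \<beta>_def)
  define \<tau> where "\<tau> x = exit_time \<Omega> x \<nu>" for x
  have \<tau>m [measurable]: "\<tau> \<in> borel_measurable borel" unfolding \<tau>_def by (intro exit_time_measurable \<Omega>) auto
  have \<tau>0: "0 \<le> \<tau> x" for x unfolding \<tau>_def by (rule exit_time_nonneg(1)[OF \<Omega>(2)])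
  have \<tau>pos: "0 < \<tau> x" if "x \<in> \<Omega>" for x unfolding \<tau>_def by (rule exit_time_pos[OF \<Omega> \<nu> that])
  have [measurable]: "\<Omega> \<in> sets borel" using \<Omega>(1) by simp
  have b0: "0 \<le> b" using g order_trans by blast
  \<comment> \<open>The exponent \<open>\<beta>\<close> is what remains of \<open>q - 1\<close> after the weight has been split off.\<close>
  define k where "k x t = ennreal (g (x - t *\<^sub>R \<nu>) powr q) * (ennreal (\<tau> (x - t *\<^sub>R \<nu>) powr \<beta>) * ennreal (\<tau> x powr (- 1 - \<beta>)))" for x t
  have [measurable]: "(\<lambda>(x, t). k x t) \<in> borel_measurable (borel \<Otimes>\<^sub>M borel)" unfolding k_def by measurable
  have pw: "ennreal ((\<integral>\<theta>. g (x - (\<tau> x * \<theta>) *\<^sub>R \<nu>) \<partial>unif01) powr q) \<le>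
      ennreal (2 powr (q - 1)) * (\<integral>\<^sup>+t. k x t * indicator {0..<\<tau> x} t \<partial>lborel)" if x: "x \<in> \<Omega>" for x
  proof -
    have \<tau>x: "0 < \<tau> x" using \<tau>pos[OF x] .
    let ?f = "\<lambda>\<theta>. g (x - (\<tau> x * \<theta>) *\<^sub>R \<nu>)" and ?w = "\<lambda>\<theta>. (1 - \<theta>) powr (- 1 / 2)"
    have fw: "?f \<theta> powr q * ?w \<theta> powr (1 - q) = ?f \<theta> powr q * (1 - \<theta>) powr \<beta>" for \<theta> :: real
    proof -
      have e: "- 1 / 2 * (1 - q) = \<beta>" by (simp add: \<beta>_def field_simps)
      show ?thesis unfolding powr_powr e by (rule refl)
    qed
    have ifw: "integrable unif01 (\<lambda>\<theta>. ?f \<theta> powr q * (1 - \<theta>) powr \<beta>)"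
    proof (rule integrable_of_bounded[OF emeasure_unif01, of _ "b powr q"])
      show "AE \<theta> in unif01. ?f \<theta> powr q * (1 - \<theta>) powr \<beta> \<le> b powr q"
        using AE_unif01
      proof eventually_elim
        case (elim \<theta>)
        have "?f \<theta> powr q * (1 - \<theta>) powr \<beta> \<le> b powr q * 1"
          using elim g q \<beta> by (intro mult_mono powr_mono2 powr_le1) auto
        then show ?case by simp
      qed
    qed auto
    have "(\<integral>\<theta>. ?f \<theta> \<partial>unif01) powr q \<le> (\<integral>\<theta>. ?w \<theta> \<partial>unif01) powr (q - 1) * (\<integral>\<theta>. ?f \<theta> powr q * ?w \<theta> powr (1 - q) \<partial>unif01)"
    proof (rule integral_powr_le_weighted)
      show "integrable unif01 ?f" by (rule integrable_of_bounded[OF emeasure_unif01, of _ b]) (use g in auto)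
      show "integrable unif01 (\<lambda>\<theta>. ?f \<theta> powr q * ?w \<theta> powr (1 - q))" unfolding fw by (rule ifw)
    qed (use q g inverse_sqrt_weight in auto)
    then have "ennreal ((\<integral>\<theta>. ?f \<theta> \<partial>unif01) powr q) \<le> ennreal (2 powr (q - 1) * (\<integral>\<theta>. ?f \<theta> powr q * (1 - \<theta>) powr \<beta> \<partial>unif01))"
      unfolding inverse_sqrt_weight(2) fw by (rule ennreal_leI)
    also have "\<dots> = ennreal (2 powr (q - 1)) * (\<integral>\<^sup>+\<theta>. ennreal (?f \<theta> powr q * (1 - \<theta>) powr \<beta>) \<partial>unif01)"
      by (subst nn_integral_eq_integral[OF ifw]) (auto simp: ennreal_mult')
    also have "(\<integral>\<^sup>+\<theta>. ennreal (?f \<theta> powr q * (1 - \<theta>) powr \<beta>) \<partial>unif01) =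
        (\<integral>\<^sup>+\<theta>. ennreal (\<tau> x) * (k x (\<tau> x * \<theta>) * indicator {0..<\<tau> x} (\<tau> x * \<theta>)) \<partial>unif01)"
    proof (rule nn_integral_cong_AE)
      show "AE \<theta> in unif01. ennreal (?f \<theta> powr q * (1 - \<theta>) powr \<beta>) =
           ennreal (\<tau> x) * (k x (\<tau> x * \<theta>) * indicator {0..<\<tau> x} (\<tau> x * \<theta>))"
        using AE_unif01 inverse_sqrt_weight(3)
      proof eventually_elim
        case (elim \<theta>)
        then have \<theta>: "0 < \<theta>" "\<theta> < 1" by (auto simp: less_le)
        then have lt: "\<tau> x * \<theta> < \<tau> x" "0 \<le> \<tau> x * \<theta>" using \<tau>x by auto
        have "\<tau> (x - (\<tau> x * \<theta>) *\<^sub>R \<nu>) = \<tau> x - \<tau> x * \<theta>"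
          unfolding \<tau>_def by (rule exit_time_shift[OF \<Omega> \<nu>]) (use lt in \<open>auto simp: \<tau>_def\<close>)
        also have "\<dots> = \<tau> x * (1 - \<theta>)" by (simp add: algebra_simps)
        finally have "\<tau> (x - (\<tau> x * \<theta>) *\<^sub>R \<nu>) powr \<beta> = \<tau> x powr \<beta> * (1 - \<theta>) powr \<beta>"
          using \<theta> \<tau>x by (simp add: powr_mult)
        then have "\<tau> x * (\<tau> (x - (\<tau> x * \<theta>) *\<^sub>R \<nu>) powr \<beta> * \<tau> x powr (- 1 - \<beta>)) =
            (1 - \<theta>) powr \<beta> * (\<tau> x powr 1 * (\<tau> x powr \<beta> * \<tau> x powr (- 1 - \<beta>)))" using \<tau>x by simp
        also have "\<tau> x powr 1 * (\<tau> x powr \<beta> * \<tau> x powr (- 1 - \<beta>)) = 1"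
          unfolding powr_add[symmetric] using \<tau>x by simp
        finally have "\<tau> x * (\<tau> (x - (\<tau> x * \<theta>) *\<^sub>R \<nu>) powr \<beta> * \<tau> x powr (- 1 - \<beta>)) = (1 - \<theta>) powr \<beta>" by simp
        then show ?case using lt \<tau>x unfolding k_def
          by (simp add: ennreal_mult'[symmetric] mult.left_commute[of "\<tau> x"])
      qed
    qed
    also have "\<dots> = ennreal (\<tau> x) * (\<integral>\<^sup>+\<theta>. k x (\<tau> x * \<theta>) * indicator {0..<\<tau> x} (\<tau> x * \<theta>) \<partial>unif01)"
      by (rule nn_integral_cmult) measurable
    also have "\<dots> = (\<integral>\<^sup>+t. k x t * indicator {0..<\<tau> x} t * indicator {0..\<tau> x} t \<partial>lborel)"
      by (rule nn_integral_unif01_scale[where H="\<lambda>t. k x t * indicator {0..<\<tau> x} t"]) (use \<tau>x in measurable)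
    also have "\<dots> = (\<integral>\<^sup>+t. k x t * indicator {0..<\<tau> x} t \<partial>lborel)"
      by (intro nn_integral_cong) (auto simp: indicator_def)
    finally show ?thesis .
  qed
  \<comment> \<open>The kernel after the substitution \<open>y = x - t \<nu>\<close>.\<close>
  define j where "j y t = ennreal (g y powr q) * (ennreal (\<tau> y powr \<beta>) * (ennreal ((\<tau> y + t) powr (- 1 - \<beta>)) * indicator {0..} t * indicator \<Omega> y))" for y and t :: real
  have [measurable]: "(\<lambda>(y, t). j y t) \<in> borel_measurable (borel \<Otimes>\<^sub>M borel)" unfolding j_def by measurable
  have kj: "k x t * indicator {0..<\<tau> x} t * indicator \<Omega> x \<le> j (x - t *\<^sub>R \<nu>) t" for x t
  proof (cases "x \<in> \<Omega> \<and> t \<in> {0..<\<tau> x}")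
    case True
    then have "\<tau> (x - t *\<^sub>R \<nu>) = \<tau> x - t" "x - t *\<^sub>R \<nu> \<in> \<Omega>"
      unfolding \<tau>_def by (auto intro: exit_time_shift[OF \<Omega> \<nu>] before_exit_time)
    then show ?thesis using True unfolding k_def j_def by simp
  qed auto
  have "(\<integral>\<^sup>+x. ennreal ((\<integral>\<theta>. g (x - (\<tau> x * \<theta>) *\<^sub>R \<nu>) \<partial>unif01) powr q) * indicator \<Omega> x \<partial>lborel) \<le>
      (\<integral>\<^sup>+x. ennreal (2 powr (q - 1)) * (\<integral>\<^sup>+t. k x t * indicator {0..<\<tau> x} t * indicator \<Omega> x \<partial>lborel) \<partial>lborel)"
    by (intro nn_integral_mono) (use pw in \<open>auto simp: indicator_def\<close>)
  also have "\<dots> \<le> (\<integral>\<^sup>+x. ennreal (2 powr (q - 1)) * (\<integral>\<^sup>+t. j (x - t *\<^sub>R \<nu>) t \<partial>lborel) \<partial>lborel)"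
    by (intro nn_integral_mono mult_left_mono kj) auto
  also have "\<dots> = ennreal (2 powr (q - 1)) * (\<integral>\<^sup>+x. (\<integral>\<^sup>+t. j (x - t *\<^sub>R \<nu>) t \<partial>lborel) \<partial>lborel)"
    by (rule nn_integral_cmult) measurable
  also have "(\<integral>\<^sup>+x. (\<integral>\<^sup>+t. j (x - t *\<^sub>R \<nu>) t \<partial>lborel) \<partial>lborel) = (\<integral>\<^sup>+t. (\<integral>\<^sup>+x. j (x - t *\<^sub>R \<nu>) t \<partial>lborel) \<partial>lborel)"
    by (rule lborel_pair.Fubini'[symmetric]) measurable
  also have "\<dots> = (\<integral>\<^sup>+t. (\<integral>\<^sup>+y. j y t \<partial>lborel) \<partial>lborel)"
    by (intro nn_integral_cong nn_integral_translate[where F="\<lambda>y. j y _"]) measurable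
  also have "\<dots> = (\<integral>\<^sup>+y. (\<integral>\<^sup>+t. j y t \<partial>lborel) \<partial>lborel)"
    by (rule lborel_pair.Fubini') measurable
  also have "\<dots> \<le> (\<integral>\<^sup>+y. ennreal (1 / \<beta>) * ennreal (g y powr q) \<partial>lborel)"
  proof (rule nn_integral_mono)
    fix y
    show "(\<integral>\<^sup>+t. j y t \<partial>lborel) \<le> ennreal (1 / \<beta>) * ennreal (g y powr q)"
    proof (cases "y \<in> \<Omega>")
      case True
      have "(\<integral>\<^sup>+t. j y t \<partial>lborel) = ennreal (g y powr q) * (ennreal (\<tau> y powr \<beta>) * (\<integral>\<^sup>+t. ennreal ((\<tau> y + t) powr (- 1 - \<beta>)) * indicator {0..} t \<partial>lborel))"
        using True unfolding j_def by (simp add: nn_integral_cmult)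
      also have "\<dots> = ennreal (g y powr q) * (ennreal (\<tau> y powr \<beta>) * ennreal (\<tau> y powr (- \<beta>) / \<beta>))"
        by (simp only: nn_integral_powr_tail[OF \<tau>pos[OF True] \<beta>])
      also have "ennreal (\<tau> y powr \<beta>) * ennreal (\<tau> y powr (- \<beta>) / \<beta>) = ennreal (1 / \<beta>)"
        using \<tau>pos[OF True] \<beta> by (simp add: ennreal_mult'[symmetric] powr_minus field_simps)
      finally show ?thesis by (simp add: mult.commute)
    qed (simp add: j_def)
  qed
  also have "\<dots> = ennreal (1 / \<beta>) * (\<integral>\<^sup>+y. ennreal (g y powr q) \<partial>lborel)"
    by (rule nn_integral_cmult) measurable
  finally have "(\<integral>\<^sup>+x. ennreal ((\<integral>\<theta>. g (x - (\<tau> x * \<theta>) *\<^sub>R \<nu>) \<partial>unif01) powr q) * indicator \<Omega> x \<partial>lborel) \<le>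
     ennreal (2 powr (q - 1)) * (ennreal (1 / \<beta>) * (\<integral>\<^sup>+y. ennreal (g y powr q) \<partial>lborel))"
    by (simp add: mult_left_mono)
  also have "\<dots> = ennreal (2 powr (q - 1) * (1 / \<beta>)) * (\<integral>\<^sup>+y. ennreal (g y powr q) \<partial>lborel)"
    using \<beta> by (subst ennreal_mult') (auto simp: mult.assoc)
  also have "2 powr (q - 1) * (1 / \<beta>) = 2 powr q / (q - 1)"
    using q by (simp add: \<beta>_def powr_diff)
  finally show ?thesis by (simp add: \<tau>_def)
qed

section \<open>Hardy's inequality with a variable exponent\<close>

lemma integral_unif01_rescale:
  fixes h :: "real \<Rightarrow> real"
  assumes [measurable]: "h \<in> borel_measurable borel" and h: "\<And>t. 0 \<le> h t" "\<And>t. h t \<le> b" and \<tau>: "0 < \<tau>" "\<tau> \<le> D"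
  shows "D * (\<integral>\<theta>. h (D * \<theta>) * of_bool (D * \<theta> < \<tau>) \<partial>unif01) = \<tau> * (\<integral>\<theta>. h (\<tau> * \<theta>) \<partial>unif01)"
proof -
  have D: "0 < D" using \<tau> by simp
  have b0: "0 \<le> b" using h order_trans by blast
  have 1: "ennreal (D * (\<integral>\<theta>. h (D * \<theta>) * of_bool (D * \<theta> < \<tau>) \<partial>unif01)) =
      (\<integral>\<^sup>+t. ennreal (h t * of_bool (t < \<tau>)) * indicator {0..D} t \<partial>lborel)"
  proof -
    have "integrable unif01 (\<lambda>\<theta>. h (D * \<theta>) * of_bool (D * \<theta> < \<tau>))"
      by (rule integrable_of_bounded[OF emeasure_unif01, of _ b]) (use h b0 in auto)
    then have "ennreal (\<integral>\<theta>. h (D * \<theta>) * of_bool (D * \<theta> < \<tau>) \<partial>unif01) = (\<integral>\<^sup>+\<theta>. ennreal (h (D * \<theta>) * of_bool (D * \<theta> < \<tau>)) \<partial>unif01)"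
      by (intro nn_integral_eq_integral[symmetric]) (use h in auto)
    then show ?thesis
      using D by (subst ennreal_mult') (auto simp: nn_integral_unif01_scale[where H="\<lambda>t. ennreal (h t * of_bool (t < \<tau>))"])
  qed
  have 2: "ennreal (\<tau> * (\<integral>\<theta>. h (\<tau> * \<theta>) \<partial>unif01)) = (\<integral>\<^sup>+t. ennreal (h t) * indicator {0..\<tau>} t \<partial>lborel)"
  proof -
    have "integrable unif01 (\<lambda>\<theta>. h (\<tau> * \<theta>))"
      by (rule integrable_of_bounded[OF emeasure_unif01, of _ b]) (use h in auto)
    then have "ennreal (\<integral>\<theta>. h (\<tau> * \<theta>) \<partial>unif01) = (\<integral>\<^sup>+\<theta>. ennreal (h (\<tau> * \<theta>)) \<partial>unif01)"
      by (intro nn_integral_eq_integral[symmetric]) (use h in auto)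
    then show ?thesis
      using \<tau> by (subst ennreal_mult') (auto simp: nn_integral_unif01_scale[where H="\<lambda>t. ennreal (h t)"])
  qed
  have "(\<integral>\<^sup>+t. ennreal (h t * of_bool (t < \<tau>)) * indicator {0..D} t \<partial>lborel) = (\<integral>\<^sup>+t. ennreal (h t) * indicator {0..\<tau>} t \<partial>lborel)"
  proof (rule nn_integral_cong_AE)
    have "AE t in lborel. t \<noteq> \<tau>" by (rule AE_lborel_singleton)
    then show "AE t in lborel. ennreal (h t * of_bool (t < \<tau>)) * indicator {0..D} t = ennreal (h t) * indicator {0..\<tau>} t"
      by eventually_elim (use \<tau> in \<open>auto simp: indicator_def\<close>)
  qed
  with 1 2 have e: "ennreal (D * (\<integral>\<theta>. h (D * \<theta>) * of_bool (D * \<theta> < \<tau>) \<partial>unif01)) = ennreal (\<tau> * (\<integral>\<theta>. h (\<tau> * \<theta>) \<partial>unif01))" by simp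
  have "0 \<le> D * (\<integral>\<theta>. h (D * \<theta>) * of_bool (D * \<theta> < \<tau>) \<partial>unif01)" "0 \<le> \<tau> * (\<integral>\<theta>. h (\<tau> * \<theta>) \<partial>unif01)"
    using D \<tau> h by (auto intro!: mult_nonneg_nonneg integral_nonneg_AE)
  with e show ?thesis by (subst (asm) ennreal_inj) auto
qed

lemma bdist_pos:
  assumes "open \<Omega>" "frontier \<Omega> \<noteq> {}" "x \<in> \<Omega>" shows "0 < bdist \<Omega> x"
proof -
  have "x \<notin> frontier \<Omega>" using assms by (simp add: frontier_def interior_open)
  then have "infdist x (frontier \<Omega>) \<noteq> 0"
    using assms(2) in_closed_iff_infdist_zero[of "frontier \<Omega>" x] by simp
  then show ?thesis unfolding bdist_def using infdist_nonneg[of x "frontier \<Omega>"] by linarith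
qed

context log_exponent begin

text \<open>On \<open>W\<close> every direction in a ball leads out of \<open>\<Omega>\<close> within the distance \<open>D = K d\<close>. So \<open>\<phi> x\<close> is at most the integral over \<open>0 < t < D\<close>
of the average over these directions of the gradient at \<open>x - t \<nu>\<close>, cut off at the exit. The averaging estimate is applied for each \<open>t\<close>
with the exponent \<open>p / q\<close>, and Hardy's inequality on lines, with the exponent \<open>q\<close>, for each direction. The assumption \<open>1 < q\<close>
is essential: on lines Hardy's inequality fails for the exponent one.\<close>

lemma local_hardy:
  assumes q: "1 < q" "\<And>x. x \<in> \<Omega> \<Longrightarrow> q \<le> p x" "q \<le> P" and M: "0 \<le> M"
    and e: "norm e = 1" and \<kappa>: "0 < \<kappa>" "\<kappa> \<le> 1 / 2" and K: "1 \<le> K" and fr: "frontier \<Omega> \<noteq> {}"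
  obtains CH where "0 \<le> CH" "\<And>\<phi> W. \<lbrakk>\<phi> \<in> test_functions \<Omega>; modular \<Omega> p (grad \<phi>) \<le> ennreal M; W \<in> sets borel; W \<subseteq> \<Omega>;
      \<And>x \<nu>. x \<in> W \<Longrightarrow> \<nu> \<in> ball e \<kappa> \<Longrightarrow> exit_time \<Omega> x \<nu> \<le> K * bdist \<Omega> x\<rbrakk> \<Longrightarrow>
     (\<integral>\<^sup>+x. ennreal (\<bar>\<phi> x / bdist \<Omega> x\<bar> powr pb x) * indicator W x \<partial>lborel) \<le> ennreal CH"
proof -
  \<comment> \<open>Division by \<open>q\<close> only decreases oscillations, so the same constant \<open>C\<close> serves.\<close>
  interpret Q: log_exponent \<Omega> "\<lambda>x. p x / q" "P / q" C
  proof
    fix x y assume xy: "x \<in> \<Omega>" "y \<in> \<Omega>" "x \<noteq> y"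
    have "\<bar>p x / q - p y / q\<bar> = \<bar>p x - p y\<bar> / q" using q by (simp add: diff_divide_distrib[symmetric])
    also have "\<dots> \<le> \<bar>p x - p y\<bar> / 1" using q by (intro divide_left_mono) auto
    also have "\<dots> \<le> C / ln (exp 1 + 1 / dist x y)" using log_h[OF xy] by simp
    finally show "\<bar>p x / q - p y / q\<bar> \<le> C / ln (exp 1 + 1 / dist x y)" .
  qed (use q p_le C open_\<Omega> bounded_\<Omega> in \<open>auto simp: divide_right_mono\<close>)
  have Qpb: "Q.pb x = pb x / q" for x by (simp add: Q.pb_def pb_def)
  let ?U = "unif e \<kappa>"
  interpret U: finite_measure ?U by (rule finite_measure_unif[OF \<kappa>(1)])
  interpret T: finite_measure unif01 by (rule finite_measure_unif01)
  have U1: "emeasure ?U (space ?U) = 1" by (rule emeasure_unif[OF \<kappa>(1)])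
  have \<nu>ball: "norm \<nu> \<le> 2" "\<nu> \<noteq> 0" if "\<nu> \<in> ball e \<kappa>" for \<nu>
  proof -
    have "dist e \<nu> < 1" using that \<kappa> by simp
    then have "norm (\<nu> - e) < 1" by (simp add: dist_norm norm_minus_commute)
    then show "norm \<nu> \<le> 2" using norm_triangle_ineq2[of \<nu> e] e by simp
    show "\<nu> \<noteq> 0" using \<open>norm (\<nu> - e) < 1\<close> e by auto
  qed
  obtain C0 where C0: "1 \<le> C0" and avg: "\<And>f b G x t. \<lbrakk>f \<in> borel_measurable borel; \<And>y. 0 \<le> f y; \<And>y. f y \<le> b; \<And>y. y \<notin> \<Omega> \<Longrightarrow> f y = 0;
       (\<integral>\<^sup>+y. ennreal (f y powr Q.pb y) \<partial>lborel) \<le> ennreal (vol + M); 0 < t; G \<in> borel_measurable borel;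
       \<And>\<nu>. 0 \<le> G \<nu>; \<And>\<nu>. G \<nu> \<le> f (x - t *\<^sub>R \<nu>); x \<in> \<Omega>\<rbrakk> \<Longrightarrow>
      (\<integral>\<nu>. G \<nu> \<partial>?U) powr (p x / q) \<le> C0 * (1 + (\<integral>\<nu>. G \<nu> powr Q.pb (x - t *\<^sub>R \<nu>) \<partial>?U))"
    by (rule Q.avg_powr_bound[of \<kappa> e 2 "vol + M"]) (use M vol \<kappa> e in \<open>simp_all, blast\<close>)
  define C2 where "C2 = (2 * K) powr P * (C0 powr q * 2 powr q)"
  have C2: "0 \<le> C2" by (simp add: C2_def)
  define T where "T z = exit_time \<Omega> (fst z) (snd z)" for z
  have [measurable]: "T \<in> borel_measurable (borel \<Otimes>\<^sub>M borel)"
    unfolding T_def borel_prod by (rule exit_time_measurable_pair[OF open_\<Omega> bounded_\<Omega>])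
  have [measurable]: "\<Omega> \<in> sets borel" using open_\<Omega> by simp
  show ?thesis
  proof (rule that[of "C2 * (vol + 2 powr q / (q - 1) * M)"])
    show "0 \<le> C2 * (vol + 2 powr q / (q - 1) * M)" using C2 vol M q by simp
    fix \<phi> :: "'a \<Rightarrow> real" and W
    assume \<phi>: "\<phi> \<in> test_functions \<Omega>" and gM: "modular \<Omega> p (grad \<phi>) \<le> ennreal M"
      and W: "W \<in> sets borel" "W \<subseteq> \<Omega>" and ex: "\<And>x \<nu>. x \<in> W \<Longrightarrow> \<nu> \<in> ball e \<kappa> \<Longrightarrow> exit_time \<Omega> x \<nu> \<le> K * bdist \<Omega> x"
    note [measurable] = W(1)
    have [measurable]: "\<phi> \<in> borel_measurable borel" "grad \<phi> \<in> borel_measurable borel"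
      using continuous_on_test_function[OF \<phi>] continuous_on_grad[OF \<phi>] by (auto intro: borel_measurable_continuous_onI)
    obtain B where B: "B > 0" "\<And>x. norm (grad \<phi> x) \<le> B" using test_function_bounded[OF \<phi>] by metis
    define f where "f y = norm (grad \<phi> y)" for y
    have [measurable]: "f \<in> borel_measurable borel" unfolding f_def by measurable
    have f: "0 \<le> f y" "f y \<le> B" "y \<notin> \<Omega> \<Longrightarrow> f y = 0" for y using B test_function_outside[OF \<phi>] by (auto simp: f_def)
    define F where "F y = f y powr Q.pb y" for y
    have [measurable]: "F \<in> borel_measurable borel" unfolding F_def by measurable
    define b where "b = (max 1 B) powr (P / q)"
    have F: "0 \<le> F y" "F y \<le> b" for y
    proof -
      have "F y \<le> (max 1 B) powr Q.pb y" unfolding F_def using f Q.pb_bounds[of y] by (intro powr_mono2) (auto simp: le_max_iff_disj)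
      also have "\<dots> \<le> b" unfolding b_def using Q.pb_bounds by (intro powr_mono) auto
      finally show "F y \<le> b" .
    qed (simp add: F_def)
    have gm: "modular \<Omega> p (grad \<phi>) = (\<integral>\<^sup>+y. ennreal (f y powr pb y) \<partial>lborel)"
      unfolding f_def by (rule modular_eq_lborel) (auto simp: test_function_outside[OF \<phi>])
    have Fq: "F y powr q = f y powr pb y" for y using q by (simp add: F_def powr_powr Qpb)
    have FM: "(\<integral>\<^sup>+y. ennreal (f y powr Q.pb y) \<partial>lborel) \<le> ennreal (vol + M)"
    proof -
      have "(\<integral>\<^sup>+y. ennreal (f y powr Q.pb y) \<partial>lborel) \<le> (\<integral>\<^sup>+y. indicator \<Omega> y + ennreal (f y powr pb y) \<partial>lborel)"
      proof (rule nn_integral_mono)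
        fix y
        have "Q.pb y \<le> pb y" using q pb_bounds(1)[of y] by (simp add: Qpb field_simps)
        then show "ennreal (f y powr Q.pb y) \<le> indicator \<Omega> y + ennreal (f y powr pb y)"
          using le_one_plus_powr[OF f(1) Q.pb_bounds(1), of y "pb y"] f(3)[of y]
          by (cases "y \<in> \<Omega>") (auto simp: ennreal_plus[symmetric] ennreal_1[symmetric] simp del: ennreal_plus ennreal_1)
      qed
      also have "\<dots> = emeasure lborel \<Omega> + modular \<Omega> p (grad \<phi>)" unfolding gm by (subst nn_integral_add) auto
      also have "\<dots> \<le> ennreal (vol + M)" using gM vol M by (simp add: ennreal_plus add_left_mono)
      finally show ?thesis .
    qed
    define a where "a x \<nu> = (\<integral>\<theta>. F (x - (T (x, \<nu>) * \<theta>) *\<^sub>R \<nu>) \<partial>unif01)" for x \<nu>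
    have [measurable]: "(\<lambda>(x, \<nu>). a x \<nu>) \<in> borel_measurable (borel \<Otimes>\<^sub>M borel)" unfolding a_def by measurable
    have a: "0 \<le> a x \<nu>" "a x \<nu> \<le> b" for x \<nu>
      unfolding a_def using F by (auto intro!: integral_nonneg_AE integral_le_bound[OF emeasure_unif01])
    have pw: "\<bar>\<phi> x / bdist \<Omega> x\<bar> powr p x \<le> C2 * (1 + (\<integral>\<nu>. a x \<nu> powr q \<partial>?U))" if xW: "x \<in> W" for x
    proof -
      have x: "x \<in> \<Omega>" using xW W by auto
      define d where "d = bdist \<Omega> x"
      have d: "0 < d" unfolding d_def by (rule bdist_pos[OF open_\<Omega> fr x])
      define D where "D = K * d"
      have D: "0 < D" using d K by (simp add: D_def)
      have px: "1 \<le> p x / q" "1 \<le> p x" "p x \<le> P" using q x p_ge p_le by auto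
      define \<tau> where "\<tau> \<nu> = T (x, \<nu>)" for \<nu>
      have [measurable]: "\<tau> \<in> borel_measurable borel" unfolding \<tau>_def by measurable
      have \<tau>: "0 < \<tau> \<nu>" "\<tau> \<nu> \<le> D" if "\<nu> \<in> ball e \<kappa>" for \<nu>
        using exit_time_pos[OF open_\<Omega> bounded_\<Omega> \<nu>ball(2)[OF that] x] ex[OF xW that]
        by (auto simp: \<tau>_def T_def D_def d_def)
      \<comment> \<open>\<open>\<theta>\<close> is the fraction of the length \<open>D\<close>, the same for all directions; \<open>ch\<close> cuts off at the exit.\<close>
      define ch :: "real \<Rightarrow> 'a \<Rightarrow> real" where "ch \<theta> \<nu> = of_bool (D * \<theta> < \<tau> \<nu>)" for \<theta> \<nu>
      have [measurable]: "(\<lambda>(\<theta>, \<nu>). ch \<theta> \<nu>) \<in> borel_measurable (borel \<Otimes>\<^sub>M borel)" unfolding ch_def by measurable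
      have ch: "0 \<le> ch \<theta> \<nu>" "ch \<theta> \<nu> \<le> 1" for \<theta> \<nu> by (auto simp: ch_def)
      define G where "G \<theta> \<nu> = f (x - (D * \<theta>) *\<^sub>R \<nu>) * ch \<theta> \<nu>" for \<theta> \<nu>
      have [measurable]: "(\<lambda>(\<theta>, \<nu>). G \<theta> \<nu>) \<in> borel_measurable (borel \<Otimes>\<^sub>M borel)" unfolding G_def by measurable
      have Gle: "0 \<le> G \<theta> \<nu>" "G \<theta> \<nu> \<le> f (x - (D * \<theta>) *\<^sub>R \<nu>)" for \<theta> \<nu>
        using f ch[of \<theta> \<nu>] by (auto simp: G_def mult_left_le)
      have GB: "G \<theta> \<nu> \<le> B" for \<theta> \<nu> using Gle f order_trans by metis
      define G' where "G' \<theta> \<nu> = F (x - (D * \<theta>) *\<^sub>R \<nu>) * ch \<theta> \<nu>" for \<theta> \<nu>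
      have [measurable]: "(\<lambda>(\<theta>, \<nu>). G' \<theta> \<nu>) \<in> borel_measurable (borel \<Otimes>\<^sub>M borel)" unfolding G'_def by measurable
      have G'le: "0 \<le> G' \<theta> \<nu>" "G' \<theta> \<nu> \<le> b" for \<theta> \<nu>
      proof -
        have "G' \<theta> \<nu> \<le> F (x - (D * \<theta>) *\<^sub>R \<nu>)" using F ch[of \<theta> \<nu>] by (auto simp: G'_def mult_left_le)
        then show "G' \<theta> \<nu> \<le> b" using F order_trans by metis
      qed (use F ch in \<open>simp add: G'_def\<close>)
      have GG': "G \<theta> \<nu> powr Q.pb (x - (D * \<theta>) *\<^sub>R \<nu>) = G' \<theta> \<nu>" for \<theta> \<nu> by (auto simp: G_def G'_def F_def ch_def)
      have b0: "b \<ge> 0" by (simp add: b_def)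
      \<comment> \<open>Integrate from the exit point, where \<open>\<phi>\<close> vanishes.\<close>
      have 1: "\<bar>\<phi> x\<bar> \<le> 2 * D * (\<integral>\<theta>. G \<theta> \<nu> \<partial>unif01)" if \<nu>: "\<nu> \<in> ball e \<kappa>" for \<nu>
      proof -
        have "x - \<tau> \<nu> *\<^sub>R \<nu> \<notin> \<Omega>" unfolding \<tau>_def T_def using at_exit_time[OF open_\<Omega> bounded_\<Omega> \<nu>ball(2)[OF \<nu>], of x] by simp
        then have "\<phi> (x - \<tau> \<nu> *\<^sub>R \<nu>) = 0" by (rule test_function_outside[OF \<phi>])
        then have "\<bar>\<phi> x\<bar> \<le> norm (\<tau> \<nu> *\<^sub>R \<nu>) * (\<integral>\<theta>. f (x - \<theta> *\<^sub>R (\<tau> \<nu> *\<^sub>R \<nu>)) \<partial>unif01)"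
          using test_function_increment_le[OF \<phi>, of x "\<tau> \<nu> *\<^sub>R \<nu>"] by (simp add: f_def)
        also have "\<dots> \<le> (2 * \<tau> \<nu>) * (\<integral>\<theta>. f (x - \<theta> *\<^sub>R (\<tau> \<nu> *\<^sub>R \<nu>)) \<partial>unif01)"
          using \<nu>ball(1)[OF \<nu>] \<tau>[OF \<nu>] f by (intro mult_right_mono) (auto intro!: integral_nonneg_AE)
        also have "\<dots> = 2 * (\<tau> \<nu> * (\<integral>\<theta>. f (x - (\<tau> \<nu> * \<theta>) *\<^sub>R \<nu>) \<partial>unif01))" by (simp add: mult.commute)
        also have "\<tau> \<nu> * (\<integral>\<theta>. f (x - (\<tau> \<nu> * \<theta>) *\<^sub>R \<nu>) \<partial>unif01) = D * (\<integral>\<theta>. G \<theta> \<nu> \<partial>unif01)"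
          unfolding G_def ch_def
          by (rule integral_unif01_rescale[symmetric, where h="\<lambda>t. f (x - t *\<^sub>R \<nu>)" and b=B]) (use f \<tau>[OF \<nu>] in auto)
        finally show ?thesis by simp
      qed
      define H where "H \<theta> = (\<integral>\<nu>. G \<theta> \<nu> \<partial>?U)" for \<theta>
      define k where "k \<theta> = (\<integral>\<nu>. G' \<theta> \<nu> \<partial>?U)" for \<theta>
      have [measurable]: "H \<in> borel_measurable borel" "k \<in> borel_measurable borel" unfolding H_def k_def by measurable
      have H: "0 \<le> H \<theta>" "H \<theta> \<le> B" for \<theta>
        unfolding H_def using Gle GB by (auto intro!: integral_nonneg_AE integral_le_bound[OF U1])
      have k: "0 \<le> k \<theta>" "k \<theta> \<le> b" for \<theta>
        unfolding k_def using G'le by (auto intro!: integral_nonneg_AE integral_le_bound[OF U1])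
      have ik: "integrable unif01 k" using k by (intro integrable_of_bounded[OF emeasure_unif01, of _ b]) auto
      have "\<bar>\<phi> x\<bar> = (\<integral>\<nu>. \<bar>\<phi> x\<bar> \<partial>?U)" using U1 by (simp add: measure_def)
      also have "\<dots> \<le> (\<integral>\<nu>. 2 * D * (\<integral>\<theta>. G \<theta> \<nu> \<partial>unif01) \<partial>?U)"
      proof (rule integral_mono_AE)
        have "integrable ?U (\<lambda>\<nu>. \<integral>\<theta>. G \<theta> \<nu> \<partial>unif01)"
          by (rule integrable_of_bounded[OF U1, of _ B])
             (use Gle GB in \<open>auto intro!: integral_nonneg_AE integral_le_bound[OF emeasure_unif01]\<close>)
        then show "integrable ?U (\<lambda>\<nu>. 2 * D * (\<integral>\<theta>. G \<theta> \<nu> \<partial>unif01))" by auto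
        show "AE \<nu> in ?U. \<bar>\<phi> x\<bar> \<le> 2 * D * (\<integral>\<theta>. G \<theta> \<nu> \<partial>unif01)" using AE_unif by eventually_elim (rule 1)
      qed auto
      also have "\<dots> = 2 * D * (\<integral>\<theta>. H \<theta> \<partial>unif01)"
        unfolding H_def by (subst fubini_bounded[OF emeasure_unif01 U1, of G B]) (use Gle GB in auto)
      finally have "\<bar>\<phi> x\<bar> / (2 * D) \<le> (\<integral>\<theta>. H \<theta> \<partial>unif01)" using D by (simp add: field_simps)
      then have "(\<bar>\<phi> x\<bar> / (2 * D)) powr (p x / q) \<le> (\<integral>\<theta>. H \<theta> \<partial>unif01) powr (p x / q)"
        using D px by (intro powr_mono2) auto
      also have "\<dots> \<le> (\<integral>\<theta>. H \<theta> powr (p x / q) \<partial>unif01)"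
        using H by (intro jensen_powr[OF emeasure_unif01 px(1), of _ B]) auto
      also have "\<dots> \<le> (\<integral>\<theta>. C0 * (1 + k \<theta>) \<partial>unif01)"
      proof (intro integral_mono_AE)
        show "integrable unif01 (\<lambda>\<theta>. H \<theta> powr (p x / q))"
          using H px by (intro integrable_of_bounded[OF emeasure_unif01, of _ "B powr (p x / q)"]) (auto intro!: powr_mono2)
        show "integrable unif01 (\<lambda>\<theta>. C0 * (1 + k \<theta>))" using ik by auto
        show "AE \<theta> in unif01. H \<theta> powr (p x / q) \<le> C0 * (1 + k \<theta>)"
          using AE_unif01
        proof eventually_elim
          case (elim \<theta>)
          have "H \<theta> powr (p x / q) \<le> C0 * (1 + (\<integral>\<nu>. G \<theta> \<nu> powr Q.pb (x - (D * \<theta>) *\<^sub>R \<nu>) \<partial>?U))"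
            unfolding H_def by (rule avg[of f B]) (use f FM Gle D x elim in auto)
          then show ?case by (simp add: GG' k_def)
        qed
      qed
      also have "\<dots> = C0 * (1 + (\<integral>\<theta>. k \<theta> \<partial>unif01))" using ik by (simp add: measure_def)
      also have "(\<integral>\<theta>. k \<theta> \<partial>unif01) = (\<integral>\<nu>. (\<integral>\<theta>. G' \<theta> \<nu> \<partial>unif01) \<partial>?U)"
        unfolding k_def by (rule fubini_bounded[OF emeasure_unif01 U1, of G' b]) (use G'le in auto)
      also have "C0 * (1 + (\<integral>\<nu>. (\<integral>\<theta>. G' \<theta> \<nu> \<partial>unif01) \<partial>?U)) \<le> C0 * (1 + (\<integral>\<nu>. a x \<nu> \<partial>?U))"
      proof (intro mult_left_mono add_left_mono integral_mono_AE)
        show "integrable ?U (\<lambda>\<nu>. \<integral>\<theta>. G' \<theta> \<nu> \<partial>unif01)"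
          by (rule integrable_of_bounded[OF U1, of _ b])
             (use G'le in \<open>auto intro!: integral_nonneg_AE integral_le_bound[OF emeasure_unif01]\<close>)
        show "integrable ?U (a x)" by (rule integrable_of_bounded[OF U1, of _ b]) (use a in auto)
        show "AE \<nu> in ?U. (\<integral>\<theta>. G' \<theta> \<nu> \<partial>unif01) \<le> a x \<nu>"
          using AE_unif
        proof eventually_elim
          case (elim \<nu>)
          have "D * (\<integral>\<theta>. G' \<theta> \<nu> \<partial>unif01) = \<tau> \<nu> * a x \<nu>"
            unfolding G'_def ch_def a_def \<tau>_def
            by (rule integral_unif01_rescale[where h="\<lambda>t. F (x - t *\<^sub>R \<nu>)" and b=b]) (use F \<tau>[OF elim] in \<open>auto simp: \<tau>_def\<close>)
          also have "\<dots> \<le> D * a x \<nu>" using \<tau>[OF elim] a by (intro mult_right_mono) auto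
          finally show ?case using D by simp
        qed
      qed (use C0 in auto)
      finally have 2: "(\<bar>\<phi> x\<bar> / (2 * D)) powr (p x / q) \<le> C0 * (1 + (\<integral>\<nu>. a x \<nu> \<partial>?U))" .
      define E where "E = (\<integral>\<nu>. a x \<nu> \<partial>?U)"
      have E: "0 \<le> E" unfolding E_def using a by (auto intro!: integral_nonneg_AE)
      have "(\<bar>\<phi> x\<bar> / (2 * D)) powr p x = ((\<bar>\<phi> x\<bar> / (2 * D)) powr (p x / q)) powr q"
        using q by (simp add: powr_powr)
      also have "\<dots> \<le> (C0 * (1 + E)) powr q" using 2 q E_def by (intro powr_mono2) auto
      also have "\<dots> = C0 powr q * (1 + E) powr q" by (simp add: powr_mult)
      also have "\<dots> \<le> C0 powr q * (2 powr q * (1 + E powr q))"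
        using norm_add_powr_le[of q q 1 E] q E by (intro mult_left_mono) auto
      also have "\<dots> \<le> C0 powr q * (2 powr q * (1 + (\<integral>\<nu>. a x \<nu> powr q \<partial>?U)))"
        unfolding E_def using a q by (intro mult_left_mono add_left_mono jensen_powr[OF U1, of _ _ b]) auto
      finally have 3: "(\<bar>\<phi> x\<bar> / (2 * D)) powr p x \<le> C0 powr q * (2 powr q * (1 + (\<integral>\<nu>. a x \<nu> powr q \<partial>?U)))" .
      have "\<bar>\<phi> x / bdist \<Omega> x\<bar> = 2 * K * (\<bar>\<phi> x\<bar> / (2 * D))" using d K by (simp add: D_def d_def[symmetric])
      then have "\<bar>\<phi> x / bdist \<Omega> x\<bar> powr p x = (2 * K) powr p x * (\<bar>\<phi> x\<bar> / (2 * D)) powr p x" by (simp only: powr_mult)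
      also have "\<dots> \<le> (2 * K) powr P * (C0 powr q * (2 powr q * (1 + (\<integral>\<nu>. a x \<nu> powr q \<partial>?U))))"
        using 3 K px by (intro mult_mono powr_mono) auto
      finally show ?thesis by (simp add: C2_def mult.assoc)
    qed
    define I where "I x = (\<integral>\<nu>. a x \<nu> powr q \<partial>?U)" for x
    have [measurable]: "I \<in> borel_measurable borel" unfolding I_def by measurable
    have I0: "0 \<le> I x" for x unfolding I_def by (auto intro!: integral_nonneg_AE)
    have In: "ennreal (I x) = (\<integral>\<^sup>+\<nu>. ennreal (a x \<nu> powr q) \<partial>?U)" for x
      unfolding I_def using a q by (intro nn_integral_eq_integral[symmetric] integrable_of_bounded[OF U1, of _ "b powr q"]) (auto intro!: powr_mono2)
    interpret LU: pair_sigma_finite lborel ?U ..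
    have "(\<integral>\<^sup>+x. ennreal (\<bar>\<phi> x / bdist \<Omega> x\<bar> powr pb x) * indicator W x \<partial>lborel) \<le>
        (\<integral>\<^sup>+x. ennreal C2 * (indicator \<Omega> x + ennreal (I x) * indicator \<Omega> x) \<partial>lborel)"
    proof (rule nn_integral_mono)
      fix x
      show "ennreal (\<bar>\<phi> x / bdist \<Omega> x\<bar> powr pb x) * indicator W x \<le> ennreal C2 * (indicator \<Omega> x + ennreal (I x) * indicator \<Omega> x)"
      proof (cases "x \<in> W")
        case True
        then have "x \<in> \<Omega>" using W by auto
        then show ?thesis using pw[OF True] True C2 I0[of x]
          by (simp add: I_def[symmetric] pb_def ennreal_1[symmetric] ennreal_plus[symmetric] ennreal_mult'[symmetric] del: ennreal_plus ennreal_1)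
      qed auto
    qed
    also have "\<dots> = ennreal C2 * (emeasure lborel \<Omega> + (\<integral>\<^sup>+x. ennreal (I x) * indicator \<Omega> x \<partial>lborel))"
      by (simp add: nn_integral_cmult nn_integral_add)
    also have "(\<integral>\<^sup>+x. ennreal (I x) * indicator \<Omega> x \<partial>lborel) \<le> ennreal (2 powr q / (q - 1) * M)"
    proof -
      have "(\<integral>\<^sup>+x. ennreal (I x) * indicator \<Omega> x \<partial>lborel) = (\<integral>\<^sup>+x. (\<integral>\<^sup>+\<nu>. ennreal (a x \<nu> powr q) * indicator \<Omega> x \<partial>?U) \<partial>lborel)"
        unfolding In by (intro nn_integral_cong nn_integral_multc[symmetric]) measurable
      also have "\<dots> = (\<integral>\<^sup>+\<nu>. (\<integral>\<^sup>+x. ennreal (a x \<nu> powr q) * indicator \<Omega> x \<partial>lborel) \<partial>?U)"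
        by (rule LU.Fubini'[symmetric]) measurable
      also have "\<dots> \<le> (\<integral>\<^sup>+(\<nu>::'a). ennreal (2 powr q / (q - 1) * M) \<partial>?U)"
      proof (rule nn_integral_mono_AE)
        show "AE \<nu> in ?U. (\<integral>\<^sup>+x. ennreal (a x \<nu> powr q) * indicator \<Omega> x \<partial>lborel) \<le> ennreal (2 powr q / (q - 1) * M)"
          using AE_unif
        proof eventually_elim
          case (elim \<nu>)
          have "(\<integral>\<^sup>+x. ennreal (a x \<nu> powr q) * indicator \<Omega> x \<partial>lborel) \<le> ennreal (2 powr q / (q - 1)) * (\<integral>\<^sup>+y. ennreal (F y powr q) \<partial>lborel)"
            unfolding a_def T_def fst_conv snd_conv
            by (rule line_hardy[OF open_\<Omega> bounded_\<Omega> \<nu>ball(2)[OF elim] q(1), where b=b]) (use F in auto)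
          also have "(\<integral>\<^sup>+y. ennreal (F y powr q) \<partial>lborel) \<le> ennreal M" using gM by (simp add: Fq gm)
          also have "ennreal (2 powr q / (q - 1)) * ennreal M = ennreal (2 powr q / (q - 1) * M)"
            using q M by (intro ennreal_mult'[symmetric]) auto
          finally show ?case by (simp add: mult_left_mono)
        qed
      qed
      also have "\<dots> = ennreal (2 powr q / (q - 1) * M)" using U1 by simp
      finally show ?thesis .
    qed
    finally show "(\<integral>\<^sup>+x. ennreal (\<bar>\<phi> x / bdist \<Omega> x\<bar> powr pb x) * indicator W x \<partial>lborel) \<le> ennreal (C2 * (vol + 2 powr q / (q - 1) * M))"
      using C2 vol q M by (simp add: mult_left_mono ennreal_plus[symmetric] ennreal_mult'[symmetric] del: ennreal_plus)
  qed
qed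

end

section \<open>Lipschitz domains\<close>

text \<open>Let \<open>F\<close> be the height above the graph in a chart. It is Lipschitz and at most zero at the nearest boundary point, so
\<open>F x \<le> (1 + L) d x\<close>. Along a direction \<open>- \<nu>\<close> with \<open>\<nu>\<close> close to \<open>e\<close> the height decreases at least at speed \<open>1 / 2\<close>, so it is gone at
time \<open>2 (1 + L) d x\<close>.\<close>

lemma lipschitz_exit_time:
  fixes \<Omega> :: "'a::euclidean_space set"
  assumes dom: "bounded_lipschitz_domain \<Omega>" and z: "z \<in> frontier \<Omega>"
  obtains \<rho> e \<kappa> K where "0 < \<rho>" "norm e = 1" "0 < \<kappa>" "\<kappa> \<le> 1 / 2" "1 \<le> K"
    "\<And>x \<nu>. x \<in> \<Omega> \<Longrightarrow> x \<in> ball z \<rho> \<Longrightarrow> \<nu> \<in> ball e \<kappa> \<Longrightarrow> exit_time \<Omega> x \<nu> \<le> K * bdist \<Omega> x"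
proof -
  have \<Omega>: "open \<Omega>" using dom by (simp add: bounded_lipschitz_domain_def)
  obtain e :: 'a and U and f :: "'a \<Rightarrow> real" and L where e: "norm e = 1" and U: "open U" "z \<in> U"
    and f: "L-lipschitz_on {y. y \<bullet> e = 0} f" and chart: "\<Omega> \<inter> U = {x \<in> U. f (x - (x \<bullet> e) *\<^sub>R e) < x \<bullet> e}"
    using dom[unfolded bounded_lipschitz_domain_def lipschitz_boundary_def] z by blast
  have L: "0 \<le> L" using f by (rule lipschitz_on_nonneg)
  obtain R where R: "0 < R" "ball z R \<subseteq> U" using U openE by metis
  \<comment> \<open>The speed of descent is at least \<open>1 - (1 + L) \<kappa> = 1 / 2\<close>, and the radius \<open>\<rho>\<close> keeps the nearest boundary point and
the segment up to time \<open>K d\<close> inside the chart.\<close>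
  define \<kappa> where "\<kappa> = 1 / (2 * (1 + L))"
  define K where "K = 2 * (1 + L)"
  define \<rho> where "\<rho> = R / (6 * (1 + L))"
  have ee: "e \<bullet> e = 1" using e by (simp add: norm_eq_1)
  define Pe where "Pe y = y - (y \<bullet> e) *\<^sub>R e" for y
  have Pe0: "Pe y \<bullet> e = 0" for y by (simp add: Pe_def inner_diff_left ee)
  have Pe_diff: "Pe y - Pe w = Pe (y - w)" for y w by (simp add: Pe_def algebra_simps)
  have Pe_norm: "norm (Pe y) \<le> norm y" for y
  proof -
    have "(norm y)\<^sup>2 = (norm (Pe y))\<^sup>2 + (y \<bullet> e)\<^sup>2"
      unfolding power2_norm_eq_inner Pe_def by (simp add: inner_diff_left inner_diff_right ee power2_eq_square inner_commute)
    then show ?thesis by (metis le_add_same_cancel1 norm_ge_zero power2_le_imp_le zero_le_power2)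
  qed
  define F where "F y = y \<bullet> e - f (Pe y)" for y
  have f_diff: "\<bar>f (Pe y) - f (Pe w)\<bar> \<le> L * norm (Pe (y - w))" for y w
    using lipschitz_onD[OF f, of "Pe y" "Pe w"] Pe0 by (simp add: dist_norm Pe_diff)
  have chartF: "y \<in> \<Omega> \<longleftrightarrow> 0 < F y" if "y \<in> U" for y
    using chart that unfolding F_def Pe_def by auto
  show ?thesis
  proof (rule that[of \<rho> e \<kappa> K])
    show "0 < \<rho>" "0 < \<kappa>" "\<kappa> \<le> 1 / 2" "1 \<le> K" using R L by (auto simp: \<rho>_def \<kappa>_def K_def field_simps)
    show "norm e = 1" by (rule e)
    fix x \<nu> assume x: "x \<in> \<Omega>" "x \<in> ball z \<rho>" and \<nu>: "\<nu> \<in> ball e \<kappa>"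
    obtain w where w: "w \<in> frontier \<Omega>" "bdist \<Omega> x = dist x w"
      using infdist_attains_inf[of "frontier \<Omega>" x] z unfolding bdist_def by auto
    define d where "d = bdist \<Omega> x"
    have xz: "norm (x - z) < \<rho>" using x(2) by (simp add: dist_norm norm_minus_commute)
    have d: "d = norm (x - w)" "0 \<le> d" using w(2) by (auto simp: d_def dist_norm)
    have d\<rho>: "d < \<rho>" using infdist_le[OF z, of x] x(2) unfolding d_def bdist_def by (simp add: dist_commute)
    have \<rho>R: "\<rho> * (6 * (1 + L)) = R" using L by (simp add: \<rho>_def)
    have \<rho>0: "0 < \<rho>" using R L by (simp add: \<rho>_def)
    have L\<rho>: "0 \<le> \<rho> * L" using \<rho>0 L by simp
    have "dist z w \<le> dist z x + dist x w" by (rule dist_triangle)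
    also have "\<dots> < 2 * \<rho>" using x(2) d\<rho> d(1) by (simp add: dist_norm)
    also have "2 * \<rho> \<le> R" using \<rho>R \<rho>0 L\<rho> by (simp add: algebra_simps)
    finally have wU: "w \<in> U" using R by auto
    have "w \<notin> \<Omega>" using w(1) \<Omega> by (simp add: frontier_def interior_open)
    then have Fw: "F w \<le> 0" using chartF[OF wU] by simp
    have "F x - F w = (x - w) \<bullet> e - (f (Pe x) - f (Pe w))" by (simp add: F_def inner_diff_left)
    also have "\<dots> \<le> norm (x - w) + L * norm (x - w)"
    proof -
      have "(x - w) \<bullet> e \<le> norm (x - w)" using norm_cauchy_schwarz[of "x - w" e] e by simp
      moreover have "L * norm (Pe (x - w)) \<le> L * norm (x - w)" using Pe_norm L by (intro mult_left_mono)
      ultimately show ?thesis using f_diff[of x w] by linarith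
    qed
    finally have Fx: "F x \<le> (1 + L) * d" using Fw by (simp add: d(1) algebra_simps)
    define t where "t = K * d"
    have t: "0 \<le> t" using L d by (simp add: t_def K_def)
    have \<eta>: "norm (\<nu> - e) < \<kappa>" using \<nu> by (simp add: dist_norm norm_minus_commute)
    have \<kappa>1: "\<kappa> \<le> 1 / 2" using L by (simp add: \<kappa>_def field_simps)
    have n\<nu>: "norm \<nu> \<le> 2" using \<eta> \<kappa>1 norm_triangle_ineq2[of \<nu> e] e by simp
    have "norm (t *\<^sub>R \<nu>) \<le> t * 2" using t n\<nu> by (simp add: mult_left_mono)
    also have "\<dots> \<le> K * \<rho> * 2" unfolding t_def using d\<rho> L by (intro mult_right_mono mult_left_mono) (auto simp: K_def)
    finally have "norm (t *\<^sub>R \<nu>) \<le> 4 * (1 + L) * \<rho>" by (simp add: K_def algebra_simps)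
    moreover have "dist z (x - t *\<^sub>R \<nu>) \<le> norm (x - z) + norm (t *\<^sub>R \<nu>)"
      using norm_triangle_ineq4[of "x - z" "t *\<^sub>R \<nu>"] by (simp add: dist_norm norm_minus_commute algebra_simps)
    ultimately have "dist z (x - t *\<^sub>R \<nu>) < R"
      using xz \<rho>R \<rho>0 L\<rho> by (simp add: algebra_simps)
    then have yU: "x - t *\<^sub>R \<nu> \<in> U" using R by auto
    have "F (x - t *\<^sub>R \<nu>) = F x - t * (\<nu> \<bullet> e) + (f (Pe x) - f (Pe (x - t *\<^sub>R \<nu>)))"
      by (simp add: F_def inner_diff_left)
    also have "f (Pe x) - f (Pe (x - t *\<^sub>R \<nu>)) \<le> L * norm (Pe (t *\<^sub>R \<nu>))"
      using f_diff[of x "x - t *\<^sub>R \<nu>"] by simp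
    also have "norm (Pe (t *\<^sub>R \<nu>)) = t * norm (Pe (\<nu> - e))"
    proof -
      have "Pe (t *\<^sub>R \<nu>) = t *\<^sub>R Pe (\<nu> - e)" by (simp add: Pe_def inner_diff_left ee algebra_simps)
      then show ?thesis using t by simp
    qed
    also have "L * (t * norm (Pe (\<nu> - e))) \<le> L * (t * \<kappa>)"
      using Pe_norm[of "\<nu> - e"] \<eta> L t by (intro mult_left_mono) auto
    also have "F x - t * (\<nu> \<bullet> e) + L * (t * \<kappa>) \<le> (1 + L) * d - t * (1 - \<kappa>) + L * (t * \<kappa>)"
    proof -
      have "(\<nu> - e) \<bullet> e \<ge> - \<kappa>" using Cauchy_Schwarz_ineq2[of "\<nu> - e" e] e \<eta> by simp
      then have "1 - \<kappa> \<le> \<nu> \<bullet> e" by (simp add: inner_diff_left ee)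
      then have "t * (1 - \<kappa>) \<le> t * (\<nu> \<bullet> e)" using t by (intro mult_left_mono)
      then show ?thesis using Fx by simp
    qed
    also have "\<dots> = (1 + L) * d - t * (1 - (1 + L) * \<kappa>)" by (simp add: algebra_simps)
    also have "(1 + L) * \<kappa> = 1 / 2" using L by (simp add: \<kappa>_def)
    also have "(1 + L) * d - t * (1 - 1 / 2) = 0" by (simp add: t_def K_def)
    finally have "x - t *\<^sub>R \<nu> \<notin> \<Omega>" using chartF[OF yU] by simp
    then show "exit_time \<Omega> x \<nu> \<le> K * bdist \<Omega> x"
      using exit_time_le[OF t] by (simp add: t_def d_def)
  qed
qed

lemma bounded_domain_frontier:
  assumes "bounded_lipschitz_domain (\<Omega> :: 'a::euclidean_space set)"
  shows "frontier \<Omega> \<noteq> {}" "compact (frontier \<Omega>)"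
proof -
  have b: "bounded \<Omega>" "\<Omega> \<noteq> {}" using assms by (auto simp: bounded_lipschitz_domain_def)
  then have "\<Omega> \<noteq> UNIV" using not_bounded_UNIV by auto
  with b show "frontier \<Omega> \<noteq> {}" by (simp add: frontier_not_empty)
  show "compact (frontier \<Omega>)" using b by (simp add: compact_frontier_bounded)
qed

context log_exponent begin

text \<open>Finitely many charts cover a neighbourhood of the compact boundary; away from the boundary \<open>1 / d\<close> is bounded.\<close>

lemma hardy_test_functions:
  assumes dom: "bounded_lipschitz_domain \<Omega>" and q: "1 < q" "\<And>x. x \<in> \<Omega> \<Longrightarrow> q \<le> p x" and M: "0 \<le> M"
  obtains CH where "0 \<le> CH" "\<And>\<phi>. \<lbrakk>\<phi> \<in> test_functions \<Omega>; modular \<Omega> p \<phi> \<le> ennreal M; modular \<Omega> p (grad \<phi>) \<le> ennreal M\<rbrakk> \<Longrightarrow>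
     modular \<Omega> p (\<lambda>x. \<phi> x / bdist \<Omega> x) \<le> ennreal CH"
proof -
  have fr: "frontier \<Omega> \<noteq> {}" "compact (frontier \<Omega>)" using bounded_domain_frontier[OF dom] by auto
  have ne: "\<Omega> \<noteq> {}" using dom by (simp add: bounded_lipschitz_domain_def)
  then have qP: "q \<le> P" using q p_le by (meson ex_in_conv order_trans)
  define good where "good z \<rho> H \<longleftrightarrow> 0 < \<rho> \<and> 0 \<le> H \<and> (\<forall>\<phi>. \<phi> \<in> test_functions \<Omega> \<longrightarrow> modular \<Omega> p (grad \<phi>) \<le> ennreal M \<longrightarrow>
     (\<integral>\<^sup>+x. ennreal (\<bar>\<phi> x / bdist \<Omega> x\<bar> powr pb x) * indicator (\<Omega> \<inter> ball z \<rho>) x \<partial>lborel) \<le> ennreal H)" for z \<rho> H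
  have "\<exists>\<rho> H. good z \<rho> H" if z: "z \<in> frontier \<Omega>" for z
  proof -
    obtain \<rho> e \<kappa> K where g: "0 < \<rho>" "norm e = 1" "0 < \<kappa>" "\<kappa> \<le> 1 / 2" "1 \<le> K"
      "\<And>x \<nu>. x \<in> \<Omega> \<Longrightarrow> x \<in> ball z \<rho> \<Longrightarrow> \<nu> \<in> ball e \<kappa> \<Longrightarrow> exit_time \<Omega> x \<nu> \<le> K * bdist \<Omega> x"
      using lipschitz_exit_time[OF dom z] by metis
    show ?thesis
    proof (rule local_hardy[OF q qP M g(2-5) fr(1)])
      fix CH assume CH: "0 \<le> CH" "\<And>\<phi> W. \<lbrakk>\<phi> \<in> test_functions \<Omega>; modular \<Omega> p (grad \<phi>) \<le> ennreal M; W \<in> sets borel; W \<subseteq> \<Omega>;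
      \<And>x \<nu>. x \<in> W \<Longrightarrow> \<nu> \<in> ball e \<kappa> \<Longrightarrow> exit_time \<Omega> x \<nu> \<le> K * bdist \<Omega> x\<rbrakk> \<Longrightarrow>
     (\<integral>\<^sup>+x. ennreal (\<bar>\<phi> x / bdist \<Omega> x\<bar> powr pb x) * indicator W x \<partial>lborel) \<le> ennreal CH"
      have "good z \<rho> CH" unfolding good_def
      proof (intro conjI allI impI)
        fix \<phi> assume \<phi>: "\<phi> \<in> test_functions \<Omega>" "modular \<Omega> p (grad \<phi>) \<le> ennreal M"
        show "(\<integral>\<^sup>+x. ennreal (\<bar>\<phi> x / bdist \<Omega> x\<bar> powr pb x) * indicator (\<Omega> \<inter> ball z \<rho>) x \<partial>lborel) \<le> ennreal CH"
          by (rule CH(2)[OF \<phi>]) (use g open_\<Omega> in auto)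
      qed (use g CH in auto)
      then show ?thesis by blast
    qed
  qed
  then obtain \<rho> H where gd: "\<And>z. z \<in> frontier \<Omega> \<Longrightarrow> good z (\<rho> z) (H z)" by metis
  obtain Z where Z: "Z \<subseteq> frontier \<Omega>" "finite Z" "frontier \<Omega> \<subseteq> (\<Union>z\<in>Z. ball z (\<rho> z))"
  proof (rule compactE_image[OF fr(2), of "frontier \<Omega>" "\<lambda>z. ball z (\<rho> z)"])
    show "frontier \<Omega> \<subseteq> (\<Union>z\<in>frontier \<Omega>. ball z (\<rho> z))" using gd by (force simp: good_def)
  qed auto
  \<comment> \<open>Points at distance at most \<open>d0\<close> from the boundary lie in one of the charts.\<close>
  obtain d0 where d0: "0 < d0" "(\<Union>x\<in>frontier \<Omega>. cball x d0) \<subseteq> (\<Union>z\<in>Z. ball z (\<rho> z))"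
    by (rule compact_subset_open_imp_cball_epsilon_subset[OF fr(2) _ Z(3)]) auto
  have near: "x \<in> (\<Union>z\<in>Z. ball z (\<rho> z))" if "bdist \<Omega> x \<le> d0" for x
  proof -
    obtain w where "w \<in> frontier \<Omega>" "bdist \<Omega> x = dist x w"
      using infdist_attains_inf[of "frontier \<Omega>" x] fr unfolding bdist_def by auto
    then have "x \<in> (\<Union>x\<in>frontier \<Omega>. cball x d0)" using that by (auto simp: dist_commute)
    then show ?thesis using d0(2) by blast
  qed
  define c0 where "c0 = (max 1 (1 / d0)) powr P"
  have c0: "0 \<le> c0" by (simp add: c0_def)
  have H0: "0 \<le> H z" if "z \<in> Z" for z using gd Z that by (auto simp: good_def)
  show ?thesis
  proof (rule that[of "(\<Sum>z\<in>Z. H z) + c0 * M"])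
    show "0 \<le> (\<Sum>z\<in>Z. H z) + c0 * M" using H0 c0 M by (intro add_nonneg_nonneg sum_nonneg) auto
    fix \<phi> assume \<phi>: "\<phi> \<in> test_functions \<Omega>" and m: "modular \<Omega> p \<phi> \<le> ennreal M" and g: "modular \<Omega> p (grad \<phi>) \<le> ennreal M"
    have [measurable]: "\<phi> \<in> borel_measurable borel"
      using continuous_on_test_function[OF \<phi>] by (rule borel_measurable_continuous_onI)
    have [measurable]: "bdist \<Omega> \<in> borel_measurable borel" unfolding bdist_def
      by (intro borel_measurable_continuous_onI continuous_intros)
    have [measurable]: "\<Omega> \<in> sets borel" using open_\<Omega> by simp
    let ?h = "\<lambda>x. ennreal (\<bar>\<phi> x / bdist \<Omega> x\<bar> powr pb x)"
    have "modular \<Omega> p (\<lambda>x. \<phi> x / bdist \<Omega> x) = (\<integral>\<^sup>+x. ?h x \<partial>lborel)"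
      by (subst modular_eq_lborel) (auto simp: test_function_outside[OF \<phi>])
    also have "\<dots> \<le> (\<integral>\<^sup>+x. (\<Sum>z\<in>Z. ?h x * indicator (\<Omega> \<inter> ball z (\<rho> z)) x) + ennreal c0 * ennreal (norm (\<phi> x) powr pb x) \<partial>lborel)"
    proof (rule nn_integral_mono)
      fix x
      show "?h x \<le> (\<Sum>z\<in>Z. ?h x * indicator (\<Omega> \<inter> ball z (\<rho> z)) x) + ennreal c0 * ennreal (norm (\<phi> x) powr pb x)"
      proof (cases "x \<in> \<Omega>")
        case False then show ?thesis by (simp add: test_function_outside[OF \<phi>])
      next
        case x: True
        show ?thesis
        proof (cases "bdist \<Omega> x \<le> d0")
          case True
          then obtain z where z: "z \<in> Z" "x \<in> ball z (\<rho> z)" using near by blast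
          have "?h x = ?h x * indicator (\<Omega> \<inter> ball z (\<rho> z)) x" using z x by simp
          also have "\<dots> \<le> (\<Sum>z\<in>Z. ?h x * indicator (\<Omega> \<inter> ball z (\<rho> z)) x)"
            by (rule member_le_sum[OF z(1)]) (use Z in auto)
          finally show ?thesis by (rule order_trans) simp
        next
          case False
          have "1 / bdist \<Omega> x \<le> max 1 (1 / d0)" using False d0(1) by (simp add: le_max_iff_disj frac_le)
          then have "\<bar>\<phi> x / bdist \<Omega> x\<bar> \<le> max 1 (1 / d0) * \<bar>\<phi> x\<bar>"
            using False d0(1) mult_right_mono[of "1 / bdist \<Omega> x" "max 1 (1 / d0)" "\<bar>\<phi> x\<bar>"] by simp
          then have "\<bar>\<phi> x / bdist \<Omega> x\<bar> powr pb x \<le> (max 1 (1 / d0) * \<bar>\<phi> x\<bar>) powr pb x"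
            using pb_bounds(1)[of x] by (intro powr_mono2) auto
          also have "\<dots> = (max 1 (1 / d0)) powr pb x * \<bar>\<phi> x\<bar> powr pb x" by (simp add: powr_mult)
          also have "\<dots> \<le> c0 * \<bar>\<phi> x\<bar> powr pb x" unfolding c0_def using pb_bounds by (intro mult_right_mono powr_mono) auto
          finally have "?h x \<le> ennreal c0 * ennreal (norm (\<phi> x) powr pb x)"
            using c0 by (simp add: ennreal_mult'[symmetric])
          then show ?thesis by (rule order_trans) simp
        qed
      qed
    qed
    also have "\<dots> = (\<Sum>z\<in>Z. (\<integral>\<^sup>+x. ?h x * indicator (\<Omega> \<inter> ball z (\<rho> z)) x \<partial>lborel)) + ennreal c0 * (\<integral>\<^sup>+x. ennreal (norm (\<phi> x) powr pb x) \<partial>lborel)"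
    proof -
      have 1: "(\<lambda>x. ?h x * indicator (\<Omega> \<inter> ball z (\<rho> z)) x) \<in> borel_measurable lborel" for z
        by (intro borel_measurable_times_ennreal borel_measurable_indicator) auto
      have 2: "(\<lambda>x. ennreal (norm (\<phi> x) powr pb x)) \<in> borel_measurable lborel" by measurable
      show ?thesis
        unfolding nn_integral_cmult[OF 2, symmetric] nn_integral_sum[OF 1, symmetric]
        by (intro nn_integral_add borel_measurable_sum borel_measurable_times_ennreal 1 2) auto
    qed
    also have "\<dots> \<le> (\<Sum>z\<in>Z. ennreal (H z)) + ennreal c0 * ennreal M"
    proof (intro add_mono sum_mono mult_left_mono)
      show "(\<integral>\<^sup>+x. ?h x * indicator (\<Omega> \<inter> ball z (\<rho> z)) x \<partial>lborel) \<le> ennreal (H z)" if "z \<in> Z" for z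
        using gd[of z] Z that \<phi> g unfolding good_def by blast
      show "(\<integral>\<^sup>+x. ennreal (norm (\<phi> x) powr pb x) \<partial>lborel) \<le> ennreal M"
        using m by (subst (asm) modular_eq_lborel) (auto simp: test_function_outside[OF \<phi>])
    qed auto
    also have "\<dots> = ennreal ((\<Sum>z\<in>Z. H z) + c0 * M)"
      using H0 c0 M by (simp add: sum_ennreal sum_nonneg ennreal_mult'[symmetric])
    finally show "modular \<Omega> p (\<lambda>x. \<phi> x / bdist \<Omega> x) \<le> ennreal ((\<Sum>z\<in>Z. H z) + c0 * M)" .
  qed
qed

end

section \<open>Completeness of the modular\<close>

context log_exponent begin

text \<open>Choose a subsequence whose increments have modular at most \<open>2 powr (- (P + 1) j)\<close>. The sum \<open>S0\<close> of the increments, each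
raised to the power \<open>p x\<close> and weighted with \<open>2 powr (P j)\<close>, is integrable and bounds every increment by \<open>2 powr (- j)\<close> times a fixed
finite number. This gives convergence, the rate, and a majorant at once.\<close>

lemma modular_complete:
  fixes w :: "nat \<Rightarrow> 'a \<Rightarrow> 'b::euclidean_space"
  assumes [measurable]: "\<And>n. w n \<in> borel_measurable (lebesgue_on \<Omega>)"
    and cauchy: "\<And>e. 0 < e \<Longrightarrow> \<exists>N. \<forall>m\<ge>N. \<forall>n\<ge>N. modular \<Omega> p (\<lambda>x. w m x - w n x) \<le> ennreal e"
  obtains r v S where "strict_mono (r :: nat \<Rightarrow> nat)" "v \<in> borel_measurable (lebesgue_on \<Omega>)"
    "AE x in lebesgue_on \<Omega>. (\<lambda>n. w (r n) x) \<longlonglongrightarrow> v x"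
    "integrable (lebesgue_on \<Omega>) S" "\<And>x. 0 \<le> S x"
    "AE x in lebesgue_on \<Omega>. \<forall>n. norm (w (r n) x - v x) powr p x \<le> S x * (1 / 2) ^ n"
proof -
  define c where "c j = 2 powr (- (P + 1) * real j)" for j
  have c: "0 < c j" for j by (simp add: c_def)
  obtain Nf where Nf: "\<And>j m n. m \<ge> Nf j \<Longrightarrow> n \<ge> Nf j \<Longrightarrow> modular \<Omega> p (\<lambda>x. w m x - w n x) \<le> ennreal (c j)"
    using cauchy[OF c] by metis
  define r where "r = rec_nat (Nf 0) (\<lambda>j k. max (Suc k) (Nf (Suc j)))"
  have r_Suc: "r (Suc j) = max (Suc (r j)) (Nf (Suc j))" and r_0: "r 0 = Nf 0" for j
    by (simp_all add: r_def)
  have r: "strict_mono r" by (rule strict_mono_Suc_iff[THEN iffD2]) (auto simp: r_Suc less_max_iff_disj)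
  have rN: "r j \<ge> Nf j" for j by (cases j) (simp_all add: r_Suc r_0)
  define \<Delta> where "\<Delta> j x = w (r (Suc j)) x - w (r j) x" for j x
  have [measurable]: "\<Delta> j \<in> borel_measurable (lebesgue_on \<Omega>)" for j unfolding \<Delta>_def by measurable
  have m\<Delta>: "modular \<Omega> p (\<Delta> j) \<le> ennreal (c j)" for j
    unfolding \<Delta>_def using Nf[of j "r (Suc j)" "r j"] rN[of j] strict_mono_less[OF r, of j "Suc j"] by simp
  \<comment> \<open>The weight \<open>2 powr (P j)\<close> dominates \<open>2 powr (p x * j)\<close>, so each summand bounds the power \<open>p x\<close> of \<open>2\<^sup>j \<Delta> j x\<close>.\<close>
  define S0 where "S0 x = (\<Sum>j. ennreal (2 powr (P * real j)) * ennreal (norm (\<Delta> j x) powr p x))" for x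
  have S0m [measurable]: "S0 \<in> borel_measurable (lebesgue_on \<Omega>)" unfolding S0_def by measurable
  have "(\<integral>\<^sup>+x. S0 x \<partial>lebesgue_on \<Omega>) = (\<Sum>j. ennreal (2 powr (P * real j)) * modular \<Omega> p (\<Delta> j))"
    unfolding S0_def modular_def by (subst nn_integral_suminf) (auto simp: nn_integral_cmult)
  also have "\<dots> \<le> (\<Sum>j. ennreal ((1 / 2) ^ j))"
  proof (rule suminf_le)
    show "ennreal (2 powr (P * real j)) * modular \<Omega> p (\<Delta> j) \<le> ennreal ((1 / 2) ^ j)" for j
    proof -
      have "ennreal (2 powr (P * real j)) * modular \<Omega> p (\<Delta> j) \<le> ennreal (2 powr (P * real j)) * ennreal (c j)"
        by (intro mult_left_mono m\<Delta>) auto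
      also have "\<dots> = ennreal (2 powr (P * real j + - (P + 1) * real j))"
        by (simp add: c_def ennreal_mult'[symmetric] powr_add)
      also have "P * real j + - (P + 1) * real j = - real j" by (simp add: algebra_simps)
      also have "2 powr (- real j) = (1 / 2) ^ j" by (simp add: powr_minus powr_realpow power_one_over inverse_eq_divide)
      finally show ?thesis .
    qed
  qed auto
  also have "\<dots> = ennreal (\<Sum>j. (1 / 2) ^ j)" by (rule suminf_ennreal2) auto
  also have "\<dots> < \<infinity>" by simp
  finally have fin: "(\<integral>\<^sup>+x. S0 x \<partial>lebesgue_on \<Omega>) < \<infinity>" .
  define S1 where "S1 x = enn2real (S0 x)" for x
  have S1m [measurable]: "S1 \<in> borel_measurable (lebesgue_on \<Omega>)" unfolding S1_def by measurable
  have S0fin: "AE x in lebesgue_on \<Omega>. S0 x \<noteq> \<infinity>"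
    by (rule nn_integral_PInf_AE[OF S0m]) (use fin in auto)
  have iS1: "integrable (lebesgue_on \<Omega>) S1"
  proof (rule integrableI_nonneg[OF S1m])
    have "(\<integral>\<^sup>+x. ennreal (S1 x) \<partial>lebesgue_on \<Omega>) \<le> (\<integral>\<^sup>+x. S0 x \<partial>lebesgue_on \<Omega>)"
      unfolding S1_def by (intro nn_integral_mono) (auto simp: ennreal_enn2real_if)
    then show "(\<integral>\<^sup>+x. ennreal (S1 x) \<partial>lebesgue_on \<Omega>) < \<infinity>" using fin by (rule le_less_trans)
  qed (simp add: S1_def)
  define v where "v x = lim (\<lambda>n. w (r n) x)" for x
  define S where "S x = 2 powr P * S1 x" for x
  have key: "(\<lambda>n. w (r n) x) \<longlonglongrightarrow> v x \<and> (\<forall>n. norm (w (r n) x - v x) powr p x \<le> S x * (1 / 2) ^ n)"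
    if x: "x \<in> \<Omega>" and f: "S0 x \<noteq> \<infinity>" for x
  proof -
    have px: "1 \<le> p x" "p x \<le> P" using p_ge p_le x by auto
    define s where "s = S1 x powr (1 / p x)"
    have s0: "0 \<le> s" by (simp add: s_def)
    have S1: "0 \<le> S1 x" "ennreal (S1 x) = S0 x" using f by (auto simp: S1_def ennreal_enn2real_if)
    have \<Delta>s: "norm (\<Delta> j x) \<le> s * (1 / 2) ^ j" for j
    proof -
      have "ennreal (2 powr (P * real j)) * ennreal (norm (\<Delta> j x) powr p x) \<le> S0 x"
        unfolding S0_def using sum_le_suminf[of "\<lambda>j. ennreal (2 powr (P * real j)) * ennreal (norm (\<Delta> j x) powr p x)" "{j}"] by simp
      then have "2 powr (P * real j) * norm (\<Delta> j x) powr p x \<le> S1 x"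
        unfolding S1(2)[symmetric] by (simp add: ennreal_mult'[symmetric] S1(1))
      moreover have "2 powr (p x * real j) \<le> 2 powr (P * real j)" using px by (intro powr_mono mult_right_mono) auto
      ultimately have "2 powr (p x * real j) * norm (\<Delta> j x) powr p x \<le> S1 x"
        by (meson mult_right_mono order_trans powr_ge_zero)
      also have "2 powr (p x * real j) * norm (\<Delta> j x) powr p x = (2 ^ j * norm (\<Delta> j x)) powr p x"
        by (simp add: powr_mult powr_realpow[symmetric] powr_powr mult.commute)
      finally have "((2 ^ j * norm (\<Delta> j x)) powr p x) powr (1 / p x) \<le> s"
        unfolding s_def using px by (intro powr_mono2) auto
      then have "2 ^ j * norm (\<Delta> j x) \<le> s" using px by (simp add: powr_powr)
      then show ?thesis by (simp add: field_simps)
    qed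
    have tele: "norm (w (r (n + k)) x - w (r n) x) \<le> 2 * s * (1 / 2) ^ n * (1 - (1 / 2) ^ k)" for n k
    proof (induction k)
      case (Suc k)
      have "w (r (n + Suc k)) x - w (r n) x = \<Delta> (n + k) x + (w (r (n + k)) x - w (r n) x)" by (simp add: \<Delta>_def)
      then have "norm (w (r (n + Suc k)) x - w (r n) x) \<le> norm (\<Delta> (n + k) x) + norm (w (r (n + k)) x - w (r n) x)"
        by (simp only: norm_triangle_ineq)
      also have "\<dots> \<le> s * (1 / 2) ^ (n + k) + 2 * s * (1 / 2) ^ n * (1 - (1 / 2) ^ k)" by (intro add_mono \<Delta>s Suc)
      also have "\<dots> = 2 * s * (1 / 2) ^ n * (1 - (1 / 2) ^ Suc k)" by (simp add: power_add algebra_simps)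
      finally show ?case .
    qed simp
    have tele2: "norm (w (r m) x - w (r n) x) \<le> 2 * s * (1 / 2) ^ n" if "n \<le> m" for n m
    proof -
      have "2 * s * (1 / 2) ^ n * (1 - (1 / 2) ^ (m - n)) \<le> 2 * s * (1 / 2) ^ n * 1"
        using s0 by (intro mult_left_mono) auto
      then show ?thesis using tele[of n "m - n"] that by simp
    qed
    have "(\<lambda>n. 2 * s * (1 / 2) ^ n) \<longlonglongrightarrow> 2 * s * 0" by (intro tendsto_intros LIMSEQ_power_zero) auto
    then have lim0: "(\<lambda>n. 2 * s * (1 / 2) ^ n) \<longlonglongrightarrow> 0" by simp
    have "Cauchy (\<lambda>n. w (r n) x)"
    proof (rule CauchyI')
      fix e :: real assume "0 < e"
      then obtain N where N: "\<And>n. n \<ge> N \<Longrightarrow> 2 * s * (1 / 2) ^ n < e"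
        using order_tendstoD(2)[OF lim0] by (auto simp: eventually_sequentially)
      show "\<exists>M. \<forall>m\<ge>M. \<forall>n>m. dist (w (r m) x) (w (r n) x) < e"
      proof (intro exI allI impI)
        fix m n assume "m \<ge> N" "n > m"
        then show "dist (w (r m) x) (w (r n) x) < e"
          using tele2[of m n] N[of m] by (simp add: dist_norm norm_minus_commute)
      qed
    qed
    then have lim: "(\<lambda>n. w (r n) x) \<longlonglongrightarrow> v x"
      unfolding v_def by (simp add: Cauchy_convergent_iff convergent_LIMSEQ_iff)
    have "norm (w (r n) x - v x) powr p x \<le> S x * (1 / 2) ^ n" for n
    proof -
      have "norm (v x - w (r n) x) \<le> 2 * s * (1 / 2) ^ n"
        by (rule LIMSEQ_le_const2[OF tendsto_norm[OF tendsto_diff[OF lim tendsto_const]]]) (use tele2 in blast)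
      then have "norm (w (r n) x - v x) powr p x \<le> (2 * s * (1 / 2) ^ n) powr p x"
        using px by (intro powr_mono2) (auto simp: norm_minus_commute)
      also have "\<dots> = 2 powr p x * s powr p x * ((1 / 2) ^ n) powr p x" by (simp add: powr_mult)
      also have "s powr p x = S1 x" using px S1 by (simp add: s_def powr_powr)
      also have "2 powr p x * S1 x * ((1 / 2) ^ n) powr p x \<le> 2 powr P * S1 x * ((1 / 2) ^ n) powr 1"
        using px S1 by (intro mult_mono powr_mono powr_mono' mult_nonneg_nonneg) (auto simp: power_le_one)
      finally show ?thesis by (simp add: S_def)
    qed
    with lim show ?thesis by blast
  qed
  show ?thesis
  proof (rule that[of r v S])
    show "v \<in> borel_measurable (lebesgue_on \<Omega>)" unfolding v_def by measurable
    show "integrable (lebesgue_on \<Omega>) S" unfolding S_def using iS1 by simp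
    show "0 \<le> S x" for x by (simp add: S_def S1_def)
    have AE\<Omega>: "AE x in lebesgue_on \<Omega>. x \<in> \<Omega>" by (rule AE_I2) simp
    show "AE x in lebesgue_on \<Omega>. (\<lambda>n. w (r n) x) \<longlonglongrightarrow> v x"
      "AE x in lebesgue_on \<Omega>. \<forall>n. norm (w (r n) x - v x) powr p x \<le> S x * (1 / 2) ^ n"
      using S0fin AE\<Omega> by (eventually_elim, use key in blast)+
  qed (rule r)
qed

lemma modular_cong_AE:
  assumes "AE x in lebesgue_on \<Omega>. f x = g x" shows "modular \<Omega> p f = modular \<Omega> p g"
  unfolding modular_def by (intro nn_integral_cong_AE) (use assms in \<open>auto elim!: eventually_mono\<close>)

text \<open>Converts smallness of the modular into smallness in \<open>L\<^sup>1\<close>: choose \<open>\<eta>\<close> small before the modular.\<close>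

lemma le_eta_powr:
  fixes y \<eta> q :: real
  assumes "0 \<le> y" "0 < \<eta>" "\<eta> \<le> 1" "1 \<le> q" "q \<le> P'"
  shows "y \<le> \<eta> + \<eta> powr (1 - P') * y powr q"
proof (cases "y \<le> \<eta>")
  case False
  then have z: "1 \<le> y / \<eta>" using assms by (simp add: field_simps)
  have "y = \<eta> * (y / \<eta>)" using assms by simp
  also have "\<dots> \<le> \<eta> * (y / \<eta>) powr q"
    using powr_mono[of 1 q "y / \<eta>"] z assms by (intro mult_left_mono) auto
  also have "\<dots> = \<eta> powr (1 - q) * y powr q"
    using assms by (simp add: powr_divide powr_diff)
  also have "\<dots> \<le> \<eta> powr (1 - P') * y powr q" using assms by (intro mult_right_mono powr_mono') auto
  finally show ?thesis using assms by simp
qed (use assms in \<open>auto intro: add_increasing2\<close>)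

end

section \<open>Luxemburg norm and modular\<close>

lemma ennreal_tendsto_0_iff:
  fixes f :: "nat \<Rightarrow> ennreal"
  shows "f \<longlonglongrightarrow> 0 \<longleftrightarrow> (\<forall>e>0. \<exists>N. \<forall>n\<ge>N. f n \<le> ennreal e)"
proof
  assume f: "f \<longlonglongrightarrow> 0"
  show "\<forall>e>0. \<exists>N. \<forall>n\<ge>N. f n \<le> ennreal e"
  proof (intro allI impI)
    fix e :: real assume "e > 0"
    then have "\<forall>\<^sub>F n in sequentially. f n < ennreal e" using order_tendstoD(2)[OF f, of "ennreal e"] by simp
    then show "\<exists>N. \<forall>n\<ge>N. f n \<le> ennreal e" by (auto simp: eventually_sequentially intro: less_imp_le)
  qed
next
  assume *: "\<forall>e>0. \<exists>N. \<forall>n\<ge>N. f n \<le> ennreal e"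
  show "f \<longlonglongrightarrow> 0"
  proof (rule order_tendstoI)
    fix a :: ennreal assume a: "0 < a"
    obtain e :: real where e: "0 < e" "ennreal e < a"
    proof (cases a)
      case (real s)
      then have "0 < s" using a by simp
      then show ?thesis using that[of "s / 2"] real by (auto simp: ennreal_less_iff)
    qed (use that[of 1] in auto)
    then show "\<forall>\<^sub>F n in sequentially. f n < a"
      using * unfolding eventually_sequentially by (meson le_less_trans)
  qed auto
qed

text \<open>Exhaust \<open>\<Omega>\<close> by compact sets.\<close>

lemma locally_integrable_measurable:
  fixes f :: "'a::euclidean_space \<Rightarrow> 'b::euclidean_space"
  assumes \<Omega>: "open \<Omega>" and f: "locally_integrable \<Omega> f"
  shows "f \<in> borel_measurable (lebesgue_on \<Omega>)"
proof -
  obtain K :: "nat \<Rightarrow> 'a set" where K: "\<And>n. compact (K n)" "\<And>n. K n \<subseteq> \<Omega>" "\<And>n. K n \<subseteq> interior (K (Suc n))" "\<Union>(range K) = \<Omega>"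
    using open_Union_compact_subsets[OF \<Omega>] by metis
  have mono: "K m \<subseteq> K n" if "m \<le> n" for m n
    using that by (rule lift_Suc_mono_le[of K, rotated]) (use K(3) interior_subset in blast)
  have m: "(\<lambda>x. indicator (K n) x *\<^sub>R f x) \<in> borel_measurable (lebesgue_on \<Omega>)" for n
    using f K(1,2)[of n] unfolding locally_integrable_def set_integrable_def
    by (intro measurable_restrict_space1) (auto dest: borel_measurable_integrable)
  show ?thesis
  proof (rule borel_measurable_LIMSEQ_metric[OF m])
    fix x assume "x \<in> space (lebesgue_on \<Omega>)"
    then obtain n where n: "x \<in> K n" using K(4) by auto
    show "(\<lambda>n. indicator (K n) x *\<^sub>R f x) \<longlonglongrightarrow> f x"
    proof (rule tendsto_eventually)
      show "\<forall>\<^sub>F n in sequentially. indicator (K n) x *\<^sub>R f x = f x"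
        unfolding eventually_sequentially using n mono by (intro exI[of _ n]) (metis indicator_simps(1) scaleR_one subsetD)
    qed
  qed
qed

context log_exponent begin

lemma modular_scale_le:
  fixes f :: "'a \<Rightarrow> 'b::{real_normed_vector, second_countable_topology}"
  assumes [measurable]: "f \<in> borel_measurable (lebesgue_on \<Omega>)"
    and c: "0 \<le> c" and b: "\<And>x. x \<in> \<Omega> \<Longrightarrow> c powr p x \<le> B"
  shows "modular \<Omega> p (\<lambda>x. c *\<^sub>R f x) \<le> ennreal B * modular \<Omega> p f"
proof -
  have "modular \<Omega> p (\<lambda>x. c *\<^sub>R f x) \<le> (\<integral>\<^sup>+x. ennreal B * ennreal (norm (f x) powr p x) \<partial>lebesgue_on \<Omega>)"
    unfolding modular_def
  proof (intro nn_integral_mono)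
    fix x assume "x \<in> space (lebesgue_on \<Omega>)"
    then have "c powr p x \<le> B" using b by simp
    moreover have "0 \<le> B" using calculation powr_ge_zero order_trans by blast
    ultimately show "ennreal (norm (c *\<^sub>R f x) powr p x) \<le> ennreal B * ennreal (norm (f x) powr p x)"
      using c by (simp add: powr_mult ennreal_mult'[symmetric] mult_right_mono)
  qed
  also have "\<dots> = ennreal B * modular \<Omega> p f"
    unfolding modular_def by (rule nn_integral_cmult) measurable
  finally show ?thesis .
qed

abbreviation lux_set :: "('a \<Rightarrow> real) \<Rightarrow> real set" where
  "lux_set f \<equiv> {\<tau>. 0 < \<tau> \<and> (\<integral>\<^sup>+x. ennreal (\<bar>f x / \<tau>\<bar> powr p x) \<partial>lebesgue_on \<Omega>) \<le> 1}"

lemma lux_set_alt: "\<tau> \<in> lux_set f \<longleftrightarrow> 0 < \<tau> \<and> modular \<Omega> p (\<lambda>x. (1 / \<tau>) *\<^sub>R f x) \<le> 1"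
  unfolding modular_def by simp

text \<open>Needed because the infimum of the empty set of reals carries no information.\<close>

lemma lux_set_nonempty:
  assumes f: "f \<in> borel_measurable (lebesgue_on \<Omega>)" and fin: "modular \<Omega> p f < \<infinity>"
  shows "lux_set f \<noteq> {}"
proof -
  obtain m where m: "modular \<Omega> p f = ennreal m" "0 \<le> m" using fin by (cases "modular \<Omega> p f") auto
  define \<tau> where "\<tau> = 1 + m"
  have \<tau>: "1 \<le> \<tau>" using m by (simp add: \<tau>_def)
  have "modular \<Omega> p (\<lambda>x. (1 / \<tau>) *\<^sub>R f x) \<le> ennreal (1 / \<tau>) * modular \<Omega> p f"
  proof (rule modular_scale_le[OF f])
    show "(1 / \<tau>) powr p x \<le> 1 / \<tau>" if "x \<in> \<Omega>" for x
      using powr_mono'[of 1 "p x" "1 / \<tau>"] p_ge[OF that] \<tau> by simp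
  qed (use \<tau> in auto)
  also have "\<dots> = ennreal (m / \<tau>)" using \<tau> m by (simp add: ennreal_mult'[symmetric])
  also have "\<dots> \<le> 1" using m \<tau> by (simp add: \<tau>_def)
  finally have "\<tau> \<in> lux_set f" unfolding lux_set_alt using less_le_trans[OF zero_less_one \<tau>] by blast
  then show ?thesis by blast
qed

lemma luxemburg_nonneg:
  assumes "f \<in> borel_measurable (lebesgue_on \<Omega>)" "modular \<Omega> p f < \<infinity>"
  shows "0 \<le> luxemburg_norm \<Omega> p f"
  unfolding luxemburg_norm_def using lux_set_nonempty[OF assms] by (intro cInf_greatest) auto

text \<open>For \<open>\<tau> \<le> 1\<close> scaling by \<open>\<tau>\<close> multiplies the modular at most by \<open>\<tau>\<close>, since \<open>p \<ge> 1\<close>.\<close>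

lemma modular_le_of_luxemburg:
  assumes f: "f \<in> borel_measurable (lebesgue_on \<Omega>)" and fin: "modular \<Omega> p f < \<infinity>"
    and e: "luxemburg_norm \<Omega> p f < e" "e \<le> 1"
  shows "modular \<Omega> p f \<le> ennreal e"
proof -
  obtain \<tau> where \<tau>: "\<tau> \<in> lux_set f" "\<tau> < e"
    using cInf_lessD[OF lux_set_nonempty[OF f fin]] e(1) unfolding luxemburg_norm_def by blast
  then have \<tau>': "0 < \<tau>" "modular \<Omega> p (\<lambda>x. (1 / \<tau>) *\<^sub>R f x) \<le> 1" using lux_set_alt by blast+
  have "modular \<Omega> p f = modular \<Omega> p (\<lambda>x. \<tau> *\<^sub>R ((1 / \<tau>) *\<^sub>R f x))" using \<tau>' by simp
  also have "\<dots> \<le> ennreal \<tau> * modular \<Omega> p (\<lambda>x. (1 / \<tau>) *\<^sub>R f x)"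
  proof (rule modular_scale_le)
    show "\<tau> powr p x \<le> \<tau>" if "x \<in> \<Omega>" for x
      using powr_mono'[of 1 "p x" \<tau>] p_ge[OF that] \<tau> \<tau>' e by simp
  qed (use f \<tau>' in auto)
  also have "\<dots> \<le> ennreal \<tau> * 1" by (intro mult_left_mono \<tau>') auto
  also have "\<dots> \<le> ennreal e" using \<tau> by (simp add: ennreal_leI)
  finally show ?thesis .
qed

text \<open>For \<open>e \<le> 1\<close> scaling by \<open>1 / e\<close> multiplies the modular at most by \<open>(1 / e) powr P\<close>.\<close>

lemma luxemburg_le_of_modular:
  assumes f: "f \<in> borel_measurable (lebesgue_on \<Omega>)" and e: "0 < e" "e \<le> 1"
    and m: "modular \<Omega> p f \<le> ennreal (e powr P)"
  shows "luxemburg_norm \<Omega> p f \<le> e"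
proof -
  have "modular \<Omega> p (\<lambda>x. (1 / e) *\<^sub>R f x) \<le> ennreal ((1 / e) powr P) * modular \<Omega> p f"
    by (rule modular_scale_le[OF f]) (use e p_le in \<open>auto intro!: powr_mono simp: field_simps\<close>)
  also have "\<dots> \<le> ennreal ((1 / e) powr P) * ennreal (e powr P)" by (intro mult_left_mono m) auto
  also have "\<dots> = 1" using e by (simp add: ennreal_mult'[symmetric] powr_mult[symmetric])
  finally have "e \<in> lux_set f" unfolding lux_set_alt using e by blast
  then show ?thesis unfolding luxemburg_norm_def
    by (intro cInf_lower) (auto intro!: bdd_belowI[of _ 0])
qed

lemma luxemburg_tendsto_0:
  assumes f: "\<And>n. f n \<in> borel_measurable (lebesgue_on \<Omega>)" and m: "(\<lambda>n. modular \<Omega> p (f n)) \<longlonglongrightarrow> 0"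
  shows "(\<lambda>n. luxemburg_norm \<Omega> p (f n)) \<longlonglongrightarrow> 0"
proof -
  have *: "\<exists>N. \<forall>n\<ge>N. 0 \<le> luxemburg_norm \<Omega> p (f n) \<and> luxemburg_norm \<Omega> p (f n) \<le> e" if e: "0 < e" "e \<le> 1" for e
  proof -
    obtain N where N: "\<And>n. n \<ge> N \<Longrightarrow> modular \<Omega> p (f n) \<le> ennreal (e powr P)"
      using m e unfolding ennreal_tendsto_0_iff by (metis powr_gt_zero less_numeral_extra(3))
    have "0 \<le> luxemburg_norm \<Omega> p (f n) \<and> luxemburg_norm \<Omega> p (f n) \<le> e" if "n \<ge> N" for n
      using luxemburg_le_of_modular[OF f e N[OF that]] luxemburg_nonneg[OF f le_less_trans[OF N[OF that]]] by auto
    then show ?thesis by blast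
  qed
  show ?thesis
  proof (rule LIMSEQ_I)
    fix r :: real assume r: "0 < r"
    obtain N where "\<forall>n\<ge>N. 0 \<le> luxemburg_norm \<Omega> p (f n) \<and> luxemburg_norm \<Omega> p (f n) \<le> min 1 (r / 2)"
      using *[of "min 1 (r / 2)"] r by auto
    then show "\<exists>no. \<forall>n\<ge>no. norm (luxemburg_norm \<Omega> p (f n) - 0) < r"
      using r by (intro exI[of _ N]) force
  qed
qed

lemma L1_tendsto_0_of_modular:
  fixes f :: "nat \<Rightarrow> 'a \<Rightarrow> 'b::{real_normed_vector, second_countable_topology}"
  assumes [measurable]: "\<And>n. f n \<in> borel_measurable (lebesgue_on \<Omega>)"
    and 0: "(\<lambda>n. modular \<Omega> p (f n)) \<longlonglongrightarrow> 0"
  shows "(\<lambda>n. \<integral>\<^sup>+x. ennreal (norm (f n x)) \<partial>lebesgue_on \<Omega>) \<longlonglongrightarrow> 0"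
  unfolding ennreal_tendsto_0_iff
proof (intro allI impI)
  fix e :: real assume e: "0 < e"
  define \<eta> where "\<eta> = min 1 (e / (2 * (vol + 1)))"
  have v: "vol + 1 > 0" using vol by simp
  have \<eta>: "0 < \<eta>" "\<eta> \<le> 1" using e v by (auto simp: \<eta>_def)
  have "\<eta> * vol \<le> e / (2 * (vol + 1)) * (vol + 1)"
    using e v vol by (intro mult_mono) (auto simp: \<eta>_def)
  also have "\<dots> = e / 2" using v by (simp add: field_simps)
  finally have \<eta>v: "\<eta> * vol \<le> e / 2" .
  define k where "k = \<eta> powr (1 - P)"
  have k: "0 < k" using \<eta> by (simp add: k_def)
  obtain N where N: "\<And>n. n \<ge> N \<Longrightarrow> modular \<Omega> p (f n) \<le> ennreal (e / (2 * k))"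
    using 0 e k unfolding ennreal_tendsto_0_iff by (metis divide_pos_pos mult_pos_pos zero_less_numeral)
  have em: "emeasure (lebesgue_on \<Omega>) (space (lebesgue_on \<Omega>)) = ennreal vol"
    using open_\<Omega> vol by (simp add: emeasure_restrict_space)
  show "\<exists>N. \<forall>n\<ge>N. (\<integral>\<^sup>+x. ennreal (norm (f n x)) \<partial>lebesgue_on \<Omega>) \<le> ennreal e"
  proof (intro exI allI impI)
    fix n assume n: "n \<ge> N"
    have "(\<integral>\<^sup>+x. ennreal (norm (f n x)) \<partial>lebesgue_on \<Omega>) \<le> (\<integral>\<^sup>+x. ennreal \<eta> + ennreal k * ennreal (norm (f n x) powr p x) \<partial>lebesgue_on \<Omega>)"
    proof (rule nn_integral_mono)
      fix x assume "x \<in> space (lebesgue_on \<Omega>)"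
      then have x: "x \<in> \<Omega>" by simp
      show "ennreal (norm (f n x)) \<le> ennreal \<eta> + ennreal k * ennreal (norm (f n x) powr p x)"
        using le_eta_powr[OF norm_ge_zero \<eta> p_ge[OF x] p_le[OF x], of "f n x"] \<eta> k
        by (simp add: k_def ennreal_plus[symmetric] ennreal_mult'[symmetric] del: ennreal_plus)
    qed
    also have "\<dots> = ennreal \<eta> * ennreal vol + ennreal k * modular \<Omega> p (f n)"
      unfolding modular_def by (subst nn_integral_add) (auto simp: nn_integral_cmult em[unfolded space_restrict_space, simplified])
    also have "\<dots> \<le> ennreal \<eta> * ennreal vol + ennreal k * ennreal (e / (2 * k))"
      by (intro add_left_mono mult_left_mono N n) auto
    also have "\<dots> = ennreal (\<eta> * vol + e / 2)"
      using \<eta> vol k e by (simp add: ennreal_plus[symmetric] ennreal_mult'[symmetric] del: ennreal_plus)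
    also have "\<dots> \<le> ennreal e" using \<eta>v by (intro ennreal_leI) simp
    finally show "(\<integral>\<^sup>+x. ennreal (norm (f n x)) \<partial>lebesgue_on \<Omega>) \<le> ennreal e" .
  qed
qed

lemma integrable_of_modular:
  fixes f :: "'a \<Rightarrow> 'b::euclidean_space"
  assumes [measurable]: "f \<in> borel_measurable (lebesgue_on \<Omega>)" and fin: "modular \<Omega> p f < \<infinity>"
  shows "integrable (lebesgue_on \<Omega>) f" "integrable (lebesgue_on \<Omega>) (\<lambda>x. norm (f x) powr p x)"
    "locally_integrable \<Omega> f"
proof -
  interpret finite_measure "lebesgue_on \<Omega>" by (rule finite_measure_\<Omega>)
  show i: "integrable (lebesgue_on \<Omega>) (\<lambda>x. norm (f x) powr p x)"
    by (rule integrableI_nonneg) (use fin in \<open>auto simp: modular_def\<close>)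
  show i2: "integrable (lebesgue_on \<Omega>) f"
  proof (rule Bochner_Integration.integrable_bound)
    show "integrable (lebesgue_on \<Omega>) (\<lambda>x. 1 + norm (f x) powr p x)" using i by simp
    show "AE x in lebesgue_on \<Omega>. norm (f x) \<le> norm (1 + norm (f x) powr p x)"
    proof (rule AE_I2)
      fix x assume "x \<in> space (lebesgue_on \<Omega>)"
      then show "norm (f x) \<le> norm (1 + norm (f x) powr p x)"
        using le_one_plus_powr[of "norm (f x)" 1 "p x"] p_ge[of x] by simp
    qed
  qed measurable
  show "locally_integrable \<Omega> f"
    unfolding locally_integrable_def set_integrable_def
  proof (intro allI impI)
    fix K assume K: "compact K \<and> K \<subseteq> \<Omega>"
    have "integrable lebesgue (\<lambda>x. indicator \<Omega> x *\<^sub>R f x)"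
      using i2 open_\<Omega> by (subst (asm) integrable_restrict_space) (auto simp: Int_def)
    then have "integrable lebesgue (\<lambda>x. indicator K x *\<^sub>R (indicator \<Omega> x *\<^sub>R f x))"
      by (rule integrable_mult_indicator[rotated]) (use K in \<open>auto intro!: borel_compact\<close>)
    also have "(\<lambda>x. indicator K x *\<^sub>R (indicator \<Omega> x *\<^sub>R f x)) = (\<lambda>x. indicator K x *\<^sub>R f x)"
      using K by (auto simp: indicator_def fun_eq_iff)
    finally show "integrable lebesgue (\<lambda>x. indicator K x *\<^sub>R f x)" .
  qed
qed

text \<open>The defining identities involve integrals against bounded functions, which are continuous under convergence
in \<open>L\<^sup>1\<close> and hence under modular convergence.\<close>

lemma has_weak_gradient_limit:
  fixes G :: "'a \<Rightarrow> 'a"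
  assumes u: "\<And>n. has_weak_gradient \<Omega> (u n) (g n)"
    and v: "v \<in> borel_measurable (lebesgue_on \<Omega>)" "modular \<Omega> p v < \<infinity>"
    and G: "G \<in> borel_measurable (lebesgue_on \<Omega>)" "modular \<Omega> p G < \<infinity>"
    and uv: "(\<lambda>n. modular \<Omega> p (\<lambda>x. u n x - v x)) \<longlonglongrightarrow> 0"
    and gG: "(\<lambda>n. modular \<Omega> p (\<lambda>x. g n x - G x)) \<longlonglongrightarrow> 0"
  shows "has_weak_gradient \<Omega> v G"
  unfolding has_weak_gradient_def
proof (intro conjI ballI)
  show lv: "locally_integrable \<Omega> v" and lG: "locally_integrable \<Omega> G"
    using integrable_of_modular v G by auto
  have lu: "locally_integrable \<Omega> (u n)" "locally_integrable \<Omega> (g n)" for n using u by (auto simp: has_weak_gradient_def)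
  have um: "u n \<in> borel_measurable (lebesgue_on \<Omega>)" "g n \<in> borel_measurable (lebesgue_on \<Omega>)" for n
    using locally_integrable_measurable[OF open_\<Omega>] lu by auto
  have lim: "(\<lambda>n. LINT x|lebesgue_on \<Omega>. a n x * k x) \<longlonglongrightarrow> (LINT x|lebesgue_on \<Omega>. z x * k x)"
    if i: "\<And>n. integrable (lebesgue_on \<Omega>) (\<lambda>x. a n x * k x)" "integrable (lebesgue_on \<Omega>) (\<lambda>x. z x * k x)"
      and B: "\<And>x. \<bar>k x\<bar> \<le> B" and am: "\<And>n. a n \<in> borel_measurable (lebesgue_on \<Omega>)" "z \<in> borel_measurable (lebesgue_on \<Omega>)"
      and m: "(\<lambda>n. modular \<Omega> p (\<lambda>x. a n x - z x)) \<longlonglongrightarrow> 0" for a :: "nat \<Rightarrow> 'a \<Rightarrow> real" and z k B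
  proof (rule tendsto_L1_int)
    note [measurable] = am
    have B0: "0 \<le> B" using B[of undefined] abs_ge_zero order_trans by blast
    have "(\<lambda>n. \<integral>\<^sup>+x. ennreal (norm (a n x - z x)) \<partial>lebesgue_on \<Omega>) \<longlonglongrightarrow> 0"
      by (rule L1_tendsto_0_of_modular[OF _ m]) measurable
    then have l: "(\<lambda>n. ennreal B * (\<integral>\<^sup>+x. ennreal (norm (a n x - z x)) \<partial>lebesgue_on \<Omega>)) \<longlonglongrightarrow> ennreal B * 0"
      by (intro ennreal_tendsto_cmult) auto
    have le: "(\<integral>\<^sup>+x. ennreal (norm (a n x * k x - z x * k x)) \<partial>lebesgue_on \<Omega>) \<le> ennreal B * (\<integral>\<^sup>+x. ennreal (norm (a n x - z x)) \<partial>lebesgue_on \<Omega>)" for n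
    proof -
      have "(\<integral>\<^sup>+x. ennreal (norm (a n x * k x - z x * k x)) \<partial>lebesgue_on \<Omega>) \<le> (\<integral>\<^sup>+x. ennreal B * ennreal (norm (a n x - z x)) \<partial>lebesgue_on \<Omega>)"
      proof (rule nn_integral_mono)
        fix x
        have "norm (a n x * k x - z x * k x) = \<bar>k x\<bar> * norm (a n x - z x)"
          by (simp add: left_diff_distrib[symmetric] abs_mult)
        also have "\<dots> \<le> B * norm (a n x - z x)" using B by (intro mult_right_mono) auto
        finally show "ennreal (norm (a n x * k x - z x * k x)) \<le> ennreal B * ennreal (norm (a n x - z x))"
          using B0 by (simp only: ennreal_mult'[symmetric] ennreal_leI)
      qed
      also have "\<dots> = ennreal B * (\<integral>\<^sup>+x. ennreal (norm (a n x - z x)) \<partial>lebesgue_on \<Omega>)"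
        by (rule nn_integral_cmult) measurable
      finally show ?thesis .
    qed
    show "(\<lambda>n. \<integral>\<^sup>+x. ennreal (norm (a n x * k x - z x * k x)) \<partial>lebesgue_on \<Omega>) \<longlonglongrightarrow> 0"
      by (rule tendsto_sandwich[OF _ _ tendsto_const l[unfolded mult_zero_right]])
         (intro always_eventually allI le zero_le)+
  qed (use i in auto)
  fix \<psi> b assume \<psi>: "\<psi> \<in> test_functions \<Omega>" and b: "b \<in> (Basis :: 'a set)"
  obtain B where B: "\<And>x. \<bar>\<psi> x\<bar> \<le> B" "\<And>x. norm (grad \<psi> x) \<le> B" using test_function_bounded[OF \<psi>] by metis
  have fB: "\<bar>frechet_derivative \<psi> (at x) b\<bar> \<le> B" for x
    unfolding grad_inner_Basis[OF b, symmetric] using Basis_le_norm[OF b, of "grad \<psi> x"] B(2)[of x] by simp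
  note i = locally_integrable_test_mult[OF open_\<Omega> _ \<psi>]
  have 1: "(\<lambda>n. LINT x|lebesgue_on \<Omega>. u n x * frechet_derivative \<psi> (at x) b) \<longlonglongrightarrow> (LINT x|lebesgue_on \<Omega>. v x * frechet_derivative \<psi> (at x) b)"
    by (rule lim[OF i(2)[OF lu(1) b] i(2)[OF lv b] fB um(1) v(1) uv])
  have mb: "(\<lambda>n. modular \<Omega> p (\<lambda>x. g n x \<bullet> b - G x \<bullet> b)) \<longlonglongrightarrow> 0"
  proof (rule tendsto_sandwich[OF _ _ tendsto_const gG])
    show "\<forall>\<^sub>F n in sequentially. modular \<Omega> p (\<lambda>x. g n x \<bullet> b - G x \<bullet> b) \<le> modular \<Omega> p (\<lambda>x. g n x - G x)"
      unfolding modular_def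
    proof (intro always_eventually allI nn_integral_mono ennreal_leI)
      fix n x assume "x \<in> space (lebesgue_on \<Omega>)"
      then have "1 \<le> p x" using p_ge by simp
      then show "norm (g n x \<bullet> b - G x \<bullet> b) powr p x \<le> norm (g n x - G x) powr p x"
        using Basis_le_norm[OF b, of "g n x - G x"] by (intro powr_mono2) (auto simp: inner_diff_left)
    qed
  qed auto
  have 2: "(\<lambda>n. LINT x|lebesgue_on \<Omega>. (g n x \<bullet> b) * \<psi> x) \<longlonglongrightarrow> (LINT x|lebesgue_on \<Omega>. (G x \<bullet> b) * \<psi> x)"
    by (rule lim[OF i(1)[OF locally_integrable_inner[OF lu(2)]] i(1)[OF locally_integrable_inner[OF lG]] B(1) _ _ mb])
       (use um(2) G(1) in auto)
  have "(LINT x|lebesgue_on \<Omega>. u n x * frechet_derivative \<psi> (at x) b) = - (LINT x|lebesgue_on \<Omega>. (g n x \<bullet> b) * \<psi> x)" for n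
    using u[of n] \<psi> b by (auto simp: has_weak_gradient_def)
  with 1 have "(\<lambda>n. - (LINT x|lebesgue_on \<Omega>. (g n x \<bullet> b) * \<psi> x)) \<longlonglongrightarrow> (LINT x|lebesgue_on \<Omega>. v x * frechet_derivative \<psi> (at x) b)" by simp
  from LIMSEQ_unique[OF this tendsto_minus[OF 2]]
  show "(LINT x|lebesgue_on \<Omega>. v x * frechet_derivative \<psi> (at x) b) = - (LINT x|lebesgue_on \<Omega>. (G x \<bullet> b) * \<psi> x)" .
qed

section \<open>The Sobolev space of functions vanishing at the boundary\<close>

lemma modular_norm: "modular \<Omega> p (\<lambda>x. norm (f x)) = modular \<Omega> p f"
  by (simp add: modular_def)

lemma Lp_space_iff: "u \<in> Lp_space \<Omega> p \<longleftrightarrow> u \<in> borel_measurable (lebesgue_on \<Omega>) \<and> modular \<Omega> p u < \<infinity>"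
  by (simp add: Lp_space_def modular_def)

lemma weak_gradient_measurable:
  assumes "has_weak_gradient \<Omega> u g"
  shows "u \<in> borel_measurable (lebesgue_on \<Omega>)" "g \<in> borel_measurable (lebesgue_on \<Omega>)"
  using assms locally_integrable_measurable[OF open_\<Omega>] by (auto simp: has_weak_gradient_def)

lemma wgrad_diff_test_AE:
  assumes "has_weak_gradient \<Omega> u g" "\<phi> \<in> test_functions \<Omega>"
  shows "AE x in lebesgue_on \<Omega>. wgrad \<Omega> (\<lambda>x. u x - \<phi> x) x = g x - grad \<phi> x"
  by (rule wgrad_eq_AE[OF open_\<Omega> has_weak_gradient_diff[OF open_\<Omega> assms(1) has_weak_gradient_grad[OF open_\<Omega> assms(2)]]])

text \<open>Together with \<open>X_spaceD\<close> and \<open>X_space_approx\<close> this describes the space by modulars and an arbitrary weak gradient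
in place of norms and the chosen one.\<close>

lemma X_spaceI:
  assumes u: "modular \<Omega> p u < \<infinity>" and g: "has_weak_gradient \<Omega> u g" "modular \<Omega> p g < \<infinity>"
    and \<phi>: "\<And>n::nat. \<phi> n \<in> test_functions \<Omega>" "(\<lambda>n. modular \<Omega> p (\<lambda>x. u x - \<phi> n x)) \<longlonglongrightarrow> 0"
      "(\<lambda>n. modular \<Omega> p (\<lambda>x. g x - grad (\<phi> n) x)) \<longlonglongrightarrow> 0"
  shows "u \<in> X_space \<Omega> p"
proof -
  note um = weak_gradient_measurable[OF g(1)]
  note wg = has_weak_gradient_wgrad[OF g(1)]
  have "u \<in> W1p_space \<Omega> p"
    unfolding W1p_space_def mem_Collect_eq Lp_space_iff modular_norm modular_cong_AE[OF wgrad_eq_AE[OF open_\<Omega> g(1)]]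
    using um u g weak_gradient_measurable(2)[OF wg] by auto
  moreover have "\<exists>\<psi>\<in>test_functions \<Omega>. W1p_norm \<Omega> p (\<lambda>x. u x - \<psi> x) < e" if e: "0 < e" for e
  proof -
    have wd: "has_weak_gradient \<Omega> (\<lambda>x. u x - \<phi> n x) (wgrad \<Omega> (\<lambda>x. u x - \<phi> n x))" for n
      by (rule has_weak_gradient_wgrad[OF has_weak_gradient_diff[OF open_\<Omega> g(1) has_weak_gradient_grad[OF open_\<Omega> \<phi>(1)]]])
    have "(\<lambda>n. luxemburg_norm \<Omega> p (\<lambda>x. u x - \<phi> n x)) \<longlonglongrightarrow> 0"
      by (rule luxemburg_tendsto_0[OF weak_gradient_measurable(1)[OF wd] \<phi>(2)])
    moreover have "(\<lambda>n. luxemburg_norm \<Omega> p (\<lambda>x. norm (wgrad \<Omega> (\<lambda>x. u x - \<phi> n x) x))) \<longlonglongrightarrow> 0"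
    proof (rule luxemburg_tendsto_0)
      show "(\<lambda>x. norm (wgrad \<Omega> (\<lambda>x. u x - \<phi> n x) x)) \<in> borel_measurable (lebesgue_on \<Omega>)" for n
        using weak_gradient_measurable(2)[OF wd] by measurable
      show "(\<lambda>n. modular \<Omega> p (\<lambda>x. norm (wgrad \<Omega> (\<lambda>x. u x - \<phi> n x) x))) \<longlonglongrightarrow> 0"
        unfolding modular_norm modular_cong_AE[OF wgrad_diff_test_AE[OF g(1) \<phi>(1)]] by (rule \<phi>(3))
    qed
    ultimately have "(\<lambda>n. W1p_norm \<Omega> p (\<lambda>x. u x - \<phi> n x)) \<longlonglongrightarrow> 0 + 0"
      unfolding W1p_norm_def by (rule tendsto_add)
    then have "\<forall>\<^sub>F n in sequentially. W1p_norm \<Omega> p (\<lambda>x. u x - \<phi> n x) < e"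
      using order_tendstoD(2)[of _ "0 + 0" sequentially e] e by simp
    then show ?thesis using \<phi>(1) by (auto simp: eventually_sequentially)
  qed
  ultimately show ?thesis unfolding X_space_def by blast
qed

lemma X_spaceD:
  assumes u: "u \<in> X_space \<Omega> p"
  shows "has_weak_gradient \<Omega> u (wgrad \<Omega> u)" "modular \<Omega> p u < \<infinity>" "modular \<Omega> p (wgrad \<Omega> u) < \<infinity>"
    "u \<in> borel_measurable (lebesgue_on \<Omega>)" "wgrad \<Omega> u \<in> borel_measurable (lebesgue_on \<Omega>)"
proof -
  have W: "u \<in> W1p_space \<Omega> p" using u by (simp add: X_space_def)
  then show w: "has_weak_gradient \<Omega> u (wgrad \<Omega> u)" by (auto simp: W1p_space_def intro: has_weak_gradient_wgrad)
  show "modular \<Omega> p u < \<infinity>" "modular \<Omega> p (wgrad \<Omega> u) < \<infinity>"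
    using W unfolding W1p_space_def by (auto simp: Lp_space_iff modular_norm)
  show "u \<in> borel_measurable (lebesgue_on \<Omega>)" "wgrad \<Omega> u \<in> borel_measurable (lebesgue_on \<Omega>)"
    by (rule weak_gradient_measurable[OF w])+
qed

lemma modular_diff_finite:
  fixes f g :: "'a \<Rightarrow> 'b::{real_normed_vector, second_countable_topology}"
  assumes "f \<in> borel_measurable (lebesgue_on \<Omega>)" "g \<in> borel_measurable (lebesgue_on \<Omega>)"
    and "modular \<Omega> p f < \<infinity>" "modular \<Omega> p g < \<infinity>"
  shows "modular \<Omega> p (\<lambda>x. f x - g x) < \<infinity>"
proof -
  have "modular \<Omega> p (\<lambda>x. f x + - g x) \<le> ennreal (2 powr P) * (modular \<Omega> p f + modular \<Omega> p (\<lambda>x. - g x))"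
    by (rule modular_add_le) (use assms in measurable)
  also have "modular \<Omega> p (\<lambda>x. - g x) = modular \<Omega> p g" by (simp add: modular_def)
  also have "ennreal (2 powr P) * (modular \<Omega> p f + modular \<Omega> p g) < \<infinity>"
    using assms by (simp add: ennreal_mult_less_top)
  finally show ?thesis by simp
qed

lemma test_function_modular_finite:
  assumes \<phi>: "\<phi> \<in> test_functions \<Omega>"
  shows "modular \<Omega> p \<phi> < \<infinity>" "modular \<Omega> p (grad \<phi>) < \<infinity>"
proof -
  interpret finite_measure "lebesgue_on \<Omega>" by (rule finite_measure_\<Omega>)
  obtain B where B: "B > 0" "\<And>x. \<bar>\<phi> x\<bar> \<le> B" "\<And>x. norm (grad \<phi> x) \<le> B" using test_function_bounded[OF \<phi>] by metis
  have fin: "modular \<Omega> p f < \<infinity>" if "\<And>x. norm (f x) \<le> B" for f :: "'a \<Rightarrow> 'c::real_normed_vector"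
  proof -
    have "modular \<Omega> p f \<le> (\<integral>\<^sup>+x. ennreal ((max 1 B) powr P) \<partial>lebesgue_on \<Omega>)"
      unfolding modular_def
    proof (intro nn_integral_mono ennreal_leI)
      fix x assume "x \<in> space (lebesgue_on \<Omega>)"
      then have x: "x \<in> \<Omega>" by simp
      have "norm (f x) powr p x \<le> (max 1 B) powr p x"
        using that[of x] p_ge[OF x] by (intro powr_mono2) (auto simp: le_max_iff_disj)
      also have "\<dots> \<le> (max 1 B) powr P" using p_le[OF x] by (intro powr_mono) auto
      finally show "norm (f x) powr p x \<le> (max 1 B) powr P" .
    qed
    also have "\<dots> < \<infinity>" using emeasure_finite[of "space (lebesgue_on \<Omega>)"]
      unfolding nn_integral_const infinity_ennreal_def by (simp add: ennreal_mult_eq_top_iff less_top[symmetric])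
    finally show ?thesis .
  qed
  show "modular \<Omega> p \<phi> < \<infinity>" "modular \<Omega> p (grad \<phi>) < \<infinity>" by (rule fin, simp add: B)+
qed

lemma X_space_approx:
  assumes u: "u \<in> X_space \<Omega> p" and e: "0 < e"
  shows "\<exists>\<phi>\<in>test_functions \<Omega>. modular \<Omega> p (\<lambda>x. u x - \<phi> x) \<le> ennreal e \<and> modular \<Omega> p (\<lambda>x. wgrad \<Omega> u x - grad \<phi> x) \<le> ennreal e"
proof -
  note U = X_spaceD[OF u]
  define \<eta> where "\<eta> = min 1 e"
  have \<eta>: "0 < \<eta>" "\<eta> \<le> 1" "\<eta> \<le> e" using e by (auto simp: \<eta>_def)
  obtain \<phi> where \<phi>: "\<phi> \<in> test_functions \<Omega>" "W1p_norm \<Omega> p (\<lambda>x. u x - \<phi> x) < \<eta>"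
    using u \<eta>(1) unfolding X_space_def by blast
  note \<phi>m = test_function_measurable_on[OF \<phi>(1)] test_function_modular_finite[OF \<phi>(1)]
  have ae: "AE x in lebesgue_on \<Omega>. wgrad \<Omega> (\<lambda>x. u x - \<phi> x) x = wgrad \<Omega> u x - grad \<phi> x"
    by (rule wgrad_diff_test_AE[OF U(1) \<phi>(1)])
  have wd: "has_weak_gradient \<Omega> (\<lambda>x. u x - \<phi> x) (wgrad \<Omega> (\<lambda>x. u x - \<phi> x))"
    by (rule has_weak_gradient_wgrad[OF has_weak_gradient_diff[OF open_\<Omega> U(1) has_weak_gradient_grad[OF open_\<Omega> \<phi>(1)]]])
  note dm = weak_gradient_measurable[OF wd]
  have f1: "modular \<Omega> p (\<lambda>x. u x - \<phi> x) < \<infinity>"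
    by (rule modular_diff_finite) (use U \<phi>m in auto)
  have f2: "modular \<Omega> p (\<lambda>x. wgrad \<Omega> u x - grad \<phi> x) < \<infinity>"
    by (rule modular_diff_finite) (use U \<phi>m in auto)
  let ?n = "\<lambda>x. norm (wgrad \<Omega> (\<lambda>x. u x - \<phi> x) x)"
  have nm: "?n \<in> borel_measurable (lebesgue_on \<Omega>)" using dm(2) by measurable
  have f3: "modular \<Omega> p ?n = modular \<Omega> p (\<lambda>x. wgrad \<Omega> u x - grad \<phi> x)"
    unfolding modular_norm by (rule modular_cong_AE[OF ae])
  have "0 \<le> luxemburg_norm \<Omega> p (\<lambda>x. u x - \<phi> x)" by (rule luxemburg_nonneg[OF dm(1) f1])
  moreover have "0 \<le> luxemburg_norm \<Omega> p ?n" by (rule luxemburg_nonneg[OF nm]) (use f2 f3 in simp)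
  ultimately have l: "luxemburg_norm \<Omega> p (\<lambda>x. u x - \<phi> x) < \<eta>" "luxemburg_norm \<Omega> p ?n < \<eta>"
    using \<phi>(2) unfolding W1p_norm_def by linarith+
  have "modular \<Omega> p (\<lambda>x. u x - \<phi> x) \<le> ennreal \<eta>" by (rule modular_le_of_luxemburg[OF dm(1) f1 l(1) \<eta>(2)])
  moreover have "modular \<Omega> p (\<lambda>x. wgrad \<Omega> u x - grad \<phi> x) \<le> ennreal \<eta>"
    unfolding f3[symmetric] by (rule modular_le_of_luxemburg[OF nm _ l(2) \<eta>(2)]) (use f2 f3 in simp)
  ultimately show ?thesis using \<phi>(1) \<eta>(3) by (meson ennreal_leI order_trans)
qed

lemma X_space_approx_each:
  fixes u :: "nat \<Rightarrow> 'a \<Rightarrow> real"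
  assumes u: "\<And>n. u n \<in> X_space \<Omega> p"
  obtains \<phi> where "\<And>n. \<phi> n \<in> test_functions \<Omega>"
    "\<And>n. modular \<Omega> p (\<lambda>x. u n x - \<phi> n x) \<le> ennreal (inverse (real (Suc n)))"
    "\<And>n. modular \<Omega> p (\<lambda>x. wgrad \<Omega> (u n) x - grad (\<phi> n) x) \<le> ennreal (inverse (real (Suc n)))"
proof -
  have "\<exists>\<phi>. \<phi> \<in> test_functions \<Omega> \<and> modular \<Omega> p (\<lambda>x. u n x - \<phi> x) \<le> ennreal (inverse (real (Suc n))) \<and>
      modular \<Omega> p (\<lambda>x. wgrad \<Omega> (u n) x - grad \<phi> x) \<le> ennreal (inverse (real (Suc n)))" for n
    using X_space_approx[OF u, of "inverse (real (Suc n))"] by auto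
  then show ?thesis using that by metis
qed

lemma ennreal_inverse_Suc:
  "(\<lambda>n. ennreal (inverse (real (Suc n)))) \<longlonglongrightarrow> 0" "ennreal (inverse (real (Suc n))) \<le> 1"
proof -
  show "(\<lambda>n. ennreal (inverse (real (Suc n)))) \<longlonglongrightarrow> 0"
    using tendsto_ennrealI[OF LIMSEQ_inverse_real_of_nat] by simp
  show "ennreal (inverse (real (Suc n))) \<le> 1"
    by (subst ennreal_1[symmetric], rule ennreal_leI) (simp add: field_simps)
qed

lemma X_space_approx_seq:
  assumes u: "u \<in> X_space \<Omega> p"
  obtains \<phi> :: "nat \<Rightarrow> 'a \<Rightarrow> real" where "\<And>n. \<phi> n \<in> test_functions \<Omega>"
    "(\<lambda>n. modular \<Omega> p (\<lambda>x. u x - \<phi> n x)) \<longlonglongrightarrow> 0" "(\<lambda>n. modular \<Omega> p (\<lambda>x. wgrad \<Omega> u x - grad (\<phi> n) x)) \<longlonglongrightarrow> 0"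
    "\<And>n. modular \<Omega> p (\<lambda>x. u x - \<phi> n x) \<le> 1" "\<And>n. modular \<Omega> p (\<lambda>x. wgrad \<Omega> u x - grad (\<phi> n) x) \<le> 1"
proof -
  obtain \<phi> where \<phi>: "\<And>n. \<phi> n \<in> test_functions \<Omega>"
    "\<And>n. modular \<Omega> p (\<lambda>x. u x - \<phi> n x) \<le> ennreal (inverse (real (Suc n)))"
    "\<And>n. modular \<Omega> p (\<lambda>x. wgrad \<Omega> u x - grad (\<phi> n) x) \<le> ennreal (inverse (real (Suc n)))"
    by (rule X_space_approx_each[of "\<lambda>_. u", OF u]) blast
  have z: "f \<longlonglongrightarrow> 0" if "\<And>n. f n \<le> ennreal (inverse (real (Suc n)))" for f
    by (rule tendsto_sandwich[OF _ _ tendsto_const ennreal_inverse_Suc(1)]) (intro always_eventually allI that zero_le)+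
  show ?thesis
    by (rule that[OF \<phi>(1) z[OF \<phi>(2)] z[OF \<phi>(3)] order_trans[OF \<phi>(2) ennreal_inverse_Suc(2)] order_trans[OF \<phi>(3) ennreal_inverse_Suc(2)]])
qed

text \<open>Completeness of the space, given limits of the functions and of their gradients.\<close>

lemma X_space_limit:
  fixes G :: "'a \<Rightarrow> 'a"
  assumes u: "\<And>n. u n \<in> X_space \<Omega> p"
    and v: "v \<in> borel_measurable (lebesgue_on \<Omega>)" and G: "G \<in> borel_measurable (lebesgue_on \<Omega>)"
    and uv: "(\<lambda>n. modular \<Omega> p (\<lambda>x. u n x - v x)) \<longlonglongrightarrow> 0"
    and gG: "(\<lambda>n. modular \<Omega> p (\<lambda>x. wgrad \<Omega> (u n) x - G x)) \<longlonglongrightarrow> 0"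
  shows "v \<in> X_space \<Omega> p" "has_weak_gradient \<Omega> v G"
proof -
  note U = X_spaceD[OF u]
  have fin: "modular \<Omega> p z < \<infinity>" if z: "z \<in> borel_measurable (lebesgue_on \<Omega>)" and a: "\<And>n. a n \<in> borel_measurable (lebesgue_on \<Omega>)"
      "\<And>n. modular \<Omega> p (a n) < \<infinity>" and l: "(\<lambda>n. modular \<Omega> p (\<lambda>x. a n x - z x)) \<longlonglongrightarrow> 0"
    for z and a :: "nat \<Rightarrow> 'a \<Rightarrow> 'c::{real_normed_vector, second_countable_topology}"
  proof -
    obtain N where "modular \<Omega> p (\<lambda>x. a N x - z x) \<le> ennreal 1" using l unfolding ennreal_tendsto_0_iff by (metis order_refl zero_less_one)
    then have "modular \<Omega> p (\<lambda>x. a N x - z x) < \<infinity>" by (rule le_less_trans) simp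
    then have "modular \<Omega> p (\<lambda>x. a N x - (a N x - z x)) < \<infinity>"
      by (rule modular_diff_finite[OF a(1) borel_measurable_diff[OF a(1) z] a(2)])
    then show ?thesis by simp
  qed
  have vf: "modular \<Omega> p v < \<infinity>" by (rule fin[OF v U(4,2) uv])
  have Gf: "modular \<Omega> p G < \<infinity>" by (rule fin[OF G U(5,3) gG])
  show wg: "has_weak_gradient \<Omega> v G"
    by (rule has_weak_gradient_limit[OF U(1) v vf G Gf uv gG])
  obtain \<phi> where \<phi>: "\<And>n. \<phi> n \<in> test_functions \<Omega>"
    "\<And>n. modular \<Omega> p (\<lambda>x. u n x - \<phi> n x) \<le> ennreal (inverse (real (Suc n)))"
    "\<And>n. modular \<Omega> p (\<lambda>x. wgrad \<Omega> (u n) x - grad (\<phi> n) x) \<le> ennreal (inverse (real (Suc n)))"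
    by (rule X_space_approx_each[of u, OF u]) blast
  have conv: "(\<lambda>n. modular \<Omega> p (\<lambda>x. z x - b n x)) \<longlonglongrightarrow> 0"
    if z: "z \<in> borel_measurable (lebesgue_on \<Omega>)" and a: "\<And>n. a n \<in> borel_measurable (lebesgue_on \<Omega>)" and b: "\<And>n. b n \<in> borel_measurable (lebesgue_on \<Omega>)"
      and az: "(\<lambda>n. modular \<Omega> p (\<lambda>x. a n x - z x)) \<longlonglongrightarrow> 0"
      and ab: "\<And>n. modular \<Omega> p (\<lambda>x. a n x - b n x) \<le> ennreal (inverse (real (Suc n)))"
    for z and a b :: "nat \<Rightarrow> 'a \<Rightarrow> 'c::{real_normed_vector, second_countable_topology}"
  proof -
    have le: "modular \<Omega> p (\<lambda>x. z x - b n x) \<le> ennreal (2 powr P) * (modular \<Omega> p (\<lambda>x. a n x - z x) + ennreal (inverse (real (Suc n))))" for n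
    proof -
      have "modular \<Omega> p (\<lambda>x. (z x - a n x) + (a n x - b n x)) \<le> ennreal (2 powr P) * (modular \<Omega> p (\<lambda>x. z x - a n x) + modular \<Omega> p (\<lambda>x. a n x - b n x))"
        by (intro modular_add_le borel_measurable_diff z a b)
      also have "\<dots> \<le> ennreal (2 powr P) * (modular \<Omega> p (\<lambda>x. a n x - z x) + ennreal (inverse (real (Suc n))))"
        unfolding modular_diff_commute[of z] by (intro mult_left_mono add_left_mono ab) auto
      finally show ?thesis by simp
    qed
    have "(\<lambda>n. ennreal (2 powr P) * (modular \<Omega> p (\<lambda>x. a n x - z x) + ennreal (inverse (real (Suc n))))) \<longlonglongrightarrow> ennreal (2 powr P) * (0 + 0)"
      by (intro ennreal_tendsto_cmult tendsto_add az ennreal_inverse_Suc(1)) auto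
    then have "(\<lambda>n. ennreal (2 powr P) * (modular \<Omega> p (\<lambda>x. a n x - z x) + ennreal (inverse (real (Suc n))))) \<longlonglongrightarrow> 0" by simp
    then show ?thesis
      by (rule tendsto_sandwich[OF _ _ tendsto_const, rotated 2]) (intro always_eventually allI le zero_le)+
  qed
  show "v \<in> X_space \<Omega> p"
    by (rule X_spaceI[OF vf wg Gf \<phi>(1) conv[OF v U(4) test_function_measurable_on(1)[OF \<phi>(1)] uv \<phi>(2)]
          conv[OF G U(5) test_function_measurable_on(2)[OF \<phi>(1)] gG \<phi>(3)]])
qed

lemma X_space_diff:
  assumes u: "u \<in> X_space \<Omega> p" and v: "v \<in> X_space \<Omega> p"
  shows "(\<lambda>x. u x - v x) \<in> X_space \<Omega> p"
    "AE x in lebesgue_on \<Omega>. wgrad \<Omega> (\<lambda>x. u x - v x) x = wgrad \<Omega> u x - wgrad \<Omega> v x"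
proof -
  note U = X_spaceD[OF u] and V = X_spaceD[OF v]
  have wg: "has_weak_gradient \<Omega> (\<lambda>x. u x - v x) (\<lambda>x. wgrad \<Omega> u x - wgrad \<Omega> v x)"
    by (rule has_weak_gradient_diff[OF open_\<Omega> U(1) V(1)])
  show "AE x in lebesgue_on \<Omega>. wgrad \<Omega> (\<lambda>x. u x - v x) x = wgrad \<Omega> u x - wgrad \<Omega> v x"
    by (rule wgrad_eq_AE[OF open_\<Omega> wg])
  obtain \<phi> where \<phi>: "\<And>n::nat. \<phi> n \<in> test_functions \<Omega>"
    "(\<lambda>n. modular \<Omega> p (\<lambda>x. u x - \<phi> n x)) \<longlonglongrightarrow> 0" "(\<lambda>n. modular \<Omega> p (\<lambda>x. wgrad \<Omega> u x - grad (\<phi> n) x)) \<longlonglongrightarrow> 0"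
    by (rule X_space_approx_seq[OF u]) blast
  obtain \<psi> where \<psi>: "\<And>n::nat. \<psi> n \<in> test_functions \<Omega>"
    "(\<lambda>n. modular \<Omega> p (\<lambda>x. v x - \<psi> n x)) \<longlonglongrightarrow> 0" "(\<lambda>n. modular \<Omega> p (\<lambda>x. wgrad \<Omega> v x - grad (\<psi> n) x)) \<longlonglongrightarrow> 0"
    by (rule X_space_approx_seq[OF v]) blast
  have conv: "(\<lambda>n. modular \<Omega> p (\<lambda>x. (a x - b x) - (s n x - t n x))) \<longlonglongrightarrow> 0"
    if [measurable]: "a \<in> borel_measurable (lebesgue_on \<Omega>)" "b \<in> borel_measurable (lebesgue_on \<Omega>)"
        "\<And>n. s n \<in> borel_measurable (lebesgue_on \<Omega>)" "\<And>n. t n \<in> borel_measurable (lebesgue_on \<Omega>)"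
      and as: "(\<lambda>n. modular \<Omega> p (\<lambda>x. a x - s n x)) \<longlonglongrightarrow> 0" and bt: "(\<lambda>n. modular \<Omega> p (\<lambda>x. b x - t n x)) \<longlonglongrightarrow> 0"
    for a b and s t :: "nat \<Rightarrow> 'a \<Rightarrow> 'c::{real_normed_vector, second_countable_topology}"
  proof -
    have le: "modular \<Omega> p (\<lambda>x. (a x - b x) - (s n x - t n x)) \<le> ennreal (2 powr P) * (modular \<Omega> p (\<lambda>x. a x - s n x) + modular \<Omega> p (\<lambda>x. b x - t n x))" for n
    proof -
      have "modular \<Omega> p (\<lambda>x. (a x - b x) - (s n x - t n x)) = modular \<Omega> p (\<lambda>x. (a x - s n x) + (t n x - b x))"
        by (simp add: algebra_simps)
      also have "\<dots> \<le> ennreal (2 powr P) * (modular \<Omega> p (\<lambda>x. a x - s n x) + modular \<Omega> p (\<lambda>x. t n x - b x))"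
        by (rule modular_add_le) measurable
      finally show ?thesis unfolding modular_diff_commute[of "t n"] .
    qed
    have "(\<lambda>n. ennreal (2 powr P) * (modular \<Omega> p (\<lambda>x. a x - s n x) + modular \<Omega> p (\<lambda>x. b x - t n x))) \<longlonglongrightarrow> ennreal (2 powr P) * (0 + 0)"
      by (intro ennreal_tendsto_cmult tendsto_add as bt) auto
    then have "(\<lambda>n. ennreal (2 powr P) * (modular \<Omega> p (\<lambda>x. a x - s n x) + modular \<Omega> p (\<lambda>x. b x - t n x))) \<longlonglongrightarrow> 0" by simp
    then show ?thesis
      by (rule tendsto_sandwich[OF _ _ tendsto_const, rotated 2]) (intro always_eventually allI le zero_le)+
  qed
  have 1: "(\<lambda>n. modular \<Omega> p (\<lambda>x. (wgrad \<Omega> u x - wgrad \<Omega> v x) - grad (\<lambda>x. \<phi> n x - \<psi> n x) x)) \<longlonglongrightarrow> 0"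
    unfolding grad_diff[OF \<phi>(1) \<psi>(1)]
    by (rule conv[OF U(5) V(5) test_function_measurable_on(2)[OF \<phi>(1)] test_function_measurable_on(2)[OF \<psi>(1)] \<phi>(3) \<psi>(3)])
  have 2: "(\<lambda>n. modular \<Omega> p (\<lambda>x. (u x - v x) - (\<phi> n x - \<psi> n x))) \<longlonglongrightarrow> 0"
    by (rule conv[OF U(4) V(4) test_function_measurable_on(1)[OF \<phi>(1)] test_function_measurable_on(1)[OF \<psi>(1)] \<phi>(2) \<psi>(2)])
  show "(\<lambda>x. u x - v x) \<in> X_space \<Omega> p"
    by (rule X_spaceI[OF modular_diff_finite[OF U(4) V(4) U(2) V(2)] wg modular_diff_finite[OF U(5) V(5) U(3) V(3)]
          test_functions_diff[OF \<phi>(1) \<psi>(1)] 2 1])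
qed

lemma modular_le_of_near:
  fixes f g :: "'a \<Rightarrow> 'b::{real_normed_vector, second_countable_topology}"
  assumes [measurable]: "f \<in> borel_measurable (lebesgue_on \<Omega>)" "g \<in> borel_measurable (lebesgue_on \<Omega>)"
    and f: "modular \<Omega> p f \<le> ennreal M" and d: "modular \<Omega> p (\<lambda>x. f x - g x) \<le> 1" and M: "0 \<le> M"
  shows "modular \<Omega> p g \<le> ennreal (2 powr P * (M + 1))"
proof -
  have "modular \<Omega> p (\<lambda>x. f x + (g x - f x)) \<le> ennreal (2 powr P) * (modular \<Omega> p f + modular \<Omega> p (\<lambda>x. g x - f x))"
    by (rule modular_add_le) measurable
  also have "\<dots> \<le> ennreal (2 powr P) * (ennreal M + ennreal 1)"
    using d unfolding modular_diff_commute[of g] by (intro mult_left_mono add_mono f) auto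
  also have "\<dots> = ennreal (2 powr P * (M + 1))"
    using M by (simp only: ennreal_plus[symmetric] ennreal_mult'[symmetric] powr_ge_zero zero_le_one)
  finally show ?thesis by simp
qed

text \<open>Replace each function by a test function within distance \<open>1 / (n + 1)\<close>.\<close>

lemma X_space_compact:
  fixes u :: "nat \<Rightarrow> 'a \<Rightarrow> real"
  assumes M: "0 \<le> M" and u: "\<And>n. u n \<in> X_space \<Omega> p"
    and b: "\<And>n. modular \<Omega> p (u n) \<le> ennreal M" "\<And>n. modular \<Omega> p (wgrad \<Omega> (u n)) \<le> ennreal M"
  obtains r where "strict_mono (r :: nat \<Rightarrow> nat)"
    "\<And>e. 0 < e \<Longrightarrow> \<exists>N. \<forall>m\<ge>N. \<forall>n\<ge>N. modular \<Omega> p (\<lambda>x. u (r m) x - u (r n) x) \<le> ennreal e"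
proof -
  note U = X_spaceD[OF u]
  obtain \<phi> where \<phi>: "\<And>n. \<phi> n \<in> test_functions \<Omega>"
    "\<And>n. modular \<Omega> p (\<lambda>x. u n x - \<phi> n x) \<le> ennreal (inverse (real (Suc n)))"
    "\<And>n. modular \<Omega> p (\<lambda>x. wgrad \<Omega> (u n) x - grad (\<phi> n) x) \<le> ennreal (inverse (real (Suc n)))"
    by (rule X_space_approx_each[of u, OF u]) blast
  note T = test_function_measurable_on[OF \<phi>(1)]
  define M' where "M' = 2 powr P * (M + 1)"
  have M': "0 \<le> M'" using M by (simp add: M'_def)
  have m1: "modular \<Omega> p (\<phi> n) \<le> ennreal M'" for n
    unfolding M'_def by (rule modular_le_of_near[OF U(4) T(1) b(1) order_trans[OF \<phi>(2) ennreal_inverse_Suc(2)] M])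
  have m2: "modular \<Omega> p (grad (\<phi> n)) \<le> ennreal M'" for n
    unfolding M'_def by (rule modular_le_of_near[OF U(5) T(2) b(2) order_trans[OF \<phi>(3) ennreal_inverse_Suc(2)] M])
  obtain r where r: "strict_mono (r :: nat \<Rightarrow> nat)"
    "\<And>e. 0 < e \<Longrightarrow> \<exists>N. \<forall>m\<ge>N. \<forall>n\<ge>N. modular \<Omega> p (\<lambda>x. \<phi> (r m) x - \<phi> (r n) x) \<le> ennreal e"
    by (rule test_functions_compact[of M' \<phi>, OF M' \<phi>(1) m1 m2]) blast
  show ?thesis
  proof (rule that[OF r(1)])
    fix e :: real assume e: "0 < e"
    define c where "c = 2 powr P"
    have c: "0 < c" by (simp add: c_def)
    define \<eta> where "\<eta> = e / (c + 2 * (c * c))"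
    have \<eta>: "0 < \<eta>" using e c by (simp add: \<eta>_def add_pos_pos)
    obtain N1 where N1: "\<And>m n. m \<ge> N1 \<Longrightarrow> n \<ge> N1 \<Longrightarrow> modular \<Omega> p (\<lambda>x. \<phi> (r m) x - \<phi> (r n) x) \<le> ennreal \<eta>"
      using r(2)[OF \<eta>] by blast
    obtain N2 where N2: "inverse (real (Suc N2)) < \<eta>" using reals_Archimedean[OF \<eta>] by blast
    have near: "modular \<Omega> p (\<lambda>x. u (r n) x - \<phi> (r n) x) \<le> ennreal \<eta>" if "n \<ge> N2" for n
    proof -
      have "r n \<ge> N2" using seq_suble[OF r(1), of n] that by simp
      then have "inverse (real (Suc (r n))) \<le> inverse (real (Suc N2))" by (intro le_imp_inverse_le) auto
      then show ?thesis using \<phi>(2)[of "r n"] N2 by (meson ennreal_leI less_imp_le order_trans)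
    qed
    show "\<exists>N. \<forall>m\<ge>N. \<forall>n\<ge>N. modular \<Omega> p (\<lambda>x. u (r m) x - u (r n) x) \<le> ennreal e"
    proof (intro exI allI impI)
      fix m n assume "m \<ge> max N1 N2" "n \<ge> max N1 N2"
      then have mn: "m \<ge> N1" "m \<ge> N2" "n \<ge> N1" "n \<ge> N2" by auto
      have "modular \<Omega> p (\<lambda>x. u (r m) x - u (r n) x) = modular \<Omega> p (\<lambda>x. (u (r m) x - \<phi> (r m) x) + ((\<phi> (r m) x - \<phi> (r n) x) + (\<phi> (r n) x - u (r n) x)))"
        by simp
      also have "\<dots> \<le> ennreal c * (modular \<Omega> p (\<lambda>x. u (r m) x - \<phi> (r m) x) + modular \<Omega> p (\<lambda>x. (\<phi> (r m) x - \<phi> (r n) x) + (\<phi> (r n) x - u (r n) x)))"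
        unfolding c_def by (intro modular_add_le borel_measurable_diff borel_measurable_add U T)
      also have "\<dots> \<le> ennreal c * (modular \<Omega> p (\<lambda>x. u (r m) x - \<phi> (r m) x) + ennreal c * (modular \<Omega> p (\<lambda>x. \<phi> (r m) x - \<phi> (r n) x) + modular \<Omega> p (\<lambda>x. \<phi> (r n) x - u (r n) x)))"
        unfolding c_def by (intro mult_left_mono add_left_mono modular_add_le borel_measurable_diff borel_measurable_add U T) auto
      also have "\<dots> \<le> ennreal c * (ennreal \<eta> + ennreal c * (ennreal \<eta> + ennreal \<eta>))"
        unfolding modular_diff_commute[of "\<phi> (r n)" "u (r n)"] using mn
        by (intro mult_left_mono add_mono near N1) auto
      also have "\<dots> = ennreal (c * (\<eta> + c * (\<eta> + \<eta>)))"
        using c \<eta> by (simp add: ennreal_plus[symmetric] ennreal_mult'[symmetric] del: ennreal_plus)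
      also have "c * (\<eta> + c * (\<eta> + \<eta>)) = \<eta> * (c + 2 * (c * c))" by (simp add: algebra_simps)
      also have "\<dots> = e" unfolding \<eta>_def using c by (simp add: add_pos_pos less_imp_neq[THEN not_sym])
      finally show "modular \<Omega> p (\<lambda>x. u (r m) x - u (r n) x) \<le> ennreal e" .
    qed
  qed
qed

text \<open>Approximating test functions satisfy Hardy's inequality with one constant, and a subsequence converges almost everywhere;
apply Fatou's lemma.\<close>

lemma X_space_hardy:
  assumes dom: "bounded_lipschitz_domain \<Omega>" and q: "1 < q" "\<And>x. x \<in> \<Omega> \<Longrightarrow> q \<le> p x"
    and u: "u \<in> X_space \<Omega> p"
  shows "modular \<Omega> p (\<lambda>x. u x / bdist \<Omega> x) < \<infinity>"
proof -
  note U = X_spaceD[OF u]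
  obtain \<phi> where \<phi>: "\<And>n::nat. \<phi> n \<in> test_functions \<Omega>"
    "(\<lambda>n. modular \<Omega> p (\<lambda>x. u x - \<phi> n x)) \<longlonglongrightarrow> 0"
    "\<And>n. modular \<Omega> p (\<lambda>x. u x - \<phi> n x) \<le> 1" "\<And>n. modular \<Omega> p (\<lambda>x. wgrad \<Omega> u x - grad (\<phi> n) x) \<le> 1"
    by (rule X_space_approx_seq[OF u]) blast
  note T = test_function_measurable_on[OF \<phi>(1)]
  note [measurable] = U(4) T(1)
  obtain M where M: "0 \<le> M" "modular \<Omega> p u \<le> ennreal M" "modular \<Omega> p (wgrad \<Omega> u) \<le> ennreal M"
  proof -
    have fin: "\<exists>a\<ge>0. y = ennreal a" if "y < \<infinity>" for y using that by (cases y) auto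
    obtain a b where "modular \<Omega> p u = ennreal a" "0 \<le> a" "modular \<Omega> p (wgrad \<Omega> u) = ennreal b" "0 \<le> b"
      using fin[OF U(2)] fin[OF U(3)] by blast
    then show ?thesis using that[of "max a b"] by (auto simp: ennreal_leI le_max_iff_disj)
  qed
  define M' where "M' = 2 powr P * (M + 1)"
  have M': "0 \<le> M'" using M by (simp add: M'_def)
  have m: "modular \<Omega> p (\<phi> n) \<le> ennreal M'" "modular \<Omega> p (grad (\<phi> n)) \<le> ennreal M'" for n
    unfolding M'_def using modular_le_of_near[OF U(4) T(1) M(2) \<phi>(3) M(1)] modular_le_of_near[OF U(5) T(2) M(3) \<phi>(4) M(1)] by auto
  obtain CH where CH: "0 \<le> CH" "\<And>\<phi>. \<lbrakk>\<phi> \<in> test_functions \<Omega>; modular \<Omega> p \<phi> \<le> ennreal M'; modular \<Omega> p (grad \<phi>) \<le> ennreal M'\<rbrakk> \<Longrightarrow>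
     modular \<Omega> p (\<lambda>x. \<phi> x / bdist \<Omega> x) \<le> ennreal CH"
    using hardy_test_functions[OF dom q M'] by metis
  have i: "integrable (lebesgue_on \<Omega>) (\<lambda>x. u x - \<phi> n x)" for n
    by (rule integrable_of_modular(1)) (use \<phi>(3)[of n] in \<open>auto intro: le_less_trans\<close>)
  have "(\<lambda>n. \<integral>\<^sup>+x. ennreal (norm (u x - \<phi> n x)) \<partial>lebesgue_on \<Omega>) \<longlonglongrightarrow> 0"
    by (rule L1_tendsto_0_of_modular[OF _ \<phi>(2)]) measurable
  then have "(\<lambda>n. ennreal (\<integral>x. norm (u x - \<phi> n x) \<partial>lebesgue_on \<Omega>)) \<longlonglongrightarrow> ennreal 0"
    using nn_integral_eq_integral[OF integrable_norm[OF i]] by simp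
  then have "(\<lambda>n. \<integral>x. norm (u x - \<phi> n x) \<partial>lebesgue_on \<Omega>) \<longlonglongrightarrow> 0"
    by (subst (asm) tendsto_ennreal_iff) (auto intro!: always_eventually integral_nonneg_AE)
  then obtain r where r: "strict_mono (r :: nat \<Rightarrow> nat)" "AE x in lebesgue_on \<Omega>. (\<lambda>n. u x - \<phi> (r n) x) \<longlonglongrightarrow> 0"
    using tendsto_L1_AE_subseq[of "lebesgue_on \<Omega>" "\<lambda>n x. u x - \<phi> n x", OF i] by blast
  have [measurable]: "bdist \<Omega> \<in> borel_measurable (lebesgue_on \<Omega>)"
  proof -
    have "bdist \<Omega> \<in> borel_measurable borel" unfolding bdist_def
      by (intro borel_measurable_continuous_onI continuous_intros)
    then show ?thesis by (intro measurable_restrict_space1 measurable_completion) simp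
  qed
  let ?f = "\<lambda>n x. ennreal (norm (\<phi> (r n) x / bdist \<Omega> x) powr p x)"
  have "modular \<Omega> p (\<lambda>x. u x / bdist \<Omega> x) = (\<integral>\<^sup>+x. liminf (\<lambda>n. ?f n x) \<partial>lebesgue_on \<Omega>)"
    unfolding modular_def
  proof (rule nn_integral_cong_AE)
    have "AE x in lebesgue_on \<Omega>. x \<in> \<Omega>" by (rule AE_I2) simp
    with r(2) show "AE x in lebesgue_on \<Omega>. ennreal (norm (u x / bdist \<Omega> x) powr p x) = liminf (\<lambda>n. ?f n x)"
    proof eventually_elim
      case (elim x)
      have "(\<lambda>n. u x - (u x - \<phi> (r n) x)) \<longlonglongrightarrow> u x - 0" by (intro tendsto_intros elim)
      then have "(\<lambda>n. \<phi> (r n) x / bdist \<Omega> x) \<longlonglongrightarrow> u x / bdist \<Omega> x"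
        unfolding divide_inverse by (intro tendsto_mult tendsto_const) simp
      then have "(\<lambda>n. norm (\<phi> (r n) x / bdist \<Omega> x) powr p x) \<longlonglongrightarrow> norm (u x / bdist \<Omega> x) powr p x"
        using p_ge[OF elim(2)] by (intro tendsto_powr' tendsto_norm tendsto_const) auto
      then have "(\<lambda>n. ?f n x) \<longlonglongrightarrow> ennreal (norm (u x / bdist \<Omega> x) powr p x)"
        by (rule tendsto_ennrealI)
      then show ?case by (rule lim_imp_Liminf[OF trivial_limit_sequentially, symmetric])
    qed
  qed
  also have "\<dots> \<le> liminf (\<lambda>n. \<integral>\<^sup>+x. ?f n x \<partial>lebesgue_on \<Omega>)"
    by (rule nn_integral_liminf) measurable
  also have "\<dots> \<le> liminf (\<lambda>n. ennreal CH)"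
    by (intro Liminf_mono always_eventually allI) (use CH(2)[OF \<phi>(1) m] in \<open>simp add: modular_def\<close>)
  also have "\<dots> = ennreal CH" by (simp add: Liminf_const)
  finally show ?thesis by (rule le_less_trans) simp
qed

end

section \<open>The regularized operator\<close>

lemma r_eps_facts:
  assumes "0 < \<epsilon>"
  shows "\<epsilon> \<le> r_eps \<epsilon> \<xi>" "norm \<xi> \<le> r_eps \<epsilon> \<xi>" "0 < r_eps \<epsilon> \<xi>" "(r_eps \<epsilon> \<xi>)\<^sup>2 = \<epsilon>\<^sup>2 + (norm \<xi>)\<^sup>2" "r_eps \<epsilon> \<xi> \<le> \<epsilon> + norm \<xi>"
proof -
  show e: "\<epsilon> \<le> r_eps \<epsilon> \<xi>" unfolding r_eps_def by (rule real_le_rsqrt) simp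
  show "norm \<xi> \<le> r_eps \<epsilon> \<xi>" unfolding r_eps_def by (rule real_le_rsqrt) simp
  show "0 < r_eps \<epsilon> \<xi>" using e assms by linarith
  show "(r_eps \<epsilon> \<xi>)\<^sup>2 = \<epsilon>\<^sup>2 + (norm \<xi>)\<^sup>2" unfolding r_eps_def by simp
  show "r_eps \<epsilon> \<xi> \<le> \<epsilon> + norm \<xi>" unfolding r_eps_def
    using assms by (intro real_le_lsqrt) (auto simp: power2_sum)
qed

text \<open>\<open>r_eps \<epsilon> \<xi>\<close> is the norm of \<open>(\<epsilon>, \<xi>)\<close>, so this is the reverse triangle inequality in one more dimension.\<close>

lemma r_eps_lipschitz:
  assumes "0 < \<epsilon>" shows "(r_eps \<epsilon> \<xi> - r_eps \<epsilon> \<eta>)\<^sup>2 \<le> (norm (\<xi> - \<eta>))\<^sup>2"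
proof -
  let ?x = "norm \<xi>" and ?y = "norm \<eta>" and ?a = "r_eps \<epsilon> \<xi>" and ?b = "r_eps \<epsilon> \<eta>"
  have ab: "\<epsilon>\<^sup>2 + ?x * ?y \<le> ?a * ?b"
  proof (rule power2_le_imp_le)
    have "(\<epsilon>\<^sup>2 + ?x * ?y)\<^sup>2 \<le> (\<epsilon>\<^sup>2 + ?x\<^sup>2) * (\<epsilon>\<^sup>2 + ?y\<^sup>2)"
    proof -
      have "(\<epsilon>\<^sup>2 + ?x\<^sup>2) * (\<epsilon>\<^sup>2 + ?y\<^sup>2) - (\<epsilon>\<^sup>2 + ?x * ?y)\<^sup>2 = \<epsilon>\<^sup>2 * (?x - ?y)\<^sup>2"
        by (simp add: power2_eq_square algebra_simps)
      moreover have "0 \<le> \<epsilon>\<^sup>2 * (?x - ?y)\<^sup>2" by simp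
      ultimately show ?thesis by linarith
    qed
    also have "\<dots> = (?a * ?b)\<^sup>2" unfolding power_mult_distrib r_eps_facts(4)[OF assms] by (rule refl)
    finally show "(\<epsilon>\<^sup>2 + ?x * ?y)\<^sup>2 \<le> (?a * ?b)\<^sup>2" .
    show "0 \<le> ?a * ?b" using r_eps_facts(3)[OF assms, of \<xi>] r_eps_facts(3)[OF assms, of \<eta>] by simp
  qed
  have "(?a - ?b)\<^sup>2 = ?a\<^sup>2 + ?b\<^sup>2 - 2 * (?a * ?b)" by (simp add: power2_diff)
  also have "\<dots> \<le> ?x\<^sup>2 + ?y\<^sup>2 - 2 * (?x * ?y)" using ab r_eps_facts(4)[OF assms, of \<xi>] r_eps_facts(4)[OF assms, of \<eta>] by linarith
  also have "\<dots> = (?x - ?y)\<^sup>2" by (simp add: power2_diff)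
  also have "\<dots> \<le> (norm (\<xi> - \<eta>))\<^sup>2"
    using norm_triangle_ineq3[of \<xi> \<eta>] by (simp add: abs_le_square_iff[symmetric])
  finally show ?thesis .
qed

text \<open>Concavity for exponents at most one, by Young's inequality.\<close>

lemma powr_le_tangent:
  fixes a b s :: real
  assumes "0 < a" "0 < b" "0 \<le> s" "s \<le> 1"
  shows "b powr s \<le> a powr s + s * a powr (s - 1) * (b - a)"
proof -
  have "(b / a) powr s * 1 powr (1 - s) \<le> s * (b / a) + (1 - s) * 1"
    using assms by (intro Youngs_inequality_0) auto
  then have "(b / a) powr s \<le> 1 + s * (b / a - 1)" by (simp add: algebra_simps)
  then have "a powr s * (b / a) powr s \<le> a powr s * (1 + s * (b / a - 1))" by (intro mult_left_mono) auto
  also have "a powr s * (b / a) powr s = b powr s" using assms by (simp add: powr_divide)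
  also have "a powr s * (1 + s * (b / a - 1)) = a powr s + s * a powr (s - 1) * (b - a)"
    using assms by (simp add: powr_diff field_simps)
  finally show ?thesis .
qed

text \<open>With \<open>a = r_eps \<epsilon> \<xi>\<close>, \<open>b = r_eps \<epsilon> \<eta>\<close>, \<open>z = norm (\<xi> - \<eta>)\<close> the product equals
\<open>(\<alpha> + \<beta>) / 2 z\<^sup>2 + (\<alpha> - \<beta>) / 2 (a\<^sup>2 - b\<^sup>2)\<close>, where \<open>\<alpha> = a powr (q - 2)\<close> and \<open>\<beta> = b powr (q - 2)\<close>. For \<open>q \<ge> 2\<close> the second term is nonnegative. For \<open>q < 2\<close> the
expression is increasing in \<open>z\<close>, and \<open>z \<ge> a - b\<close> leaves the one-dimensional inequality for \<open>x powr (q - 1)\<close>, so the product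
dominates \<open>(q - 1) a powr (q - 2) z\<^sup>2\<close>. This controls \<open>z powr q\<close> only when \<open>z\<close> is not small compared with \<open>a\<close>; the last term
of the estimate takes care of small \<open>z\<close>. The constant is uniform in \<open>q\<close> between \<open>pm\<close> and \<open>P\<close>.\<close>

lemma strong_monotonicity:
  fixes \<xi> \<eta> :: "'a::euclidean_space"
  assumes \<epsilon>: "0 < \<epsilon>" and q: "1 < pm" "pm \<le> q" "q \<le> P" and \<tau>: "0 < \<tau>" "\<tau> \<le> 1"
  defines "D \<equiv> (r_eps \<epsilon> \<xi> powr (q - 2) *\<^sub>R \<xi> - r_eps \<epsilon> \<eta> powr (q - 2) *\<^sub>R \<eta>) \<bullet> (\<xi> - \<eta>)"
  shows "norm (\<xi> - \<eta>) powr q \<le> (2 * 2 powr P + 1 / (pm - 1)) / \<tau> * D + \<tau> * (max (r_eps \<epsilon> \<xi>) (r_eps \<epsilon> \<eta>)) powr q"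
proof -
  have "norm (\<xi> - \<eta>) powr q \<le> (2 * 2 powr P + 1 / (pm - 1)) / \<tau> * D + \<tau> * (max (r_eps \<epsilon> \<xi>) (r_eps \<epsilon> \<eta>)) powr q \<and> 0 \<le> D"
    if ab: "r_eps \<epsilon> \<eta> \<le> r_eps \<epsilon> \<xi>" and D: "D = (r_eps \<epsilon> \<xi> powr (q - 2) *\<^sub>R \<xi> - r_eps \<epsilon> \<eta> powr (q - 2) *\<^sub>R \<eta>) \<bullet> (\<xi> - \<eta>)"
    for \<xi> \<eta> :: 'a and D
  proof -
    define a b z where "a = r_eps \<epsilon> \<xi>" and "b = r_eps \<epsilon> \<eta>" and "z = norm (\<xi> - \<eta>)"
    note A = r_eps_facts[OF \<epsilon>, of \<xi>, folded a_def] and B = r_eps_facts[OF \<epsilon>, of \<eta>, folded b_def]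
    have ab': "b \<le> a" using ab by (simp add: a_def b_def)
    define \<alpha> \<beta> where "\<alpha> = a powr (q - 2)" and "\<beta> = b powr (q - 2)"
    have \<alpha>\<beta>: "0 < \<alpha>" "0 < \<beta>" using A B by (auto simp: \<alpha>_def \<beta>_def)
    have z0: "0 \<le> z" by (simp add: z_def)
    have z2: "z\<^sup>2 = (norm \<xi>)\<^sup>2 + (norm \<eta>)\<^sup>2 - 2 * (\<xi> \<bullet> \<eta>)"
      unfolding z_def power2_norm_eq_inner by (simp add: inner_diff_left inner_diff_right inner_commute)
    have Did: "D = (\<alpha> + \<beta>) / 2 * z\<^sup>2 + (\<alpha> - \<beta>) / 2 * (a\<^sup>2 - b\<^sup>2)"
    proof -
      have "D = \<alpha> * (norm \<xi>)\<^sup>2 + \<beta> * (norm \<eta>)\<^sup>2 - (\<alpha> + \<beta>) * (\<xi> \<bullet> \<eta>)"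
        unfolding D \<alpha>_def \<beta>_def a_def b_def power2_norm_eq_inner
        by (simp add: inner_diff_left inner_diff_right inner_commute algebra_simps)
      then show ?thesis unfolding z2 A(4) B(4) by (simp add: field_simps)
    qed
    have za: "z \<le> 2 * a" using norm_triangle_ineq4[of \<xi> \<eta>] A(2) B(2) ab' by (simp add: z_def)
    have max: "max a b = a" using ab' by simp
    have K: "0 \<le> 2 * 2 powr P" "0 < 1 / (pm - 1)" using q by auto
    have "z powr q \<le> (2 * 2 powr P + 1 / (pm - 1)) / \<tau> * D + \<tau> * a powr q \<and> 0 \<le> D"
    proof (cases "2 \<le> q")
      case True
      have "\<beta> \<le> \<alpha>" unfolding \<alpha>_def \<beta>_def using True ab' B by (intro powr_mono2) auto
      moreover have "b\<^sup>2 \<le> a\<^sup>2" using ab' B by (intro power_mono) auto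
      ultimately have "0 \<le> (\<alpha> - \<beta>) / 2 * (a\<^sup>2 - b\<^sup>2)" by (intro mult_nonneg_nonneg) auto
      moreover have "\<alpha> / 2 * z\<^sup>2 \<le> (\<alpha> + \<beta>) / 2 * z\<^sup>2" using \<alpha>\<beta> by (intro mult_right_mono) auto
      ultimately have 1: "\<alpha> / 2 * z\<^sup>2 \<le> D" unfolding Did by linarith
      have D0: "0 \<le> D" using 1 \<alpha>\<beta> by (meson divide_nonneg_nonneg less_imp_le mult_nonneg_nonneg order_trans zero_le_numeral zero_le_power2)
      have "z powr q \<le> 2 powr P * (\<alpha> * z\<^sup>2)"
      proof (cases "z = 0")
        case False
        then have zp: "0 < z" using z0 by simp
        have "z powr q = z powr (q - 2) * z powr 2" by (simp add: powr_add[symmetric])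
        also have "z powr 2 = z\<^sup>2" using zp by (simp add: powr_numeral)
        also have "z powr (q - 2) \<le> (2 * a) powr (q - 2)" using True za z0 by (intro powr_mono2) auto
        also have "(2 * a) powr (q - 2) = 2 powr (q - 2) * \<alpha>" by (simp add: powr_mult \<alpha>_def)
        also have "2 powr (q - 2) * \<alpha> \<le> 2 powr P * \<alpha>" using q \<alpha>\<beta> by (intro mult_right_mono powr_mono) auto
        finally show ?thesis by (simp add: mult_right_mono mult.assoc)
      qed (use \<alpha>\<beta> in simp)
      also have "\<dots> \<le> 2 powr P * (2 * D)" using 1 by (intro mult_left_mono) auto
      also have "\<dots> = 2 * 2 powr P * D" by simp
      also have "\<dots> \<le> (2 * 2 powr P + 1 / (pm - 1)) / \<tau> * D"
      proof (rule mult_right_mono[OF _ D0])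
        have "2 * 2 powr P \<le> 2 * 2 powr P + 1 / (pm - 1)" using K by simp
        also have "\<dots> \<le> (2 * 2 powr P + 1 / (pm - 1)) / \<tau>" using \<tau> K by (simp add: pos_le_divide_eq mult_left_le)
        finally show "2 * 2 powr P \<le> (2 * 2 powr P + 1 / (pm - 1)) / \<tau>" .
      qed
      also have "\<dots> \<le> (2 * 2 powr P + 1 / (pm - 1)) / \<tau> * D + \<tau> * a powr q" using \<tau> by simp
      finally show ?thesis using D0 by simp
    next
      case False
      have \<alpha>le: "\<alpha> \<le> \<beta>" unfolding \<alpha>_def \<beta>_def using False ab' B by (intro powr_mono2') auto
      define c where "c = (\<alpha> + \<beta>) / 2 - (q - 1) * \<alpha>"
      have c: "0 \<le> c"
      proof -
        have "(q - 1) * \<alpha> \<le> 1 * \<alpha>" using False \<alpha>\<beta> by (intro mult_right_mono) auto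
        then show ?thesis unfolding c_def using \<alpha>le by simp
      qed
      have "(a - b)\<^sup>2 \<le> z\<^sup>2" unfolding a_def b_def z_def by (rule r_eps_lipschitz[OF \<epsilon>])
      then have "c * (a - b)\<^sup>2 \<le> c * z\<^sup>2" using c by (intro mult_left_mono)
      then have "D - (q - 1) * \<alpha> * z\<^sup>2 \<ge> c * (a - b)\<^sup>2 + (\<alpha> - \<beta>) / 2 * (a\<^sup>2 - b\<^sup>2)"
        unfolding Did c_def by (simp add: algebra_simps)
      also have "c * (a - b)\<^sup>2 + (\<alpha> - \<beta>) / 2 * (a\<^sup>2 - b\<^sup>2) = (a - b) * (\<alpha> * a - \<beta> * b - (q - 1) * \<alpha> * (a - b))"
        unfolding c_def by (simp add: field_simps power2_eq_square)
      finally have 1: "(a - b) * (\<alpha> * a - \<beta> * b - (q - 1) * \<alpha> * (a - b)) \<le> D - (q - 1) * \<alpha> * z\<^sup>2" .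
      have t: "b powr (q - 1) \<le> a powr (q - 1) + (q - 1) * a powr (q - 1 - 1) * (b - a)"
        using A B False q by (intro powr_le_tangent) auto
      have e1: "a powr (q - 1) = \<alpha> * a" and e2: "b powr (q - 1) = \<beta> * b"
        using A(3) B(3) powr_add[of a "q - 2" 1] powr_add[of b "q - 2" 1] by (simp_all add: \<alpha>_def \<beta>_def)
      have e3: "a powr (q - 1 - 1) = \<alpha>" by (simp add: \<alpha>_def)
      from t[unfolded e1 e2 e3] have "0 \<le> \<alpha> * a - \<beta> * b - (q - 1) * \<alpha> * (a - b)" by (simp add: algebra_simps)
      then have "0 \<le> (a - b) * (\<alpha> * a - \<beta> * b - (q - 1) * \<alpha> * (a - b))" using ab' by (intro mult_nonneg_nonneg) auto
      with 1 have 2: "(q - 1) * \<alpha> * z\<^sup>2 \<le> D" by linarith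
      have "0 \<le> (q - 1) * \<alpha> * z\<^sup>2" using q \<alpha>\<beta> by simp
      with 2 have D0: "0 \<le> D" by linarith
      have "z powr q \<le> 1 / (pm - 1) / \<tau> * D + \<tau> * a powr q"
      proof (cases "z \<le> \<tau> * a")
        case True
        have "z powr q \<le> (\<tau> * a) powr q" using True z0 q by (intro powr_mono2) auto
        also have "\<dots> = \<tau> powr q * a powr q" by (simp add: powr_mult)
        also have "\<dots> \<le> \<tau> powr 1 * a powr q" using \<tau> q by (intro mult_right_mono powr_mono') auto
        also have "\<dots> = \<tau> * a powr q" using \<tau> by simp
        finally show ?thesis using D0 K \<tau> by (smt (verit) divide_nonneg_pos mult_nonneg_nonneg)
      next
        case zbig: False
        have \<tau>a: "0 < \<tau> * a" using \<tau> A by simp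
        then have zp: "0 < z" using zbig by linarith
        have "z powr q = z powr (q - 2) * z powr 2" by (simp add: powr_add[symmetric])
        also have "z powr 2 = z\<^sup>2" using zp by (simp add: powr_numeral)
        also have "z powr (q - 2) \<le> (\<tau> * a) powr (q - 2)" using False zbig \<tau>a by (intro powr_mono2') auto
        also have "(\<tau> * a) powr (q - 2) = \<tau> powr (q - 2) * \<alpha>" by (simp add: powr_mult \<alpha>_def)
        also have "\<tau> powr (q - 2) * \<alpha> \<le> \<tau> powr (- 1) * \<alpha>" using \<tau> q \<alpha>\<beta> by (intro mult_right_mono powr_mono') auto
        also have "\<tau> powr (- 1) = 1 / \<tau>" using \<tau> by (simp add: powr_minus inverse_eq_divide)
        finally have "z powr q \<le> 1 / \<tau> * \<alpha> * z\<^sup>2" by (simp add: mult_right_mono)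
        also have "\<dots> = 1 / \<tau> * (\<alpha> * z\<^sup>2)" by simp
        also have "\<alpha> * z\<^sup>2 \<le> 1 / (pm - 1) * D"
        proof -
          have "(pm - 1) * (\<alpha> * z\<^sup>2) \<le> (q - 1) * (\<alpha> * z\<^sup>2)" using q \<alpha>\<beta> by (intro mult_right_mono) auto
          then have "(pm - 1) * (\<alpha> * z\<^sup>2) \<le> D" using 2 by (simp add: mult.assoc)
          then show ?thesis using q by (simp add: field_simps)
        qed
        also have "1 / \<tau> * (1 / (pm - 1) * D) = 1 / (pm - 1) / \<tau> * D" by simp
        finally have "z powr q \<le> 1 / (pm - 1) / \<tau> * D" using \<tau> by (simp add: divide_right_mono)
        moreover have "0 \<le> \<tau> * a powr q" using \<tau> by simp
        ultimately show ?thesis by linarith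
      qed
      also have "\<dots> \<le> (2 * 2 powr P + 1 / (pm - 1)) / \<tau> * D + \<tau> * a powr q"
        using K \<tau> D0 by (intro add_right_mono mult_right_mono divide_right_mono) auto
      finally show ?thesis using D0 by simp
    qed
    then show ?thesis using max by (simp add: a_def b_def z_def)
  qed
  note main = this
  have "norm (\<xi> - \<eta>) powr q \<le> (2 * 2 powr P + 1 / (pm - 1)) / \<tau> * D + \<tau> * (max (r_eps \<epsilon> \<xi>) (r_eps \<epsilon> \<eta>)) powr q \<and> 0 \<le> D"
  proof (cases "r_eps \<epsilon> \<eta> \<le> r_eps \<epsilon> \<xi>")
    case True then show ?thesis by (rule main) (simp add: D_def)
  next
    case False
    have D': "D = (r_eps \<epsilon> \<eta> powr (q - 2) *\<^sub>R \<eta> - r_eps \<epsilon> \<xi> powr (q - 2) *\<^sub>R \<xi>) \<bullet> (\<eta> - \<xi>)"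
      unfolding D_def by (simp add: inner_diff_left inner_diff_right)
    have "r_eps \<epsilon> \<xi> \<le> r_eps \<epsilon> \<eta>" using False by simp
    from main[OF this D'] show ?thesis
      unfolding max.commute[of "r_eps \<epsilon> \<xi>"] norm_minus_commute[of \<xi>] .
  qed
  then show ?thesis by (rule conjunct1)
qed

text \<open>Compare the two factors: the product is at most the power of the larger one.\<close>

lemma powr_mult_le_sum:
  fixes a b q :: real
  assumes "0 \<le> a" "0 \<le> b" "1 \<le> q" shows "a powr (q - 1) * b \<le> a powr q + b powr q"
proof -
  have e: "c powr (q - 1) * c = c powr q" if "0 \<le> c" for c
    using that powr_add[of c "q - 1" 1] by (cases "c = 0") auto
  show ?thesis
  proof (cases "b \<le> a")
    case True
    then have "a powr (q - 1) * b \<le> a powr (q - 1) * a" by (intro mult_left_mono) auto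
    then show ?thesis using e[OF assms(1)] powr_ge_zero[of b q] by linarith
  next
    case False
    then have "a powr (q - 1) * b \<le> b powr (q - 1) * b" using assms by (intro mult_right_mono powr_mono2) auto
    then show ?thesis using e[OF assms(2)] powr_ge_zero[of a q] by linarith
  qed
qed

text \<open>As before, but comparing \<open>z\<close> with \<open>\<tau> a\<close>.\<close>

lemma powr_mult_le_small:
  fixes a z q \<tau> :: real
  assumes "0 \<le> a" "0 \<le> z" "1 \<le> q" "q \<le> P" "0 < \<tau>" "\<tau> \<le> 1"
  shows "a powr (q - 1) * z \<le> \<tau> * a powr q + \<tau> powr (- P) * z powr q"
proof -
  have e: "c powr (q - 1) * c = c powr q" if "0 \<le> c" for c
    using that powr_add[of c "q - 1" 1] by (cases "c = 0") auto
  show ?thesis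
  proof (cases "z \<le> \<tau> * a")
    case True
    then have "a powr (q - 1) * z \<le> a powr (q - 1) * (\<tau> * a)" by (intro mult_left_mono) auto
    also have "\<dots> = \<tau> * a powr q" by (simp add: e[OF assms(1), symmetric])
    finally show ?thesis by (rule order_trans) simp
  next
    case False
    then have "a \<le> z / \<tau>" using assms by (simp add: field_simps)
    then have "a powr (q - 1) * z \<le> (z / \<tau>) powr (q - 1) * z" using assms by (intro mult_right_mono powr_mono2) auto
    also have "(z / \<tau>) powr (q - 1) = \<tau> powr (1 - q) * z powr (q - 1)" using assms by (simp add: powr_divide powr_diff)
    also have "\<tau> powr (1 - q) * z powr (q - 1) * z = \<tau> powr (1 - q) * z powr q" by (simp only: mult.assoc e[OF assms(2)])
    also have "\<dots> \<le> \<tau> powr (- P) * z powr q" using assms by (intro mult_right_mono powr_mono') auto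
    also have "\<dots> \<le> \<tau> * a powr q + \<tau> powr (- P) * z powr q" using assms by simp
    finally show ?thesis .
  qed
qed

text \<open>If \<open>s > t\<close>, the product is positive only when \<open>s + \<delta> < t + \<eta>\<close>. Then \<open>s - t < \<eta>\<close>, and \<open>s + \<delta>\<close> is at least
\<open>s - t\<close>, so the product is at most \<open>(s - t) powr (1 - \<gamma>)\<close>. The bound does not degenerate as \<open>s\<close> and \<open>t\<close> approach zero.\<close>

lemma singular_difference_le:
  fixes s t \<delta> \<eta> \<gamma> :: real
  assumes "0 \<le> s" "0 \<le> t" "0 < \<delta>" "0 < \<eta>" "0 < \<gamma>" "\<gamma> < 1"
  shows "((s + \<delta>) powr (- \<gamma>) - (t + \<eta>) powr (- \<gamma>)) * (s - t) \<le> (max \<delta> \<eta>) powr (1 - \<gamma>)"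
proof -
  have main: "((s + \<delta>) powr (- \<gamma>) - (t + \<eta>) powr (- \<gamma>)) * (s - t) \<le> \<eta> powr (1 - \<gamma>)"
    if "0 \<le> t" "t < s" "0 < \<delta>" "0 < \<eta>" for s t \<delta> \<eta> :: real
  proof (cases "t + \<eta> \<le> s + \<delta>")
    case True
    then have "(s + \<delta>) powr (- \<gamma>) \<le> (t + \<eta>) powr (- \<gamma>)" using that assms by (intro powr_mono2') auto
    then have "((s + \<delta>) powr (- \<gamma>) - (t + \<eta>) powr (- \<gamma>)) * (s - t) \<le> 0" using that by (intro mult_nonpos_nonneg) auto
    then show ?thesis by (rule order_trans) simp
  next
    case False
    have "((s + \<delta>) powr (- \<gamma>) - (t + \<eta>) powr (- \<gamma>)) * (s - t) \<le> (s + \<delta>) powr (- \<gamma>) * (s - t)"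
      using that by (intro mult_right_mono) auto
    also have "\<dots> \<le> (s - t) powr (- \<gamma>) * (s - t)" using that assms by (intro mult_right_mono powr_mono2') auto
    also have "\<dots> = (s - t) powr (1 - \<gamma>)" using that powr_add[of "s - t" "- \<gamma>" 1] by simp
    also have "\<dots> \<le> \<eta> powr (1 - \<gamma>)" using that False assms by (intro powr_mono2) auto
    finally show ?thesis .
  qed
  consider "t < s" | "s < t" | "s = t" by linarith
  then show ?thesis
  proof cases
    case 1
    have "\<eta> powr (1 - \<gamma>) \<le> (max \<delta> \<eta>) powr (1 - \<gamma>)" using assms by (intro powr_mono2) auto
    then show ?thesis using main[of t s \<delta> \<eta>] 1 assms by linarith
  next
    case 2
    have "\<delta> powr (1 - \<gamma>) \<le> (max \<delta> \<eta>) powr (1 - \<gamma>)" using assms by (intro powr_mono2) auto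
    moreover have "((s + \<delta>) powr (- \<gamma>) - (t + \<eta>) powr (- \<gamma>)) * (s - t) = ((t + \<eta>) powr (- \<gamma>) - (s + \<delta>) powr (- \<gamma>)) * (t - s)"
      by (simp add: algebra_simps)
    ultimately show ?thesis using main[of s t \<eta> \<delta>] 2 assms by linarith
  qed simp
qed

section \<open>Energies\<close>

context log_exponent begin

lemma AE_in_\<Omega>: "AE x in lebesgue_on \<Omega>. x \<in> \<Omega>"
  by (rule AE_I2) simp

lemma integral_const_\<Omega>: "(\<integral>x. c \<partial>lebesgue_on \<Omega>) = c * vol"
  using open_\<Omega> by (simp add: vol_def measure_restrict_space)

lemma integrable_const_\<Omega>: "integrable (lebesgue_on \<Omega>) (\<lambda>x. c :: real)"
proof -
  interpret finite_measure "lebesgue_on \<Omega>" by (rule finite_measure_\<Omega>)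
  show ?thesis by simp
qed

lemma modular_eq_integral:
  fixes f :: "'a \<Rightarrow> 'b::euclidean_space"
  assumes "f \<in> borel_measurable (lebesgue_on \<Omega>)" "modular \<Omega> p f < \<infinity>"
  shows "modular \<Omega> p f = ennreal (\<integral>x. norm (f x) powr p x \<partial>lebesgue_on \<Omega>)"
  unfolding modular_def by (rule nn_integral_eq_integral[OF integrable_of_modular(2)[OF assms]]) simp

lemma J_fun_bounds:
  assumes u: "u \<in> X_space \<Omega> p" and J: "J_fun \<Omega> p u = m"
  shows "(\<integral>x. \<bar>u x\<bar> powr p x \<partial>lebesgue_on \<Omega>) \<le> P * m" "m \<le> (\<integral>x. \<bar>u x\<bar> powr p x \<partial>lebesgue_on \<Omega>)"
proof -
  note U = X_spaceD[OF u]
  note [measurable] = U(4)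
  have i: "integrable (lebesgue_on \<Omega>) (\<lambda>x. \<bar>u x\<bar> powr p x)" using integrable_of_modular(2)[OF U(4,2)] by simp
  have i2: "integrable (lebesgue_on \<Omega>) (\<lambda>x. \<bar>u x\<bar> powr p x / p x)"
  proof (rule Bochner_Integration.integrable_bound[OF i])
    show "AE x in lebesgue_on \<Omega>. norm (\<bar>u x\<bar> powr p x / p x) \<le> norm (\<bar>u x\<bar> powr p x)"
      using AE_in_\<Omega>
    proof eventually_elim
      case (elim x)
      then have "\<bar>u x\<bar> powr p x / p x \<le> \<bar>u x\<bar> powr p x / 1" using p_ge by (intro divide_left_mono) (auto intro: less_le_trans[OF zero_less_one])
      then show ?case using p_ge[OF elim] by simp
    qed
  qed measurable
  have "(\<integral>x. \<bar>u x\<bar> powr p x \<partial>lebesgue_on \<Omega>) \<le> (\<integral>x. P * (\<bar>u x\<bar> powr p x / p x) \<partial>lebesgue_on \<Omega>)"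
  proof (rule integral_mono_AE[OF i])
    show "AE x in lebesgue_on \<Omega>. \<bar>u x\<bar> powr p x \<le> P * (\<bar>u x\<bar> powr p x / p x)"
      using AE_in_\<Omega>
    proof eventually_elim
      case (elim x)
      have "\<bar>u x\<bar> powr p x = p x * (\<bar>u x\<bar> powr p x / p x)" using p_ge[OF elim] by simp
      also have "\<dots> \<le> P * (\<bar>u x\<bar> powr p x / p x)" using p_ge[OF elim] p_le[OF elim] by (intro mult_right_mono) auto
      finally show ?case .
    qed
  qed (rule integrable_mult_right[OF i2])
  also have "\<dots> = P * m" unfolding integral_mult_right_zero using J by (simp add: J_fun_def)
  finally show "(\<integral>x. \<bar>u x\<bar> powr p x \<partial>lebesgue_on \<Omega>) \<le> P * m" .
  have "(\<integral>x. \<bar>u x\<bar> powr p x / p x \<partial>lebesgue_on \<Omega>) \<le> (\<integral>x. \<bar>u x\<bar> powr p x \<partial>lebesgue_on \<Omega>)"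
  proof (rule integral_mono_AE[OF i2 i])
    show "AE x in lebesgue_on \<Omega>. \<bar>u x\<bar> powr p x / p x \<le> \<bar>u x\<bar> powr p x"
      using AE_in_\<Omega>
    proof eventually_elim
      case (elim x)
      then have "\<bar>u x\<bar> powr p x / p x \<le> \<bar>u x\<bar> powr p x / 1" using p_ge by (intro divide_left_mono) (auto intro: less_le_trans[OF zero_less_one])
      then show ?case by simp
    qed
  qed
  then show "m \<le> (\<integral>x. \<bar>u x\<bar> powr p x \<partial>lebesgue_on \<Omega>)" using J by (simp add: J_fun_def)
qed

definition eps_const :: "real \<Rightarrow> real" where "eps_const \<epsilon> = (max 1 \<epsilon>) powr P"

lemma r_eps_powr_le:
  assumes "0 < \<epsilon>" "x \<in> \<Omega>"
  shows "r_eps \<epsilon> \<xi> powr p x \<le> 2 powr P * (eps_const \<epsilon> + norm \<xi> powr p x)" "\<epsilon> powr p x \<le> eps_const \<epsilon>"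
proof -
  have px: "1 \<le> p x" "p x \<le> P" using p_ge p_le assms by auto
  have "\<epsilon> powr p x \<le> (max 1 \<epsilon>) powr p x" using px assms by (intro powr_mono2) auto
  also have "\<dots> \<le> eps_const \<epsilon>" unfolding eps_const_def using px by (intro powr_mono) auto
  finally show e: "\<epsilon> powr p x \<le> eps_const \<epsilon>" .
  have "r_eps \<epsilon> \<xi> powr p x \<le> (\<epsilon> + norm \<xi>) powr p x"
    using r_eps_facts(3,5)[OF assms(1), of \<xi>] px by (intro powr_mono2) auto
  also have "\<dots> \<le> 2 powr P * (\<epsilon> powr p x + norm \<xi> powr p x)"
    using norm_add_powr_le[of "p x" P \<epsilon> "norm \<xi>"] px assms by simp
  also have "\<dots> \<le> 2 powr P * (eps_const \<epsilon> + norm \<xi> powr p x)" using e by (intro mult_left_mono) auto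
  finally show "r_eps \<epsilon> \<xi> powr p x \<le> 2 powr P * (eps_const \<epsilon> + norm \<xi> powr p x)" .
qed

lemma r_eps_measurable [measurable]:
  "g \<in> borel_measurable M \<Longrightarrow> (\<lambda>x. r_eps \<epsilon> (g x :: 'b::euclidean_space)) \<in> borel_measurable M"
  unfolding r_eps_def by measurable

lemma r_eps_integrable:
  fixes g :: "'a \<Rightarrow> 'b::euclidean_space"
  assumes \<epsilon>: "0 < \<epsilon>" and g: "g \<in> borel_measurable (lebesgue_on \<Omega>)" "modular \<Omega> p g < \<infinity>"
  shows "integrable (lebesgue_on \<Omega>) (\<lambda>x. r_eps \<epsilon> (g x) powr p x)"
    "(\<integral>x. r_eps \<epsilon> (g x) powr p x \<partial>lebesgue_on \<Omega>) \<le> 2 powr P * (eps_const \<epsilon> * vol + (\<integral>x. norm (g x) powr p x \<partial>lebesgue_on \<Omega>))"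
proof -
  note [measurable] = g(1)
  have i: "integrable (lebesgue_on \<Omega>) (\<lambda>x. 2 powr P * (eps_const \<epsilon> + norm (g x) powr p x))"
    using integrable_of_modular(2)[OF g] integrable_const_\<Omega> by (intro integrable_mult_right Bochner_Integration.integrable_add) auto
  have ae: "AE x in lebesgue_on \<Omega>. r_eps \<epsilon> (g x) powr p x \<le> 2 powr P * (eps_const \<epsilon> + norm (g x) powr p x)"
    using AE_in_\<Omega> by eventually_elim (rule r_eps_powr_le[OF \<epsilon>])
  show i2: "integrable (lebesgue_on \<Omega>) (\<lambda>x. r_eps \<epsilon> (g x) powr p x)"
    by (rule Bochner_Integration.integrable_bound[OF i]) (use ae in \<open>auto elim!: eventually_mono\<close>)
  have "(\<integral>x. r_eps \<epsilon> (g x) powr p x \<partial>lebesgue_on \<Omega>) \<le> (\<integral>x. 2 powr P * (eps_const \<epsilon> + norm (g x) powr p x) \<partial>lebesgue_on \<Omega>)"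
    by (rule integral_mono_AE[OF i2 i ae])
  also have "\<dots> = 2 powr P * (eps_const \<epsilon> * vol + (\<integral>x. norm (g x) powr p x \<partial>lebesgue_on \<Omega>))"
    using integrable_of_modular(2)[OF g] integrable_const_\<Omega> integral_const_\<Omega> by simp
  finally show "(\<integral>x. r_eps \<epsilon> (g x) powr p x \<partial>lebesgue_on \<Omega>) \<le> 2 powr P * (eps_const \<epsilon> * vol + (\<integral>x. norm (g x) powr p x \<partial>lebesgue_on \<Omega>))" .
qed

lemma A_eps_inner_le:
  assumes "0 < \<epsilon>" "x \<in> \<Omega>"
  shows "\<bar>A_eps p \<epsilon> x \<xi> \<bullet> \<eta>\<bar> \<le> r_eps \<epsilon> \<xi> powr p x + norm \<eta> powr p x"
proof -
  have "\<bar>A_eps p \<epsilon> x \<xi> \<bullet> \<eta>\<bar> \<le> norm (A_eps p \<epsilon> x \<xi>) * norm \<eta>" by (rule Cauchy_Schwarz_ineq2)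
  also have "norm (A_eps p \<epsilon> x \<xi>) \<le> r_eps \<epsilon> \<xi> powr (p x - 2) * r_eps \<epsilon> \<xi>"
    unfolding A_eps_def using r_eps_facts(2)[OF assms(1), of \<xi>] by (auto intro: mult_left_mono)
  also have "\<dots> = r_eps \<epsilon> \<xi> powr (p x - 1)"
    using r_eps_facts(3)[OF assms(1), of \<xi>] powr_add[of "r_eps \<epsilon> \<xi>" "p x - 2" 1] by simp
  also have "r_eps \<epsilon> \<xi> powr (p x - 1) * norm \<eta> \<le> r_eps \<epsilon> \<xi> powr p x + norm \<eta> powr p x"
    using r_eps_facts(3)[OF assms(1), of \<xi>] p_ge[OF assms(2)] by (intro powr_mult_le_sum) auto
  finally show ?thesis by (simp add: mult_right_mono)
qed

lemma A_eps_measurable [measurable]: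
  assumes [measurable]: "g \<in> borel_measurable (lebesgue_on \<Omega>)"
  shows "(\<lambda>x. A_eps p \<epsilon> x (g x)) \<in> borel_measurable (lebesgue_on \<Omega>)"
proof -
  have [measurable]: "(\<lambda>x. p x - 2) \<in> borel_measurable (lebesgue_on \<Omega>)"
    by (intro borel_measurable_diff p_measurable borel_measurable_const)
  show ?thesis unfolding A_eps_def by measurable
qed

lemma A_eps_integrable:
  fixes g k :: "'a \<Rightarrow> 'a"
  assumes \<epsilon>: "0 < \<epsilon>" and g: "g \<in> borel_measurable (lebesgue_on \<Omega>)" "modular \<Omega> p g < \<infinity>"
    and k: "k \<in> borel_measurable (lebesgue_on \<Omega>)" "modular \<Omega> p k < \<infinity>"
  shows "integrable (lebesgue_on \<Omega>) (\<lambda>x. A_eps p \<epsilon> x (g x) \<bullet> k x)"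
proof -
  note [measurable] = g(1) k(1)
  show ?thesis
  proof (rule Bochner_Integration.integrable_bound)
    show "integrable (lebesgue_on \<Omega>) (\<lambda>x. r_eps \<epsilon> (g x) powr p x + norm (k x) powr p x)"
      using r_eps_integrable(1)[OF \<epsilon> g] integrable_of_modular(2)[OF k] by simp
    show "AE x in lebesgue_on \<Omega>. norm (A_eps p \<epsilon> x (g x) \<bullet> k x) \<le> norm (r_eps \<epsilon> (g x) powr p x + norm (k x) powr p x)"
      using AE_in_\<Omega> by eventually_elim (use A_eps_inner_le[OF \<epsilon>] in simp)
  qed measurable
qed

lemma powr_mult_integrable:
  assumes u: "u \<in> borel_measurable (lebesgue_on \<Omega>)" "modular \<Omega> p u < \<infinity>" and u0: "AE x in lebesgue_on \<Omega>. 0 \<le> u x"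
    and v: "v \<in> borel_measurable (lebesgue_on \<Omega>)" "modular \<Omega> p v < \<infinity>"
  shows "integrable (lebesgue_on \<Omega>) (\<lambda>x. u x powr (p x - 1) * v x)"
proof -
  note [measurable] = u(1) v(1)
  show ?thesis
  proof (rule Bochner_Integration.integrable_bound)
    show "integrable (lebesgue_on \<Omega>) (\<lambda>x. norm (u x) powr p x + norm (v x) powr p x)"
      using integrable_of_modular(2)[OF u] integrable_of_modular(2)[OF v] by simp
    show "AE x in lebesgue_on \<Omega>. norm (u x powr (p x - 1) * v x) \<le> norm (norm (u x) powr p x + norm (v x) powr p x)"
      using AE_in_\<Omega> u0 by eventually_elim (use powr_mult_le_sum p_ge in \<open>auto simp: abs_mult\<close>)
  qed measurable
qed

text \<open>The density of the energy dominates \<open>norm \<xi> powr p x\<close> up to a constant.\<close>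

lemma gradient_le_energy:
  assumes \<epsilon>: "0 < \<epsilon>" and u: "u \<in> X_space \<Omega> p"
  shows "(\<integral>x. norm (wgrad \<Omega> u x) powr p x \<partial>lebesgue_on \<Omega>) \<le> P * E_eps \<Omega> p \<epsilon> u + eps_const \<epsilon> * vol"
proof -
  note U = X_spaceD[OF u]
  note [measurable] = U(5)
  let ?Phi = "\<lambda>x. Phi_eps p \<epsilon> x (wgrad \<Omega> u x)"
  have ir: "integrable (lebesgue_on \<Omega>) (\<lambda>x. r_eps \<epsilon> (wgrad \<Omega> u x) powr p x)" by (rule r_eps_integrable(1)[OF \<epsilon> U(5,3)])
  have bnd: "0 \<le> Phi_eps p \<epsilon> x \<xi>" "Phi_eps p \<epsilon> x \<xi> \<le> r_eps \<epsilon> \<xi> powr p x" "norm \<xi> powr p x \<le> P * Phi_eps p \<epsilon> x \<xi> + eps_const \<epsilon>"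
    if x: "x \<in> \<Omega>" for x and \<xi> :: 'a
  proof -
    have px: "1 \<le> p x" "p x \<le> P" using p_ge p_le x by auto
    have "\<epsilon> powr p x \<le> r_eps \<epsilon> \<xi> powr p x" using r_eps_facts(1)[OF \<epsilon>, of \<xi>] \<epsilon> px by (intro powr_mono2) auto
    then show 0: "0 \<le> Phi_eps p \<epsilon> x \<xi>" unfolding Phi_eps_def using px by simp
    have "Phi_eps p \<epsilon> x \<xi> \<le> r_eps \<epsilon> \<xi> powr p x / p x" unfolding Phi_eps_def using px by (intro divide_right_mono) auto
    also have "\<dots> \<le> r_eps \<epsilon> \<xi> powr p x / 1" using px by (intro divide_left_mono) auto
    finally show "Phi_eps p \<epsilon> x \<xi> \<le> r_eps \<epsilon> \<xi> powr p x" by simp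
    have "norm \<xi> powr p x \<le> r_eps \<epsilon> \<xi> powr p x" using r_eps_facts(2)[OF \<epsilon>, of \<xi>] px by (intro powr_mono2) auto
    also have "\<dots> = p x * Phi_eps p \<epsilon> x \<xi> + \<epsilon> powr p x" using px by (simp add: Phi_eps_def)
    also have "\<dots> \<le> P * Phi_eps p \<epsilon> x \<xi> + eps_const \<epsilon>" using px 0 r_eps_powr_le(2)[OF \<epsilon> x] by (intro add_mono mult_right_mono) auto
    finally show "norm \<xi> powr p x \<le> P * Phi_eps p \<epsilon> x \<xi> + eps_const \<epsilon>" .
  qed
  have iP: "integrable (lebesgue_on \<Omega>) ?Phi"
  proof (rule Bochner_Integration.integrable_bound[OF ir])
    show "?Phi \<in> borel_measurable (lebesgue_on \<Omega>)" unfolding Phi_eps_def by measurable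
    show "AE x in lebesgue_on \<Omega>. norm (?Phi x) \<le> norm (r_eps \<epsilon> (wgrad \<Omega> u x) powr p x)"
      using AE_in_\<Omega> by eventually_elim (use bnd in simp)
  qed
  have "(\<integral>x. norm (wgrad \<Omega> u x) powr p x \<partial>lebesgue_on \<Omega>) \<le> (\<integral>x. P * ?Phi x + eps_const \<epsilon> \<partial>lebesgue_on \<Omega>)"
  proof (rule integral_mono_AE)
    show "integrable (lebesgue_on \<Omega>) (\<lambda>x. norm (wgrad \<Omega> u x) powr p x)" by (rule integrable_of_modular(2)[OF U(5,3)])
    show "integrable (lebesgue_on \<Omega>) (\<lambda>x. P * ?Phi x + eps_const \<epsilon>)" using iP integrable_const_\<Omega> by simp
    show "AE x in lebesgue_on \<Omega>. norm (wgrad \<Omega> u x) powr p x \<le> P * ?Phi x + eps_const \<epsilon>"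
      using AE_in_\<Omega> by eventually_elim (use bnd in blast)
  qed
  also have "\<dots> = P * E_eps \<Omega> p \<epsilon> u + eps_const \<epsilon> * vol"
    unfolding E_eps_def using iP integrable_const_\<Omega> integral_const_\<Omega> by simp
  finally show ?thesis .
qed

text \<open>Since the integral of a nonintegrable function is zero, a nonnegative integrable majorant bounds the integral in
every case.\<close>

lemma integral_le_of_bound:
  fixes f g :: "'a \<Rightarrow> real"
  assumes "integrable (lebesgue_on \<Omega>) g" "AE x in lebesgue_on \<Omega>. f x \<le> g x" "AE x in lebesgue_on \<Omega>. 0 \<le> g x"
  shows "(\<integral>x. f x \<partial>lebesgue_on \<Omega>) \<le> (\<integral>x. g x \<partial>lebesgue_on \<Omega>)"
proof (cases "integrable (lebesgue_on \<Omega>) f")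
  case True then show ?thesis using assms by (intro integral_mono_AE)
next
  case False
  then show ?thesis using assms(3) by (simp add: not_integrable_integral_eq integral_nonneg_AE)
qed

lemma G_delta_bounds:
  assumes "0 < \<delta>" "\<delta> \<le> 1" "0 \<le> s" "0 < \<gamma> x" "\<gamma> x \<le> \<gamma>p" "\<gamma>p < 1" "1 \<le> q"
  shows "0 \<le> G_delta \<gamma> \<delta> x s" "G_delta \<gamma> \<delta> x s \<le> (2 + s powr q) / (1 - \<gamma>p)"
proof -
  have "\<delta> powr (1 - \<gamma> x) \<le> (s + \<delta>) powr (1 - \<gamma> x)" using assms by (intro powr_mono2) auto
  then show "0 \<le> G_delta \<gamma> \<delta> x s" unfolding G_delta_def using assms by (intro divide_nonneg_nonneg) auto
  have "(s + \<delta>) powr (1 - \<gamma> x) \<le> (1 + s) powr (1 - \<gamma> x)" using assms by (intro powr_mono2) auto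
  also have "\<dots> \<le> (1 + s) powr 1" using assms by (intro powr_mono) auto
  also have "\<dots> \<le> 2 + s powr q" using le_one_plus_powr[of s 1 q] assms by simp
  finally have "(s + \<delta>) powr (1 - \<gamma> x) - \<delta> powr (1 - \<gamma> x) \<le> 2 + s powr q" by (smt (verit) powr_ge_zero)
  moreover have "0 \<le> 2 + s powr q" by simp
  ultimately show "G_delta \<gamma> \<delta> x s \<le> (2 + s powr q) / (1 - \<gamma>p)" unfolding G_delta_def using assms by (intro frac_le) auto
qed

text \<open>The competitor \<open>w\<close> is fixed while \<open>\<delta>\<close> varies. The singular energy of \<open>u\<close> is bounded by the constraint, that of \<open>w\<close> is
nonnegative.\<close>

lemma minimizer_gradient_bound:
  assumes \<epsilon>: "0 < \<epsilon>" and \<mu>: "0 \<le> \<mu>" and \<delta>: "0 < \<delta>" "\<delta> \<le> 1"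
    and h: "AE x in lebesgue_on \<Omega>. 0 \<le> h x \<and> h x \<le> H" "0 \<le> H"
    and \<gamma>: "\<And>x. x \<in> \<Omega> \<Longrightarrow> 0 < \<gamma> x \<and> \<gamma> x \<le> \<gamma>p" "\<gamma>p < 1"
    and u: "is_minimizer_on (I_fun \<Omega> p h \<gamma> \<epsilon> \<mu> \<delta>) (M_plus \<Omega> p m) u" and w: "w \<in> M_plus \<Omega> p m"
  shows "(\<integral>x. norm (wgrad \<Omega> u x) powr p x \<partial>lebesgue_on \<Omega>) \<le>
    P * (E_eps \<Omega> p \<epsilon> w + \<mu> * (H / (1 - \<gamma>p) * (2 * vol + P * m))) + eps_const \<epsilon> * vol"
proof -
  have uM: "u \<in> M_plus \<Omega> p m" and min: "I_fun \<Omega> p h \<gamma> \<epsilon> \<mu> \<delta> u \<le> I_fun \<Omega> p h \<gamma> \<epsilon> \<mu> \<delta> w"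
    using u w by (auto simp: is_minimizer_on_def)
  have uX: "u \<in> X_space \<Omega> p" "AE x in lebesgue_on \<Omega>. 0 \<le> u x" "J_fun \<Omega> p u = m"
    and w0: "AE x in lebesgue_on \<Omega>. 0 \<le> w x"
    using uM w by (auto simp: M_plus_def X_plus_def)
  note U = X_spaceD[OF uX(1)]
  have iu: "integrable (lebesgue_on \<Omega>) (\<lambda>x. \<bar>u x\<bar> powr p x)" using integrable_of_modular(2)[OF U(4,2)] by simp
  have k: "0 \<le> H / (1 - \<gamma>p)" using h(2) \<gamma>(2) by simp
  have "(LINT x|lebesgue_on \<Omega>. h x * G_delta \<gamma> \<delta> x (u x)) \<le> (LINT x|lebesgue_on \<Omega>. H / (1 - \<gamma>p) * (2 + \<bar>u x\<bar> powr p x))"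
  proof (rule integral_le_of_bound)
    show "integrable (lebesgue_on \<Omega>) (\<lambda>x. H / (1 - \<gamma>p) * (2 + \<bar>u x\<bar> powr p x))" using iu integrable_const_\<Omega> by simp
    show "AE x in lebesgue_on \<Omega>. h x * G_delta \<gamma> \<delta> x (u x) \<le> H / (1 - \<gamma>p) * (2 + \<bar>u x\<bar> powr p x)"
      using AE_in_\<Omega> h(1) uX(2)
    proof eventually_elim
      case (elim x)
      have "h x * G_delta \<gamma> \<delta> x (u x) \<le> H * ((2 + u x powr p x) / (1 - \<gamma>p))"
        using elim G_delta_bounds[of \<delta> "u x" \<gamma> x \<gamma>p "p x"] \<delta> \<gamma> p_ge h(2) by (intro mult_mono) auto
      then show ?case using elim by simp
    qed
    show "AE x in lebesgue_on \<Omega>. 0 \<le> H / (1 - \<gamma>p) * (2 + \<bar>u x\<bar> powr p x)"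
      by (intro AE_I2 mult_nonneg_nonneg k) simp
  qed
  also have "\<dots> = H / (1 - \<gamma>p) * (2 * vol + (\<integral>x. \<bar>u x\<bar> powr p x \<partial>lebesgue_on \<Omega>))"
    using iu integrable_const_\<Omega> integral_const_\<Omega> by simp
  also have "\<dots> \<le> H / (1 - \<gamma>p) * (2 * vol + P * m)"
    using J_fun_bounds(1)[OF uX(1,3)] k by (intro mult_left_mono) auto
  finally have 1: "(LINT x|lebesgue_on \<Omega>. h x * G_delta \<gamma> \<delta> x (u x)) \<le> H / (1 - \<gamma>p) * (2 * vol + P * m)" .
  have 2: "0 \<le> (LINT x|lebesgue_on \<Omega>. h x * G_delta \<gamma> \<delta> x (w x))"
  proof (rule integral_nonneg_AE)
    show "AE x in lebesgue_on \<Omega>. 0 \<le> h x * G_delta \<gamma> \<delta> x (w x)"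
      using AE_in_\<Omega> h(1) w0
    proof eventually_elim
      case (elim x)
      then show ?case using G_delta_bounds(1)[of \<delta> "w x" \<gamma> x \<gamma>p 1] \<delta> \<gamma> by (intro mult_nonneg_nonneg) auto
    qed
  qed
  have "\<mu> * (LINT x|lebesgue_on \<Omega>. h x * G_delta \<gamma> \<delta> x (u x)) \<le> \<mu> * (H / (1 - \<gamma>p) * (2 * vol + P * m))"
    using 1 \<mu> by (rule mult_left_mono)
  moreover have "0 \<le> \<mu> * (LINT x|lebesgue_on \<Omega>. h x * G_delta \<gamma> \<delta> x (w x))" using 2 \<mu> by simp
  ultimately have "E_eps \<Omega> p \<epsilon> u \<le> E_eps \<Omega> p \<epsilon> w + \<mu> * (H / (1 - \<gamma>p) * (2 * vol + P * m))"
    using min unfolding I_fun_def by linarith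
  then have "P * E_eps \<Omega> p \<epsilon> u \<le> P * (E_eps \<Omega> p \<epsilon> w + \<mu> * (H / (1 - \<gamma>p) * (2 * vol + P * m)))"
    using P by (intro mult_left_mono) auto
  then show ?thesis using gradient_le_energy[OF \<epsilon> uX(1)] by linarith
qed

end

section \<open>Solutions of the shifted problems\<close>

text \<open>The situation after the energies have been bounded: \<open>M\<close> bounds the gradients.\<close>

locale singular_sequence = log_exponent \<Omega> p P C
  for \<Omega> :: "'a::euclidean_space set" and p P C +
  fixes pm H \<epsilon> m \<mu> \<gamma>p M :: real and h \<gamma> :: "'a \<Rightarrow> real" and \<delta> lam :: "nat \<Rightarrow> real" and u :: "nat \<Rightarrow> 'a \<Rightarrow> real"
  assumes pm: "1 < pm" "\<And>x. x \<in> \<Omega> \<Longrightarrow> pm \<le> p x"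
    and h_meas [measurable]: "h \<in> borel_measurable (lebesgue_on \<Omega>)"
    and h_bounds: "AE x in lebesgue_on \<Omega>. 0 \<le> h x \<and> h x \<le> H" "0 \<le> H"
    and \<gamma>_meas [measurable]: "\<gamma> \<in> borel_measurable (lebesgue_on \<Omega>)"
    and \<gamma>: "\<And>x. x \<in> \<Omega> \<Longrightarrow> 0 < \<gamma> x \<and> \<gamma> x \<le> \<gamma>p" "\<gamma>p < 1"
    and params: "0 < \<epsilon>" "0 < m" "0 \<le> \<mu>" "0 \<le> M"
    and \<delta>: "\<And>n. 0 < \<delta> n" "\<And>n. \<delta> n \<le> 1" "\<delta> \<longlonglongrightarrow> 0"
    and u_X: "\<And>n. u n \<in> X_space \<Omega> p" and u_nonneg: "\<And>n. AE x in lebesgue_on \<Omega>. 0 \<le> u n x"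
    and u_J: "\<And>n. J_fun \<Omega> p (u n) = m"
    and u_grad: "\<And>n. (\<integral>x. norm (wgrad \<Omega> (u n) x) powr p x \<partial>lebesgue_on \<Omega>) \<le> M"
    and euler_lagrange: "\<And>n \<phi>. \<phi> \<in> X_space \<Omega> p \<Longrightarrow>
      (LINT x|lebesgue_on \<Omega>. A_eps p \<epsilon> x (wgrad \<Omega> (u n) x) \<bullet> wgrad \<Omega> \<phi> x) =
        lam n * (LINT x|lebesgue_on \<Omega>. u n x powr (p x - 1) * \<phi> x) +
        \<mu> * (LINT x|lebesgue_on \<Omega>. h x * (u n x + \<delta> n) powr (- \<gamma> x) * \<phi> x)"
begin

lemmas uD = X_spaceD[OF u_X]

lemma u_meas [measurable]: "u n \<in> borel_measurable (lebesgue_on \<Omega>)" "wgrad \<Omega> (u n) \<in> borel_measurable (lebesgue_on \<Omega>)"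
  by (rule uD)+

lemma u_powr: "integrable (lebesgue_on \<Omega>) (\<lambda>x. \<bar>u n x\<bar> powr p x)"
    "(\<integral>x. \<bar>u n x\<bar> powr p x \<partial>lebesgue_on \<Omega>) \<le> P * m" "m \<le> (\<integral>x. \<bar>u n x\<bar> powr p x \<partial>lebesgue_on \<Omega>)"
  using integrable_of_modular(2)[OF uD(4,2)] J_fun_bounds[OF u_X u_J] by auto

lemma u_modular: "modular \<Omega> p (u n) \<le> ennreal (P * m + M)" "modular \<Omega> p (wgrad \<Omega> (u n)) \<le> ennreal (P * m + M)"
proof -
  have "0 \<le> P * m" using P params by simp
  then show "modular \<Omega> p (u n) \<le> ennreal (P * m + M)" "modular \<Omega> p (wgrad \<Omega> (u n)) \<le> ennreal (P * m + M)"
    unfolding modular_eq_integral[OF uD(4,2)] modular_eq_integral[OF uD(5,3)]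
    using u_powr(2)[of n] u_grad[of n] params by (intro ennreal_leI; simp)+
qed

definition Rb :: real where "Rb = 2 powr P * (eps_const \<epsilon> * vol + M)"

lemma r_bound: "integrable (lebesgue_on \<Omega>) (\<lambda>x. r_eps \<epsilon> (wgrad \<Omega> (u n) x) powr p x)"
   "(\<integral>x. r_eps \<epsilon> (wgrad \<Omega> (u n) x) powr p x \<partial>lebesgue_on \<Omega>) \<le> Rb"
proof -
  show "integrable (lebesgue_on \<Omega>) (\<lambda>x. r_eps \<epsilon> (wgrad \<Omega> (u n) x) powr p x)"
    by (rule r_eps_integrable(1)[OF params(1) uD(5,3)])
  have "2 powr P * (eps_const \<epsilon> * vol + (\<integral>x. norm (wgrad \<Omega> (u n) x) powr p x \<partial>lebesgue_on \<Omega>)) \<le> Rb"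
    unfolding Rb_def using u_grad by (intro mult_left_mono add_left_mono) auto
  then show "(\<integral>x. r_eps \<epsilon> (wgrad \<Omega> (u n) x) powr p x \<partial>lebesgue_on \<Omega>) \<le> Rb"
    using r_eps_integrable(2)[OF params(1) uD(5,3)] by (rule order_trans[rotated])
qed

text \<open>For a fixed positive shift the singular factor is bounded.\<close>

lemma singular_integrable:
  assumes \<phi>: "\<phi> \<in> X_space \<Omega> p"
  shows "integrable (lebesgue_on \<Omega>) (\<lambda>x. h x * (u n x + \<delta> n) powr (- \<gamma> x) * \<phi> x)"
proof -
  note F = X_spaceD[OF \<phi>]
  note [measurable] = F(4)
  have i: "integrable (lebesgue_on \<Omega>) (\<lambda>x. H / \<delta> n * \<phi> x)" using integrable_of_modular(1)[OF F(4,2)] by simp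
  show ?thesis
  proof (rule Bochner_Integration.integrable_bound[OF i])
    show "AE x in lebesgue_on \<Omega>. norm (h x * (u n x + \<delta> n) powr (- \<gamma> x) * \<phi> x) \<le> norm (H / \<delta> n * \<phi> x)"
      using AE_in_\<Omega> h_bounds(1) u_nonneg[of n]
    proof eventually_elim
      case (elim x)
      have "(u n x + \<delta> n) powr (- \<gamma> x) \<le> \<delta> n powr (- \<gamma> x)" using elim \<delta>(1)[of n] \<gamma>(1)[of x] by (intro powr_mono2') auto
      also have "\<dots> \<le> \<delta> n powr (- 1)" using elim \<delta>(1,2)[of n] \<gamma>(1)[of x] \<gamma>(2) by (intro powr_mono') auto
      finally have "(u n x + \<delta> n) powr (- \<gamma> x) \<le> 1 / \<delta> n" using \<delta>(1)[of n] by (simp add: powr_minus inverse_eq_divide)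
      then have "h x * (u n x + \<delta> n) powr (- \<gamma> x) \<le> H * (1 / \<delta> n)" using elim h_bounds(2) by (intro mult_mono) auto
      then have "h x * (u n x + \<delta> n) powr (- \<gamma> x) * \<bar>\<phi> x\<bar> \<le> H * (1 / \<delta> n) * \<bar>\<phi> x\<bar>" by (rule mult_right_mono) simp
      then show ?case using elim h_bounds(2) \<delta>(1)[of n] by (simp add: abs_mult)
    qed
  qed measurable
qed

text \<open>Test the equation with its own solution: the multiplier is multiplied by at least \<open>m > 0\<close>, and all other terms are bounded.\<close>

lemma lam_bounded: "\<exists>\<Lambda>\<ge>0. \<forall>n. \<bar>lam n\<bar> \<le> \<Lambda>"
proof -
  define B where "B = Rb + M + \<mu> * (H * (2 * vol + P * m))"
  have "\<bar>lam n\<bar> * m \<le> B" for n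
  proof -
    let ?a = "LINT x|lebesgue_on \<Omega>. A_eps p \<epsilon> x (wgrad \<Omega> (u n) x) \<bullet> wgrad \<Omega> (u n) x"
    let ?b = "LINT x|lebesgue_on \<Omega>. u n x powr (p x - 1) * u n x"
    let ?c = "LINT x|lebesgue_on \<Omega>. h x * (u n x + \<delta> n) powr (- \<gamma> x) * u n x"
    have E: "?a = lam n * ?b + \<mu> * ?c" by (rule euler_lagrange[OF u_X])
    have ig: "integrable (lebesgue_on \<Omega>) (\<lambda>x. norm (wgrad \<Omega> (u n) x) powr p x)" by (rule integrable_of_modular(2)[OF uD(5,3)])
    have "\<bar>?a\<bar> \<le> (LINT x|lebesgue_on \<Omega>. \<bar>A_eps p \<epsilon> x (wgrad \<Omega> (u n) x) \<bullet> wgrad \<Omega> (u n) x\<bar>)"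
      by (rule integral_abs_bound)
    also have "\<dots> \<le> (LINT x|lebesgue_on \<Omega>. r_eps \<epsilon> (wgrad \<Omega> (u n) x) powr p x + norm (wgrad \<Omega> (u n) x) powr p x)"
    proof (rule integral_le_of_bound)
      show "AE x in lebesgue_on \<Omega>. \<bar>A_eps p \<epsilon> x (wgrad \<Omega> (u n) x) \<bullet> wgrad \<Omega> (u n) x\<bar> \<le> r_eps \<epsilon> (wgrad \<Omega> (u n) x) powr p x + norm (wgrad \<Omega> (u n) x) powr p x"
        using AE_in_\<Omega> by eventually_elim (rule A_eps_inner_le[OF params(1)])
    qed (use r_bound(1) ig in auto)
    also have "\<dots> \<le> Rb + M" using r_bound[of n] ig u_grad[of n] by simp
    finally have a: "\<bar>?a\<bar> \<le> Rb + M" .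
    have "?b = (LINT x|lebesgue_on \<Omega>. \<bar>u n x\<bar> powr p x)"
    proof (rule integral_cong_AE)
      show "AE x in lebesgue_on \<Omega>. u n x powr (p x - 1) * u n x = \<bar>u n x\<bar> powr p x"
        using u_nonneg[of n] AE_in_\<Omega>
      proof eventually_elim
        case (elim x)
        then show ?case using powr_add[of "u n x" "p x - 1" 1] by (cases "u n x = 0") auto
      qed
    qed measurable
    then have b: "m \<le> ?b" using u_powr(3)[of n] by simp
    have "\<bar>?c\<bar> \<le> (LINT x|lebesgue_on \<Omega>. \<bar>h x * (u n x + \<delta> n) powr (- \<gamma> x) * u n x\<bar>)" by (rule integral_abs_bound)
    also have "\<dots> \<le> (LINT x|lebesgue_on \<Omega>. H * (2 + \<bar>u n x\<bar> powr p x))"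
    proof (rule integral_le_of_bound)
      show "integrable (lebesgue_on \<Omega>) (\<lambda>x. H * (2 + \<bar>u n x\<bar> powr p x))" using u_powr(1) integrable_const_\<Omega> by simp
      show "AE x in lebesgue_on \<Omega>. 0 \<le> H * (2 + \<bar>u n x\<bar> powr p x)" using h_bounds(2) by (intro AE_I2 mult_nonneg_nonneg) auto
      show "AE x in lebesgue_on \<Omega>. \<bar>h x * (u n x + \<delta> n) powr (- \<gamma> x) * u n x\<bar> \<le> H * (2 + \<bar>u n x\<bar> powr p x)"
        using AE_in_\<Omega> h_bounds(1) u_nonneg[of n]
      proof eventually_elim
        case (elim x)
        let ?s = "u n x" and ?d = "\<delta> n"
        have "(?s + ?d) powr (- \<gamma> x) * ?s \<le> (?s + ?d) powr (- \<gamma> x) * (?s + ?d)" using \<delta>(1)[of n] by (intro mult_left_mono) auto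
        also have "\<dots> = (?s + ?d) powr (1 - \<gamma> x)" using elim \<delta>(1)[of n] powr_add[of "?s + ?d" "- \<gamma> x" 1] by simp
        also have "\<dots> \<le> (1 + ?s) powr (1 - \<gamma> x)" using elim \<delta>(1,2)[of n] \<gamma>(1)[of x] \<gamma>(2) by (intro powr_mono2) auto
        also have "\<dots> \<le> (1 + ?s) powr 1" using elim \<gamma>(1)[of x] by (intro powr_mono) auto
        also have "\<dots> \<le> 2 + \<bar>?s\<bar> powr p x" using le_one_plus_powr[of ?s 1 "p x"] elim p_ge[of x] by simp
        finally have "h x * ((?s + ?d) powr (- \<gamma> x) * ?s) \<le> H * (2 + \<bar>?s\<bar> powr p x)"
          using elim h_bounds(2) by (intro mult_mono) auto
        then show ?case using elim by (simp add: abs_mult mult.assoc)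
      qed
    qed
    also have "\<dots> = H * (2 * vol + (\<integral>x. \<bar>u n x\<bar> powr p x \<partial>lebesgue_on \<Omega>))"
      using u_powr(1)[of n] integrable_const_\<Omega> integral_const_\<Omega> by simp
    also have "\<dots> \<le> H * (2 * vol + P * m)" using u_powr(2)[of n] h_bounds(2) by (intro mult_left_mono) auto
    finally have c: "\<mu> * \<bar>?c\<bar> \<le> \<mu> * (H * (2 * vol + P * m))" using params(3) by (rule mult_left_mono)
    have "\<bar>lam n\<bar> * m \<le> \<bar>lam n\<bar> * ?b" using b by (intro mult_left_mono) auto
    also have "\<dots> = \<bar>lam n * ?b\<bar>" using b params(2) by (simp add: abs_mult)
    also have "lam n * ?b = ?a - \<mu> * ?c" using E by simp
    also have "\<bar>?a - \<mu> * ?c\<bar> \<le> \<bar>?a\<bar> + \<mu> * \<bar>?c\<bar>" using abs_triangle_ineq4[of ?a "\<mu> * ?c"] params(3) by (simp add: abs_mult)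
    also have "\<dots> \<le> B" unfolding B_def using a c by linarith
    finally show ?thesis .
  qed
  then have "\<bar>lam n\<bar> \<le> B / m" for n using params(2) by (simp add: field_simps)
  moreover from this[of 0] have "0 \<le> B / m" by (rule order_trans[OF abs_ge_zero])
  ultimately show ?thesis by blast
qed

text \<open>Its integral is the left-hand side of the difference of two equations, tested with the difference of the solutions.\<close>

abbreviation Dif :: "nat \<Rightarrow> nat \<Rightarrow> 'a \<Rightarrow> real" where
  "Dif n k x \<equiv> (A_eps p \<epsilon> x (wgrad \<Omega> (u n) x) - A_eps p \<epsilon> x (wgrad \<Omega> (u k) x)) \<bullet> (wgrad \<Omega> (u n) x - wgrad \<Omega> (u k) x)"

lemma u_diff_powr:
  "integrable (lebesgue_on \<Omega>) (\<lambda>x. \<bar>u n x - u k x\<bar> powr p x)"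
  "modular \<Omega> p (\<lambda>x. u n x - u k x) = ennreal (\<integral>x. \<bar>u n x - u k x\<bar> powr p x \<partial>lebesgue_on \<Omega>)"
  using integrable_of_modular(2)[OF X_spaceD(4,2)[OF X_space_diff(1)[OF u_X u_X]], of n k]
    modular_eq_integral[OF X_spaceD(4,2)[OF X_space_diff(1)[OF u_X u_X]], of n k] by auto

lemma Dif_integrable: "integrable (lebesgue_on \<Omega>) (Dif n k)"
  unfolding inner_diff_left inner_diff_right
  by (intro Bochner_Integration.integrable_diff A_eps_integrable[OF params(1)] uD)

text \<open>The multiplier terms are small when the solutions are close, up to \<open>\<tau>\<close>; the difference of the singular terms is at most
a power of the larger shift by \<open>singular_difference_le\<close>.\<close>

lemma Dif_le:
  assumes \<Lambda>: "\<And>n. \<bar>lam n\<bar> \<le> \<Lambda>" and \<tau>: "0 < \<tau>" "\<tau> \<le> 1"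
  shows "(\<integral>x. Dif n k x \<partial>lebesgue_on \<Omega>) \<le>
    2 * \<Lambda> * (\<tau> * (P * m) + \<tau> powr (- P) * (\<integral>x. \<bar>u n x - u k x\<bar> powr p x \<partial>lebesgue_on \<Omega>))
    + \<mu> * (H * (max (\<delta> n) (\<delta> k)) powr (1 - \<gamma>p) * vol)"
proof -
  \<comment> \<open>The difference of the solutions is an admissible test function in both equations.\<close>
  define \<phi> where "\<phi> x = u n x - u k x" for x
  have \<phi>X: "\<phi> \<in> X_space \<Omega> p" unfolding \<phi>_def by (rule X_space_diff(1)[OF u_X u_X])
  note F = X_spaceD[OF \<phi>X]
  note [measurable] = F(4)
  have wg: "AE x in lebesgue_on \<Omega>. wgrad \<Omega> \<phi> x = wgrad \<Omega> (u n) x - wgrad \<Omega> (u k) x"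
    unfolding \<phi>_def by (rule X_space_diff(2)[OF u_X u_X])
  define E where "E = (\<integral>x. \<bar>u n x - u k x\<bar> powr p x \<partial>lebesgue_on \<Omega>)"
  define a where "a j = (LINT x|lebesgue_on \<Omega>. A_eps p \<epsilon> x (wgrad \<Omega> (u j) x) \<bullet> wgrad \<Omega> \<phi> x)" for j
  define b where "b j = (LINT x|lebesgue_on \<Omega>. u j x powr (p x - 1) * \<phi> x)" for j
  define s where "s j x = h x * (u j x + \<delta> j) powr (- \<gamma> x) * \<phi> x" for j x
  have EL: "a j = lam j * b j + \<mu> * (LINT x|lebesgue_on \<Omega>. s j x)" for j
    unfolding a_def b_def s_def by (rule euler_lagrange[OF \<phi>X])
  have "(\<integral>x. Dif n k x \<partial>lebesgue_on \<Omega>) = (LINT x|lebesgue_on \<Omega>. A_eps p \<epsilon> x (wgrad \<Omega> (u n) x) \<bullet> wgrad \<Omega> \<phi> x - A_eps p \<epsilon> x (wgrad \<Omega> (u k) x) \<bullet> wgrad \<Omega> \<phi> x)"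
  proof (rule integral_cong_AE)
    show "Dif n k \<in> borel_measurable (lebesgue_on \<Omega>)" using Dif_integrable by (rule borel_measurable_integrable)
    show "(\<lambda>x. A_eps p \<epsilon> x (wgrad \<Omega> (u n) x) \<bullet> wgrad \<Omega> \<phi> x - A_eps p \<epsilon> x (wgrad \<Omega> (u k) x) \<bullet> wgrad \<Omega> \<phi> x) \<in> borel_measurable (lebesgue_on \<Omega>)"
      using F(5) by measurable
    show "AE x in lebesgue_on \<Omega>. Dif n k x = A_eps p \<epsilon> x (wgrad \<Omega> (u n) x) \<bullet> wgrad \<Omega> \<phi> x - A_eps p \<epsilon> x (wgrad \<Omega> (u k) x) \<bullet> wgrad \<Omega> \<phi> x"
      using wg by eventually_elim (simp add: inner_diff_left)
  qed
  also have "\<dots> = a n - a k"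
    unfolding a_def by (intro Bochner_Integration.integral_diff A_eps_integrable[OF params(1)] uD F)
  also have "\<dots> = lam n * b n - lam k * b k + \<mu> * ((LINT x|lebesgue_on \<Omega>. s n x) - (LINT x|lebesgue_on \<Omega>. s k x))"
    unfolding EL by (simp add: algebra_simps)
  finally have 1: "(\<integral>x. Dif n k x \<partial>lebesgue_on \<Omega>) = lam n * b n - lam k * b k + \<mu> * ((LINT x|lebesgue_on \<Omega>. s n x) - (LINT x|lebesgue_on \<Omega>. s k x))" .
  have bb: "\<bar>lam j * b j\<bar> \<le> \<Lambda> * (\<tau> * (P * m) + \<tau> powr (- P) * E)" for j
  proof -
    have "\<bar>b j\<bar> \<le> (LINT x|lebesgue_on \<Omega>. \<bar>u j x powr (p x - 1) * \<phi> x\<bar>)" unfolding b_def by (rule integral_abs_bound)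
    also have "\<dots> \<le> (LINT x|lebesgue_on \<Omega>. \<tau> * \<bar>u j x\<bar> powr p x + \<tau> powr (- P) * \<bar>\<phi> x\<bar> powr p x)"
    proof (rule integral_le_of_bound)
      show "integrable (lebesgue_on \<Omega>) (\<lambda>x. \<tau> * \<bar>u j x\<bar> powr p x + \<tau> powr (- P) * \<bar>\<phi> x\<bar> powr p x)"
        using u_powr(1)[of j] u_diff_powr(1)[of n k] by (simp add: \<phi>_def)
      show "AE x in lebesgue_on \<Omega>. \<bar>u j x powr (p x - 1) * \<phi> x\<bar> \<le> \<tau> * \<bar>u j x\<bar> powr p x + \<tau> powr (- P) * \<bar>\<phi> x\<bar> powr p x"
        using AE_in_\<Omega> u_nonneg[of j]
      proof eventually_elim
        case (elim x)
        then show ?case using powr_mult_le_small[of "u j x" "\<bar>\<phi> x\<bar>" "p x" P \<tau>] p_ge p_le \<tau> by (simp add: abs_mult)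
      qed
      show "AE x in lebesgue_on \<Omega>. 0 \<le> \<tau> * \<bar>u j x\<bar> powr p x + \<tau> powr (- P) * \<bar>\<phi> x\<bar> powr p x" using \<tau> by simp
    qed
    also have "\<dots> = \<tau> * (LINT x|lebesgue_on \<Omega>. \<bar>u j x\<bar> powr p x) + \<tau> powr (- P) * E"
      using u_powr(1)[of j] u_diff_powr(1)[of n k] by (simp add: \<phi>_def E_def)
    also have "\<dots> \<le> \<tau> * (P * m) + \<tau> powr (- P) * E" using u_powr(2)[of j] \<tau> by (simp add: mult_left_mono)
    finally have "\<bar>b j\<bar> \<le> \<tau> * (P * m) + \<tau> powr (- P) * E" .
    then show ?thesis unfolding abs_mult using \<Lambda>[of j] by (intro mult_mono) (auto intro: order_trans[OF abs_ge_zero])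
  qed
  have si: "integrable (lebesgue_on \<Omega>) (s j)" for j unfolding s_def by (rule singular_integrable[OF \<phi>X])
  have "(LINT x|lebesgue_on \<Omega>. s n x) - (LINT x|lebesgue_on \<Omega>. s k x) = (LINT x|lebesgue_on \<Omega>. s n x - s k x)"
    by (rule Bochner_Integration.integral_diff[OF si si, symmetric])
  also have "\<dots> \<le> (LINT x|lebesgue_on \<Omega>. H * (max (\<delta> n) (\<delta> k)) powr (1 - \<gamma>p))"
  proof (rule integral_mono_AE)
    show "AE x in lebesgue_on \<Omega>. s n x - s k x \<le> H * (max (\<delta> n) (\<delta> k)) powr (1 - \<gamma>p)"
      using AE_in_\<Omega> h_bounds(1) u_nonneg[of n] u_nonneg[of k]
    proof eventually_elim
      case (elim x)
      have "s n x - s k x = h x * (((u n x + \<delta> n) powr (- \<gamma> x) - (u k x + \<delta> k) powr (- \<gamma> x)) * (u n x - u k x))"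
        unfolding s_def \<phi>_def by (simp add: algebra_simps)
      also have "\<dots> \<le> h x * (max (\<delta> n) (\<delta> k)) powr (1 - \<gamma> x)"
        using elim \<delta>(1) \<gamma>(1)[of x] \<gamma>(2) by (intro mult_left_mono singular_difference_le) auto
      also have "\<dots> \<le> h x * (max (\<delta> n) (\<delta> k)) powr (1 - \<gamma>p)"
        using elim \<delta>(1)[of n] \<delta>(2) \<gamma>(1)[of x] by (intro mult_left_mono powr_mono') auto
      also have "\<dots> \<le> H * (max (\<delta> n) (\<delta> k)) powr (1 - \<gamma>p)" using elim by (intro mult_right_mono) auto
      finally show ?case .
    qed
  qed (use si integrable_const_\<Omega> in auto)
  also have "\<dots> = H * (max (\<delta> n) (\<delta> k)) powr (1 - \<gamma>p) * vol" by (rule integral_const_\<Omega>)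
  finally have "\<mu> * ((LINT x|lebesgue_on \<Omega>. s n x) - (LINT x|lebesgue_on \<Omega>. s k x)) \<le> \<mu> * (H * (max (\<delta> n) (\<delta> k)) powr (1 - \<gamma>p) * vol)"
    using params(3) by (rule mult_left_mono)
  then show ?thesis using 1 bb[of n] bb[of k] unfolding E_def[symmetric] by (simp add: abs_le_iff algebra_simps)
qed

lemma gradient_difference_le:
  assumes \<tau>: "0 < \<tau>" "\<tau> \<le> 1"
  shows "modular \<Omega> p (\<lambda>x. wgrad \<Omega> (u n) x - wgrad \<Omega> (u k) x) \<le>
    ennreal ((2 * 2 powr P + 1 / (pm - 1)) / \<tau> * (\<integral>x. Dif n k x \<partial>lebesgue_on \<Omega>) + \<tau> * (2 * Rb))"
proof -
  let ?K = "2 * 2 powr P + 1 / (pm - 1)"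
  let ?g = "\<lambda>x. norm (wgrad \<Omega> (u n) x - wgrad \<Omega> (u k) x) powr p x"
  have gm: "(\<lambda>x. wgrad \<Omega> (u n) x - wgrad \<Omega> (u k) x) \<in> borel_measurable (lebesgue_on \<Omega>)" by measurable
  have gf: "modular \<Omega> p (\<lambda>x. wgrad \<Omega> (u n) x - wgrad \<Omega> (u k) x) < \<infinity>" by (rule modular_diff_finite[OF uD(5) uD(5) uD(3) uD(3)])
  have "(LINT x|lebesgue_on \<Omega>. ?g x) \<le> (LINT x|lebesgue_on \<Omega>. ?K / \<tau> * Dif n k x +
      \<tau> * (r_eps \<epsilon> (wgrad \<Omega> (u n) x) powr p x + r_eps \<epsilon> (wgrad \<Omega> (u k) x) powr p x))"
  proof (rule integral_mono_AE)
    show "integrable (lebesgue_on \<Omega>) ?g" by (rule integrable_of_modular(2)[OF gm gf])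
    show "integrable (lebesgue_on \<Omega>) (\<lambda>x. ?K / \<tau> * Dif n k x +
      \<tau> * (r_eps \<epsilon> (wgrad \<Omega> (u n) x) powr p x + r_eps \<epsilon> (wgrad \<Omega> (u k) x) powr p x))"
      by (intro Bochner_Integration.integrable_add integrable_mult_right Dif_integrable r_bound(1))
    show "AE x in lebesgue_on \<Omega>. ?g x \<le> ?K / \<tau> * Dif n k x +
      \<tau> * (r_eps \<epsilon> (wgrad \<Omega> (u n) x) powr p x + r_eps \<epsilon> (wgrad \<Omega> (u k) x) powr p x)"
      using AE_in_\<Omega>
    proof eventually_elim
      case (elim x)
      let ?a = "r_eps \<epsilon> (wgrad \<Omega> (u n) x)" and ?b = "r_eps \<epsilon> (wgrad \<Omega> (u k) x)"
      have "?g x \<le> ?K / \<tau> * Dif n k x + \<tau> * (max ?a ?b) powr p x"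
        unfolding A_eps_def by (rule strong_monotonicity[OF params(1) pm(1) pm(2)[OF elim] p_le[OF elim] \<tau>])
      also have "(max ?a ?b) powr p x \<le> ?a powr p x + ?b powr p x" by (simp add: max_def)
      finally show ?case using \<tau> by (simp add: mult_left_mono)
    qed
  qed
  also have "\<dots> = ?K / \<tau> * (\<integral>x. Dif n k x \<partial>lebesgue_on \<Omega>) +
      \<tau> * ((\<integral>x. r_eps \<epsilon> (wgrad \<Omega> (u n) x) powr p x \<partial>lebesgue_on \<Omega>) + (\<integral>x. r_eps \<epsilon> (wgrad \<Omega> (u k) x) powr p x \<partial>lebesgue_on \<Omega>))"
    using Dif_integrable[of n k] r_bound(1)[of n] r_bound(1)[of k]
    by (subst Bochner_Integration.integral_add; (intro integrable_mult_right Bochner_Integration.integrable_add)?; simp)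
  also have "\<dots> \<le> ?K / \<tau> * (\<integral>x. Dif n k x \<partial>lebesgue_on \<Omega>) + \<tau> * (2 * Rb)"
    using r_bound(2)[of n] r_bound(2)[of k] \<tau> by (intro add_left_mono mult_left_mono) auto
  finally show ?thesis unfolding modular_eq_integral[OF gm gf] by (rule ennreal_leI)
qed

text \<open>The parameters are chosen in the order \<open>\<tau>\<close> (strong monotonicity), \<open>\<sigma>\<close> (multiplier terms), \<open>\<eta>\<close> (distance of the solutions),
and finally the index beyond which the shifts are small.\<close>

lemma gradients_cauchy:
  assumes r: "strict_mono (r :: nat \<Rightarrow> nat)"
    and c: "\<And>e. 0 < e \<Longrightarrow> \<exists>N. \<forall>m\<ge>N. \<forall>n\<ge>N. modular \<Omega> p (\<lambda>x. u (r m) x - u (r n) x) \<le> ennreal e"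
    and e: "0 < e"
  shows "\<exists>N. \<forall>m\<ge>N. \<forall>n\<ge>N. modular \<Omega> p (\<lambda>x. wgrad \<Omega> (u (r m)) x - wgrad \<Omega> (u (r n)) x) \<le> ennreal e"
proof -
  obtain \<Lambda> where \<Lambda>: "0 \<le> \<Lambda>" "\<And>n. \<bar>lam n\<bar> \<le> \<Lambda>" using lam_bounded by blast
  define K where "K = 2 * 2 powr P + 1 / (pm - 1)"
  have K: "0 < K" unfolding K_def using pm by (intro add_nonneg_pos) auto
  have small: "\<exists>\<tau>. 0 < \<tau> \<and> \<tau> \<le> 1 \<and> \<tau> * B \<le> y" if "0 < y" "0 \<le> B" for y B :: real
  proof (intro exI conjI)
    show "0 < min 1 (y / (B + 1))" using that by simp
    have "min 1 (y / (B + 1)) * B \<le> y / (B + 1) * (B + 1)" using that by (intro mult_mono) auto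
    then show "min 1 (y / (B + 1)) * B \<le> y" using that by simp
  qed simp
  have Rb: "0 \<le> 2 * Rb" using vol params by (simp add: Rb_def eps_const_def)
  obtain \<tau> where \<tau>: "0 < \<tau>" "\<tau> \<le> 1" "\<tau> * (2 * Rb) \<le> e / 2" using small[OF half_gt_zero[OF e] Rb] by blast
  define d where "d = e * \<tau> / (2 * K)"
  have d: "0 < d" using e \<tau> K by (simp add: d_def)
  have Pm: "0 \<le> 2 * \<Lambda> * (P * m)" using \<Lambda> P params by simp
  obtain \<sigma> where \<sigma>: "0 < \<sigma>" "\<sigma> \<le> 1" "\<sigma> * (2 * \<Lambda> * (P * m)) \<le> d / 3" using small[OF _ Pm, of "d / 3"] divide_pos_pos[OF d zero_less_numeral] by blast
  have B2: "0 \<le> 2 * \<Lambda> * \<sigma> powr (- P)" using \<Lambda> by simp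
  obtain \<eta> where \<eta>: "0 < \<eta>" "\<eta> * (2 * \<Lambda> * \<sigma> powr (- P)) \<le> d / 3" using small[OF _ B2, of "d / 3"] divide_pos_pos[OF d zero_less_numeral] by blast
  obtain N1 where N1: "\<And>m n. m \<ge> N1 \<Longrightarrow> n \<ge> N1 \<Longrightarrow> modular \<Omega> p (\<lambda>x. u (r m) x - u (r n) x) \<le> ennreal \<eta>"
    using c[OF \<eta>(1)] by blast
  have "(\<lambda>n. \<delta> n powr (1 - \<gamma>p)) \<longlonglongrightarrow> 0"
    using \<gamma>(2) \<delta>(1) by (intro tendsto_zero_powrI[OF \<delta>(3) tendsto_const]) (auto intro!: always_eventually less_imp_le)
  then have "(\<lambda>n. \<mu> * (H * \<delta> n powr (1 - \<gamma>p) * vol)) \<longlonglongrightarrow> \<mu> * (H * 0 * vol)" by (intro tendsto_intros)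
  then have "\<forall>\<^sub>F n in sequentially. \<mu> * (H * \<delta> n powr (1 - \<gamma>p) * vol) < d / 3"
    using order_tendstoD(2)[of _ "\<mu> * (H * 0 * vol)" sequentially "d / 3"] d by simp
  then obtain N2 where N2: "\<And>n. n \<ge> N2 \<Longrightarrow> \<mu> * (H * \<delta> n powr (1 - \<gamma>p) * vol) < d / 3"
    by (auto simp: eventually_sequentially)
  show ?thesis
  proof (intro exI allI impI)
    fix i j assume "i \<ge> max N1 N2" "j \<ge> max N1 N2"
    then have ij: "i \<ge> N1" "j \<ge> N1" "r i \<ge> N2" "r j \<ge> N2" using seq_suble[OF r, of i] seq_suble[OF r, of j] by auto
    define E where "E = (\<integral>x. \<bar>u (r i) x - u (r j) x\<bar> powr p x \<partial>lebesgue_on \<Omega>)"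
    have "E \<le> \<eta>" using N1[OF ij(1,2)] \<eta>(1) unfolding u_diff_powr(2) E_def by (subst (asm) ennreal_le_iff) auto
    then have "2 * \<Lambda> * \<sigma> powr (- P) * E \<le> 2 * \<Lambda> * \<sigma> powr (- P) * \<eta>" by (rule mult_left_mono[OF _ B2])
    also have "\<dots> = \<eta> * (2 * \<Lambda> * \<sigma> powr (- P))" by (rule mult.commute)
    finally have E: "2 * \<Lambda> * \<sigma> powr (- P) * E \<le> d / 3" using \<eta>(2) by (rule order_trans)
    have \<delta>3: "\<mu> * (H * (max (\<delta> (r i)) (\<delta> (r j))) powr (1 - \<gamma>p) * vol) \<le> d / 3"
      using N2[OF ij(3)] N2[OF ij(4)] by (simp add: max_def)
    have "(\<integral>x. Dif (r i) (r j) x \<partial>lebesgue_on \<Omega>) \<le>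
      2 * \<Lambda> * (\<sigma> * (P * m) + \<sigma> powr (- P) * E) + \<mu> * (H * (max (\<delta> (r i)) (\<delta> (r j))) powr (1 - \<gamma>p) * vol)"
      unfolding E_def by (rule Dif_le[OF \<Lambda>(2) \<sigma>(1,2)])
    also have "2 * \<Lambda> * (\<sigma> * (P * m) + \<sigma> powr (- P) * E) = \<sigma> * (2 * \<Lambda> * (P * m)) + 2 * \<Lambda> * \<sigma> powr (- P) * E"
      by (simp add: algebra_simps)
    finally have Dd: "(\<integral>x. Dif (r i) (r j) x \<partial>lebesgue_on \<Omega>) \<le> d" using \<sigma>(3) E \<delta>3 by linarith
    have "K / \<tau> * (\<integral>x. Dif (r i) (r j) x \<partial>lebesgue_on \<Omega>) \<le> K / \<tau> * d" using Dd K \<tau> by (intro mult_left_mono) auto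
    also have "\<dots> = e / 2" using K \<tau> by (simp add: d_def)
    finally have "K / \<tau> * (\<integral>x. Dif (r i) (r j) x \<partial>lebesgue_on \<Omega>) + \<tau> * (2 * Rb) \<le> e" using \<tau>(3) by linarith
    then show "modular \<Omega> p (\<lambda>x. wgrad \<Omega> (u (r i)) x - wgrad \<Omega> (u (r j)) x) \<le> ennreal e"
      using gradient_difference_le[OF \<tau>(1,2), of "r i" "r j"] unfolding K_def by (meson ennreal_leI order_trans)
  qed
qed

text \<open>Functions and gradients are treated together as functions with values in \<open>real \<times> 'a\<close>, so that one
application of \<open>modular_complete\<close> provides a common subsequence and a common majorant.\<close>

lemma convergent_subsequence:
  obtains r v l S where "strict_mono (r :: nat \<Rightarrow> nat)" "v \<in> X_space \<Omega> p" "(\<lambda>n. lam (r n)) \<longlonglongrightarrow> l"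
    "(\<lambda>n. modular \<Omega> p (\<lambda>x. wgrad \<Omega> (u (r n)) x - wgrad \<Omega> v x)) \<longlonglongrightarrow> 0"
    "AE x in lebesgue_on \<Omega>. (\<lambda>n. u (r n) x) \<longlonglongrightarrow> v x"
    "AE x in lebesgue_on \<Omega>. (\<lambda>n. wgrad \<Omega> (u (r n)) x) \<longlonglongrightarrow> wgrad \<Omega> v x"
    "integrable (lebesgue_on \<Omega>) S"
    "AE x in lebesgue_on \<Omega>. \<forall>n. \<bar>u (r n) x\<bar> powr p x \<le> S x \<and> norm (wgrad \<Omega> (u (r n)) x) powr p x \<le> S x"
proof -
  have M0: "0 \<le> P * m + M" using P params by simp
  obtain r1 where r1: "strict_mono (r1 :: nat \<Rightarrow> nat)"
    "\<And>e. 0 < e \<Longrightarrow> \<exists>N. \<forall>m\<ge>N. \<forall>n\<ge>N. modular \<Omega> p (\<lambda>x. u (r1 m) x - u (r1 n) x) \<le> ennreal e"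
    by (rule X_space_compact[of "P * m + M" u, OF M0 u_X u_modular]) blast
  obtain \<Lambda> where \<Lambda>: "0 \<le> \<Lambda>" "\<And>n. \<bar>lam n\<bar> \<le> \<Lambda>" using lam_bounded by blast
  have "bounded (range (\<lambda>n. lam (r1 n)))" using \<Lambda>(2) by (auto simp: bounded_iff)
  then obtain l r2 where r2: "strict_mono (r2 :: nat \<Rightarrow> nat)" "((\<lambda>n. lam (r1 n)) \<circ> r2) \<longlonglongrightarrow> l"
    using bounded_imp_convergent_subsequence by blast
  define \<rho> where "\<rho> = r1 \<circ> r2"
  have \<rho>: "strict_mono \<rho>" unfolding \<rho>_def by (rule strict_mono_o[OF r1(1) r2(1)])
  have cu: "\<exists>N. \<forall>m\<ge>N. \<forall>n\<ge>N. modular \<Omega> p (\<lambda>x. u (\<rho> m) x - u (\<rho> n) x) \<le> ennreal e" if e: "0 < e" for e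
  proof -
    obtain N where N: "\<And>m n. m \<ge> N \<Longrightarrow> n \<ge> N \<Longrightarrow> modular \<Omega> p (\<lambda>x. u (r1 m) x - u (r1 n) x) \<le> ennreal e"
      using r1(2)[OF e] by blast
    have "modular \<Omega> p (\<lambda>x. u (\<rho> m) x - u (\<rho> n) x) \<le> ennreal e" if "m \<ge> N" "n \<ge> N" for m n
      unfolding \<rho>_def comp_def using seq_suble[OF r2(1), of m] seq_suble[OF r2(1), of n] that by (intro N) auto
    then show ?thesis by blast
  qed
  note cg = gradients_cauchy[OF \<rho> cu]
  define w where "w n x = (u (\<rho> n) x, wgrad \<Omega> (u (\<rho> n)) x)" for n x
  have wm [measurable]: "w n \<in> borel_measurable (lebesgue_on \<Omega>)" for n unfolding w_def by measurable
  have cw: "\<exists>N. \<forall>m\<ge>N. \<forall>n\<ge>N. modular \<Omega> p (\<lambda>x. w m x - w n x) \<le> ennreal e" if e: "0 < e" for e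
  proof -
    define \<eta> where "\<eta> = e / (2 * 2 powr P)"
    have \<eta>: "0 < \<eta>" using e by (simp add: \<eta>_def)
    obtain N1 where N1: "\<And>m n. m \<ge> N1 \<Longrightarrow> n \<ge> N1 \<Longrightarrow> modular \<Omega> p (\<lambda>x. u (\<rho> m) x - u (\<rho> n) x) \<le> ennreal \<eta>"
      using cu[OF \<eta>] by blast
    obtain N2 where N2: "\<And>m n. m \<ge> N2 \<Longrightarrow> n \<ge> N2 \<Longrightarrow> modular \<Omega> p (\<lambda>x. wgrad \<Omega> (u (\<rho> m)) x - wgrad \<Omega> (u (\<rho> n)) x) \<le> ennreal \<eta>"
      using cg[OF _ \<eta>] by blast
    show ?thesis
    proof (intro exI allI impI)
      fix m n assume "m \<ge> max N1 N2" "n \<ge> max N1 N2"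
      then have mn: "m \<ge> N1" "n \<ge> N1" "m \<ge> N2" "n \<ge> N2" by auto
      have "modular \<Omega> p (\<lambda>x. w m x - w n x) =
          modular \<Omega> p (\<lambda>x. (u (\<rho> m) x - u (\<rho> n) x, 0 :: 'a) + (0 :: real, wgrad \<Omega> (u (\<rho> m)) x - wgrad \<Omega> (u (\<rho> n)) x))"
        by (simp add: w_def)
      also have "\<dots> \<le> ennreal (2 powr P) * (modular \<Omega> p (\<lambda>x. (u (\<rho> m) x - u (\<rho> n) x, 0 :: 'a)) + modular \<Omega> p (\<lambda>x. (0 :: real, wgrad \<Omega> (u (\<rho> m)) x - wgrad \<Omega> (u (\<rho> n)) x)))"
        by (rule modular_add_le) measurable
      also have "modular \<Omega> p (\<lambda>x. (u (\<rho> m) x - u (\<rho> n) x, 0 :: 'a)) = modular \<Omega> p (\<lambda>x. u (\<rho> m) x - u (\<rho> n) x)"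
        by (simp add: modular_def norm_prod_def)
      also have "modular \<Omega> p (\<lambda>x. (0 :: real, wgrad \<Omega> (u (\<rho> m)) x - wgrad \<Omega> (u (\<rho> n)) x)) = modular \<Omega> p (\<lambda>x. wgrad \<Omega> (u (\<rho> m)) x - wgrad \<Omega> (u (\<rho> n)) x)"
        by (simp add: modular_def norm_prod_def)
      also have "ennreal (2 powr P) * (modular \<Omega> p (\<lambda>x. u (\<rho> m) x - u (\<rho> n) x) + modular \<Omega> p (\<lambda>x. wgrad \<Omega> (u (\<rho> m)) x - wgrad \<Omega> (u (\<rho> n)) x)) \<le> ennreal (2 powr P) * (ennreal \<eta> + ennreal \<eta>)"
        using mn by (intro mult_left_mono add_mono N1 N2) auto
      also have "\<dots> = ennreal (2 powr P * (\<eta> + \<eta>))"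
        using \<eta> by (simp add: ennreal_plus[symmetric] ennreal_mult'[symmetric] del: ennreal_plus)
      also have "2 powr P * (\<eta> + \<eta>) = e" by (simp add: \<eta>_def)
      finally show "modular \<Omega> p (\<lambda>x. w m x - w n x) \<le> ennreal e" .
    qed
  qed
  have "\<exists>r3 v0 S0. strict_mono (r3 :: nat \<Rightarrow> nat) \<and> v0 \<in> borel_measurable (lebesgue_on \<Omega>) \<and>
     (AE x in lebesgue_on \<Omega>. (\<lambda>n. w (r3 n) x) \<longlonglongrightarrow> v0 x) \<and>
     integrable (lebesgue_on \<Omega>) S0 \<and> (\<forall>x. 0 \<le> S0 x) \<and>
     (AE x in lebesgue_on \<Omega>. \<forall>n. norm (w (r3 n) x - v0 x) powr p x \<le> S0 x * (1 / 2) ^ n)"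
  proof (rule modular_complete[of w, OF wm cw])
    fix r3 v0 S0
    assume a: "strict_mono (r3 :: nat \<Rightarrow> nat)" "v0 \<in> borel_measurable (lebesgue_on \<Omega>)"
      "AE x in lebesgue_on \<Omega>. (\<lambda>n. w (r3 n) x) \<longlonglongrightarrow> v0 x"
      "integrable (lebesgue_on \<Omega>) S0" "\<And>x. 0 \<le> S0 x"
      "AE x in lebesgue_on \<Omega>. \<forall>n. norm (w (r3 n) x - v0 x) powr p x \<le> S0 x * (1 / 2) ^ n"
    show ?thesis by (rule exI[of _ r3], rule exI[of _ v0], rule exI[of _ S0]) (intro conjI allI a)
  qed
  then obtain r3 v0 S0 where r3: "strict_mono (r3 :: nat \<Rightarrow> nat)" and v0m [measurable]: "v0 \<in> borel_measurable (lebesgue_on \<Omega>)"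
    and conv: "AE x in lebesgue_on \<Omega>. (\<lambda>n. w (r3 n) x) \<longlonglongrightarrow> v0 x"
    and S0: "integrable (lebesgue_on \<Omega>) S0" "\<And>x. 0 \<le> S0 x"
    and dom: "AE x in lebesgue_on \<Omega>. \<forall>n. norm (w (r3 n) x - v0 x) powr p x \<le> S0 x * (1 / 2) ^ n"
    by blast
  define r where "r = \<rho> \<circ> r3"
  define v G where "v x = fst (v0 x)" and "G x = snd (v0 x)" for x
  have vm [measurable]: "v \<in> borel_measurable (lebesgue_on \<Omega>)" and Gm [measurable]: "G \<in> borel_measurable (lebesgue_on \<Omega>)"
    unfolding v_def G_def borel_prod[symmetric] using v0m unfolding borel_prod[symmetric] by measurable
  have modw: "(\<lambda>n. modular \<Omega> p (\<lambda>x. w (r3 n) x - v0 x)) \<longlonglongrightarrow> 0"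
  proof -
    have le: "modular \<Omega> p (\<lambda>x. w (r3 n) x - v0 x) \<le> ennreal ((\<integral>x. S0 x \<partial>lebesgue_on \<Omega>) * (1 / 2) ^ n)" for n
    proof -
      have "modular \<Omega> p (\<lambda>x. w (r3 n) x - v0 x) \<le> (\<integral>\<^sup>+x. ennreal (S0 x * (1 / 2) ^ n) \<partial>lebesgue_on \<Omega>)"
        unfolding modular_def by (intro nn_integral_mono_AE) (use dom in \<open>auto elim!: eventually_mono intro!: ennreal_leI\<close>)
      also have "\<dots> = ennreal (\<integral>x. S0 x * (1 / 2) ^ n \<partial>lebesgue_on \<Omega>)"
        using S0 by (intro nn_integral_eq_integral) auto
      finally show ?thesis by simp
    qed
    have "(\<lambda>n. (\<integral>x. S0 x \<partial>lebesgue_on \<Omega>) * (1 / 2) ^ n) \<longlonglongrightarrow> (\<integral>x. S0 x \<partial>lebesgue_on \<Omega>) * 0"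
      by (intro tendsto_intros LIMSEQ_power_zero) auto
    then have "(\<lambda>n. ennreal ((\<integral>x. S0 x \<partial>lebesgue_on \<Omega>) * (1 / 2) ^ n)) \<longlonglongrightarrow> 0"
      using tendsto_ennrealI by fastforce
    then show ?thesis
      by (rule tendsto_sandwich[OF _ _ tendsto_const, rotated 2]) (intro always_eventually allI le zero_le)+
  qed
  have comp_le: "modular \<Omega> p a \<le> modular \<Omega> p b" if "\<And>x. norm (a x) \<le> norm (b x)"
    for a :: "'a \<Rightarrow> 'b::real_normed_vector" and b :: "'a \<Rightarrow> 'c::real_normed_vector"
    unfolding modular_def
  proof (intro nn_integral_mono ennreal_leI powr_mono2 that)
    fix x assume "x \<in> space (lebesgue_on \<Omega>)"
    then show "0 \<le> p x" using p_ge[of x] by simp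
  qed auto
  have wsplit: "w (r3 n) x - v0 x = (u (r n) x - v x, wgrad \<Omega> (u (r n)) x - G x)" for n x
    by (simp add: w_def r_def v_def G_def prod_eq_iff)
  have 1: "(\<lambda>n. modular \<Omega> p (\<lambda>x. u (r n) x - v x)) \<longlonglongrightarrow> 0"
    by (rule tendsto_sandwich[OF _ _ tendsto_const modw]) (intro always_eventually allI comp_le zero_le, (simp add: wsplit real_norm_def[symmetric] norm_fst_le del: real_norm_def)?)+
  have 2: "(\<lambda>n. modular \<Omega> p (\<lambda>x. wgrad \<Omega> (u (r n)) x - G x)) \<longlonglongrightarrow> 0"
    by (rule tendsto_sandwich[OF _ _ tendsto_const modw]) (intro always_eventually allI comp_le zero_le, (simp add: wsplit norm_snd_le)?)+
  have vX: "v \<in> X_space \<Omega> p" and wv: "has_weak_gradient \<Omega> v G"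
    using X_space_limit[of "\<lambda>n. u (r n)", OF u_X vm Gm 1 2] by auto
  have vG: "AE x in lebesgue_on \<Omega>. wgrad \<Omega> v x = G x" by (rule wgrad_eq_AE[OF open_\<Omega> wv])
  have dG: "AE x in lebesgue_on \<Omega>. wgrad \<Omega> (u (r n)) x - wgrad \<Omega> v x = wgrad \<Omega> (u (r n)) x - G x" for n
    using vG by eventually_elim simp
  have v0f: "modular \<Omega> p v0 < \<infinity>"
  proof -
    have "modular \<Omega> p (\<lambda>x. (v x, 0 :: 'a) + (0 :: real, G x)) \<le> ennreal (2 powr P) * (modular \<Omega> p (\<lambda>x. (v x, 0 :: 'a)) + modular \<Omega> p (\<lambda>x. (0 :: real, G x)))"
      by (rule modular_add_le) measurable
    also have "modular \<Omega> p (\<lambda>x. (v x, 0 :: 'a)) = modular \<Omega> p v" by (simp add: modular_def norm_prod_def)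
    also have "modular \<Omega> p (\<lambda>x. (0 :: real, G x)) = modular \<Omega> p (wgrad \<Omega> v)"
      unfolding modular_cong_AE[OF vG] by (simp add: modular_def norm_prod_def)
    also have "ennreal (2 powr P) * (modular \<Omega> p v + modular \<Omega> p (wgrad \<Omega> v)) < \<infinity>"
      using X_spaceD(2,3)[OF vX] by (simp add: ennreal_mult_less_top)
    finally show ?thesis by (simp add: v_def G_def)
  qed
  define S where "S x = 2 powr P * (norm (v0 x) powr p x + S0 x)" for x
  show ?thesis
  proof (rule that[of r v l S])
    show "strict_mono r" unfolding r_def by (rule strict_mono_o[OF \<rho> r3])
    show "v \<in> X_space \<Omega> p" by (rule vX)
    show "(\<lambda>n. lam (r n)) \<longlonglongrightarrow> l"
      using LIMSEQ_subseq_LIMSEQ[OF r2(2) r3] by (simp add: r_def \<rho>_def comp_def)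
    show "(\<lambda>n. modular \<Omega> p (\<lambda>x. wgrad \<Omega> (u (r n)) x - wgrad \<Omega> v x)) \<longlonglongrightarrow> 0"
      unfolding modular_cong_AE[OF dG] by (rule 2)
    show "AE x in lebesgue_on \<Omega>. (\<lambda>n. u (r n) x) \<longlonglongrightarrow> v x"
      using conv
    proof eventually_elim
      case (elim x) from tendsto_fst[OF this] show ?case by (simp add: w_def r_def v_def)
    qed
    show "AE x in lebesgue_on \<Omega>. (\<lambda>n. wgrad \<Omega> (u (r n)) x) \<longlonglongrightarrow> wgrad \<Omega> v x"
      using conv vG
    proof eventually_elim
      case (elim x) from tendsto_snd[OF this(1)] elim(2) show ?case by (simp add: w_def r_def G_def)
    qed
    show "integrable (lebesgue_on \<Omega>) S" unfolding S_def
      using S0(1) integrable_of_modular(2)[OF v0m v0f] by simp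
    show "AE x in lebesgue_on \<Omega>. \<forall>n. \<bar>u (r n) x\<bar> powr p x \<le> S x \<and> norm (wgrad \<Omega> (u (r n)) x) powr p x \<le> S x"
      using dom AE_in_\<Omega>
    proof eventually_elim
      case (elim x)
      have px: "1 \<le> p x" "p x \<le> P" using elim p_ge p_le by auto
      have W: "norm (w (r3 n) x) powr p x \<le> S x" for n
      proof -
        have "norm (v0 x + (w (r3 n) x - v0 x)) powr p x \<le> 2 powr P * (norm (v0 x) powr p x + norm (w (r3 n) x - v0 x) powr p x)"
          using px by (intro norm_add_powr_le) auto
        also have "norm (w (r3 n) x - v0 x) powr p x \<le> S0 x"
          using elim(1) mult_left_mono[of "(1 / 2) ^ n" 1 "S0 x"] S0(2)[of x] by (fastforce simp: power_le_one intro: order_trans)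
        finally show ?thesis by (simp add: S_def)
      qed
      have "\<bar>u (r n) x\<bar> powr p x \<le> norm (w (r3 n) x) powr p x" for n
        using px norm_fst_le[of "u (r n) x" "wgrad \<Omega> (u (r n)) x"] by (intro powr_mono2) (auto simp: w_def r_def)
      moreover have "norm (wgrad \<Omega> (u (r n)) x) powr p x \<le> norm (w (r3 n) x) powr p x" for n
        using px norm_snd_le[of "wgrad \<Omega> (u (r n)) x" "u (r n) x"] by (intro powr_mono2) (auto simp: w_def r_def)
      ultimately show ?case using W by (meson order_trans)
    qed
  qed
qed

end

section \<open>Passage to the limit\<close>

text \<open>By the lower bound for \<open>s\<close> the left-hand side is at most a constant times the product of the weight
\<open>\<omega> = h d powr (1 - \<theta> \<gamma>)\<close> and \<open>\<bar>y\<bar> / d\<close>; then apply Young's inequality.\<close>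

lemma singular_term_bound:
  fixes c d \<theta> \<gamma> s y h q :: real
  assumes d: "0 < d" and c: "0 < c" and s: "c * d powr \<theta> \<le> s" and h: "0 \<le> h" and \<gamma>: "0 < \<gamma>" "\<gamma> < 1" and q: "1 < q"
  shows "\<bar>h * s powr (- \<gamma>) * y\<bar> \<le> max 1 (1 / c) * (\<bar>h * d powr (1 - \<theta> * \<gamma>)\<bar> powr (q / (q - 1)) + \<bar>y / d\<bar> powr q)"
proof -
  define k where "k = max 1 (1 / c)"
  have k: "0 \<le> k" by (simp add: k_def)
  define \<omega> where "\<omega> = h * d powr (1 - \<theta> * \<gamma>)"
  have \<omega>: "0 \<le> \<omega>" using h by (simp add: \<omega>_def)
  have cd: "0 < c * d powr \<theta>" using c d by simp
  have "s powr (- \<gamma>) \<le> (c * d powr \<theta>) powr (- \<gamma>)" using s cd \<gamma> by (intro powr_mono2') auto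
  also have "\<dots> = c powr (- \<gamma>) * d powr (- (\<theta> * \<gamma>))" by (simp add: powr_mult powr_powr)
  also have "c powr (- \<gamma>) = (1 / c) powr \<gamma>" using c by (simp add: powr_divide powr_minus inverse_eq_divide)
  also have "(1 / c) powr \<gamma> \<le> k"
  proof -
    have "(1 / c) powr \<gamma> \<le> k powr \<gamma>" using c \<gamma> by (intro powr_mono2) (auto simp: k_def)
    also have "\<dots> \<le> k powr 1" using \<gamma> by (intro powr_mono) (auto simp: k_def)
    finally show ?thesis using k by simp
  qed
  also have "d powr (- (\<theta> * \<gamma>)) = d powr (1 - \<theta> * \<gamma>) / d"
    using d powr_add[of d 1 "- (\<theta> * \<gamma>)"] by simp
  finally have "s powr (- \<gamma>) \<le> k * (d powr (1 - \<theta> * \<gamma>) / d)" by (simp add: mult_right_mono)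
  then have "h * s powr (- \<gamma>) * \<bar>y\<bar> \<le> h * (k * (d powr (1 - \<theta> * \<gamma>) / d)) * \<bar>y\<bar>"
    using h by (intro mult_right_mono mult_left_mono) auto
  also have "\<dots> = k * (\<omega> * \<bar>y / d\<bar>)" using d by (simp add: \<omega>_def)
  also have "\<omega> * \<bar>y / d\<bar> \<le> \<omega> powr (q / (q - 1)) + \<bar>y / d\<bar> powr q"
  proof -
    let ?a = "\<omega> powr (1 / (q - 1))"
    have "?a powr (q - 1) * \<bar>y / d\<bar> \<le> ?a powr q + \<bar>y / d\<bar> powr q" using q by (intro powr_mult_le_sum) auto
    moreover have "?a powr (q - 1) = \<omega>" using q \<omega> by (simp add: powr_powr)
    moreover have "?a powr q = \<omega> powr (q / (q - 1))" by (simp add: powr_powr)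
    ultimately show ?thesis by simp
  qed
  finally have "h * s powr (- \<gamma>) * \<bar>y\<bar> \<le> k * (\<omega> powr (q / (q - 1)) + \<bar>y / d\<bar> powr q)"
    using k by (simp add: mult_left_mono)
  moreover have "\<bar>h * s powr (- \<gamma>) * y\<bar> = h * s powr (- \<gamma>) * \<bar>y\<bar>" using h by (simp add: abs_mult)
  ultimately show ?thesis using \<omega> by (simp add: k_def \<omega>_def)
qed

context singular_sequence begin

text \<open>Every term of the equation converges by dominated convergence along the subsequence. In the singular term
the majorant is available only from the index \<open>N0\<close> on.\<close>

lemma limit_solution:
  assumes dom: "bounded_lipschitz_domain \<Omega>" and c: "0 < c"
    and lower: "\<And>n. N0 \<le> n \<Longrightarrow> AE x in lebesgue_on \<Omega>. u n x \<ge> c * bdist \<Omega> x powr \<theta>"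
    and weight: "(\<lambda>x. h x * bdist \<Omega> x powr (1 - \<theta> * \<gamma> x)) \<in> Lp_space \<Omega> (\<lambda>x. p x / (p x - 1))"
  shows "\<exists>r v l. strict_mono (r :: nat \<Rightarrow> nat) \<and> v \<in> X_space \<Omega> p \<and>
    (\<lambda>n. X_norm \<Omega> p (\<lambda>x. u (r n) x - v x)) \<longlonglongrightarrow> 0 \<and>
    (\<lambda>n. lam (r n)) \<longlonglongrightarrow> l \<and>
    J_fun \<Omega> p v = m \<and>
    (AE x in lebesgue_on \<Omega>. v x \<ge> c * bdist \<Omega> x powr \<theta> \<and> c * bdist \<Omega> x powr \<theta> > 0) \<and>
    (\<forall>\<phi>\<in>X_space \<Omega> p.
      integrable (lebesgue_on \<Omega>) (\<lambda>x. A_eps p \<epsilon> x (wgrad \<Omega> v x) \<bullet> wgrad \<Omega> \<phi> x) \<and>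
      integrable (lebesgue_on \<Omega>) (\<lambda>x. v x powr (p x - 1) * \<phi> x) \<and>
      integrable (lebesgue_on \<Omega>) (\<lambda>x. h x * v x powr (- \<gamma> x) * \<phi> x) \<and>
      (LINT x|lebesgue_on \<Omega>. A_eps p \<epsilon> x (wgrad \<Omega> v x) \<bullet> wgrad \<Omega> \<phi> x) =
        l * (LINT x|lebesgue_on \<Omega>. v x powr (p x - 1) * \<phi> x) +
        \<mu> * (LINT x|lebesgue_on \<Omega>. h x * v x powr (- \<gamma> x) * \<phi> x))"
proof -
  obtain r v l S where r: "strict_mono (r :: nat \<Rightarrow> nat)" and vX: "v \<in> X_space \<Omega> p" and lam: "(\<lambda>n. lam (r n)) \<longlonglongrightarrow> l"
    and mod0: "(\<lambda>n. modular \<Omega> p (\<lambda>x. wgrad \<Omega> (u (r n)) x - wgrad \<Omega> v x)) \<longlonglongrightarrow> 0"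
    and conv: "AE x in lebesgue_on \<Omega>. (\<lambda>n. u (r n) x) \<longlonglongrightarrow> v x"
    and gconv: "AE x in lebesgue_on \<Omega>. (\<lambda>n. wgrad \<Omega> (u (r n)) x) \<longlonglongrightarrow> wgrad \<Omega> v x"
    and S: "integrable (lebesgue_on \<Omega>) S"
    and dominated: "AE x in lebesgue_on \<Omega>. \<forall>n. \<bar>u (r n) x\<bar> powr p x \<le> S x \<and> norm (wgrad \<Omega> (u (r n)) x) powr p x \<le> S x"
    by (rule convergent_subsequence)
  note V = X_spaceD[OF vX]
  note [measurable] = V(4,5)
  have Sm [measurable]: "S \<in> borel_measurable (lebesgue_on \<Omega>)" using S by (rule borel_measurable_integrable)
  have [measurable]: "bdist \<Omega> \<in> borel_measurable (lebesgue_on \<Omega>)"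
  proof -
    have "bdist \<Omega> \<in> borel_measurable borel" unfolding bdist_def
      by (intro borel_measurable_continuous_onI continuous_intros)
    then show ?thesis by (intro measurable_restrict_space1 measurable_completion) simp
  qed
  have bd: "0 < bdist \<Omega> x" if "x \<in> \<Omega>" for x
    using bdist_pos[OF open_\<Omega> bounded_domain_frontier(1)[OF dom] that] .
  have rge: "N0 \<le> r n" if "N0 \<le> n" for n using seq_suble[OF r, of n] that by simp
  have lowr: "AE x in lebesgue_on \<Omega>. \<forall>n\<ge>N0. u (r n) x \<ge> c * bdist \<Omega> x powr \<theta>"
  proof -
    have "AE x in lebesgue_on \<Omega>. \<forall>n. n \<ge> N0 \<longrightarrow> u (r n) x \<ge> c * bdist \<Omega> x powr \<theta>"
      unfolding AE_all_countable using lower[OF rge] by auto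
    then show ?thesis by simp
  qed
  have vlow: "AE x in lebesgue_on \<Omega>. v x \<ge> c * bdist \<Omega> x powr \<theta> \<and> c * bdist \<Omega> x powr \<theta> > 0"
    using conv lowr AE_in_\<Omega>
  proof eventually_elim
    case (elim x)
    have "v x \<ge> c * bdist \<Omega> x powr \<theta>"
      by (rule LIMSEQ_le_const[OF elim(1)]) (use elim(2) in blast)
    then show ?case using c bd[OF elim(3)] by simp
  qed
  then have vpos: "AE x in lebesgue_on \<Omega>. 0 < v x" by eventually_elim auto
  have Xn: "(\<lambda>n. X_norm \<Omega> p (\<lambda>x. u (r n) x - v x)) \<longlonglongrightarrow> 0"
    unfolding X_norm_def
  proof (rule luxemburg_tendsto_0)
    show "(\<lambda>x. norm (wgrad \<Omega> (\<lambda>x. u (r n) x - v x) x)) \<in> borel_measurable (lebesgue_on \<Omega>)" for n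
      using X_spaceD(5)[OF X_space_diff(1)[OF u_X vX]] by measurable
    show "(\<lambda>n. modular \<Omega> p (\<lambda>x. norm (wgrad \<Omega> (\<lambda>x. u (r n) x - v x) x))) \<longlonglongrightarrow> 0"
      unfolding modular_norm modular_cong_AE[OF X_space_diff(2)[OF u_X vX]] by (rule mod0)
  qed
  have Jv: "J_fun \<Omega> p v = m"
  proof -
    have "(\<lambda>n. J_fun \<Omega> p (u (r n))) \<longlonglongrightarrow> J_fun \<Omega> p v"
      unfolding J_fun_def
    proof (rule integral_dominated_convergence[OF _ _ S])
      show "AE x in lebesgue_on \<Omega>. (\<lambda>n. \<bar>u (r n) x\<bar> powr p x / p x) \<longlonglongrightarrow> \<bar>v x\<bar> powr p x / p x"
        using conv AE_in_\<Omega>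
      proof eventually_elim
        case (elim x)
        then show ?case using p_ge[OF elim(2)]
          by (intro tendsto_divide tendsto_powr' tendsto_rabs tendsto_const) auto
      qed
      show "AE x in lebesgue_on \<Omega>. norm (\<bar>u (r n) x\<bar> powr p x / p x) \<le> S x" for n
        using dominated AE_in_\<Omega>
      proof eventually_elim
        case (elim x)
        have "\<bar>u (r n) x\<bar> powr p x / p x \<le> \<bar>u (r n) x\<bar> powr p x / 1"
          using p_ge[OF elim(2)] by (intro divide_left_mono) auto
        also have "\<dots> \<le> S x" using elim(1) by simp
        finally show ?case using p_ge[OF elim(2)] by simp
      qed
    qed measurable
    then show ?thesis unfolding u_J by (simp add: LIMSEQ_const_iff)
  qed
  have "integrable (lebesgue_on \<Omega>) (\<lambda>x. A_eps p \<epsilon> x (wgrad \<Omega> v x) \<bullet> wgrad \<Omega> \<phi> x) \<and>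
      integrable (lebesgue_on \<Omega>) (\<lambda>x. v x powr (p x - 1) * \<phi> x) \<and>
      integrable (lebesgue_on \<Omega>) (\<lambda>x. h x * v x powr (- \<gamma> x) * \<phi> x) \<and>
      (LINT x|lebesgue_on \<Omega>. A_eps p \<epsilon> x (wgrad \<Omega> v x) \<bullet> wgrad \<Omega> \<phi> x) =
        l * (LINT x|lebesgue_on \<Omega>. v x powr (p x - 1) * \<phi> x) +
        \<mu> * (LINT x|lebesgue_on \<Omega>. h x * v x powr (- \<gamma> x) * \<phi> x)" if \<phi>: "\<phi> \<in> X_space \<Omega> p" for \<phi>
  proof -
    note F = X_spaceD[OF \<phi>]
    note [measurable] = F(4,5)
    have i\<phi>: "integrable (lebesgue_on \<Omega>) (\<lambda>x. norm (\<phi> x) powr p x)" "integrable (lebesgue_on \<Omega>) (\<lambda>x. norm (wgrad \<Omega> \<phi> x) powr p x)"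
      using integrable_of_modular(2)[OF F(4,2)] integrable_of_modular(2)[OF F(5,3)] by auto
    have I1: "integrable (lebesgue_on \<Omega>) (\<lambda>x. A_eps p \<epsilon> x (wgrad \<Omega> v x) \<bullet> wgrad \<Omega> \<phi> x)"
      by (rule A_eps_integrable[OF params(1) V(5,3) F(5,3)])
    have I2: "integrable (lebesgue_on \<Omega>) (\<lambda>x. v x powr (p x - 1) * \<phi> x)"
      by (rule powr_mult_integrable[OF V(4,2) _ F(4,2)]) (use vpos in \<open>auto elim: eventually_mono\<close>)
    \<comment> \<open>The majorant of the singular terms; it is integrable by the assumption on the weight and Hardy's inequality.\<close>
    define W where "W x = max 1 (1 / c) * (\<bar>h x * bdist \<Omega> x powr (1 - \<theta> * \<gamma> x)\<bar> powr (p x / (p x - 1)) + \<bar>\<phi> x / bdist \<Omega> x\<bar> powr p x)" for x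
    have hm: "modular \<Omega> p (\<lambda>x. \<phi> x / bdist \<Omega> x) < \<infinity>" by (rule X_space_hardy[OF dom pm \<phi>])
    have iW: "integrable (lebesgue_on \<Omega>) W"
    proof -
      have "(\<lambda>x. \<phi> x / bdist \<Omega> x) \<in> borel_measurable (lebesgue_on \<Omega>)" by measurable
      from integrable_of_modular(2)[OF this hm]
      have 1: "integrable (lebesgue_on \<Omega>) (\<lambda>x. \<bar>\<phi> x / bdist \<Omega> x\<bar> powr p x)" by simp
      have 2: "integrable (lebesgue_on \<Omega>) (\<lambda>x. \<bar>h x * bdist \<Omega> x powr (1 - \<theta> * \<gamma> x)\<bar> powr (p x / (p x - 1)))"
        by (rule integrableI_nonneg) (use weight in \<open>auto simp: Lp_space_def\<close>)
      show ?thesis unfolding W_def by (intro integrable_mult_right Bochner_Integration.integrable_add 1 2)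
    qed
    have bound: "AE x in lebesgue_on \<Omega>. \<forall>s. s \<ge> c * bdist \<Omega> x powr \<theta> \<longrightarrow> norm (h x * s powr (- \<gamma> x) * \<phi> x) \<le> W x"
      using AE_in_\<Omega> h_bounds(1)
    proof eventually_elim
      case (elim x)
      show ?case unfolding W_def real_norm_def
        using singular_term_bound[OF bd[OF elim(1)] c _ _ _ _ less_le_trans[OF pm(1) pm(2)[OF elim(1)]], of \<theta> _ "h x" "\<gamma> x" "\<phi> x"]
          elim \<gamma>(1)[of x] \<gamma>(2) by auto
    qed
    have I3: "integrable (lebesgue_on \<Omega>) (\<lambda>x. h x * v x powr (- \<gamma> x) * \<phi> x)"
    proof (rule Bochner_Integration.integrable_bound[OF iW])
      show "AE x in lebesgue_on \<Omega>. norm (h x * v x powr (- \<gamma> x) * \<phi> x) \<le> norm (W x)"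
        using bound vlow by eventually_elim (force simp: abs_le_iff)
    qed measurable
    have L1: "(\<lambda>n. LINT x|lebesgue_on \<Omega>. A_eps p \<epsilon> x (wgrad \<Omega> (u (r n)) x) \<bullet> wgrad \<Omega> \<phi> x) \<longlonglongrightarrow>
        (LINT x|lebesgue_on \<Omega>. A_eps p \<epsilon> x (wgrad \<Omega> v x) \<bullet> wgrad \<Omega> \<phi> x)"
    proof (rule integral_dominated_convergence[where w="\<lambda>x. 2 powr P * (eps_const \<epsilon> + S x) + norm (wgrad \<Omega> \<phi> x) powr p x"])
      show "integrable (lebesgue_on \<Omega>) (\<lambda>x. 2 powr P * (eps_const \<epsilon> + S x) + norm (wgrad \<Omega> \<phi> x) powr p x)"
        using S i\<phi>(2) integrable_const_\<Omega> by simp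
      show "AE x in lebesgue_on \<Omega>. (\<lambda>n. A_eps p \<epsilon> x (wgrad \<Omega> (u (r n)) x) \<bullet> wgrad \<Omega> \<phi> x) \<longlonglongrightarrow> A_eps p \<epsilon> x (wgrad \<Omega> v x) \<bullet> wgrad \<Omega> \<phi> x"
        using gconv
      proof eventually_elim
        case (elim x)
        have "(\<lambda>n. r_eps \<epsilon> (wgrad \<Omega> (u (r n)) x)) \<longlonglongrightarrow> r_eps \<epsilon> (wgrad \<Omega> v x)"
          unfolding r_eps_def by (intro tendsto_intros elim)
        then show ?case unfolding A_eps_def
          using r_eps_facts(3)[OF params(1), of "wgrad \<Omega> v x"]
          by (intro tendsto_inner tendsto_scaleR tendsto_powr tendsto_const elim) auto
      qed
      show "AE x in lebesgue_on \<Omega>. norm (A_eps p \<epsilon> x (wgrad \<Omega> (u (r n)) x) \<bullet> wgrad \<Omega> \<phi> x) \<le> 2 powr P * (eps_const \<epsilon> + S x) + norm (wgrad \<Omega> \<phi> x) powr p x" for n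
        using dominated AE_in_\<Omega>
      proof eventually_elim
        case (elim x)
        have "\<bar>A_eps p \<epsilon> x (wgrad \<Omega> (u (r n)) x) \<bullet> wgrad \<Omega> \<phi> x\<bar> \<le> r_eps \<epsilon> (wgrad \<Omega> (u (r n)) x) powr p x + norm (wgrad \<Omega> \<phi> x) powr p x"
          by (rule A_eps_inner_le[OF params(1) elim(2)])
        also have "r_eps \<epsilon> (wgrad \<Omega> (u (r n)) x) powr p x \<le> 2 powr P * (eps_const \<epsilon> + norm (wgrad \<Omega> (u (r n)) x) powr p x)"
          by (rule r_eps_powr_le(1)[OF params(1) elim(2)])
        also have "\<dots> \<le> 2 powr P * (eps_const \<epsilon> + S x)" using elim(1) by (intro mult_left_mono add_left_mono) auto
        finally show ?case by simp
      qed
    qed measurable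
    have L2: "(\<lambda>n. LINT x|lebesgue_on \<Omega>. u (r n) x powr (p x - 1) * \<phi> x) \<longlonglongrightarrow> (LINT x|lebesgue_on \<Omega>. v x powr (p x - 1) * \<phi> x)"
    proof (rule integral_dominated_convergence[where w="\<lambda>x. S x + norm (\<phi> x) powr p x"])
      show "integrable (lebesgue_on \<Omega>) (\<lambda>x. S x + norm (\<phi> x) powr p x)" using S i\<phi>(1) by simp
      show "AE x in lebesgue_on \<Omega>. (\<lambda>n. u (r n) x powr (p x - 1) * \<phi> x) \<longlonglongrightarrow> v x powr (p x - 1) * \<phi> x"
        using conv vpos by eventually_elim (intro tendsto_mult tendsto_powr tendsto_const; simp)
      show "AE x in lebesgue_on \<Omega>. norm (u (r n) x powr (p x - 1) * \<phi> x) \<le> S x + norm (\<phi> x) powr p x" for n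
        using dominated AE_in_\<Omega> u_nonneg[of "r n"]
      proof eventually_elim
        case (elim x)
        have "\<bar>u (r n) x powr (p x - 1) * \<phi> x\<bar> \<le> u (r n) x powr p x + \<bar>\<phi> x\<bar> powr p x"
          using powr_mult_le_sum[of "u (r n) x" "\<bar>\<phi> x\<bar>" "p x"] elim(3) p_ge[OF elim(2)] by (simp add: abs_mult)
        moreover have "u (r n) x powr p x \<le> S x" using elim(1,3) by (metis abs_of_nonneg)
        ultimately show ?case by simp
      qed
    qed measurable
    have \<delta>r: "(\<lambda>n. \<delta> (r n)) \<longlonglongrightarrow> 0" using LIMSEQ_subseq_LIMSEQ[OF \<delta>(3) r] by (simp add: comp_def)
    have "(\<lambda>n. LINT x|lebesgue_on \<Omega>. h x * (u (r (n + N0)) x + \<delta> (r (n + N0))) powr (- \<gamma> x) * \<phi> x) \<longlonglongrightarrow> (LINT x|lebesgue_on \<Omega>. h x * v x powr (- \<gamma> x) * \<phi> x)"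
    proof (rule integral_dominated_convergence[OF _ _ iW])
      show "AE x in lebesgue_on \<Omega>. (\<lambda>n. h x * (u (r (n + N0)) x + \<delta> (r (n + N0))) powr (- \<gamma> x) * \<phi> x) \<longlonglongrightarrow> h x * v x powr (- \<gamma> x) * \<phi> x"
        using conv vpos
      proof eventually_elim
        case (elim x)
        have "(\<lambda>n. u (r n) x + \<delta> (r n)) \<longlonglongrightarrow> v x + 0" by (intro tendsto_add elim \<delta>r)
        from LIMSEQ_ignore_initial_segment[OF this, of N0]
        show ?case using elim(2) by (intro tendsto_mult tendsto_powr tendsto_const) auto
      qed
      show "AE x in lebesgue_on \<Omega>. norm (h x * (u (r (n + N0)) x + \<delta> (r (n + N0))) powr (- \<gamma> x) * \<phi> x) \<le> W x" for n
        using bound lowr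
      proof eventually_elim
        case (elim x)
        have "c * bdist \<Omega> x powr \<theta> \<le> u (r (n + N0)) x + \<delta> (r (n + N0))"
          using elim(2) \<delta>(1)[of "r (n + N0)"] by (smt (verit) le_add2)
        then show ?case using elim(1) by blast
      qed
    qed measurable
    then have L3: "(\<lambda>n. LINT x|lebesgue_on \<Omega>. h x * (u (r n) x + \<delta> (r n)) powr (- \<gamma> x) * \<phi> x) \<longlonglongrightarrow> (LINT x|lebesgue_on \<Omega>. h x * v x powr (- \<gamma> x) * \<phi> x)"
      by (rule LIMSEQ_offset)
    have "(\<lambda>n. LINT x|lebesgue_on \<Omega>. A_eps p \<epsilon> x (wgrad \<Omega> (u (r n)) x) \<bullet> wgrad \<Omega> \<phi> x) \<longlonglongrightarrow>
        l * (LINT x|lebesgue_on \<Omega>. v x powr (p x - 1) * \<phi> x) + \<mu> * (LINT x|lebesgue_on \<Omega>. h x * v x powr (- \<gamma> x) * \<phi> x)"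
      unfolding euler_lagrange[OF \<phi>] by (intro tendsto_add tendsto_mult tendsto_const lam L2 L3)
    from LIMSEQ_unique[OF L1 this] I1 I2 I3 show ?thesis by blast
  qed
  then show ?thesis
    using r vX Xn lam Jv vlow by blast
qed

end

theorem theorem3p3:
  fixes \<Omega> :: "'a::euclidean_space set"
    and p h \<gamma> :: "'a \<Rightarrow> real"
    and \<gamma>m \<gamma>p \<epsilon> m \<mu> \<delta>0 c \<theta> :: real
    and U :: "real \<Rightarrow> 'a \<Rightarrow> real"
    and \<delta> lam :: "nat \<Rightarrow> real"
    and u :: "nat \<Rightarrow> 'a \<Rightarrow> real"
  assumes dim: "DIM('a) \<ge> 2"
    and dom: "bounded_lipschitz_domain \<Omega>"
    and exponent: "admissible_exponent \<Omega> p"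
    and h_bdd: "h \<in> Linfty_space \<Omega>"
    and h_nonneg: "AE x in lebesgue_on \<Omega>. 0 \<le> h x"
    and h_nonzero: "\<not> (AE x in lebesgue_on \<Omega>. h x = 0)"
    and gamma_cont: "continuous_on (closure \<Omega>) \<gamma>"
    and gamma_bounds: "0 < \<gamma>m" "\<gamma>p < 1" "\<And>x. x \<in> closure \<Omega> \<Longrightarrow> \<gamma>m \<le> \<gamma> x \<and> \<gamma> x \<le> \<gamma>p"
    and params: "0 < \<epsilon>" "0 < m" "0 \<le> \<mu>"
    and minimizer:
      "\<And>t. 0 < t \<Longrightarrow> t \<le> 1 \<Longrightarrow> is_minimizer_on (I_fun \<Omega> p h \<gamma> \<epsilon> \<mu> t) (M_plus \<Omega> p m) (U t)"
    and constants: "0 < \<delta>0" "\<delta>0 \<le> 1" "0 < c" "0 < \<theta>"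
    and lower_bound:
      "\<And>t. 0 < t \<Longrightarrow> t \<le> \<delta>0 \<Longrightarrow> AE x in lebesgue_on \<Omega>. U t x \<ge> c * bdist \<Omega> x powr \<theta>"
    and weight:
      "(\<lambda>x. h x * bdist \<Omega> x powr (1 - \<theta> * \<gamma> x)) \<in> Lp_space \<Omega> (\<lambda>x. p x / (p x - 1))"
    and delta: "\<And>n. 0 < \<delta> n" "\<And>n. \<delta> n \<le> 1" "decseq \<delta>" "\<delta> \<longlonglongrightarrow> 0"
    and u_eq: "\<And>n. u n = U (\<delta> n)"
    and u_X: "\<And>n. u n \<in> X_space \<Omega> p"
    and u_J: "\<And>n. J_fun \<Omega> p (u n) = m"
    and euler_lagrange: "\<And>n \<phi>. \<phi> \<in> X_space \<Omega> p \<Longrightarrow>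
      (LINT x|lebesgue_on \<Omega>. A_eps p \<epsilon> x (wgrad \<Omega> (u n) x) \<bullet> wgrad \<Omega> \<phi> x) =
        lam n * (LINT x|lebesgue_on \<Omega>. u n x powr (p x - 1) * \<phi> x) +
        \<mu> * (LINT x|lebesgue_on \<Omega>. h x * (u n x + \<delta> n) powr (- \<gamma> x) * \<phi> x)"
  shows "\<exists>r v l. strict_mono (r :: nat \<Rightarrow> nat) \<and> v \<in> X_space \<Omega> p \<and>
    (\<lambda>n. X_norm \<Omega> p (\<lambda>x. u (r n) x - v x)) \<longlonglongrightarrow> 0 \<and>
    (\<lambda>n. lam (r n)) \<longlonglongrightarrow> l \<and>
    J_fun \<Omega> p v = m \<and>
    (AE x in lebesgue_on \<Omega>. v x \<ge> c * bdist \<Omega> x powr \<theta> \<and> c * bdist \<Omega> x powr \<theta> > 0) \<and>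
    (\<forall>\<phi>\<in>X_space \<Omega> p.
      integrable (lebesgue_on \<Omega>) (\<lambda>x. A_eps p \<epsilon> x (wgrad \<Omega> v x) \<bullet> wgrad \<Omega> \<phi> x) \<and>
      integrable (lebesgue_on \<Omega>) (\<lambda>x. v x powr (p x - 1) * \<phi> x) \<and>
      integrable (lebesgue_on \<Omega>) (\<lambda>x. h x * v x powr (- \<gamma> x) * \<phi> x) \<and>
      (LINT x|lebesgue_on \<Omega>. A_eps p \<epsilon> x (wgrad \<Omega> v x) \<bullet> wgrad \<Omega> \<phi> x) =
        l * (LINT x|lebesgue_on \<Omega>. v x powr (p x - 1) * \<phi> x) +
        \<mu> * (LINT x|lebesgue_on \<Omega>. h x * v x powr (- \<gamma> x) * \<phi> x))"
proof -
  have \<Omega>: "open \<Omega>" "bounded \<Omega>" "\<Omega> \<noteq> {}" using dom by (auto simp: bounded_lipschitz_domain_def)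
  have cl: "x \<in> closure \<Omega>" if "x \<in> \<Omega>" for x using that closure_subset by blast
  obtain pm P where pmP: "1 < pm" "\<And>x. x \<in> \<Omega> \<Longrightarrow> pm \<le> p x \<and> p x \<le> P"
    using exponent cl unfolding admissible_exponent_def by blast
  obtain C where C: "0 < C" "\<And>x y. x \<in> \<Omega> \<Longrightarrow> y \<in> \<Omega> \<Longrightarrow> x \<noteq> y \<Longrightarrow> \<bar>p x - p y\<bar> \<le> C / ln (exp 1 + 1 / dist x y)"
    using exponent cl unfolding admissible_exponent_def log_hoelder_on_def by blast
  have P1: "1 \<le> P" using \<Omega>(3) pmP by (metis ex_in_conv less_imp_le order_trans)
  interpret log_exponent \<Omega> p P C
    by unfold_locales (use \<Omega> pmP C P1 in \<open>auto intro: less_imp_le order_trans[OF less_imp_le[OF pmP(1)]]\<close>)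
  obtain H0 where H0: "AE x in lebesgue_on \<Omega>. \<bar>h x\<bar> \<le> H0" and hm: "h \<in> borel_measurable (lebesgue_on \<Omega>)"
    using h_bdd by (auto simp: Linfty_space_def)
  define H where "H = \<bar>H0\<bar>"
  have h: "AE x in lebesgue_on \<Omega>. 0 \<le> h x \<and> h x \<le> H" "0 \<le> H"
    using H0 h_nonneg by (auto simp: H_def elim!: eventually_elim2)
  have \<gamma>: "0 < \<gamma> x \<and> \<gamma> x \<le> \<gamma>p" if "x \<in> \<Omega>" for x
    using gamma_bounds(1) gamma_bounds(3)[OF cl[OF that]] by linarith
  have \<gamma>m: "\<gamma> \<in> borel_measurable (lebesgue_on \<Omega>)"
    using \<Omega>(1) by (intro continuous_imp_measurable_on_sets_lebesgue continuous_on_subset[OF gamma_cont closure_subset]) auto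
  have uM: "u n \<in> M_plus \<Omega> p m" for n
    using minimizer[OF delta(1,2)] by (simp add: u_eq is_minimizer_on_def)
  have wM: "U 1 \<in> M_plus \<Omega> p m" using minimizer[of 1] by (simp add: is_minimizer_on_def)
  \<comment> \<open>The fixed competitor is the minimizer for the shift one, which belongs to the constraint set.\<close>
  define M where "M = \<bar>P * (E_eps \<Omega> p \<epsilon> (U 1) + \<mu> * (H / (1 - \<gamma>p) * (2 * vol + P * m))) + eps_const \<epsilon> * vol\<bar>"
  have grad: "(\<integral>x. norm (wgrad \<Omega> (u n) x) powr p x \<partial>lebesgue_on \<Omega>) \<le> M" for n
    unfolding M_def u_eq
    by (rule order_trans[OF minimizer_gradient_bound[OF params(1,3) delta(1,2) h \<gamma> gamma_bounds(2) minimizer[OF delta(1,2)] wM] abs_ge_self])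
  interpret singular_sequence \<Omega> p P C pm H \<epsilon> m \<mu> \<gamma>p M h \<gamma> \<delta> lam u
  proof
    show "AE x in lebesgue_on \<Omega>. 0 \<le> u n x" for n using uM[of n] by (simp add: M_plus_def X_plus_def)
    show "0 \<le> M" by (simp add: M_def)
    show "AE x in lebesgue_on \<Omega>. 0 \<le> h x \<and> h x \<le> H" by (rule h(1))
    show "(\<integral>x. norm (wgrad \<Omega> (u n) x) powr p x \<partial>lebesgue_on \<Omega>) \<le> M" for n by (rule grad)
    show "(LINT x|lebesgue_on \<Omega>. A_eps p \<epsilon> x (wgrad \<Omega> (u n) x) \<bullet> wgrad \<Omega> \<phi> x) =
        lam n * (LINT x|lebesgue_on \<Omega>. u n x powr (p x - 1) * \<phi> x) +
        \<mu> * (LINT x|lebesgue_on \<Omega>. h x * (u n x + \<delta> n) powr (- \<gamma> x) * \<phi> x)" if "\<phi> \<in> X_space \<Omega> p" for n \<phi>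
      by (rule euler_lagrange[OF that])
  qed (use pmP h(2) hm \<gamma>m \<gamma> gamma_bounds(2) params delta u_X u_J in auto)
  \<comment> \<open>From \<open>N0\<close> on the shifts are below \<open>\<delta>0\<close>, so that the lower bound applies.\<close>
  obtain N0 where N0: "\<And>n. N0 \<le> n \<Longrightarrow> \<delta> n < \<delta>0"
    using order_tendstoD(2)[OF delta(4) constants(1)] by (auto simp: eventually_sequentially)
  have "AE x in lebesgue_on \<Omega>. u n x \<ge> c * bdist \<Omega> x powr \<theta>" if "N0 \<le> n" for n
    unfolding u_eq by (rule lower_bound[OF delta(1) less_imp_le[OF N0[OF that]]])
  then show ?thesis by (rule limit_solution[OF dom constants(3) _ weight])
qed

end
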